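(* Let $X$ be a real separable Hilbert space, and let $B\times\mathcal Q\subset X\times\mathscr S_1(X)$ be such that (i) every $Q\in\mathcal Q$ is selfadjoint and positive semidefinite, (ii) $Q_1Q_2=Q_2Q_1$ for all $Q_1,Q_2\in\mathcal Q$, (iii) $B\times\mathcal Q$ is bounded. Let $(e_k)_{k\in\mathbb N}$ be a joint orthonormal basis of eigenvectors, $\Lambda:=B\times\{\mu_Q:Q\in\mathcal Q\}\subset X\times\ell^1$, and let $(I(t))_{t\ge0}$ and $(T(t))_{t\ge0}$ be defined on $C_b$ by $$(I(t)f)(x):=\sup_{(b,\mu)\in\Lambda}\mathbb E\Big[f\Big(x+tb+\sum_{k\in\mathbb N}\sqrt{\mu_k}\,\xi_t^ke_k\Big)\Big],$$ $$(T(t)f)(x):=\sup_{(b,\mu)\in\mathcal A}\mathbb E\Big[f\Big(x+\int_0^tb_s\,ds+\sum_{k\in\mathbb N}\Big(\int_0^t\sqrt{\mu_s^k}\,d\xi_s^k\Big)e_k\Big)\Big].$$ Let $(h_n)_{n\in\mathbb N}\subset(0,\infty)$ with $h_n\to0$ and $\mathcal T_n\subset\mathcal T_{n+1}$ for all $n\in\mathbb N$, where $\mathcal T_n:=\{kh_n:k\in\mathbb N_0\}$; put $k_n^t:=\max\{k\in\mathbb N_0:kh_n\le t\}$ and $I(\pi_n^t)f:=I(h_n)^{k_n^t}f$. Then $$T(t)f=\lim_{n\to\infty}I(\pi_n^t)f=\sup_{n\in\mathbb N}I(\pi_n^t)f$$ for all $t\ge0$ and all $f\in C_b$ such that there exist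 a compact linear operator $K\colon X\to X$ and a function $g\in C_b$ with $f(x)=g(Kx)$ for all $x\in X$.
   Context: $\mathscr S_1(X)$ is the space of trace class operators on $X$ with the trace class norm. $C_b$ is the space of bounded continuous functions $X\to\mathbb R$; the supremum is pointwise and the limit is in the mixed topology, i.e. $f_n\to f$ iff $\sup_n\|f_n\|_\infty<\infty$ and $f_n\to f$ uniformly on compact subsets of $X$. Under the assumptions there is an orthonormal basis $(e_k)_{k\in\mathbb N}$ of $X$ such that every $Q\in\mathcal Q$ satisfies $Qe_k=\mu_{Q,k}e_k$ with $\mu_{Q,k}\ge0$; $\mu_Q:=(\mu_{Q,k})_{k\in\mathbb N}\in\ell^1$. $(\xi^k)_{k\in\mathbb N}$ is a sequence of independent one-dimensional Brownian motions on a complete filtered probability space satisfying the usual conditions. $\mathcal A$ is the set of all predictable processes $(b,\mu)\colon\Omega\times[0,\infty)\to\Lambda$, $(\omega,t)\mapsto(b_t(\omega),(\mu_t^k(\omega))_{k\in\mathbb N})$.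
   Formalization: The supremum identity is false as printed (Q={0}, B={b}, f(x)=-arctan<x,b>, t not in some T_n); it is stated only for t in the union of the T_n, with the supremum over those n with t in T_n. The limit is stated for all t>=0; B and Q are taken nonempty. *)

theory Defs
  imports "HOL-Probability.Probability"
begin

section \<open>Operators on a real separable Hilbert space\<close>

text \<open>
  A real separable Hilbert space is a type of sort
  \<open>{real_inner, banach, second_countable_topology}\<close>; bounded operators are bounded linear
  functions \<open>'a \<Rightarrow>\<^sub>L 'a\<close>.
\<close>

definition selfadjoint_op :: "('a::real_inner \<Rightarrow>\<^sub>L 'a) \<Rightarrow> bool" where
  "selfadjoint_op A \<longleftrightarrow> (\<forall>x y. A x \<bullet> y = x \<bullet> A y)"

definition positive_op :: "('a::real_inner \<Rightarrow>\<^sub>L 'a) \<Rightarrow> bool" where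
  "positive_op A \<longleftrightarrow> (\<forall>x. 0 \<le> A x \<bullet> x)"

text \<open>
  Bases are indexed by all of \<open>nat\<close>. If the space has finite dimension \<open>d\<close>, the basis is
  \<open>e 0, \<dots>, e (d - 1)\<close>, padded by zeros; if the dimension is infinite, density of the span
  and the last condition force every \<open>e k\<close> to be a unit vector.
\<close>

definition orthonormal_basis :: "(nat \<Rightarrow> 'a::real_inner) \<Rightarrow> bool" where
  "orthonormal_basis e \<longleftrightarrow>
     (\<forall>i j. i \<noteq> j \<longrightarrow> e i \<bullet> e j = 0) \<and>
     (\<forall>i. e i = 0 \<or> norm (e i) = 1) \<and>
     closure (span (range e)) = UNIV \<and>
     (\<forall>i j. e i = 0 \<longrightarrow> i \<le> j \<longrightarrow> e j = 0)"

text \<open>The absolute value \<open>(A\<^sup>* A)\<^sup>1\<^sup>/\<^sup>2\<close>, i.e. the positive square root of \<open>A\<^sup>* A\<close>.\<close>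

definition op_abs :: "('a::real_inner \<Rightarrow>\<^sub>L 'a) \<Rightarrow> 'a \<Rightarrow>\<^sub>L 'a" where
  "op_abs A = (THE S. selfadjoint_op S \<and> positive_op S \<and> (\<forall>x. S (S x) = adjoint A (A x)))"

text \<open>
  The trace of the positive operator \<open>op_abs A\<close> does not depend on the orthonormal basis,
  so all members of the supremum coincide.
\<close>

definition trace_norm :: "('a::real_inner \<Rightarrow>\<^sub>L 'a) \<Rightarrow> ennreal" where
  "trace_norm A = (SUP e\<in>Collect orthonormal_basis. \<Sum>k. ennreal (op_abs A (e k) \<bullet> e k))"

definition trace_class :: "('a::real_inner \<Rightarrow>\<^sub>L 'a) set" where
  "trace_class = {A. trace_norm A < \<infinity>}"

text \<open>Boundedness of \<open>B \<times> Q\<close> in the product of the space with the trace class operators.\<close>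

definition bounded_in_trace_class :: "('a::real_inner \<times> ('a \<Rightarrow>\<^sub>L 'a)) set \<Rightarrow> bool" where
  "bounded_in_trace_class S \<longleftrightarrow>
     (\<exists>C::real. \<forall>(b, A)\<in>S. norm b \<le> C \<and> trace_norm A \<le> ennreal C)"

text \<open>
  \<open>\<mu> A k\<close> is the eigenvalue of \<open>A\<close> at \<open>e k\<close>; it is set to zero at padding indices, where the
  eigenvalue equation is void.
\<close>

definition joint_eigenbasis ::
  "('a::real_inner \<Rightarrow>\<^sub>L 'a) set \<Rightarrow> (nat \<Rightarrow> 'a) \<Rightarrow> (('a \<Rightarrow>\<^sub>L 'a) \<Rightarrow> nat \<Rightarrow> real) \<Rightarrow> bool" where
  "joint_eigenbasis Q e \<mu> \<longleftrightarrow>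
     orthonormal_basis e \<and>
     (\<forall>A\<in>Q. \<forall>k. blinfun_apply A (e k) = \<mu> A k *\<^sub>R e k \<and> (e k = 0 \<longrightarrow> \<mu> A k = 0))"

definition compact_operator :: "('a::real_normed_vector \<Rightarrow> 'b::real_normed_vector) \<Rightarrow> bool" where
  "compact_operator K \<longleftrightarrow> linear K \<and> (\<forall>S. bounded S \<longrightarrow> compact (closure (K ` S)))"


section \<open>Filtered probability spaces and Brownian motion\<close>

text \<open>Only the members \<open>F t\<close> with \<open>t \<ge> 0\<close> of a filtration are relevant.\<close>

definition usual_filtered_prob_space :: "'w measure \<Rightarrow> (real \<Rightarrow> 'w measure) \<Rightarrow> bool" where
  "usual_filtered_prob_space M F \<longleftrightarrow>
     prob_space M \<and> complete_measure M \<and>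
     (\<forall>t\<ge>0. subalgebra M (F t)) \<and>
     (\<forall>s t. 0 \<le> s \<longrightarrow> s \<le> t \<longrightarrow> sets (F s) \<subseteq> sets (F t)) \<and>
     null_sets M \<subseteq> sets (F 0) \<and>
     (\<forall>t\<ge>0. (\<Inter>u\<in>{t<..}. sets (F u)) = sets (F t))"

definition brownian_motion ::
  "'w measure \<Rightarrow> (real \<Rightarrow> 'w measure) \<Rightarrow> (real \<Rightarrow> 'w \<Rightarrow> real) \<Rightarrow> bool" where
  "brownian_motion M F W \<longleftrightarrow>
     (\<forall>t\<ge>0. W t \<in> borel_measurable (F t)) \<and>
     (AE \<omega> in M. W 0 \<omega> = 0) \<and>
     (AE \<omega> in M. continuous_on {0..} (\<lambda>t. W t \<omega>)) \<and>
     (\<forall>s t. 0 \<le> s \<longrightarrow> s < t \<longrightarrow>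
        distributed M lborel (\<lambda>\<omega>. W t \<omega> - W s \<omega>) (normal_density 0 (sqrt (t - s))) \<and>
        prob_space.indep_set M (sets (F s))
          {(\<lambda>\<omega>. W t \<omega> - W s \<omega>) -` A \<inter> space M | A. A \<in> sets borel})"

definition indep_brownian_motions ::
  "'w measure \<Rightarrow> (real \<Rightarrow> 'w measure) \<Rightarrow> (nat \<Rightarrow> real \<Rightarrow> 'w \<Rightarrow> real) \<Rightarrow> bool" where
  "indep_brownian_motions M F \<xi> \<longleftrightarrow>
     (\<forall>k. brownian_motion M F (\<xi> k)) \<and>
     prob_space.indep_vars M (\<lambda>_. Pi\<^sub>M {0..} (\<lambda>_. borel))
       (\<lambda>k \<omega>. restrict (\<lambda>t. \<xi> k t \<omega>) {0..}) UNIV"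


section \<open>The Ito integral\<close>

definition elementary_process ::
  "'w measure \<Rightarrow> (real \<Rightarrow> 'w measure) \<Rightarrow> nat \<Rightarrow> (nat \<Rightarrow> real) \<Rightarrow> (nat \<Rightarrow> 'w \<Rightarrow> real) \<Rightarrow> bool" where
  "elementary_process M F m \<tau> \<eta> \<longleftrightarrow>
     0 \<le> \<tau> 0 \<and> (\<forall>i<m. \<tau> i \<le> \<tau> (Suc i)) \<and>
     (\<forall>i<m. \<eta> i \<in> borel_measurable (F (\<tau> i)) \<and> bounded (\<eta> i ` space M))"

definition elementary_value ::
  "nat \<Rightarrow> (nat \<Rightarrow> real) \<Rightarrow> (nat \<Rightarrow> 'w \<Rightarrow> real) \<Rightarrow> real \<Rightarrow> 'w \<Rightarrow> real" where
  "elementary_value m \<tau> \<eta> s \<omega> = (\<Sum>i<m. \<eta> i \<omega> * indicator {\<tau> i<..\<tau> (Suc i)} s)"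

definition elementary_integral ::
  "(real \<Rightarrow> 'w \<Rightarrow> real) \<Rightarrow> nat \<Rightarrow> (nat \<Rightarrow> real) \<Rightarrow> (nat \<Rightarrow> 'w \<Rightarrow> real) \<Rightarrow> real \<Rightarrow> 'w \<Rightarrow> real" where
  "elementary_integral W m \<tau> \<eta> t \<omega> =
     (\<Sum>i<m. \<eta> i \<omega> * (W (min t (\<tau> (Suc i))) \<omega> - W (min t (\<tau> i)) \<omega>))"

text \<open>
  \<open>J\<close> is a version of the integral of \<open>H\<close> over \<open>[0, t]\<close>: the mean square limit of the
  integrals of elementary processes converging to \<open>H\<close> in mean square on \<open>[0, t]\<close>.
\<close>

definition has_ito_integral ::
  "'w measure \<Rightarrow> (real \<Rightarrow> 'w measure) \<Rightarrow> (real \<Rightarrow> 'w \<Rightarrow> real) \<Rightarrow>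
   (real \<Rightarrow> 'w \<Rightarrow> real) \<Rightarrow> real \<Rightarrow> ('w \<Rightarrow> real) \<Rightarrow> bool" where
  "has_ito_integral M F W H t J \<longleftrightarrow>
     J \<in> borel_measurable M \<and>
     (\<exists>m \<tau> \<eta>. (\<forall>n. elementary_process M F (m n) (\<tau> n) (\<eta> n)) \<and>
        (\<lambda>n. \<integral>\<^sup>+ \<omega>. (\<integral>\<^sup>+ s\<in>{0..t}.
            ennreal ((elementary_value (m n) (\<tau> n) (\<eta> n) s \<omega> - H s \<omega>)\<^sup>2) \<partial>lborel) \<partial>M)
          \<longlonglongrightarrow> 0 \<and>
        (\<lambda>n. \<integral>\<^sup>+ \<omega>. ennreal ((elementary_integral W (m n) (\<tau> n) (\<eta> n) t \<omega> - J \<omega>)\<^sup>2) \<partial>M)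
          \<longlonglongrightarrow> 0)"

text \<open>The integral is unique only up to null sets; some version is chosen.\<close>

definition ito_integral ::
  "'w measure \<Rightarrow> (real \<Rightarrow> 'w measure) \<Rightarrow> (real \<Rightarrow> 'w \<Rightarrow> real) \<Rightarrow>
   (real \<Rightarrow> 'w \<Rightarrow> real) \<Rightarrow> real \<Rightarrow> 'w \<Rightarrow> real" where
  "ito_integral M F W H t = (SOME J. has_ito_integral M F W H t J)"


section \<open>Predictable controls\<close>

definition predictable_sigma :: "'w measure \<Rightarrow> (real \<Rightarrow> 'w measure) \<Rightarrow> ('w \<times> real) measure" where
  "predictable_sigma M F = sigma (space M \<times> {0..})
     ({A \<times> {0} | A. A \<in> sets (F 0)} \<union>
      {A \<times> {s<..t} | A s t. 0 \<le> s \<and> s \<le> t \<and> A \<in> sets (F s)})"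

definition l1 :: "(nat \<Rightarrow> real) set" where
  "l1 = {x. (\<lambda>k. \<bar>x k\<bar>) summable_on UNIV}"

definition l1_dist :: "(nat \<Rightarrow> real) \<Rightarrow> (nat \<Rightarrow> real) \<Rightarrow> real" where
  "l1_dist x y = (\<Sum>\<^sub>\<infinity>k. \<bar>x k - y k\<bar>)"

lemma Metric_space_l1: "Metric_space l1 l1_dist"
proof
  show "0 \<le> l1_dist x y" for x y
    by (simp add: l1_dist_def infsum_nonneg)
  show "l1_dist x y = l1_dist y x" for x y
    by (simp add: l1_dist_def abs_minus_commute)
  have diff: "(\<lambda>k. \<bar>x k - y k\<bar>) summable_on UNIV" if "x \<in> l1" "y \<in> l1" for x y :: "nat \<Rightarrow> real"
  proof (rule summable_on_comparison_test)
    show "(\<lambda>k. \<bar>x k\<bar> + \<bar>y k\<bar>) summable_on UNIV"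
      using that by (auto simp: l1_def intro: summable_on_add)
  qed auto
  show "l1_dist x y = 0 \<longleftrightarrow> x = y" if "x \<in> l1" "y \<in> l1" for x y
  proof
    assume "l1_dist x y = 0"
    then have "\<bar>x k - y k\<bar> = 0" for k
      using nonneg_infsum_le_0D[OF _ diff[OF that], of k] by (simp add: l1_dist_def)
    then show "x = y" by auto
  qed (simp add: l1_dist_def)
  show "l1_dist x z \<le> l1_dist x y + l1_dist y z" if "x \<in> l1" "y \<in> l1" "z \<in> l1" for x y z
  proof -
    have "l1_dist x z \<le> (\<Sum>\<^sub>\<infinity>k. \<bar>x k - y k\<bar> + \<bar>y k - z k\<bar>)"
      unfolding l1_dist_def
      by (intro infsum_mono diff summable_on_add that) auto
    also have "\<dots> = l1_dist x y + l1_dist y z"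
      unfolding l1_dist_def by (intro infsum_add diff that)
    finally show ?thesis .
  qed
qed

text \<open>\<open>\<Lambda>\<close> with the Borel sets it inherits from the product of the space with \<open>l1\<close>.\<close>

definition control_borel ::
  "('a::topological_space \<times> (nat \<Rightarrow> real)) set \<Rightarrow> ('a \<times> (nat \<Rightarrow> real)) measure" where
  "control_borel \<Lambda> = sigma \<Lambda>
     {\<Lambda> \<inter> U | U. openin (prod_topology euclidean (Metric_space.mtopology l1 l1_dist)) U}"

definition controls ::
  "'w measure \<Rightarrow> (real \<Rightarrow> 'w measure) \<Rightarrow> ('a::topological_space \<times> (nat \<Rightarrow> real)) set \<Rightarrow>
   ('w \<times> real \<Rightarrow> 'a \<times> (nat \<Rightarrow> real)) set" where
  "controls M F \<Lambda> = predictable_sigma M F \<rightarrow>\<^sub>M control_borel \<Lambda>"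


section \<open>The two families of operators\<close>

definition control_set ::
  "'a set \<Rightarrow> ('a::real_inner \<Rightarrow>\<^sub>L 'a) set \<Rightarrow> (('a \<Rightarrow>\<^sub>L 'a) \<Rightarrow> nat \<Rightarrow> real) \<Rightarrow>
   ('a \<times> (nat \<Rightarrow> real)) set" where
  "control_set B Q \<mu> = B \<times> \<mu> ` Q"

text \<open>
  The operators act on arbitrary real functions, since \<open>I_op\<close> need not map bounded continuous
  functions to continuous ones. The series over \<open>k\<close> converge in norm almost surely.
\<close>

definition I_op ::
  "'w measure \<Rightarrow> (nat \<Rightarrow> real \<Rightarrow> 'w \<Rightarrow> real) \<Rightarrow> (nat \<Rightarrow> 'a::real_inner) \<Rightarrow>
   ('a \<times> (nat \<Rightarrow> real)) set \<Rightarrow> real \<Rightarrow> ('a \<Rightarrow> real) \<Rightarrow> 'a \<Rightarrow> real" where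
  "I_op M \<xi> e \<Lambda> t f x =
     (SUP (b, \<mu>)\<in>\<Lambda>. LINT \<omega>|M. f (x + t *\<^sub>R b + (\<Sum>k. (sqrt (\<mu> k) * \<xi> k t \<omega>) *\<^sub>R e k)))"

definition T_op ::
  "'w measure \<Rightarrow> (real \<Rightarrow> 'w measure) \<Rightarrow> (nat \<Rightarrow> real \<Rightarrow> 'w \<Rightarrow> real) \<Rightarrow>
   (nat \<Rightarrow> 'a::{real_inner, banach, second_countable_topology}) \<Rightarrow>
   ('a \<times> (nat \<Rightarrow> real)) set \<Rightarrow> real \<Rightarrow> ('a \<Rightarrow> real) \<Rightarrow> 'a \<Rightarrow> real" where
  "T_op M F \<xi> e \<Lambda> t f x =
     (SUP \<alpha>\<in>controls M F \<Lambda>. LINT \<omega>|M.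
        f (x + (LBINT s:{0..t}. fst (\<alpha> (\<omega>, s)))
             + (\<Sum>k. ito_integral M F (\<xi> k) (\<lambda>s \<omega>. sqrt (snd (\<alpha> (\<omega>, s)) k)) t \<omega> *\<^sub>R e k)))"

definition grid :: "real \<Rightarrow> real set" where
  "grid h = {real k * h | k. True}"

text \<open>
  If \<open>t\<close> is not in \<open>grid h\<close>, then \<open>num_steps h t\<close> iterations of \<open>I_op\<close> with step \<open>h\<close> end
  strictly before time \<open>t\<close>. Such an iterate can exceed \<open>T_op\<close> at time \<open>t\<close> (already for a single
  constant drift), so only indices \<open>n\<close> with \<open>t \<in> grid (h n)\<close> can enter a supremum formula.
\<close>

definition num_steps :: "real \<Rightarrow> real \<Rightarrow> nat" where
  "num_steps h t = Max {k. real k * h \<le> t}"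

text \<open>Convergence of sequences of bounded continuous functions in the mixed topology.\<close>

definition mixed_limit :: "(nat \<Rightarrow> 'a::topological_space \<Rightarrow> real) \<Rightarrow> ('a \<Rightarrow> real) \<Rightarrow> bool" where
  "mixed_limit u v \<longleftrightarrow>
     (\<forall>n. u n \<in> bcontfun) \<and> v \<in> bcontfun \<and>
     (\<exists>C. \<forall>n x. \<bar>u n x\<bar> \<le> C) \<and>
     (\<forall>S. compact S \<longrightarrow> uniform_limit S u v sequentially)"

end

theory Submission
  imports Defs
begin

text \<open>
  Choosing near-optimal controls step by step identifies the iterate \<open>I(h)\<^sup>k f(x)\<close> with the
  supremum of \<open>E f(x + S)\<close> over random walks \<open>S\<close> driven by controls that are constant and adapted on
  the grid of mesh \<open>h\<close>; measurable selection is elementary because \<open>\<Lambda>\<close>, embedded by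
  \<open>(b, \<mu>) \<mapsto> (b, \<Sum>\<^sub>k \<surd>\<mu>\<^sub>k e\<^sub>k)\<close>, is a separable subset of the square of the Hilbert space. Such
  walks are, up to the last incomplete step, controlled states, which gives the upper bound. Conversely,
  every predictable control is a mean square limit of grid controls, and by the Ito isometry the states
  converge. The function \<open>f = g \<circ> K\<close> is uniformly continuous on bounded sets, so second moment bounds
  make all estimates uniform in the control, and pointwise convergence improves to locally uniform
  convergence by equicontinuity.

  The Brownian motions are only assumed to be adapted individually and independent of each other.
  That the whole vector of increments is independent of the past is Levy's characterisation; it
  follows from a Taylor expansion of the characteristic function along partitions.
\<close>

section \<open>Brownian increments with respect to the filtration\<close>

text \<open>Uniformity in the control rests on one pathwise inequality, |f(x + X) - f(x + X')| \<le>
  \<epsilon> + \<epsilon> |X|^2 + b |X' - X|^2, which turns mean square closeness of displacements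
  into closeness of expectations with constants that do not see the control. The class
  \<open>ucb\<close> of functions for which it is proved is preserved by \<open>I_op\<close> with a
  positive step and can therefore carry the induction over the steps. Controls are compared by
  \<open>dd\<close>, built on \<surd>\<mu> rather than \<mu>, because the square root is what
  multiplies the noise. A single estimate, \<open>state_walk_dist\<close>, serves both bounds: the
  mean square distance between the state of a control and a walk is at most a constant times the
  mean of \<open>dd\<close> plus the length of the last incomplete step. If the control is the one
  generated by the walk, the first contribution is zero; at a grid time the second is zero as well.
  This is why the iterates stay below \<open>T_op\<close> exactly at grid times and only up to a
  vanishing error at others, and why the supremum formula speaks of grid times.\<close>

locale brownian_family = prob_space M for M :: "'w measure" +
  fixes F :: "real \<Rightarrow> 'w measure" and \<xi> :: "nat \<Rightarrow> real \<Rightarrow> 'w \<Rightarrow> real"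
  assumes usual: "usual_filtered_prob_space M F"
    and brownian: "indep_brownian_motions M F \<xi>"
begin

lemma subalgebra_F: "0 \<le> s \<Longrightarrow> subalgebra M (F s)"
  using usual by (auto simp: usual_filtered_prob_space_def)

lemma space_F: "0 \<le> s \<Longrightarrow> space (F s) = space M"
  using subalgebra_F by (auto simp: subalgebra_def)

lemma sets_F: "0 \<le> s \<Longrightarrow> A \<in> sets (F s) \<Longrightarrow> A \<in> sets M"
  using subalgebra_F by (auto simp: subalgebra_def)

lemma subalgebra_F_mono: "0 \<le> s \<Longrightarrow> s \<le> t \<Longrightarrow> subalgebra (F t) (F s)"
  using usual by (auto simp: usual_filtered_prob_space_def subalgebra_def)

lemma measurable_F_mono: "f \<in> measurable (F s) N \<Longrightarrow> 0 \<le> s \<Longrightarrow> s \<le> t \<Longrightarrow> f \<in> measurable (F t) N"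
  using measurable_from_subalg[OF subalgebra_F_mono] by blast

lemma measurable_F: "f \<in> measurable (F s) N \<Longrightarrow> 0 \<le> s \<Longrightarrow> f \<in> measurable M N"
  using measurable_from_subalg[OF subalgebra_F] by blast

lemma bm: "brownian_motion M F (\<xi> k)"
  using brownian by (auto simp: indep_brownian_motions_def)

lemma adapted: "0 \<le> t \<Longrightarrow> \<xi> k t \<in> borel_measurable (F t)"
  using bm[of k] by (auto simp: brownian_motion_def)

lemma measurable_bm [measurable]: "0 \<le> t \<Longrightarrow> \<xi> k t \<in> borel_measurable M"
  using adapted measurable_F by blast

lemma measurable_increment [measurable]:
  "0 \<le> s \<Longrightarrow> 0 \<le> t \<Longrightarrow> (\<lambda>\<omega>. \<xi> k t \<omega> - \<xi> k s \<omega>) \<in> borel_measurable M"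
  by (auto intro!: borel_measurable_diff measurable_bm)

lemma adapted_increment:
  "0 \<le> s \<Longrightarrow> s \<le> t \<Longrightarrow> t \<le> u \<Longrightarrow> (\<lambda>\<omega>. \<xi> k t \<omega> - \<xi> k s \<omega>) \<in> borel_measurable (F u)"
  by (intro borel_measurable_diff; rule measurable_F_mono[OF adapted]) auto

lemma increment_distributed:
  "0 \<le> s \<Longrightarrow> s < t \<Longrightarrow>
    distributed M lborel (\<lambda>\<omega>. \<xi> k t \<omega> - \<xi> k s \<omega>) (normal_density 0 (sqrt (t - s)))"
  using bm[of k] by (auto simp: brownian_motion_def)

lemma increment_indep_set:
  assumes "0 \<le> s" "s < t"
  shows "indep_set (sets (F s)) {(\<lambda>\<omega>. \<xi> k t \<omega> - \<xi> k s \<omega>) -` A \<inter> space M | A. A \<in> sets borel}"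
  using bm[of k] assms by (auto simp: brownian_motion_def)

text \<open>Sets generated by Z lie in \<open>F s\<close>, and sets generated by g of the increment
  lie in the family independent of \<open>F s\<close>; the product rule for expectations follows.
  The value type stays open because characteristic functions need complex weights and the isometry
  needs real ones.\<close>

lemma increment_mult:
  fixes Z :: "'w \<Rightarrow> 'b::{real_normed_field, banach, second_countable_topology}"
  assumes st: "0 \<le> s" "s < t" and Z: "Z \<in> borel_measurable (F s)" "integrable M Z"
    and g: "g \<in> borel_measurable borel" "integrable M (\<lambda>\<omega>. g (\<xi> k t \<omega> - \<xi> k s \<omega>))"
  shows "integrable M (\<lambda>\<omega>. Z \<omega> * g (\<xi> k t \<omega> - \<xi> k s \<omega>))"
    and "(\<integral>\<omega>. Z \<omega> * g (\<xi> k t \<omega> - \<xi> k s \<omega>) \<partial>M) = (\<integral>\<omega>. Z \<omega> \<partial>M) * (\<integral>\<omega>. g (\<xi> k t \<omega> - \<xi> k s \<omega>) \<partial>M)"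
proof -
  have [measurable]: "Z \<in> borel_measurable M" "g \<in> borel_measurable borel"
    using measurable_F[OF Z(1) st(1)] g(1) by auto
  have gm[measurable]: "(\<lambda>\<omega>. g (\<xi> k t \<omega> - \<xi> k s \<omega>)) \<in> borel_measurable M"
    using st by (intro measurable_compose[OF measurable_increment g(1)]) auto
  have A: "{Z -` A \<inter> space M |A. A \<in> sets borel} \<subseteq> sets (F s)"
    using measurable_sets[OF Z(1)] space_F[OF st(1)] by auto
  have B: "{(\<lambda>\<omega>. g (\<xi> k t \<omega> - \<xi> k s \<omega>)) -` A \<inter> space M |A. A \<in> sets borel}
    \<subseteq> {(\<lambda>\<omega>. \<xi> k t \<omega> - \<xi> k s \<omega>) -` A \<inter> space M | A. A \<in> sets borel}"
  proof safe
    fix A :: "'b set" assume "A \<in> sets borel"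
    then show "\<exists>B. (\<lambda>\<omega>. g (\<xi> k t \<omega> - \<xi> k s \<omega>)) -` A \<inter> space M =
      (\<lambda>\<omega>. \<xi> k t \<omega> - \<xi> k s \<omega>) -` B \<inter> space M \<and> B \<in> sets borel"
      using measurable_sets[OF g(1), of A] by (intro exI[of _ "g -` A"]) auto
  qed
  have "indep_set {Z -` A \<inter> space M |A. A \<in> sets borel}
      {(\<lambda>\<omega>. g (\<xi> k t \<omega> - \<xi> k s \<omega>)) -` A \<inter> space M |A. A \<in> sets borel}"
    unfolding indep_sets2_eq
  proof (intro conjI ballI)
    note * = increment_indep_set[OF st, of k, unfolded indep_sets2_eq]
    show "prob (a \<inter> b) = prob a * prob b"
      if "a \<in> {Z -` A \<inter> space M |A. A \<in> sets borel}"
        "b \<in> {(\<lambda>\<omega>. g (\<xi> k t \<omega> - \<xi> k s \<omega>)) -` A \<inter> space M |A. A \<in> sets borel}" for a b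
      using *[THEN conjunct2, THEN conjunct2] subsetD[OF A that(1)] subsetD[OF B that(2)] by simp
  qed (use A sets_F[OF st(1)] in auto)
  moreover have stable: "Int_stable {f -` A \<inter> space M |A. A \<in> sets borel}" for f :: "'w \<Rightarrow> 'b"
  proof (rule Int_stableI)
    fix a b assume "a \<in> {f -` A \<inter> space M |A. A \<in> sets borel}" "b \<in> {f -` A \<inter> space M |A. A \<in> sets borel}"
    then obtain A B where "A \<in> sets borel" "B \<in> sets borel" "a = f -` A \<inter> space M" "b = f -` B \<inter> space M"
      by auto
    then show "a \<inter> b \<in> {f -` A \<inter> space M |A. A \<in> sets borel}"
      by (auto intro!: exI[of _ "A \<inter> B"])
  qed
  ultimately have ind: "indep_var borel Z borel (\<lambda>\<omega>. g (\<xi> k t \<omega> - \<xi> k s \<omega>))"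
    unfolding indep_var_eq by (intro conjI indep_set_sigma_sets stable) auto
  show "integrable M (\<lambda>\<omega>. Z \<omega> * g (\<xi> k t \<omega> - \<xi> k s \<omega>))"
    by (rule indep_var_integrable[OF ind Z(2) g(2)])
  show "(\<integral>\<omega>. Z \<omega> * g (\<xi> k t \<omega> - \<xi> k s \<omega>) \<partial>M) = (\<integral>\<omega>. Z \<omega> \<partial>M) * (\<integral>\<omega>. g (\<xi> k t \<omega> - \<xi> k s \<omega>) \<partial>M)"
    by (rule indep_var_lebesgue_integral[OF ind Z(2) g(2)])
qed

lemma increment_power_integrable:
  assumes "0 \<le> s" "s \<le> t"
  shows "integrable M (\<lambda>\<omega>. (\<xi> k t \<omega> - \<xi> k s \<omega>) ^ n)"
proof (cases "s = t")
  case False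
  then have "s < t" using assms by simp
  then show ?thesis
    using distributed_integrable[OF increment_distributed[OF assms(1)], of t "\<lambda>x. x ^ n" k]
      integrable_normal_moment[of "sqrt (t - s)" 0 n] by (simp)
qed (cases n; simp)

lemma increment_mean:
  assumes "0 \<le> s" "s \<le> t"
  shows "(\<integral>\<omega>. \<xi> k t \<omega> - \<xi> k s \<omega> \<partial>M) = 0"
proof (cases "s = t")
  case False
  then have "s < t" using assms by simp
  then show ?thesis
    using distributed_integral[OF increment_distributed[OF assms(1)], of t "\<lambda>x. x" k]
      integral_normal_moment_nz_1[of "sqrt (t - s)" 0] by simp
qed simp

lemma increment_moment2:
  assumes "0 \<le> s" "s \<le> t"
  shows "(\<integral>\<omega>. (\<xi> k t \<omega> - \<xi> k s \<omega>)\<^sup>2 \<partial>M) = t - s"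
proof (cases "s = t")
  case False
  then have "s < t" using assms by simp
  then show ?thesis
    using distributed_integral[OF increment_distributed[OF assms(1)], of t "\<lambda>x. x^2" k]
      integral_normal_moment_even[of "sqrt (t - s)" 0 1] by simp
qed simp

lemma increment_moment4:
  assumes "0 \<le> s" "s \<le> t"
  shows "(\<integral>\<omega>. (\<xi> k t \<omega> - \<xi> k s \<omega>)^4 \<partial>M) = 3 * (t - s)\<^sup>2"
proof (cases "s = t")
  case False
  then have "s < t" using assms by simp
  then show ?thesis
    using distributed_integral[OF increment_distributed[OF assms(1)], of t "\<lambda>x. x^4" k]
      integral_normal_moment_even[of "sqrt (t - s)" 0 2] by (simp add: fact_numeral field_simps)
qed simp

text \<open>The martingale property of \<open>\<xi> k\<close>, tested against an earlier weight. The
  case s = t is included because truncating intervals at a time horizon produces empty ones.\<close>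

lemma increment_mult_mean:
  fixes Z :: "'w \<Rightarrow> 'b::{real_normed_field, banach, second_countable_topology}"
  assumes st: "0 \<le> s" "s \<le> t" and Z: "Z \<in> borel_measurable (F s)" "integrable M Z"
  shows "integrable M (\<lambda>\<omega>. Z \<omega> * of_real (\<xi> k t \<omega> - \<xi> k s \<omega>))"
    and "(\<integral>\<omega>. Z \<omega> * of_real (\<xi> k t \<omega> - \<xi> k s \<omega>) \<partial>M) = 0"
proof -
  have *: "integrable M (\<lambda>\<omega>. of_real (\<xi> k t \<omega> - \<xi> k s \<omega>) :: 'b)"
    using increment_power_integrable[OF st, of k 1] by (intro integrable_of_real) simp
  have "integrable M (\<lambda>\<omega>. Z \<omega> * of_real (\<xi> k t \<omega> - \<xi> k s \<omega>)) \<and>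
    (\<integral>\<omega>. Z \<omega> * of_real (\<xi> k t \<omega> - \<xi> k s \<omega>) \<partial>M) = 0"
  proof (cases "s = t")
    case False
    have "(\<integral>\<omega>. of_real (\<xi> k t \<omega> - \<xi> k s \<omega>) \<partial>M) = (0 :: 'b)"
      by (subst integral_bounded_linear[OF bounded_linear_of_real increment_power_integrable[OF st, of k 1, simplified]])
        (simp only: increment_mean[OF st, of k] of_real_0)
    then show ?thesis using increment_mult[of s t Z of_real k] False st Z *
      by (simp del: of_real_diff)
  qed simp
  then show "integrable M (\<lambda>\<omega>. Z \<omega> * of_real (\<xi> k t \<omega> - \<xi> k s \<omega>))"
    "(\<integral>\<omega>. Z \<omega> * of_real (\<xi> k t \<omega> - \<xi> k s \<omega>) \<partial>M) = 0" by auto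
qed

lemma increment_mult_square:
  fixes Z :: "'w \<Rightarrow> 'b::{real_normed_field, banach, second_countable_topology}"
  assumes st: "0 \<le> s" "s \<le> t" and Z: "Z \<in> borel_measurable (F s)" "integrable M Z"
  shows "integrable M (\<lambda>\<omega>. Z \<omega> * of_real ((\<xi> k t \<omega> - \<xi> k s \<omega>)\<^sup>2))"
    and "(\<integral>\<omega>. Z \<omega> * of_real ((\<xi> k t \<omega> - \<xi> k s \<omega>)\<^sup>2) \<partial>M) = (\<integral>\<omega>. Z \<omega> \<partial>M) * of_real (t - s)"
proof -
  have *: "integrable M (\<lambda>\<omega>. of_real ((\<xi> k t \<omega> - \<xi> k s \<omega>)\<^sup>2) :: 'b)"
    using increment_power_integrable[OF st, of k 2] by (intro integrable_of_real)
  have "integrable M (\<lambda>\<omega>. Z \<omega> * of_real ((\<xi> k t \<omega> - \<xi> k s \<omega>)\<^sup>2)) \<and>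
    (\<integral>\<omega>. Z \<omega> * of_real ((\<xi> k t \<omega> - \<xi> k s \<omega>)\<^sup>2) \<partial>M) = (\<integral>\<omega>. Z \<omega> \<partial>M) * of_real (t - s)"
  proof (cases "s = t")
    case False
    have 1: "(\<lambda>x. of_real (x\<^sup>2) :: 'b) \<in> borel_measurable borel" by measurable
    have 2: "integral\<^sup>L M (\<lambda>\<omega>. of_real ((\<xi> k t \<omega> - \<xi> k s \<omega>)\<^sup>2) :: 'b) = of_real (t - s)"
      by (subst integral_bounded_linear[OF bounded_linear_of_real increment_power_integrable[OF st, of k 2]])
        (simp only: increment_moment2[OF st, of k])
    show ?thesis using increment_mult[OF _ _ Z 1 *] st False
      unfolding 2 by simp
  qed simp
  then show "integrable M (\<lambda>\<omega>. Z \<omega> * of_real ((\<xi> k t \<omega> - \<xi> k s \<omega>)\<^sup>2))"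
    "(\<integral>\<omega>. Z \<omega> * of_real ((\<xi> k t \<omega> - \<xi> k s \<omega>)\<^sup>2) \<partial>M) = (\<integral>\<omega>. Z \<omega> \<partial>M) * of_real (t - s)"
    by auto
qed

end

lemma integrable_mult_L2:
  fixes f g :: "'a \<Rightarrow> real"
  assumes [measurable]: "f \<in> borel_measurable M" "g \<in> borel_measurable M"
    and "integrable M (\<lambda>x. (f x)\<^sup>2)" "integrable M (\<lambda>x. (g x)\<^sup>2)"
  shows "integrable M (\<lambda>x. f x * g x)"
proof (rule Bochner_Integration.integrable_bound)
  show "integrable M (\<lambda>x. (f x)\<^sup>2 + (g x)\<^sup>2)" using assms by auto
  have "\<bar>a * b\<bar> \<le> a\<^sup>2 + b\<^sup>2" for a b :: real
  proof -
    have "0 \<le> \<bar>a\<bar> * \<bar>b\<bar>" "2 * (\<bar>a\<bar> * \<bar>b\<bar>) \<le> a\<^sup>2 + b\<^sup>2"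
      using sum_squares_bound[of "\<bar>a\<bar>" "\<bar>b\<bar>"] by (simp_all add: mult.assoc)
    then show ?thesis unfolding abs_mult by linarith
  qed
  then show "AE x in M. norm (f x * g x) \<le> norm ((f x)\<^sup>2 + (g x)\<^sup>2)"
    by auto
qed auto

context brownian_family begin

lemma bounded_integrable:
  fixes Z :: "'w \<Rightarrow> 'b::{banach, second_countable_topology}"
  assumes "Z \<in> borel_measurable M" "\<And>\<omega>. \<omega> \<in> space M \<Longrightarrow> norm (Z \<omega>) \<le> c"
  shows "integrable M Z"
  using assms by (intro integrable_const_bound[where B=c]) auto

text \<open>Mutual independence of the Brownian motions enters here and nowhere else. It speaks of
  whole paths, so the same functional \<phi> of two different paths factorises; the filtration is
  not involved.\<close>

lemma processes_indep:
  assumes kl: "k \<noteq> l" and \<phi>: "\<phi> \<in> borel_measurable (Pi\<^sub>M {0..} (\<lambda>_. borel))"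
    and int: "\<And>k. integrable M (\<lambda>\<omega>. \<phi> (restrict (\<lambda>t. \<xi> k t \<omega>) {0..}) :: real)"
  shows "(\<integral>\<omega>. \<phi> (restrict (\<lambda>t. \<xi> k t \<omega>) {0..}) * \<phi> (restrict (\<lambda>t. \<xi> l t \<omega>) {0..}) \<partial>M) =
    (\<integral>\<omega>. \<phi> (restrict (\<lambda>t. \<xi> k t \<omega>) {0..}) \<partial>M) * (\<integral>\<omega>. \<phi> (restrict (\<lambda>t. \<xi> l t \<omega>) {0..}) \<partial>M)"
    "integrable M (\<lambda>\<omega>. \<phi> (restrict (\<lambda>t. \<xi> k t \<omega>) {0..}) * \<phi> (restrict (\<lambda>t. \<xi> l t \<omega>) {0..}))"
proof -
  have "indep_vars (\<lambda>_. Pi\<^sub>M {0..} (\<lambda>_. borel)) (\<lambda>k \<omega>. restrict (\<lambda>t. \<xi> k t \<omega>) {0..}) UNIV"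
    using brownian by (auto simp: indep_brownian_motions_def)
  from indep_vars_subset[OF indep_vars_compose2[OF this, of "\<lambda>_. \<phi>" "\<lambda>_. borel", OF \<phi>], of "{k, l}"]
  have ind: "indep_vars (\<lambda>_. borel) (\<lambda>i x. \<phi> (restrict (\<lambda>t. \<xi> i t x) {0..})) {k, l}" by simp
  from indep_vars_lebesgue_integral[OF _ ind int] indep_vars_integrable[OF _ ind int] kl
  show "(\<integral>\<omega>. \<phi> (restrict (\<lambda>t. \<xi> k t \<omega>) {0..}) * \<phi> (restrict (\<lambda>t. \<xi> l t \<omega>) {0..}) \<partial>M) =
    (\<integral>\<omega>. \<phi> (restrict (\<lambda>t. \<xi> k t \<omega>) {0..}) \<partial>M) * (\<integral>\<omega>. \<phi> (restrict (\<lambda>t. \<xi> l t \<omega>) {0..}) \<partial>M)"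
    "integrable M (\<lambda>\<omega>. \<phi> (restrict (\<lambda>t. \<xi> k t \<omega>) {0..}) * \<phi> (restrict (\<lambda>t. \<xi> l t \<omega>) {0..}))"
    by simp_all
qed

lemma increments_integrable:
  assumes "0 \<le> s" "s \<le> t" "0 \<le> s'" "s' \<le> t'"
  shows "integrable M (\<lambda>\<omega>. (\<xi> k t \<omega> - \<xi> k s \<omega>) * (\<xi> l t' \<omega> - \<xi> l s' \<omega>))"
  using assms by (intro integrable_mult_L2 increment_power_integrable measurable_increment) auto

text \<open>The later increment is centred given everything known at its left end, and Z times the
  earlier increment is such a quantity. Only the filtration property of the later motion is used, so
  k and l may be equal or different.\<close>

lemma disjoint_increments:
  assumes Z: "Z \<in> borel_measurable (F s)" "\<And>\<omega>. \<omega> \<in> space M \<Longrightarrow> norm (Z \<omega>) \<le> 1"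
    and "0 \<le> s" "s \<le> a" "a \<le> b" "b \<le> c" "c \<le> d"
  shows "integrable M (\<lambda>\<omega>. (Z \<omega> :: complex) * of_real ((\<xi> k b \<omega> - \<xi> k a \<omega>) * (\<xi> l d \<omega> - \<xi> l c \<omega>)))"
    "(\<integral>\<omega>. Z \<omega> * of_real ((\<xi> k b \<omega> - \<xi> k a \<omega>) * (\<xi> l d \<omega> - \<xi> l c \<omega>)) \<partial>M) = 0"
proof -
  have "Z \<in> borel_measurable M" using Z(1) assms(3) by (rule measurable_F)
  then have iZ: "integrable M Z" using Z(2) by (rule bounded_integrable)
  have m: "(\<lambda>\<omega>. Z \<omega> * of_real (\<xi> k b \<omega> - \<xi> k a \<omega>)) \<in> borel_measurable (F c)"
    using assms adapted_increment[of a b c k] measurable_F_mono[OF Z(1), of c]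
    by (intro borel_measurable_times borel_measurable_of_real) (auto simp del: of_real_diff)
  have i: "integrable M (\<lambda>\<omega>. Z \<omega> * of_real (\<xi> k b \<omega> - \<xi> k a \<omega>))"
    using assms iZ measurable_F_mono[OF Z(1), of a] by (intro increment_mult_mean) auto
  show "integrable M (\<lambda>\<omega>. (Z \<omega> :: complex) * of_real ((\<xi> k b \<omega> - \<xi> k a \<omega>) * (\<xi> l d \<omega> - \<xi> l c \<omega>)))"
    "(\<integral>\<omega>. Z \<omega> * of_real ((\<xi> k b \<omega> - \<xi> k a \<omega>) * (\<xi> l d \<omega> - \<xi> l c \<omega>)) \<partial>M) = 0"
    using increment_mult_mean[OF _ _ m i, of d l] assms by (simp_all add: mult.assoc)
qed

text \<open>The quadratic covariation of two independent Brownian motions is computed along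
  partitions, hence does not see the filtration. So two of the given Brownian motions are
  orthogonal martingales although only their individual increments are assumed to be independent
  of the filtration.\<close>

lemma increments_orthogonal:
  assumes Z: "Z \<in> borel_measurable (F s)" "\<And>\<omega>. \<omega> \<in> space M \<Longrightarrow> norm (Z \<omega>) \<le> 1"
    and st: "0 \<le> s" "s \<le> t" and kl: "k \<noteq> l"
  shows "(\<integral>\<omega>. (Z \<omega> :: complex) * of_real ((\<xi> k t \<omega> - \<xi> k s \<omega>) * (\<xi> l t \<omega> - \<xi> l s \<omega>)) \<partial>M) = 0"
proof -
  let ?q = "\<integral>\<omega>. Z \<omega> * of_real ((\<xi> k t \<omega> - \<xi> k s \<omega>) * (\<xi> l t \<omega> - \<xi> l s \<omega>)) \<partial>M"
  have Zm[measurable]: "Z \<in> borel_measurable M" using Z(1) st(1) by (rule measurable_F)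
  \<comment> \<open>Splitting [s, t] into n equal pieces leaves, in expectation, only the discrete
    covariation Y, whose root mean square is (t - s) / sqrt n.\<close>
  have bound: "norm ?q \<le> (t - s) / sqrt n" if n: "n > 0" for n :: nat
  proof (cases "s = t")
    case False
    define \<delta> where "\<delta> = (t - s) / n"
    define r where "r i = s + real i * \<delta>" for i
    define D where "D k i \<omega> = \<xi> k (r (Suc i)) \<omega> - \<xi> k (r i) \<omega>" for k i \<omega>
    define Y where "Y \<omega> = (\<Sum>i<n. D k i \<omega> * D l i \<omega>)" for \<omega>
    have \<delta>: "\<delta> > 0" using False st n by (auto simp: \<delta>_def)
    have r: "0 \<le> r i" "s \<le> r i" "r i \<le> r (Suc i)" "r (Suc i) - r i = \<delta>" for i
      using st \<delta> by (auto simp: r_def algebra_simps)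
    have rij: "r (Suc i) \<le> r j" if "i < j" for i j
    proof -
      have "real (Suc i) * \<delta> \<le> real j * \<delta>" using that \<delta> by (intro mult_right_mono) auto
      then show ?thesis by (simp add: r_def)
    qed
    have rn: "r n = t" "r 0 = s" using n by (auto simp: r_def \<delta>_def)
    have [measurable]: "D k i \<in> borel_measurable M" for k i
      unfolding D_def using r by (intro measurable_increment) auto
    have Dint: "integrable M (\<lambda>\<omega>. D k i \<omega> * D l j \<omega>)" for k l i j
      unfolding D_def using r by (intro increments_integrable) auto
    have ZDint: "integrable M (\<lambda>\<omega>. Z \<omega> * of_real (D k i \<omega> * D l j \<omega>))" for k l i j
    proof (rule Bochner_Integration.integrable_bound[OF Dint[of k i l j]])
      show "AE \<omega> in M. norm (Z \<omega> * of_real (D k i \<omega> * D l j \<omega>)) \<le> norm (D k i \<omega> * D l j \<omega>)"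
        using Z(2) by (intro AE_I2) (simp add: norm_mult mult_left_le_one_le del: of_real_mult)
      show "(\<lambda>\<omega>. Z \<omega> * of_real (D k i \<omega> * D l j \<omega>)) \<in> borel_measurable M"
        by (intro borel_measurable_times borel_measurable_of_real) auto
    qed
    have tele: "\<xi> k t \<omega> - \<xi> k s \<omega> = (\<Sum>i<n. D k i \<omega>)" for k \<omega>
      using sum_lessThan_telescope[of "\<lambda>i. \<xi> k (r i) \<omega>" n] by (simp add: D_def rn)
    \<comment> \<open>Increments over two different pieces are orthogonal by conditioning on the
      left end of the later piece; the two cases differ only in which factor is the later
      one.\<close>
    have zero: "(\<integral>\<omega>. Z \<omega> * of_real (D k i \<omega> * D l j \<omega>) \<partial>M) = 0" if "i \<noteq> j" for i j k l
    proof (cases "i < j")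
      case True
      show ?thesis unfolding D_def
        using disjoint_increments(2)[OF Z st(1) r(2) r(3) rij[OF True] r(3), of k l] .
    next
      case False
      then have "j < i" using that by auto
      from disjoint_increments(2)[OF Z st(1) r(2) r(3) rij[OF this] r(3), of l k]
      show ?thesis unfolding D_def by (simp add: mult.commute)
    qed
    have "?q = (\<integral>\<omega>. (\<Sum>i<n. \<Sum>j<n. Z \<omega> * of_real (D k i \<omega> * D l j \<omega>)) \<partial>M)"
      unfolding tele sum_product by (simp only: of_real_sum sum_distrib_left)
    also have "\<dots> = (\<Sum>i<n. \<Sum>j<n. \<integral>\<omega>. Z \<omega> * of_real (D k i \<omega> * D l j \<omega>) \<partial>M)"
      using ZDint by (simp add: Bochner_Integration.integral_sum del: of_real_mult)
    also have "\<dots> = (\<Sum>i<n. \<Sum>j<n. if i = j then \<integral>\<omega>. Z \<omega> * of_real (D k i \<omega> * D l i \<omega>) \<partial>M else 0)"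
      using zero by (intro sum.cong refl) auto
    also have "\<dots> = (\<integral>\<omega>. (\<Sum>i<n. Z \<omega> * of_real (D k i \<omega> * D l i \<omega>)) \<partial>M)"
      using ZDint by (simp add: Bochner_Integration.integral_sum del: of_real_mult)
    also have "\<dots> = (\<integral>\<omega>. Z \<omega> * of_real (Y \<omega>) \<partial>M)"
      by (simp only: Y_def sum_distrib_left of_real_sum)
    finally have q: "?q = (\<integral>\<omega>. Z \<omega> * of_real (Y \<omega>) \<partial>M)" .
    have DD: "(\<integral>\<omega>. D k i \<omega> * D k j \<omega> \<partial>M) = (if i = j then \<delta> else 0)" for i j k
    proof (cases "i = j")
      case True
      then show ?thesis using increment_moment2[of "r i" "r (Suc i)" k] r[of i]
        by (simp add: D_def power2_eq_square)
    next
      case False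
      have "complex_of_real (\<integral>\<omega>. D k i \<omega> * D k j \<omega> \<partial>M) = 0"
      proof (cases "i < j")
        case True
        show ?thesis
          using disjoint_increments(2)[OF _ _ st(1) r(2) r(3) rij[OF True] r(3), of "\<lambda>_. 1" k k]
          unfolding D_def by (simp flip: integral_complex_of_real)
      next
        case F: False
        then have "j < i" using False by auto
        from disjoint_increments(2)[OF _ _ st(1) r(2) r(3) rij[OF this] r(3), of "\<lambda>_. 1" k k]
        show ?thesis
          unfolding D_def by (simp add: mult.commute flip: integral_complex_of_real)
      qed
      then show ?thesis using False by simp
    qed
    \<comment> \<open>The product of two increments of path k is a functional of that path, and the
      corresponding product for path l is the same functional of the other path. The expectation is
      therefore the square of the one in \<open>DD\<close>: \<delta>^2 on the diagonal and 0 off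
      it.\<close>
    have DDDD: "(\<integral>\<omega>. (D k i \<omega> * D k j \<omega>) * (D l i \<omega> * D l j \<omega>) \<partial>M) = (if i = j then \<delta>\<^sup>2 else 0)"
      "integrable M (\<lambda>\<omega>. (D k i \<omega> * D k j \<omega>) * (D l i \<omega> * D l j \<omega>))" for i j
    proof -
      have *: "(\<lambda>w. (w (r (Suc i)) - w (r i)) * (w (r (Suc j)) - w (r j)) :: real)
        \<in> borel_measurable (Pi\<^sub>M {0..} (\<lambda>_. borel))"
        using r(1)
        by (intro borel_measurable_times borel_measurable_diff measurable_component_singleton) auto
      show "(\<integral>\<omega>. (D k i \<omega> * D k j \<omega>) * (D l i \<omega> * D l j \<omega>) \<partial>M) = (if i = j then \<delta>\<^sup>2 else 0)"
        using processes_indep(1)[OF kl *] Dint[of _ i _ j, unfolded D_def] DD[of _ i j] r(1)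
        by (simp add: D_def power2_eq_square)
      show "integrable M (\<lambda>\<omega>. (D k i \<omega> * D k j \<omega>) * (D l i \<omega> * D l j \<omega>))"
        using processes_indep(2)[OF kl *] Dint[of _ i _ j, unfolded D_def] r(1)
        by (simp add: D_def)
    qed
    have Y2: "(\<lambda>\<omega>. (Y \<omega>)\<^sup>2) = (\<lambda>\<omega>. \<Sum>i<n. \<Sum>j<n. (D k i \<omega> * D k j \<omega>) * (D l i \<omega> * D l j \<omega>))"
      by (auto simp: Y_def power2_eq_square sum_product mult_ac intro!: sum.cong)
    have Y2i: "integrable M (\<lambda>\<omega>. (Y \<omega>)\<^sup>2)"
      unfolding Y2 using DDDD(2) by (intro Bochner_Integration.integrable_sum)
    have Y2e: "(\<integral>\<omega>. (Y \<omega>)\<^sup>2 \<partial>M) = n * \<delta>\<^sup>2"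
      unfolding Y2 using DDDD by (simp add: Bochner_Integration.integral_sum)
    \<comment> \<open>The root mean square of Y. With this weight the two terms of |Y| \<le> (a +
      Y^2 / a) / 2 have equal expectation, and the total is exactly a.\<close>
    define a where "a = (t - s) / sqrt n"
    have a: "a > 0" using False st n by (auto simp: a_def)
    have ZY: "norm (Z \<omega> * of_real (Y \<omega>)) \<le> (a + (Y \<omega>)\<^sup>2 / a) / 2" if "\<omega> \<in> space M" for \<omega>
    proof -
      have "norm (Z \<omega> * of_real (Y \<omega>)) \<le> \<bar>Y \<omega>\<bar>"
        using Z(2)[OF that] by (simp add: norm_mult mult_left_le_one_le)
      also have "\<dots> \<le> (a + (Y \<omega>)\<^sup>2 / a) / 2"
        using sum_squares_bound[of a "\<bar>Y \<omega>\<bar>"] a by (simp add: field_simps power2_eq_square)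
      finally show ?thesis .
    qed
    have i1: "integrable M (\<lambda>\<omega>. (a + (Y \<omega>)\<^sup>2 / a) / 2)"
      using Y2i by auto
    have i2: "integrable M (\<lambda>\<omega>. Z \<omega> * of_real (Y \<omega>))"
      using ZY by (intro Bochner_Integration.integrable_bound[OF i1])
        (auto simp: Y_def intro!: AE_I2 order_trans[OF _ abs_ge_self])
    have "norm ?q \<le> (\<integral>\<omega>. (a + (Y \<omega>)\<^sup>2 / a) / 2 \<partial>M)"
      unfolding q by (intro order_trans[OF Bochner_Integration.integral_norm_bound] Bochner_Integration.integral_mono integrable_norm i1 i2 ZY)
    also have "\<dots> = (a + n * \<delta>\<^sup>2 / a) / 2"
      using Y2i by (simp add: Y2e prob_space)
    also have "\<dots> = a"
      using n a by (simp add: a_def \<delta>_def power2_eq_square field_simps)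
    finally show ?thesis by (simp add: a_def)
  qed simp
  have "(\<lambda>n. (t - s) / sqrt (real n)) \<longlonglongrightarrow> 0" by real_asymp
  moreover have "eventually (\<lambda>n. norm ?q \<le> (t - s) / sqrt (real n)) sequentially"
    using bound by (auto simp: eventually_sequentially intro!: exI[of _ 1])
  ultimately have "norm ?q \<le> 0"
    by (intro tendsto_lowerbound[of _ 0 sequentially]) auto
  then show ?thesis by simp
qed

end

section \<open>Characteristic functions of the increments by Taylor expansion along
  partitions\<close>

lemma norm_iexp_taylor2:
  "norm (iexp x - (1 + \<i> * of_real x - of_real (x\<^sup>2) / 2)) \<le> \<bar>x\<bar> ^ 3 / 6"
proof -
  have "(\<Sum>k\<le>2. (\<i> * of_real x) ^ k / fact k) = 1 + \<i> * of_real x - of_real (x\<^sup>2) / 2"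
    by (simp add: numeral_2_eq_2 power_mult_distrib)
  then show ?thesis
    using iexp_approx1[of x 2] by (simp add: fact_numeral)
qed

text \<open>Interpolation of a third moment between a second and a fourth one. For an increment over
  time \<delta> these have order \<delta> and \<delta>^2, so the weight r = sqrt \<delta> makes both
  terms of order \<delta>^(3/2).\<close>

lemma cube_le:
  fixes x r :: real assumes "r > 0" shows "\<bar>x\<bar> ^ 3 / 6 \<le> r * x\<^sup>2 + x ^ 4 / r"
proof -
  have "2 * (r * \<bar>x\<bar>) * x\<^sup>2 \<le> (r * \<bar>x\<bar>)\<^sup>2 + (x\<^sup>2)\<^sup>2" by (rule sum_squares_bound)
  then have "2 * \<bar>x\<bar> ^ 3 \<le> r * x\<^sup>2 + x ^ 4 / r"
    using assms by (simp add: field_simps power2_eq_square power3_eq_cube power4_eq_xxxx abs_mult_self)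
  moreover have "0 \<le> \<bar>x\<bar> ^ 3" by simp
  ultimately show ?thesis by linarith
qed

text \<open>Cauchy-Schwarz twice: the inner use contributes d^2 after squaring, the outer one a
  further d.\<close>

lemma sum_power4_le:
  fixes y :: "nat \<Rightarrow> real"
  shows "(\<Sum>k<d. y k) ^ 4 \<le> real d ^ 3 * (\<Sum>k<d. y k ^ 4)"
proof -
  have "(\<Sum>k<d. y k)\<^sup>2 \<le> (\<Sum>k<d. (y k)\<^sup>2) * d"
    using sum_squared_le_sum_of_squares[of y "{..<d}"] by simp
  then have "((\<Sum>k<d. y k)\<^sup>2)\<^sup>2 \<le> ((\<Sum>k<d. (y k)\<^sup>2) * d)\<^sup>2"
    by (intro power_mono) auto
  also have "\<dots> = (\<Sum>k<d. (y k)\<^sup>2)\<^sup>2 * (real d)\<^sup>2" by (simp add: power_mult_distrib)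
  also have "\<dots> \<le> ((\<Sum>k<d. ((y k)\<^sup>2)\<^sup>2) * d) * (real d)\<^sup>2"
    using sum_squared_le_sum_of_squares[of "\<lambda>k. (y k)\<^sup>2" "{..<d}"] by (intro mult_right_mono) auto
  also have "\<dots> = real d ^ 3 * (\<Sum>k<d. y k ^ 4)"
  proof -
    have "((y k)\<^sup>2)\<^sup>2 = y k ^ 4" for k by (simp flip: power_mult)
    then show ?thesis by (simp add: power3_eq_cube power2_eq_square mult_ac)
  qed
  finally show ?thesis by (simp flip: power_mult)
qed

text \<open>Errors of an approximately geometric sequence add up without amplification because the
  ratio a has modulus at most 1.\<close>

lemma norm_power_approx:
  fixes p :: "nat \<Rightarrow> complex" and a :: real
  assumes "\<And>i. i < n \<Longrightarrow> norm (p (Suc i) - of_real a * p i) \<le> \<epsilon>" "\<bar>a\<bar> \<le> 1"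
  shows "norm (p n - of_real (a ^ n) * p 0) \<le> n * \<epsilon>"
  using assms(1)
proof (induction n)
  case (Suc n)
  have "p (Suc n) - of_real (a ^ Suc n) * p 0 =
      (p (Suc n) - of_real a * p n) + of_real a * (p n - of_real (a ^ n) * p 0)"
    by (simp add: algebra_simps)
  also have "norm \<dots> \<le> \<epsilon> + norm (of_real a * (p n - of_real (a ^ n) * p 0))"
    using Suc.prems[of n] by (intro norm_triangle_le add_mono) auto
  also have "norm (of_real a * (p n - of_real (a ^ n) * p 0)) \<le> 1 * norm (p n - of_real (a ^ n) * p 0)"
    unfolding norm_mult using assms(2) by (intro mult_right_mono) auto
  also have "\<dots> \<le> n * \<epsilon>" using Suc by simp
  finally show ?case by (simp add: algebra_simps)
qed simp

lemma borel_measurable_iexp: "iexp \<in> borel_measurable borel"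
  by (intro borel_measurable_continuous_onI continuous_intros)

context brownian_family begin

text \<open>Expansion of exp(i V) to second order: the linear term vanishes by the martingale
  property, the mixed quadratic terms vanish by \<open>increments_orthogonal\<close>, and the
  diagonal ones produce the factor in front of the mean of Z. The remainder has order \<delta>^(3/2)
  and is negligible over 1/\<delta> steps. Z stands for the part of the exponential that has already
  been accumulated.\<close>

lemma cf_step:
  fixes u :: "nat \<Rightarrow> real" and d :: nat
  assumes Z: "Z \<in> borel_measurable (F r)" "\<And>\<omega>. \<omega> \<in> space M \<Longrightarrow> norm (Z \<omega> :: complex) \<le> 1"
    and r: "0 \<le> r" and \<delta>: "0 < \<delta>"
  defines "V \<equiv> \<lambda>\<omega>. \<Sum>k<d. u k * (\<xi> k (r + \<delta>) \<omega> - \<xi> k r \<omega>)"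
  shows "norm ((\<integral>\<omega>. Z \<omega> * iexp (V \<omega>) \<partial>M) - of_real (1 - (\<Sum>k<d. (u k)\<^sup>2) / 2 * \<delta>) * (\<integral>\<omega>. Z \<omega> \<partial>M))
    \<le> (d * (\<Sum>k<d. (u k)\<^sup>2) + 3 * real d ^ 3 * (\<Sum>k<d. u k ^ 4)) * \<delta> * sqrt \<delta>"
proof -
  have Zm[measurable]: "Z \<in> borel_measurable M" using Z(1) r by (rule measurable_F)
  have Zi: "integrable M Z" using Zm Z(2) by (rule bounded_integrable)
  have le: "0 \<le> r" "r \<le> r + \<delta>" using r \<delta> by auto
  define D where "D k \<omega> = \<xi> k (r + \<delta>) \<omega> - \<xi> k r \<omega>" for k \<omega>
  have V: "V \<omega> = (\<Sum>k<d. u k * D k \<omega>)" for \<omega> by (simp add: V_def D_def)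
  have Dm[measurable]: "D k \<in> borel_measurable M" for k
    unfolding D_def using le by (intro measurable_increment) auto
  have Vm[measurable]: "V \<in> borel_measurable M" unfolding V by measurable
  have Dint: "integrable M (\<lambda>\<omega>. D k \<omega> * D l \<omega>)" for k l
    unfolding D_def using le by (intro increments_integrable) auto
  have dom: "integrable M (\<lambda>\<omega>. Z \<omega> * of_real (g \<omega>))" if "integrable M g" for g :: "'w \<Rightarrow> real"
  proof (rule Bochner_Integration.integrable_bound[OF that])
    show "AE \<omega> in M. norm (Z \<omega> * of_real (g \<omega>)) \<le> norm (g \<omega>)"
      using Z(2) by (intro AE_I2) (simp add: norm_mult mult_left_le_one_le)
    have "g \<in> borel_measurable M" using that by auto
    then show "(\<lambda>\<omega>. Z \<omega> * of_real (g \<omega>)) \<in> borel_measurable M"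
      by (intro borel_measurable_times borel_measurable_of_real) auto
  qed
  have ZD: "(\<integral>\<omega>. Z \<omega> * of_real (D k \<omega>) \<partial>M) = 0" "integrable M (\<lambda>\<omega>. Z \<omega> * of_real (D k \<omega>))" for k
    using increment_mult_mean[OF le Z(1) Zi, of k] unfolding D_def by auto
  have ZDD: "(\<integral>\<omega>. Z \<omega> * of_real (D k \<omega> * D l \<omega>) \<partial>M) = (if k = l then of_real \<delta> * (\<integral>\<omega>. Z \<omega> \<partial>M) else 0)" for k l
  proof (cases "k = l")
    case True
    then show ?thesis using increment_mult_square(2)[OF le Z(1) Zi, of k]
      unfolding D_def power2_eq_square by (simp add: mult.commute)
  next
    case False
    then show ?thesis using increments_orthogonal[OF Z le False] unfolding D_def by simp
  qed
  have V1: "(\<integral>\<omega>. Z \<omega> * of_real (V \<omega>) \<partial>M) = 0" "integrable M (\<lambda>\<omega>. Z \<omega> * of_real (V \<omega>))"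
  proof -
    have eq: "Z \<omega> * of_real (V \<omega>) = (\<Sum>k<d. of_real (u k) * (Z \<omega> * of_real (D k \<omega>)))" for \<omega>
      unfolding V of_real_sum sum_distrib_left by (intro sum.cong) (auto simp: mult_ac)
    show "(\<integral>\<omega>. Z \<omega> * of_real (V \<omega>) \<partial>M) = 0"
      unfolding eq using ZD by (subst Bochner_Integration.integral_sum) auto
    show "integrable M (\<lambda>\<omega>. Z \<omega> * of_real (V \<omega>))"
      unfolding eq using ZD by (intro Bochner_Integration.integrable_sum integrable_mult_right)
  qed
  have V2eq: "(V \<omega>)\<^sup>2 = (\<Sum>k<d. \<Sum>l<d. (u k * u l) * (D k \<omega> * D l \<omega>))" for \<omega>
    unfolding V power2_eq_square sum_product by (intro sum.cong) (auto simp: mult_ac)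
  have V2i: "integrable M (\<lambda>\<omega>. (V \<omega>)\<^sup>2)"
    unfolding V2eq using Dint by (intro Bochner_Integration.integrable_sum integrable_mult_right)
  have V2: "(\<integral>\<omega>. Z \<omega> * of_real ((V \<omega>)\<^sup>2) \<partial>M) = of_real ((\<Sum>k<d. (u k)\<^sup>2) * \<delta>) * (\<integral>\<omega>. Z \<omega> \<partial>M)"
  proof -
    have eq: "Z \<omega> * of_real ((V \<omega>)\<^sup>2) = (\<Sum>k<d. \<Sum>l<d. of_real (u k * u l) * (Z \<omega> * of_real (D k \<omega> * D l \<omega>)))" for \<omega>
      unfolding V2eq of_real_sum sum_distrib_left by (intro sum.cong) (auto simp: mult_ac)
    have "(\<integral>\<omega>. Z \<omega> * of_real ((V \<omega>)\<^sup>2) \<partial>M) =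
       (\<Sum>k<d. \<Sum>l<d. of_real (u k * u l) * (\<integral>\<omega>. Z \<omega> * of_real (D k \<omega> * D l \<omega>) \<partial>M))"
      unfolding eq using dom[OF Dint]
      by (simp add: Bochner_Integration.integral_sum del: of_real_mult)
    also have "\<dots> = (\<Sum>k<d. of_real ((u k)\<^sup>2 * \<delta>) * (\<integral>\<omega>. Z \<omega> \<partial>M))"
      unfolding ZDD by (simp add: power2_eq_square if_distrib[of "\<lambda>x. _ * x"] mult_ac cong: if_cong)
    finally show ?thesis by (simp add: sum_distrib_left sum_distrib_right mult_ac)
  qed
  have V4le: "(V \<omega>) ^ 4 \<le> real d ^ 3 * (\<Sum>k<d. u k ^ 4 * D k \<omega> ^ 4)" for \<omega>
    unfolding V using sum_power4_le[of "\<lambda>k. u k * D k \<omega>" d] by (simp add: power_mult_distrib)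
  have D4: "integrable M (\<lambda>\<omega>. D k \<omega> ^ 4)" "(\<integral>\<omega>. D k \<omega> ^ 4 \<partial>M) = 3 * \<delta>\<^sup>2" for k
    using increment_power_integrable[OF le, of k 4] increment_moment4[OF le, of k] by (auto simp: D_def)
  have D2: "integrable M (\<lambda>\<omega>. (D k \<omega>)\<^sup>2)" "(\<integral>\<omega>. (D k \<omega>)\<^sup>2 \<partial>M) = \<delta>" for k
    using increment_power_integrable[OF le, of k 2] increment_moment2[OF le, of k] by (auto simp: D_def)
  have V2le: "(V \<omega>)\<^sup>2 \<le> d * (\<Sum>k<d. (u k)\<^sup>2 * (D k \<omega>)\<^sup>2)" for \<omega>
    unfolding V using sum_squared_le_sum_of_squares[of "\<lambda>k. u k * D k \<omega>" "{..<d}"]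
    by (simp add: power_mult_distrib mult.commute)
  define R where "R \<omega> = iexp (V \<omega>) - (1 + \<i> * of_real (V \<omega>) - of_real ((V \<omega>)\<^sup>2) / 2)" for \<omega>
  \<comment> \<open>The weight for \<open>cube_le\<close>: s times the second moment and the fourth
    moment divided by s both have order \<delta> s.\<close>
  define s where "s = sqrt \<delta>"
  have s: "s > 0" "s * s = \<delta>" using \<delta> by (auto simp: s_def)
  define b where "b \<omega> = s * (d * (\<Sum>k<d. (u k)\<^sup>2 * (D k \<omega>)\<^sup>2)) + (real d ^ 3 * (\<Sum>k<d. u k ^ 4 * D k \<omega> ^ 4)) / s" for \<omega>
  have Rb: "norm (Z \<omega> * R \<omega>) \<le> b \<omega>" if "\<omega> \<in> space M" for \<omega>
  proof -
    have "norm (Z \<omega> * R \<omega>) \<le> norm (R \<omega>)"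
      using Z(2)[OF that] by (simp add: norm_mult mult_left_le_one_le)
    also have "\<dots> \<le> \<bar>V \<omega>\<bar> ^ 3 / 6" unfolding R_def by (rule norm_iexp_taylor2)
    also have "\<dots> \<le> s * (V \<omega>)\<^sup>2 + V \<omega> ^ 4 / s" by (rule cube_le) (rule s)
    also have "\<dots> \<le> b \<omega>" unfolding b_def
      using V2le V4le s by (intro add_mono mult_left_mono divide_right_mono) auto
    finally show ?thesis .
  qed
  have bi: "integrable M b"
    unfolding b_def using D2 D4 by auto
  have be: "(\<integral>\<omega>. b \<omega> \<partial>M) = (d * (\<Sum>k<d. (u k)\<^sup>2) + 3 * real d ^ 3 * (\<Sum>k<d. u k ^ 4)) * \<delta> * s"
  proof -
    have "(\<integral>\<omega>. b \<omega> \<partial>M) = s * (d * (\<Sum>k<d. (u k)\<^sup>2 * \<delta>)) + (real d ^ 3 * (\<Sum>k<d. u k ^ 4 * (3 * \<delta>\<^sup>2))) / s"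
      unfolding b_def using D2 D4 by (simp add: Bochner_Integration.integral_sum)
    also have "(\<Sum>k<d. (u k)\<^sup>2 * \<delta>) = (\<Sum>k<d. (u k)\<^sup>2) * \<delta>" by (simp add: sum_distrib_right)
    also have "(\<Sum>k<d. u k ^ 4 * (3 * \<delta>\<^sup>2)) = (\<Sum>k<d. u k ^ 4) * (3 * \<delta>\<^sup>2)" by (simp add: sum_distrib_right)
    also have "real d ^ 3 * ((\<Sum>k<d. u k ^ 4) * (3 * \<delta>\<^sup>2)) / s = 3 * real d ^ 3 * (\<Sum>k<d. u k ^ 4) * (\<delta>\<^sup>2 / s)" by simp
    also have "\<delta>\<^sup>2 / s = \<delta> * s" using s by (simp add: field_simps power2_eq_square)
    finally show ?thesis by (simp add: algebra_simps)
  qed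
  have Rm[measurable]: "R \<in> borel_measurable M" unfolding R_def by measurable
  have Ri: "integrable M (\<lambda>\<omega>. Z \<omega> * R \<omega>)"
    using Rb by (intro Bochner_Integration.integrable_bound[OF bi]) (auto intro!: AE_I2 order_trans[OF _ abs_ge_self])
  have split: "Z \<omega> * iexp (V \<omega>) = Z \<omega> + \<i> * (Z \<omega> * of_real (V \<omega>)) - (Z \<omega> * of_real ((V \<omega>)\<^sup>2)) / 2 + Z \<omega> * R \<omega>" for \<omega>
    unfolding R_def by (simp add: algebra_simps)
  have "(\<integral>\<omega>. Z \<omega> * iexp (V \<omega>) \<partial>M) = (\<integral>\<omega>. Z \<omega> \<partial>M) + \<i> * (\<integral>\<omega>. Z \<omega> * of_real (V \<omega>) \<partial>M)
     - (\<integral>\<omega>. Z \<omega> * of_real ((V \<omega>)\<^sup>2) \<partial>M) / 2 + (\<integral>\<omega>. Z \<omega> * R \<omega> \<partial>M)"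
    unfolding split using Zi V1(2) dom[OF V2i] Ri by (simp del: of_real_power)
  then have "(\<integral>\<omega>. Z \<omega> * iexp (V \<omega>) \<partial>M) - of_real (1 - (\<Sum>k<d. (u k)\<^sup>2) / 2 * \<delta>) * (\<integral>\<omega>. Z \<omega> \<partial>M) = (\<integral>\<omega>. Z \<omega> * R \<omega> \<partial>M)"
    unfolding V1 V2 by (simp add: algebra_simps)
  also have "norm \<dots> \<le> (\<integral>\<omega>. b \<omega> \<partial>M)"
    by (intro order_trans[OF Bochner_Integration.integral_norm_bound] Bochner_Integration.integral_mono integrable_norm Ri bi Rb)
  finally show ?thesis unfolding be s_def .
qed

text \<open>The n-th power of the one-step factor 1 - c (t - s) / n tends to the exponential, while
  n one-step errors of order n^(-3/2) vanish. The indicator of A carries the past along, so the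
  limit expresses, in terms of characteristic functions, that the first d increments are jointly
  Gaussian and independent of \<open>F s\<close>.\<close>

lemma increments_cf:
  assumes A: "A \<in> sets (F s)" and st: "0 \<le> s" "s < t"
  shows "(\<integral>\<omega>. indicator A \<omega> * iexp (\<Sum>k<d. u k * (\<xi> k t \<omega> - \<xi> k s \<omega>)) \<partial>M) =
    of_real (prob A * exp (- (\<Sum>k<d. (u k)\<^sup>2) / 2 * (t - s)))"
proof -
  define c where "c = (\<Sum>k<d. (u k)\<^sup>2) / 2"
  define K where "K = d * (\<Sum>k<d. (u k)\<^sup>2) + 3 * real d ^ 3 * (\<Sum>k<d. u k ^ 4)"
  have AM[measurable]: "A \<in> sets M" using sets_F A st by auto
  define q :: complex where "q = (\<integral>\<omega>. indicator A \<omega> * iexp (\<Sum>k<d. u k * (\<xi> k t \<omega> - \<xi> k s \<omega>)) \<partial>M)"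
  have "(\<lambda>\<omega>. indicator A \<omega> :: complex) = (\<lambda>\<omega>. of_real (indicator A \<omega>))"
    by (auto simp: indicator_def)
  then have prob_A: "(\<integral>\<omega>. (indicator A \<omega> :: complex) \<partial>M) = of_real (prob A)"
    by simp
  \<comment> \<open>The second condition on n puts the one-step factor into [0, 1], so that
    \<open>norm_power_approx\<close> applies.\<close>
  have bound: "norm (q - of_real ((1 + (- c * (t - s)) / n) ^ n) * of_real (prob A))
      \<le> K * (t - s) * sqrt ((t - s) / n)" if n: "n > 0" "c * (t - s) \<le> n" for n :: nat
  proof -
    define \<delta> where "\<delta> = (t - s) / n"
    have \<delta>: "\<delta> > 0" using st n by (auto simp: \<delta>_def)
    define r where "r i = s + real i * \<delta>" for i
    have r: "0 \<le> r i" "s \<le> r i" "r (Suc i) = r i + \<delta>" for i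
      using st \<delta> by (auto simp: r_def algebra_simps)
    \<comment> \<open>The partial exponential up to the i-th partition point: bounded by 1 and
      measurable at time \<open>r i\<close>, hence an admissible weight for the next step.\<close>
    define Z :: "nat \<Rightarrow> 'w \<Rightarrow> complex"
      where "Z i \<omega> = indicator A \<omega> * iexp (\<Sum>k<d. u k * (\<xi> k (r i) \<omega> - \<xi> k s \<omega>))" for i \<omega>
    define p where "p i = (\<integral>\<omega>. Z i \<omega> \<partial>M)" for i
    have "norm (p (Suc i) - of_real (1 - c * \<delta>) * p i) \<le> K * \<delta> * sqrt \<delta>" for i
    proof -
      have "A \<in> sets (F (r i))"
        using A subalgebra_F_mono[OF st(1) r(2), of i] by (auto simp: subalgebra_def)
      moreover have "(\<lambda>\<omega>. \<xi> k (r i) \<omega> - \<xi> k s \<omega>) \<in> borel_measurable (F (r i))" for k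
        using r(2)[of i] st by (intro adapted_increment) auto
      ultimately have Zm: "Z i \<in> borel_measurable (F (r i))"
        unfolding Z_def by (intro borel_measurable_times borel_measurable_indicator measurable_compose[OF _ borel_measurable_iexp] borel_measurable_sum borel_measurable_const) auto
      have Z1: "norm (Z i \<omega>) \<le> 1" for \<omega>
        unfolding Z_def by (auto simp: norm_mult indicator_def)
      have "Z (Suc i) \<omega> = Z i \<omega> * iexp (\<Sum>k<d. u k * (\<xi> k (r i + \<delta>) \<omega> - \<xi> k (r i) \<omega>))" for \<omega>
        unfolding Z_def r(3) mult.assoc exp_add[symmetric] distrib_left[symmetric] of_real_add[symmetric] sum.distrib[symmetric]
        by (simp add: algebra_simps)
      then have Zeq: "Z (Suc i) = (\<lambda>\<omega>. Z i \<omega> * iexp (\<Sum>k<d. u k * (\<xi> k (r i + \<delta>) \<omega> - \<xi> k (r i) \<omega>)))"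
        by (rule ext)
      show ?thesis
        unfolding p_def Zeq c_def K_def by (rule cf_step[OF Zm Z1 r(1) \<delta>])
    qed
    moreover have "\<bar>1 - c * \<delta>\<bar> \<le> 1"
    proof -
      have "0 \<le> c * \<delta>" unfolding c_def using \<delta> by (intro mult_nonneg_nonneg divide_nonneg_nonneg sum_nonneg) auto
      moreover have "c * \<delta> \<le> 1" using n unfolding \<delta>_def by (simp add: field_simps)
      ultimately show ?thesis by linarith
    qed
    ultimately have n1: "norm (p n - of_real ((1 - c * \<delta>) ^ n) * p 0) \<le> n * (K * \<delta> * sqrt \<delta>)"
      by (intro norm_power_approx) auto
    have "r n = t" "r 0 = s" using n by (auto simp: r_def \<delta>_def)
    then have pq: "p n = q" "p 0 = of_real (prob A)"
      unfolding p_def q_def Z_def by (simp_all add: prob_A)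
    have e1: "real n * (K * \<delta> * sqrt \<delta>) = K * (t - s) * sqrt ((t - s) / n)"
      using n by (simp add: \<delta>_def)
    have e2: "1 - c * \<delta> = 1 + (- c * (t - s)) / n" by (simp add: \<delta>_def)
    from n1 show ?thesis unfolding pq e1 e2 .
  qed
  have "(\<lambda>n. norm (q - of_real ((1 + (- c * (t - s)) / real n) ^ n) * of_real (prob A)))
    \<longlonglongrightarrow> norm (q - of_real (exp (- c * (t - s))) * of_real (prob A))"
    by (intro tendsto_intros tendsto_exp_limit_sequentially)
  moreover have "(\<lambda>n. K * (t - s) * sqrt ((t - s) / real n)) \<longlonglongrightarrow> K * (t - s) * sqrt 0"
    by (intro tendsto_intros lim_const_over_n)
  moreover have "eventually (\<lambda>n. norm (q - of_real ((1 + (- c * (t - s)) / real n) ^ n) * of_real (prob A))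
      \<le> K * (t - s) * sqrt ((t - s) / real n)) sequentially"
    using eventually_gt_at_top[of 0] eventually_ge_at_top[of "nat \<lceil>c * (t - s)\<rceil>"]
  proof eventually_elim
    case (elim n)
    then have "c * (t - s) \<le> n" by linarith
    then show ?case using bound[of n] elim by blast
  qed
  ultimately have "norm (q - of_real (exp (- c * (t - s))) * of_real (prob A)) \<le> K * (t - s) * sqrt 0"
    by (intro tendsto_le[of sequentially]) auto
  then show ?thesis unfolding q_def c_def by (simp add: mult.commute)
qed

end

section \<open>Joint law of the increments\<close>

context prob_space begin

text \<open>Adding 2 makes the signed weight positive, and after normalisation it is the density of
  a new probability measure. Under it, as under the original measure, Y has characteristic function
  \<open>char N\<close>, so Levy's uniqueness theorem in dimension one identifies both laws;
  subtracting the shift gives the claim.\<close>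

lemma weighted_law_real:
  assumes [measurable]: "Y \<in> borel_measurable M" "W \<in> borel_measurable M"
    and W: "\<And>\<omega>. \<omega> \<in> space M \<Longrightarrow> \<bar>W \<omega>\<bar> \<le> (1::real)" and N: "real_distribution N"
    and Wcf: "\<And>v. (\<integral>\<omega>. of_real (W \<omega>) * iexp (v * Y \<omega>) \<partial>M) = of_real (expectation W) * char N v"
    and cf: "\<And>v. (\<integral>\<omega>. iexp (v * Y \<omega>) \<partial>M) = char N v"
    and B: "B \<in> sets borel"
  shows "(\<integral>\<omega>. W \<omega> * indicator B (Y \<omega>) \<partial>M) = expectation W * measure N B"
proof -
  interpret N: real_distribution N by fact
  have Wi: "integrable M W" using W by (intro integrable_const_bound[where B=1]) auto
  have "(\<integral>\<omega>. -1 \<partial>M) \<le> expectation W"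
    using W Wi by (intro Bochner_Integration.integral_mono) (auto simp: abs_le_iff)
  then have EW: "expectation W + 2 > 0" by (simp add: prob_space)
  define V where "V \<omega> = (W \<omega> + 2) / (expectation W + 2)" for \<omega>
  have V0: "0 \<le> V \<omega>" if "\<omega> \<in> space M" for \<omega>
    using W[OF that] EW by (auto simp: V_def abs_le_iff)
  have Vm[measurable]: "V \<in> borel_measurable M" unfolding V_def by measurable
  have V1: "(\<integral>\<omega>. V \<omega> \<partial>M) = 1"
    unfolding V_def using Wi EW by (simp add: prob_space)
  have Vi: "integrable M V" unfolding V_def using Wi by auto
  define P where "P = distr (density M (\<lambda>\<omega>. ennreal (V \<omega>))) borel Y"
  have "emeasure (density M (\<lambda>\<omega>. ennreal (V \<omega>))) (space M) = (\<integral>\<^sup>+\<omega>. ennreal (V \<omega>) \<partial>M)"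
    by (subst emeasure_density) (auto intro!: nn_integral_cong simp: indicator_def)
  also have "\<dots> = 1"
    using V1 Vi V0 by (subst nn_integral_eq_integral) (auto intro!: AE_I2)
  finally have prob: "prob_space (density M (\<lambda>\<omega>. ennreal (V \<omega>)))"
    by (intro prob_spaceI) simp
  then interpret P: real_distribution P
    unfolding P_def by (intro prob_space.real_distribution_distr) auto
  have iexpm: "iexp \<in> borel_measurable borel" by (rule borel_measurable_iexp)
  have VI: "(\<integral>x. g x \<partial>P) = (\<integral>\<omega>. V \<omega> *\<^sub>R g (Y \<omega>) \<partial>M)" if [measurable]: "g \<in> borel_measurable borel"
    for g :: "real \<Rightarrow> 'c::{banach, second_countable_topology}"
    unfolding P_def using V0
    by (subst integral_distr, simp, simp, subst integral_density) (auto intro!: AE_I2)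
  have "char P v = char N v" for v
  proof -
    have [measurable]: "(\<lambda>x. iexp (v * x)) \<in> borel_measurable borel"
      by (rule measurable_compose[OF _ iexpm]) measurable
    have "char P v = (\<integral>\<omega>. V \<omega> *\<^sub>R iexp (v * Y \<omega>) \<partial>M)"
      unfolding char_def by (rule VI) measurable
    also have "\<dots> = (\<integral>\<omega>. (of_real (W \<omega>) * iexp (v * Y \<omega>) + 2 * iexp (v * Y \<omega>)) / of_real (expectation W + 2) \<partial>M)"
      unfolding V_def scaleR_conv_of_real by (intro Bochner_Integration.integral_cong) (auto simp: algebra_simps)
    also have "\<dots> = ((\<integral>\<omega>. of_real (W \<omega>) * iexp (v * Y \<omega>) \<partial>M) + 2 * (\<integral>\<omega>. iexp (v * Y \<omega>) \<partial>M)) / of_real (expectation W + 2)"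
    proof -
      have "(\<lambda>\<omega>. iexp (v * Y \<omega>)) \<in> borel_measurable M"
        by (rule measurable_compose[OF _ iexpm]) measurable
      then have "integrable M (\<lambda>\<omega>. iexp (v * Y \<omega>))" "integrable M (\<lambda>\<omega>. of_real (W \<omega>) * iexp (v * Y \<omega>))"
        using W by (auto intro!: integrable_const_bound[where B=1] AE_I2 simp: norm_mult)
      then show ?thesis by simp
    qed
    also have "\<dots> = (of_real (expectation W + 2) * char N v) / of_real (expectation W + 2)"
      unfolding Wcf cf by (simp add: algebra_simps)
    also have "\<dots> = char N v"
    proof -
      have "complex_of_real (expectation W + 2) \<noteq> 0" using EW by (simp only: of_real_eq_0_iff)
      then show ?thesis by simp
    qed
    finally show ?thesis .
  qed
  then have PN: "P = N"
    by (intro Levy_uniqueness P.real_distribution_axioms N) auto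
  have DN: "distr M borel Y = N"
  proof (rule Levy_uniqueness)
    show "real_distribution (distr M borel Y)" by simp
    have [measurable]: "(\<lambda>x. iexp (v * x)) \<in> borel_measurable borel" for v
      by (rule measurable_compose[OF _ iexpm]) measurable
    show "char (distr M borel Y) = char N"
    proof
      fix v
      have "char (distr M borel Y) v = (\<integral>\<omega>. iexp (v * Y \<omega>) \<partial>M)"
        unfolding char_def by (rule integral_distr) measurable
      then show "char (distr M borel Y) v = char N v" unfolding cf .
    qed
  qed fact
  have ind: "integrable M (\<lambda>\<omega>. W \<omega> * indicator B (Y \<omega>))" "integrable M (\<lambda>\<omega>. indicator B (Y \<omega>) :: real)"
    using B W by (auto intro!: integrable_const_bound[where B=1] AE_I2 simp: indicator_def)
  have "measure N B = (\<integral>x. indicator B x \<partial>P)" using B by (simp add: PN[symmetric] P_def)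
  also have "\<dots> = (\<integral>\<omega>. V \<omega> *\<^sub>R indicator B (Y \<omega>) \<partial>M)" using B by (intro VI) auto
  also have "\<dots> = ((\<integral>\<omega>. W \<omega> * indicator B (Y \<omega>) \<partial>M) + 2 * (\<integral>\<omega>. indicator B (Y \<omega>) \<partial>M)) / (expectation W + 2)"
    unfolding V_def using ind by (simp add: field_simps add_divide_distrib flip: mult.assoc)
  also have "(\<integral>\<omega>. indicator B (Y \<omega>) \<partial>M) = (\<integral>x. (indicator B x :: real) \<partial>distr M borel Y)"
    using integral_distr[of Y M borel "indicator B :: real \<Rightarrow> real"] B by simp
  also have "\<dots> = measure N B" unfolding DN[symmetric] using B by simp
  finally show ?thesis using EW by (simp add: field_simps)
qed

lemma cnj_char: "cnj (char N (- v)) = char N v"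
  unfolding char_def Bochner_Integration.integral_cnj[symmetric] by (simp add: exp_cnj)

text \<open>The real and the imaginary part of Z are real weights. Their characteristic functions
  involve the conjugate weight too, which is obtained from the hypothesis at -v together with
  \<open>cnj_char\<close>.\<close>

lemma weighted_law:
  assumes [measurable]: "Y \<in> borel_measurable M" "Z \<in> borel_measurable M"
    and Z: "\<And>\<omega>. \<omega> \<in> space M \<Longrightarrow> norm (Z \<omega> :: complex) \<le> 1" and N: "real_distribution N"
    and Zcf: "\<And>v. (\<integral>\<omega>. Z \<omega> * iexp (v * Y \<omega>) \<partial>M) = (\<integral>\<omega>. Z \<omega> \<partial>M) * char N v"
    and cf: "\<And>v. (\<integral>\<omega>. iexp (v * Y \<omega>) \<partial>M) = char N v"
    and B: "B \<in> sets borel"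
  shows "(\<integral>\<omega>. Z \<omega> * indicator B (Y \<omega>) \<partial>M) = (\<integral>\<omega>. Z \<omega> \<partial>M) * of_real (measure N B)"
proof -
  have iexpm: "(\<lambda>\<omega>. iexp (v * Y \<omega>)) \<in> borel_measurable M" for v
    by (rule measurable_compose[OF _ borel_measurable_iexp]) measurable
  have Zi: "integrable M Z" using Z by (intro integrable_const_bound[where B=1]) auto
  have [measurable]: "(\<lambda>\<omega>. cnj (Z \<omega>)) \<in> borel_measurable M"
    by (rule measurable_compose[OF assms(2)])
      (intro borel_measurable_continuous_onI continuous_intros)
  have ZI: "integrable M (\<lambda>\<omega>. Z \<omega> * iexp (v * Y \<omega>))" "integrable M (\<lambda>\<omega>. cnj (Z \<omega>) * iexp (v * Y \<omega>))" for v
    using Z iexpm[of v] by (auto intro!: integrable_const_bound[where B=1] AE_I2 simp: norm_mult)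
  have cn: "(\<integral>\<omega>. cnj (Z \<omega>) * iexp (v * Y \<omega>) \<partial>M) = cnj (\<integral>\<omega>. Z \<omega> \<partial>M) * char N v" for v
  proof -
    have "(\<integral>\<omega>. cnj (Z \<omega>) * iexp (v * Y \<omega>) \<partial>M) = cnj (\<integral>\<omega>. Z \<omega> * iexp (- v * Y \<omega>) \<partial>M)"
      unfolding Bochner_Integration.integral_cnj[symmetric] by (simp add: exp_cnj)
    also have "\<dots> = cnj (\<integral>\<omega>. Z \<omega> \<partial>M) * char N v"
      unfolding Zcf by (simp add: cnj_char)
    finally show ?thesis .
  qed
  have re: "of_real (Re z) = (z + cnj z) / 2" and im: "of_real (Im z) = (z - cnj z) / (2 * \<i>)" for z
    by (auto simp: complex_eq_iff)
  have "(\<integral>\<omega>. Re (Z \<omega>) * indicator B (Y \<omega>) \<partial>M) = (\<integral>\<omega>. Re (Z \<omega>) \<partial>M) * measure N B"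
  proof (rule weighted_law_real[OF _ _ _ N _ cf B])
    show "\<bar>Re (Z \<omega>)\<bar> \<le> 1" if "\<omega> \<in> space M" for \<omega> using Z[OF that] abs_Re_le_cmod[of "Z \<omega>"] by simp
    show "(\<integral>\<omega>. of_real (Re (Z \<omega>)) * iexp (v * Y \<omega>) \<partial>M) = of_real (\<integral>\<omega>. Re (Z \<omega>) \<partial>M) * char N v" for v
    proof -
      have "(\<integral>\<omega>. of_real (Re (Z \<omega>)) * iexp (v * Y \<omega>) \<partial>M) =
         (\<integral>\<omega>. (Z \<omega> * iexp (v * Y \<omega>) + cnj (Z \<omega>) * iexp (v * Y \<omega>)) / 2 \<partial>M)"
        unfolding re by (simp add: algebra_simps add_divide_distrib)
      also have "\<dots> = ((\<integral>\<omega>. Z \<omega> \<partial>M) * char N v + cnj (\<integral>\<omega>. Z \<omega> \<partial>M) * char N v) / 2"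
        using ZI[of v] Zcf[of v] cn[of v] by simp
      also have "\<dots> = of_real (Re (\<integral>\<omega>. Z \<omega> \<partial>M)) * char N v"
        unfolding re by (simp add: algebra_simps add_divide_distrib)
      finally show ?thesis using Zi by simp
    qed
  qed auto
  moreover have "(\<integral>\<omega>. Im (Z \<omega>) * indicator B (Y \<omega>) \<partial>M) = (\<integral>\<omega>. Im (Z \<omega>) \<partial>M) * measure N B"
  proof (rule weighted_law_real[OF _ _ _ N _ cf B])
    show "\<bar>Im (Z \<omega>)\<bar> \<le> 1" if "\<omega> \<in> space M" for \<omega> using Z[OF that] abs_Im_le_cmod[of "Z \<omega>"] by simp
    show "(\<integral>\<omega>. of_real (Im (Z \<omega>)) * iexp (v * Y \<omega>) \<partial>M) = of_real (\<integral>\<omega>. Im (Z \<omega>) \<partial>M) * char N v" for v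
    proof -
      have "(\<integral>\<omega>. of_real (Im (Z \<omega>)) * iexp (v * Y \<omega>) \<partial>M) =
         (\<integral>\<omega>. (Z \<omega> * iexp (v * Y \<omega>) - cnj (Z \<omega>) * iexp (v * Y \<omega>)) / (2 * \<i>) \<partial>M)"
        unfolding im by (simp add: algebra_simps diff_divide_distrib)
      also have "\<dots> = ((\<integral>\<omega>. Z \<omega> \<partial>M) * char N v - cnj (\<integral>\<omega>. Z \<omega> \<partial>M) * char N v) / (2 * \<i>)"
        using ZI[of v] Zcf[of v] cn[of v] by simp
      also have "\<dots> = of_real (Im (\<integral>\<omega>. Z \<omega> \<partial>M)) * char N v"
        unfolding im by (simp add: algebra_simps diff_divide_distrib)
      finally show ?thesis using Zi by simp
    qed
  qed auto
  moreover have "integrable M (\<lambda>\<omega>. Z \<omega> * indicator B (Y \<omega>))"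
    using B Z by (auto intro!: integrable_const_bound[where B=1] AE_I2 simp: indicator_def)
  moreover have "Re (Z \<omega> * indicator B (Y \<omega>)) = Re (Z \<omega>) * indicator B (Y \<omega>)"
    "Im (Z \<omega> * indicator B (Y \<omega>)) = Im (Z \<omega>) * indicator B (Y \<omega>)" for \<omega>
    by (auto simp: indicator_def)
  ultimately show ?thesis
    using Zi by (simp add: complex_eq_iff flip: integral_Re integral_Im)
qed

end

text \<open>The parameter is the variance, whereas \<open>normal_density\<close> expects the
  standard deviation.\<close>

definition gauss1 :: "real \<Rightarrow> real measure" where
  "gauss1 h = density lborel (normal_density 0 (sqrt h))"

text \<open>The law of all coordinates of the noise over a time step of length h.\<close>

definition gauss :: "real \<Rightarrow> (nat \<Rightarrow> real) measure" where
  "gauss h = Pi\<^sub>M UNIV (\<lambda>_. gauss1 h)"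

lemma real_distribution_gauss1: "0 < h \<Longrightarrow> real_distribution (gauss1 h)"
  unfolding gauss1_def real_distribution_def real_distribution_axioms_def
  by (auto intro!: prob_space_normal_density)

lemma sets_gauss1 [simp, measurable_cong]: "sets (gauss1 h) = sets borel"
  by (simp add: gauss1_def)

lemma space_gauss1 [simp]: "space (gauss1 h) = UNIV"
  by (simp add: gauss1_def)

lemma sets_gauss [measurable_cong]: "sets (gauss h) = sets (Pi\<^sub>M UNIV (\<lambda>_. borel))"
  unfolding gauss_def by (intro sets_PiM_cong) auto

lemma product_prob_space_gauss1: "0 < h \<Longrightarrow> product_prob_space (\<lambda>_. gauss1 h)"
  unfolding product_prob_space_def product_prob_space_axioms_def product_sigma_finite_def
  using real_distribution_gauss1
  by (auto simp: real_distribution_def intro: prob_space_imp_sigma_finite)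

lemma prob_space_gauss: "0 < h \<Longrightarrow> prob_space (gauss h)"
  unfolding gauss_def by (intro prob_space_PiM) (use real_distribution_gauss1 in \<open>auto simp: real_distribution_def\<close>)

context brownian_family begin

lemma increment_cf1:
  assumes "0 \<le> s" "s < t"
  shows "(\<integral>\<omega>. iexp (v * (\<xi> k t \<omega> - \<xi> k s \<omega>)) \<partial>M) = exp (- v\<^sup>2 / 2 * (t - s))"
proof -
  have top: "space M \<in> sets (F s)" using space_F[OF assms(1)] sets.top[of "F s"] by simp
  have "(\<Sum>j<Suc k. (if j = k then v else 0) * x j) = v * x k" for x :: "nat \<Rightarrow> real"
    by (simp add: if_distrib[of "\<lambda>y. y * _"] cong: if_cong)
  moreover have "(\<Sum>j<Suc k. (if j = k then v else 0)\<^sup>2) = v\<^sup>2"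
    by (simp add: if_distrib[of "\<lambda>y. y\<^sup>2"] cong: if_cong)
  moreover have "(\<integral>\<omega>. iexp (v * (\<xi> k t \<omega> - \<xi> k s \<omega>)) \<partial>M) =
     (\<integral>\<omega>. indicator (space M) \<omega> * iexp (v * (\<xi> k t \<omega> - \<xi> k s \<omega>)) \<partial>M)"
    by (intro Bochner_Integration.integral_cong) auto
  ultimately show ?thesis
    \<comment> \<open>The event is the whole space and the frequency vector is supported at
      coordinate k, so d = k + 1 coordinates are enough.\<close>
    using increments_cf[OF top assms, where d="Suc k" and u="\<lambda>j. if j = k then v else 0"]
    by (simp only: prob_space) simp
qed

lemma increment_law:
  assumes "0 \<le> s" "s < t"
  shows "distr M borel (\<lambda>\<omega>. \<xi> k t \<omega> - \<xi> k s \<omega>) = gauss1 (t - s)"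
  using distributed_distr_eq_density[OF increment_distributed[OF assms, of k]]
  by (simp add: gauss1_def cong: distr_cong)

text \<open>\<open>gauss1 h\<close> is the law of an increment over [0, h], so its characteristic
  function is a special case of the limit already computed along partitions.\<close>

lemma char_gauss1:
  assumes "0 < h"
  shows "char (gauss1 h) v = exp (- v\<^sup>2 / 2 * h)"
proof -
  have "char (gauss1 h) v = char (distr M borel (\<lambda>\<omega>. \<xi> 0 h \<omega> - \<xi> 0 0 \<omega>)) v"
    using increment_law[of 0 h 0] assms by simp
  also have "\<dots> = (\<integral>\<omega>. iexp (v * (\<xi> 0 h \<omega> - \<xi> 0 0 \<omega>)) \<partial>M)"
  proof -
    have [measurable]: "(\<lambda>x. iexp (v * x)) \<in> borel_measurable borel"
      by (rule measurable_compose[OF _ borel_measurable_iexp]) measurable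
    show ?thesis
      unfolding char_def using assms by (subst integral_distr) (auto intro!: measurable_increment)
  qed
  finally show ?thesis using increment_cf1[of 0 h v 0] assms by simp
qed

lemma joint_cf:
  assumes A: "A \<in> sets (F s)" and st: "0 \<le> s" "s < t"
    and B: "\<And>k. B k \<in> sets borel" and jd: "j \<le> d"
  shows "(\<integral>\<omega>. indicator A \<omega> * (\<Prod>k<j. indicator (B k) (\<xi> k t \<omega> - \<xi> k s \<omega>)) *
      iexp (\<Sum>k=j..<d. u k * (\<xi> k t \<omega> - \<xi> k s \<omega>)) \<partial>M) =
    of_real (prob A * (\<Prod>k<j. measure (gauss1 (t - s)) (B k)) * exp (- (\<Sum>k=j..<d. (u k)\<^sup>2) / 2 * (t - s)))"
  using jd
proof (induction j arbitrary: u)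
  case 0
  then show ?case using increments_cf[OF A st, where d=d and u=u] by (simp add: atLeast0LessThan)
next
  case (Suc j)
  have [measurable]: "A \<in> sets M" using sets_F A st by auto
  have [measurable]: "\<And>k. B k \<in> sets borel" by fact
  have D[measurable]: "(\<lambda>\<omega>. \<xi> k t \<omega> - \<xi> k s \<omega>) \<in> borel_measurable M" for k
    using st by (intro measurable_increment) auto
  define Z :: "'w \<Rightarrow> complex" where "Z \<omega> = indicator A \<omega> * (\<Prod>k<j. indicator (B k) (\<xi> k t \<omega> - \<xi> k s \<omega>)) *
      iexp (\<Sum>k=Suc j..<d. u k * (\<xi> k t \<omega> - \<xi> k s \<omega>))" for \<omega>
  have up: "(\<Sum>k=j..<d. f k) = f j + (\<Sum>k=Suc j..<d. f k)" for f :: "nat \<Rightarrow> real"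
    using Suc.prems by (simp add: sum.atLeast_Suc_lessThan)
  \<comment> \<open>The frequency at coordinate j is free in the induction hypothesis; letting it
    run through all v yields the weighted characteristic function, and v = 0 yields the mean of
    Z.\<close>
  have IH: "(\<integral>\<omega>. Z \<omega> * iexp (v * (\<xi> j t \<omega> - \<xi> j s \<omega>)) \<partial>M) =
     of_real (prob A * (\<Prod>k<j. measure (gauss1 (t - s)) (B k)) * exp (- (\<Sum>k=Suc j..<d. (u k)\<^sup>2) / 2 * (t - s)))
      * exp (- v\<^sup>2 / 2 * (t - s))" for v
  proof -
    have "Z \<omega> * iexp (v * (\<xi> j t \<omega> - \<xi> j s \<omega>)) = indicator A \<omega> * (\<Prod>k<j. indicator (B k) (\<xi> k t \<omega> - \<xi> k s \<omega>)) *
      iexp (\<Sum>k=j..<d. (u(j := v)) k * (\<xi> k t \<omega> - \<xi> k s \<omega>))" for \<omega>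
      unfolding Z_def up mult.assoc exp_add[symmetric] distrib_left[symmetric] of_real_add[symmetric]
      by (simp add: add.commute)
    moreover have "(\<Sum>k=j..<d. ((u(j := v)) k)\<^sup>2) = v\<^sup>2 + (\<Sum>k=Suc j..<d. (u k)\<^sup>2)"
      unfolding up by simp
    moreover have "exp (- (v\<^sup>2 + x) / 2 * (t - s)) = exp (- x / 2 * (t - s)) * exp (- v\<^sup>2 / 2 * (t - s))" for x
      unfolding exp_add[symmetric] by (simp add: field_simps)
    ultimately show ?thesis
      using Suc.IH[of "u(j := v)"] Suc.prems by (simp add: exp_of_real mult.assoc)
  qed
  have Zint: "(\<integral>\<omega>. Z \<omega> \<partial>M) = of_real (prob A * (\<Prod>k<j. measure (gauss1 (t - s)) (B k)) * exp (- (\<Sum>k=Suc j..<d. (u k)\<^sup>2) / 2 * (t - s)))"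
    using IH[of 0] by simp
  have "(\<integral>\<omega>. Z \<omega> * indicator (B j) (\<xi> j t \<omega> - \<xi> j s \<omega>) \<partial>M) = (\<integral>\<omega>. Z \<omega> \<partial>M) * of_real (measure (gauss1 (t - s)) (B j))"
  proof (rule weighted_law[OF D])
    show "Z \<in> borel_measurable M"
      unfolding Z_def by (intro borel_measurable_times borel_measurable_prod measurable_compose[OF _ borel_measurable_iexp])
       (auto intro!: borel_measurable_indicator measurable_compose[OF D borel_measurable_indicator])
    show "norm (Z \<omega>) \<le> 1" for \<omega>
      unfolding Z_def by (auto simp: norm_mult indicator_def intro!: prod_le_1 simp flip: prod_norm)
    show "(\<integral>\<omega>. Z \<omega> * iexp (v * (\<xi> j t \<omega> - \<xi> j s \<omega>)) \<partial>M) = (\<integral>\<omega>. Z \<omega> \<partial>M) * char (gauss1 (t - s)) v" for v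
      unfolding IH Zint using st char_gauss1[of "t - s" v] by simp
    show "(\<integral>\<omega>. iexp (v * (\<xi> j t \<omega> - \<xi> j s \<omega>)) \<partial>M) = char (gauss1 (t - s)) v" for v
      using increment_cf1[OF st, of v j] st char_gauss1[of "t - s" v] by simp
    show "real_distribution (gauss1 (t - s))" using st by (intro real_distribution_gauss1) auto
  qed fact
  then show ?case unfolding Zint unfolding Z_def by (simp add: mult_ac)
qed

lemma measurable_increments:
  assumes "0 \<le> s" "s \<le> t"
  shows "(\<lambda>\<omega> k. \<xi> k t \<omega> - \<xi> k s \<omega>) \<in> measurable M (Pi\<^sub>M UNIV (\<lambda>_. borel))"
  using assms by (intro measurable_PiM_single') (auto intro!: measurable_increment)

text \<open>For fixed A both sides are finite measures in E on the product \<sigma>-algebra, so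
  agreement on cylinders suffices, and there \<open>joint_cf\<close> with no exponential left
  applies. Over all A this is independence of the whole vector of increments from
  \<open>F s\<close>.\<close>

lemma increments_indep:
  assumes A: "A \<in> sets (F s)" and st: "0 \<le> s" "s < t" and E: "E \<in> sets (Pi\<^sub>M UNIV (\<lambda>_. borel))"
  shows "emeasure M (A \<inter> (\<lambda>\<omega> k. \<xi> k t \<omega> - \<xi> k s \<omega>) -` E) = emeasure M A * emeasure (gauss (t - s)) E"
proof -
  let ?D = "\<lambda>\<omega> k. \<xi> k t \<omega> - \<xi> k s \<omega>" and ?PM = "Pi\<^sub>M UNIV (\<lambda>_. borel) :: (nat \<Rightarrow> real) measure"
  have h: "0 < t - s" using st by simp
  have AM[measurable]: "A \<in> sets M" using sets_F A st by auto
  have D[measurable]: "?D \<in> measurable M ?PM" using st by (intro measurable_increments) auto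
  interpret G: product_prob_space "\<lambda>_. gauss1 (t - s)" UNIV by (rule product_prob_space_gauss1) fact
  define P where "P = distr (density M (indicator A)) ?PM ?D"
  define Q where "Q = density (gauss (t - s)) (\<lambda>_. emeasure M A)"
  have Pe: "emeasure P E = emeasure M (A \<inter> ?D -` E)" if E: "E \<in> sets ?PM" for E
  proof -
    have [measurable]: "?D -` E \<inter> space M \<in> sets M" using D E by (rule measurable_sets)
    have eq: "A \<inter> (?D -` E \<inter> space M) = A \<inter> ?D -` E" using sets.sets_into_space[OF AM] by auto
    have "A \<inter> (?D -` E \<inter> space M) \<in> sets M" by simp
    then show ?thesis unfolding P_def using E
      by (simp add: emeasure_distr emeasure_density eq flip: indicator_inter_arith)
  qed
  have Qe: "emeasure Q E = emeasure M A * emeasure (gauss (t - s)) E" if E: "E \<in> sets ?PM" for E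
    unfolding Q_def using E by (simp add: emeasure_density sets_gauss nn_integral_cmult_indicator)
  have "P = Q"
  proof (rule measure_eqI_PiM_infinite)
    show "sets P = sets ?PM" "sets Q = sets ?PM" by (auto simp: P_def Q_def sets_gauss)
    have "space P = space ?PM" by (simp add: P_def)
    then have "emeasure P (space P) \<le> emeasure M (space M)"
      by (simp only: Pe[OF sets.top]) (intro emeasure_mono; use sets.sets_into_space[OF AM] in auto)
    then show "finite_measure P" by (intro finite_measureI) (auto simp: emeasure_space_1 top_unique)
    fix B and J :: "nat set" assume J: "finite J" and B: "\<And>i. i \<in> J \<Longrightarrow> B i \<in> sets (borel :: real measure)"
    let ?X = "prod_emb UNIV (\<lambda>_. borel) J (Pi\<^sub>E J B)"
    have X: "?X \<in> sets ?PM" using J B by (intro sets_PiM_I) auto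
    obtain d where d: "J \<subseteq> {..<d}" using finite_nat_bounded[OF J] by auto
    \<comment> \<open>Padding by the whole line turns a cylinder over J into a box over an initial
      segment of the coordinates; the additional factors are 1.\<close>
    define C where "C k = (if k \<in> J then B k else UNIV)" for k
    have C: "C k \<in> sets borel" for k using B by (auto simp: C_def)
    have Cprod: "(\<Prod>k<d. g k (C k)) = (\<Prod>k\<in>J. g k (B k))" if "\<And>k. g k UNIV = 1" for g :: "nat \<Rightarrow> real set \<Rightarrow> 'z::comm_monoid_mult"
      using d that by (intro prod.mono_neutral_cong_right) (auto simp: C_def)
    have "indicator (A \<inter> ?D -` ?X) \<omega> = indicator A \<omega> * (\<Prod>k<d. indicator (C k) (?D \<omega> k) :: complex)" for \<omega>
    proof -
      have "(\<Prod>k<d. indicator (C k) (?D \<omega> k) :: complex) = (\<Prod>k\<in>J. indicator (B k) (?D \<omega> k))"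
        by (rule Cprod[of "\<lambda>k X. indicator X (?D \<omega> k)"]) simp
      also have "\<dots> = (if \<forall>k\<in>J. ?D \<omega> k \<in> B k then 1 else 0)"
        using J by (auto simp: indicator_def)
      also have "\<dots> = indicator (?D -` ?X) \<omega>"
        by (auto simp: prod_emb_def indicator_def space_PiM)
      finally show ?thesis by (simp add: indicator_inter_arith)
    qed
    moreover have "(\<integral>\<omega>. indicator A \<omega> * (\<Prod>k<d. indicator (C k) (?D \<omega> k)) \<partial>M) =
      complex_of_real (prob A * (\<Prod>k<d. measure (gauss1 (t - s)) (C k)))"
      using joint_cf[where j=d and d=d and u="\<lambda>_. 0" and B=C, OF A st C order_refl] by simp
    moreover have "(\<integral>\<omega>. indicator (A \<inter> ?D -` ?X) \<omega> \<partial>M) = complex_of_real (prob (A \<inter> ?D -` ?X))"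
    proof -
      have "A \<inter> ?D -` ?X = A \<inter> (?D -` ?X \<inter> space M)" using sets.sets_into_space[OF AM] by auto
      also have "\<dots> \<in> sets M" using measurable_sets[OF D X] by auto
      finally have m: "A \<inter> ?D -` ?X \<in> sets M" .
      have "(\<lambda>\<omega>. indicator (A \<inter> ?D -` ?X) \<omega> :: complex) = (\<lambda>\<omega>. of_real (indicator (A \<inter> ?D -` ?X) \<omega>))"
        by (auto simp: indicator_def)
      then show ?thesis using m by simp
    qed
    ultimately have "prob (A \<inter> ?D -` ?X) = prob A * (\<Prod>k<d. measure (gauss1 (t - s)) (C k))"
      by (simp only: of_real_eq_iff)
    also have "(\<Prod>k<d. measure (gauss1 (t - s)) (C k)) = (\<Prod>k\<in>J. measure (gauss1 (t - s)) (B k))"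
      using G.M.prob_space by (intro Cprod) simp
    also have "\<dots> = measure (gauss (t - s)) ?X"
    proof -
      have "?X = prod_emb UNIV (\<lambda>_. gauss1 (t - s)) J (Pi\<^sub>E J B)"
        by (simp add: prod_emb_def space_PiM)
      then show ?thesis
        unfolding gauss_def using J B by (simp add: G.measure_PiM_emb)
    qed
    finally have "prob (A \<inter> ?D -` ?X) = prob A * measure (gauss (t - s)) ?X" .
    then show "emeasure P ?X = emeasure Q ?X"
      unfolding Pe[OF X] Qe[OF X]
      using finite_measure.emeasure_eq_measure[OF prob_space.finite_measure[OF prob_space_gauss[OF h]]]
      by (simp add: emeasure_eq_measure ennreal_mult')
  qed
  then show ?thesis using Pe[OF E] Qe[OF E] by simp
qed

lemma increments_law:
  assumes "0 \<le> s" "s < t"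
  shows "distr M (Pi\<^sub>M UNIV (\<lambda>_. borel)) (\<lambda>\<omega> k. \<xi> k t \<omega> - \<xi> k s \<omega>) = gauss (t - s)"
proof (rule measure_eqI)
  fix E :: "(nat \<Rightarrow> real) set" assume "E \<in> sets (distr M (Pi\<^sub>M UNIV (\<lambda>_. borel)) (\<lambda>\<omega> k. \<xi> k t \<omega> - \<xi> k s \<omega>))"
  then have E: "E \<in> sets (Pi\<^sub>M UNIV (\<lambda>_. borel))" by simp
  have "space M \<in> sets (F s)" using space_F[OF assms(1)] sets.top[of "F s"] by simp
  from increments_indep[OF this assms E] E assms
  show "emeasure (distr M (Pi\<^sub>M UNIV (\<lambda>_. borel)) (\<lambda>\<omega> k. \<xi> k t \<omega> - \<xi> k s \<omega>)) E = emeasure (gauss (t - s)) E"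
    by (subst emeasure_distr) (auto simp: emeasure_space_1 Int_commute intro!: measurable_increments)
qed (simp add: sets_gauss)

text \<open>By independence the pair of the past and the increments has a product law, so Fubini
  integrates the increments out with the past held fixed. The integrand may depend on \<omega>
  through anything known at time s, in particular through a position and a control.\<close>

lemma freezing:
  fixes H :: "'w \<times> (nat \<Rightarrow> real) \<Rightarrow> real"
  assumes st: "0 \<le> s" "s < t"
    and H: "H \<in> borel_measurable (F s \<Otimes>\<^sub>M Pi\<^sub>M UNIV (\<lambda>_. borel))" "\<And>p. \<bar>H p\<bar> \<le> c"
  shows "(\<integral>\<omega>. H (\<omega>, \<lambda>k. \<xi> k t \<omega> - \<xi> k s \<omega>) \<partial>M) = (\<integral>\<omega>. (\<integral>z. H (\<omega>, z) \<partial>gauss (t - s)) \<partial>M)"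
    and "(\<lambda>\<omega>. \<integral>z. H (\<omega>, z) \<partial>gauss (t - s)) \<in> borel_measurable (F s)"
proof -
  let ?D = "\<lambda>\<omega> k. \<xi> k t \<omega> - \<xi> k s \<omega>" and ?PM = "Pi\<^sub>M UNIV (\<lambda>_. borel) :: (nat \<Rightarrow> real) measure"
  \<comment> \<open>The probability measure on the smaller \<sigma>-algebra, written as an image
    under the identity.\<close>
  let ?P = "distr M (F s) (\<lambda>x. x)"
  have id[measurable]: "(\<lambda>x. x) \<in> measurable M (F s)"
    using measurable_F[OF measurable_ident st(1)] by (simp add: id_def)
  have D[measurable]: "?D \<in> measurable M ?PM" using st by (intro measurable_increments) auto
  interpret P: prob_space ?P by (rule prob_space_distr) (rule id)
  interpret G: prob_space "gauss (t - s)" using st by (intro prob_space_gauss) simp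
  interpret PG: pair_prob_space ?P "gauss (t - s)" ..
  have sPG: "sets (?P \<Otimes>\<^sub>M gauss (t - s)) = sets (F s \<Otimes>\<^sub>M ?PM)"
    by (intro sets_pair_measure_cong) (auto simp: sets_gauss)
  have joint: "?P \<Otimes>\<^sub>M gauss (t - s) = distr M (F s \<Otimes>\<^sub>M ?PM) (\<lambda>\<omega>. (\<omega>, ?D \<omega>))"
  proof (rule pair_measure_eqI)
    show "sigma_finite_measure ?P" "sigma_finite_measure (gauss (t - s))" by unfold_locales
    show "sets (?P \<Otimes>\<^sub>M gauss (t - s)) = sets (distr M (F s \<Otimes>\<^sub>M ?PM) (\<lambda>\<omega>. (\<omega>, ?D \<omega>)))"
      by (subst sPG) simp
    fix A B assume "A \<in> sets ?P" "B \<in> sets (gauss (t - s))"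
    then have A: "A \<in> sets (F s)" and B: "B \<in> sets ?PM" by (auto simp: sets_gauss)
    then have A': "A \<subseteq> space M" using sets_F[OF st(1)] sets.sets_into_space by blast
    have "emeasure (distr M (F s \<Otimes>\<^sub>M ?PM) (\<lambda>\<omega>. (\<omega>, ?D \<omega>))) (A \<times> B) = emeasure M (A \<inter> ?D -` B)"
      using A B A' by (subst emeasure_distr) (auto intro!: arg_cong[where f="emeasure M"])
    also have "\<dots> = emeasure M A * emeasure (gauss (t - s)) B" by (rule increments_indep[OF A st B])
    also have "emeasure M A = emeasure ?P A"
      using A A' by (subst emeasure_distr) (auto simp: Int_absorb2)
    finally show "emeasure ?P A * emeasure (gauss (t - s)) B = emeasure (distr M (F s \<Otimes>\<^sub>M ?PM) (\<lambda>\<omega>. (\<omega>, ?D \<omega>))) (A \<times> B)" ..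
  qed
  have Hm: "H \<in> borel_measurable (?P \<Otimes>\<^sub>M gauss (t - s))" using H(1) measurable_cong_sets[OF sPG refl] by auto
  have HF: "H \<in> borel_measurable (F s \<Otimes>\<^sub>M gauss (t - s))"
  proof -
    have "sets (F s \<Otimes>\<^sub>M gauss (t - s)) = sets (F s \<Otimes>\<^sub>M ?PM)" by (intro sets_pair_measure_cong) (auto simp: sets_gauss)
    then show ?thesis using H(1) measurable_cong_sets by blast
  qed
  show m: "(\<lambda>\<omega>. \<integral>z. H (\<omega>, z) \<partial>gauss (t - s)) \<in> borel_measurable (F s)"
    using G.borel_measurable_lebesgue_integral[of "\<lambda>\<omega> z. H (\<omega>, z)" "F s"] HF by simp
  have "(\<integral>\<omega>. H (\<omega>, ?D \<omega>) \<partial>M) = (\<integral>p. H p \<partial>distr M (F s \<Otimes>\<^sub>M ?PM) (\<lambda>\<omega>. (\<omega>, ?D \<omega>)))"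
    by (rule integral_distr[symmetric]) (use H(1) in auto)
  also have "\<dots> = (\<integral>p. H p \<partial>(?P \<Otimes>\<^sub>M gauss (t - s)))" unfolding joint ..
  also have "\<dots> = (\<integral>\<omega>. (\<integral>z. H (\<omega>, z) \<partial>gauss (t - s)) \<partial>?P)"
    by (rule PG.integral_fst'[symmetric]) (use Hm H(2) in \<open>auto intro!: PG.P.integrable_const_bound[where B=c]\<close>)
  also have "\<dots> = (\<integral>\<omega>. (\<integral>z. H (\<omega>, z) \<partial>gauss (t - s)) \<partial>M)"
    by (rule integral_distr[OF id m])
  finally show "(\<integral>\<omega>. H (\<omega>, ?D \<omega>) \<partial>M) = (\<integral>\<omega>. (\<integral>z. H (\<omega>, z) \<partial>gauss (t - s)) \<partial>M)" .
qed

lemma bm_zero: "AE \<omega> in M. \<forall>k. \<xi> k 0 \<omega> = 0"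
  using bm by (intro AE_all_countable[THEN iffD2]) (auto simp: brownian_motion_def)

text \<open>\<open>I_op\<close> uses values of the Brownian motions at time h, while the Gaussian
  law is known for increments; the two agree because the paths start at 0 almost surely.\<close>

lemma integral_bm:
  fixes g :: "(nat \<Rightarrow> real) \<Rightarrow> real"
  assumes h: "0 < h" and g: "g \<in> borel_measurable (Pi\<^sub>M UNIV (\<lambda>_. borel))"
  shows "(\<integral>\<omega>. g (\<lambda>k. \<xi> k h \<omega>) \<partial>M) = (\<integral>z. g z \<partial>gauss h)"
proof -
  have m: "(\<lambda>\<omega> k. \<xi> k h \<omega>) \<in> measurable M (Pi\<^sub>M UNIV (\<lambda>_. borel))"
    using h by (intro measurable_PiM_single') auto
  have m': "(\<lambda>\<omega> k. \<xi> k h \<omega> - \<xi> k 0 \<omega>) \<in> measurable M (Pi\<^sub>M UNIV (\<lambda>_. borel))"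
    using h by (intro measurable_increments) auto
  have "(\<integral>\<omega>. g (\<lambda>k. \<xi> k h \<omega>) \<partial>M) = (\<integral>\<omega>. g (\<lambda>k. \<xi> k h \<omega> - \<xi> k 0 \<omega>) \<partial>M)"
    using bm_zero by (intro integral_cong_AE measurable_compose[OF m g] measurable_compose[OF m' g]) auto
  also have "\<dots> = (\<integral>z. g z \<partial>gauss h)"
    using integral_distr[OF m' g] increments_law[of 0 h] h by simp
  finally show ?thesis .
qed

lemma gauss_moment2:
  assumes h: "0 < h"
  shows "(\<integral>\<^sup>+ z. ennreal ((z k)\<^sup>2) \<partial>gauss h) = ennreal h"
proof -
  have m: "(\<lambda>\<omega> k. \<xi> k h \<omega> - \<xi> k 0 \<omega>) \<in> measurable M (Pi\<^sub>M UNIV (\<lambda>_. borel))"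
    using h by (intro measurable_increments) auto
  have "(\<integral>\<^sup>+ z. ennreal ((z k)\<^sup>2) \<partial>gauss h) = (\<integral>\<^sup>+ z. ennreal ((z k)\<^sup>2) \<partial>distr M (Pi\<^sub>M UNIV (\<lambda>_. borel)) (\<lambda>\<omega> k. \<xi> k h \<omega> - \<xi> k 0 \<omega>))"
    using increments_law[of 0 h] h by simp
  also have "\<dots> = (\<integral>\<^sup>+ \<omega>. ennreal ((\<xi> k h \<omega> - \<xi> k 0 \<omega>)\<^sup>2) \<partial>M)"
    using m by (subst nn_integral_distr) auto
  also have "\<dots> = ennreal h"
    using increment_moment2[of 0 h k] increment_power_integrable[of 0 h k 2] h
    by (subst nn_integral_eq_integral) auto
  finally show ?thesis .
qed

end

section \<open>The Ito isometry\<close>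

text \<open>Squared and extended-valued, so that it makes sense before any integrability is known;
  the price is the factor 2 in its triangle inequality.\<close>

definition msd :: "'a measure \<Rightarrow> ('a \<Rightarrow> real) \<Rightarrow> ('a \<Rightarrow> real) \<Rightarrow> ennreal" where
  "msd N f g = (\<integral>\<^sup>+ x. ennreal ((f x - g x)\<^sup>2) \<partial>N)"

lemma msd_commute: "msd N f g = msd N g f"
  by (simp add: msd_def power2_commute)

lemma square_diff_le: "(x - z)\<^sup>2 \<le> 2 * (x - y)\<^sup>2 + 2 * (y - z)\<^sup>2" for x y z :: real
proof -
  have "0 \<le> ((x - y) - (y - z))\<^sup>2" by simp
  then show ?thesis by (simp add: power2_eq_square algebra_simps)
qed

lemma msd_triangle:
  assumes [measurable]: "f \<in> borel_measurable N" "g \<in> borel_measurable N" "h \<in> borel_measurable N"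
  shows "msd N f h \<le> 2 * msd N f g + 2 * msd N g h"
proof -
  have "msd N f h \<le> (\<integral>\<^sup>+ x. 2 * ennreal ((f x - g x)\<^sup>2) + 2 * ennreal ((g x - h x)\<^sup>2) \<partial>N)"
    unfolding msd_def
  proof (intro nn_integral_mono)
    fix x
    have "ennreal ((f x - h x)\<^sup>2) \<le> ennreal (2 * (f x - g x)\<^sup>2 + 2 * (g x - h x)\<^sup>2)"
      by (intro ennreal_leI square_diff_le)
    then show "ennreal ((f x - h x)\<^sup>2) \<le> 2 * ennreal ((f x - g x)\<^sup>2) + 2 * ennreal ((g x - h x)\<^sup>2)"
      by (simp add: ennreal_plus ennreal_mult')
  qed
  also have "\<dots> = 2 * msd N f g + 2 * msd N g h"
    unfolding msd_def by (simp add: nn_integral_add nn_integral_cmult)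
  finally show ?thesis .
qed

text \<open>Restriction to [0, t] as one function on the product space, with the argument order of
  that product. The \<open>msd\<close> of two cuts is the squared L^2 distance over \<Omega>
  \<times> [0, t].\<close>

definition cut :: "real \<Rightarrow> (real \<Rightarrow> 'w \<Rightarrow> real) \<Rightarrow> 'w \<times> real \<Rightarrow> real" where
  "cut t H = (\<lambda>(\<omega>, s). indicator {0..t} s * H s \<omega>)"

lemma integrable_indicator_Ioc: "integrable lborel (indicator {x<..y::real} :: real \<Rightarrow> real)"
  by (cases "x \<le> y") auto

lemma integral_indicator_Ioc: "(\<integral>s. indicator {x<..y::real} s \<partial>lborel) = max 0 (y - x)"
  by (cases "x \<le> y") auto

context brownian_family begin

abbreviation "MT \<equiv> M \<Otimes>\<^sub>M (lborel :: real measure)"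

lemma pd_eq_msd:
  assumes [measurable]: "cut t H \<in> borel_measurable MT" "cut t H' \<in> borel_measurable MT"
  shows "(\<integral>\<^sup>+ \<omega>. (\<integral>\<^sup>+ s\<in>{0..t}. ennreal ((H s \<omega> - H' s \<omega>)\<^sup>2) \<partial>lborel) \<partial>M) = msd MT (cut t H) (cut t H')"
proof -
  have "ennreal ((H s \<omega> - H' s \<omega>)\<^sup>2) * indicator {0..t} s = ennreal ((cut t H (\<omega>, s) - cut t H' (\<omega>, s))\<^sup>2)" for s \<omega>
    by (auto simp: cut_def indicator_def)
  then have "(\<integral>\<^sup>+ \<omega>. (\<integral>\<^sup>+ s\<in>{0..t}. ennreal ((H s \<omega> - H' s \<omega>)\<^sup>2) \<partial>lborel) \<partial>M) =
      (\<integral>\<^sup>+ \<omega>. (\<integral>\<^sup>+ s. ennreal ((cut t H (\<omega>, s) - cut t H' (\<omega>, s))\<^sup>2) \<partial>lborel) \<partial>M)"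
    by simp
  also have "\<dots> = msd MT (cut t H) (cut t H')"
    unfolding msd_def by (subst lborel.nn_integral_fst) auto
  finally show ?thesis .
qed

lemma bounded_mult_integrable:
  fixes X Y :: "'w \<Rightarrow> real"
  assumes "X \<in> borel_measurable M" "\<And>\<omega>. \<omega> \<in> space M \<Longrightarrow> \<bar>X \<omega>\<bar> \<le> c" "integrable M Y"
  shows "integrable M (\<lambda>\<omega>. X \<omega> * Y \<omega>)"
proof (rule Bochner_Integration.integrable_bound)
  show "integrable M (\<lambda>\<omega>. c * Y \<omega>)" using assms(3) by simp
  have "\<bar>X \<omega>\<bar> * \<bar>Y \<omega>\<bar> \<le> \<bar>c\<bar> * \<bar>Y \<omega>\<bar>" if "\<omega> \<in> space M" for \<omega>
    using assms(2)[OF that] by (intro mult_right_mono) auto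
  then show "AE \<omega> in M. norm (X \<omega> * Y \<omega>) \<le> norm (c * Y \<omega>)" by (intro AE_I2) (auto simp: abs_mult)
  have "Y \<in> borel_measurable M" using assms(3) by auto
  then show "(\<lambda>\<omega>. X \<omega> * Y \<omega>) \<in> borel_measurable M" using assms(1) by auto
qed

lemma increment_mult_mean_real:
  assumes "0 \<le> s" "s \<le> t" and "Z \<in> borel_measurable (F s)" "integrable M (Z :: 'w \<Rightarrow> real)"
  shows "integrable M (\<lambda>\<omega>. Z \<omega> * (\<xi> k t \<omega> - \<xi> k s \<omega>))"
    and "(\<integral>\<omega>. Z \<omega> * (\<xi> k t \<omega> - \<xi> k s \<omega>) \<partial>M) = 0"
  using increment_mult_mean[OF assms, of k] by simp_all

lemma increment_mult_square_real:
  assumes "0 \<le> s" "s \<le> t" and "Z \<in> borel_measurable (F s)" "integrable M (Z :: 'w \<Rightarrow> real)"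
  shows "integrable M (\<lambda>\<omega>. Z \<omega> * (\<xi> k t \<omega> - \<xi> k s \<omega>)\<^sup>2)"
    and "(\<integral>\<omega>. Z \<omega> * (\<xi> k t \<omega> - \<xi> k s \<omega>)\<^sup>2 \<partial>M) = (\<integral>\<omega>. Z \<omega> \<partial>M) * (t - s)"
  using increment_mult_square[OF assms, of k] by simp_all

text \<open>Both increments are split at c, the start of the overlap, and at its end e. Products of
  pieces over non-overlapping intervals have mean 0 against the earlier weight, and the square over
  (c, e] contributes its length.\<close>

lemma increments_covariance_aux:
  fixes \<eta> \<eta>' :: "'w \<Rightarrow> real"
  assumes ab: "0 \<le> a" "a \<le> b" and cd: "a \<le> c" "c \<le> d"
    and \<eta>: "\<eta> \<in> borel_measurable (F a)" "\<And>\<omega>. \<omega> \<in> space M \<Longrightarrow> \<bar>\<eta> \<omega>\<bar> \<le> K"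
    and \<eta>': "\<eta>' \<in> borel_measurable (F c)" "\<And>\<omega>. \<omega> \<in> space M \<Longrightarrow> \<bar>\<eta>' \<omega>\<bar> \<le> K"
  shows "integrable M (\<lambda>\<omega>. (\<eta> \<omega> * \<eta>' \<omega>) * ((\<xi> k b \<omega> - \<xi> k a \<omega>) * (\<xi> k d \<omega> - \<xi> k c \<omega>)))
    \<and> (\<integral>\<omega>. (\<eta> \<omega> * \<eta>' \<omega>) * ((\<xi> k b \<omega> - \<xi> k a \<omega>) * (\<xi> k d \<omega> - \<xi> k c \<omega>)) \<partial>M) =
       (\<integral>\<omega>. \<eta> \<omega> * \<eta>' \<omega> \<partial>M) * max 0 (min b d - max a c)"
proof -
  define X where "X \<omega> = \<eta> \<omega> * \<eta>' \<omega>" for \<omega>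
  have c0: "0 \<le> c" using ab cd by simp
  have Xc: "X \<in> borel_measurable (F c)"
    unfolding X_def using \<eta>'(1) measurable_F_mono[OF \<eta>(1) ab(1) cd(1)] by measurable
  have Xe: "X \<in> borel_measurable (F e)" if "c \<le> e" for e
    using measurable_F_mono[OF Xc c0 that] .
  have XM: "X \<in> borel_measurable M" using measurable_F[OF Xc c0] .
  have Xb: "\<bar>X \<omega>\<bar> \<le> K * K" if "\<omega> \<in> space M" for \<omega>
    using \<eta>(2)[OF that] \<eta>'(2)[OF that] unfolding X_def abs_mult by (intro mult_mono) auto
  have Xi: "integrable M X" using XM Xb by (intro bounded_integrable[where c="K * K"]) auto
  have XW: "integrable M (\<lambda>\<omega>. X \<omega> * (\<xi> k q \<omega> - \<xi> k p \<omega>))" if "0 \<le> p" "p \<le> q" for p q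
    using increment_power_integrable[OF that, of k 1] by (intro bounded_mult_integrable[OF XM Xb]) auto
  show ?thesis
  proof (cases "b \<le> c")
    case True
    have "(\<lambda>\<omega>. X \<omega> * (\<xi> k b \<omega> - \<xi> k a \<omega>)) \<in> borel_measurable (F c)"
      by (intro borel_measurable_times Xc adapted_increment ab True)
    from increment_mult_mean_real[OF c0 cd(2) this XW[OF ab], of k]
    show ?thesis using True cd ab unfolding X_def by (simp add: mult.assoc)
  next
    case False
    define e where "e = min b d"
    have e: "c \<le> e" "e \<le> b" "e \<le> d" "e = b \<or> e = d" "0 \<le> e" using False cd c0 by (auto simp: e_def)
    have m1: "(\<lambda>\<omega>. X \<omega> * (\<xi> k c \<omega> - \<xi> k a \<omega>)) \<in> borel_measurable (F c)"
      by (intro borel_measurable_times Xc adapted_increment ab cd order_refl)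
    have m2: "(\<lambda>\<omega>. X \<omega> * (\<xi> k e \<omega> - \<xi> k c \<omega>)) \<in> borel_measurable (F e)"
      by (intro borel_measurable_times Xe adapted_increment e c0 order_refl)
    note i1 = increment_mult_mean_real[OF c0 cd(2) m1 XW[OF ab(1) cd(1)], of k]
    note i2 = increment_mult_square_real[OF c0 e(1) Xc Xi, of k]
    note i3 = increment_mult_mean_real[OF e(5) e(3) m2 XW[OF c0 e(1)], of k]
    note i4 = increment_mult_mean_real[OF e(5) e(2) m2 XW[OF c0 e(1)], of k]
    \<comment> \<open>Since e equals b or d, the product of the two pieces beyond e is identically 0
      and does not appear in the expansion.\<close>
    have *: "X \<omega> * ((\<xi> k b \<omega> - \<xi> k a \<omega>) * (\<xi> k d \<omega> - \<xi> k c \<omega>)) =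
      X \<omega> * (\<xi> k c \<omega> - \<xi> k a \<omega>) * (\<xi> k d \<omega> - \<xi> k c \<omega>) + X \<omega> * (\<xi> k e \<omega> - \<xi> k c \<omega>)\<^sup>2
      + X \<omega> * (\<xi> k e \<omega> - \<xi> k c \<omega>) * (\<xi> k d \<omega> - \<xi> k e \<omega>)
      + X \<omega> * (\<xi> k e \<omega> - \<xi> k c \<omega>) * (\<xi> k b \<omega> - \<xi> k e \<omega>)" for \<omega>
      using e(4) by (elim disjE) (simp_all add: power2_eq_square algebra_simps)
    have "max 0 (min b d - max a c) = e - c"
      using e cd unfolding e_def[symmetric] by simp
    then show ?thesis
      unfolding X_def[symmetric] * using i1 i2 i3 i4 by simp
  qed
qed

lemma increments_covariance:
  fixes \<eta> \<eta>' :: "'w \<Rightarrow> real"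
  assumes ab: "0 \<le> a" "a \<le> b" and cd: "0 \<le> c" "c \<le> d"
    and \<eta>: "\<eta> \<in> borel_measurable (F a)" "\<And>\<omega>. \<omega> \<in> space M \<Longrightarrow> \<bar>\<eta> \<omega>\<bar> \<le> K"
    and \<eta>': "\<eta>' \<in> borel_measurable (F c)" "\<And>\<omega>. \<omega> \<in> space M \<Longrightarrow> \<bar>\<eta>' \<omega>\<bar> \<le> K"
  shows "integrable M (\<lambda>\<omega>. (\<eta> \<omega> * \<eta>' \<omega>) * ((\<xi> k b \<omega> - \<xi> k a \<omega>) * (\<xi> k d \<omega> - \<xi> k c \<omega>)))"
    and "(\<integral>\<omega>. (\<eta> \<omega> * \<eta>' \<omega>) * ((\<xi> k b \<omega> - \<xi> k a \<omega>) * (\<xi> k d \<omega> - \<xi> k c \<omega>)) \<partial>M) =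
       (\<integral>\<omega>. \<eta> \<omega> * \<eta>' \<omega> \<partial>M) * max 0 (min b d - max a c)"
proof -
  have "integrable M (\<lambda>\<omega>. (\<eta> \<omega> * \<eta>' \<omega>) * ((\<xi> k b \<omega> - \<xi> k a \<omega>) * (\<xi> k d \<omega> - \<xi> k c \<omega>)))
    \<and> (\<integral>\<omega>. (\<eta> \<omega> * \<eta>' \<omega>) * ((\<xi> k b \<omega> - \<xi> k a \<omega>) * (\<xi> k d \<omega> - \<xi> k c \<omega>)) \<partial>M) =
       (\<integral>\<omega>. \<eta> \<omega> * \<eta>' \<omega> \<partial>M) * max 0 (min b d - max a c)"
  proof (cases "a \<le> c")
    case True
    show ?thesis by (rule increments_covariance_aux[OF ab True cd(2) \<eta> \<eta>'])
  next
    case False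
    then have "c \<le> a" by simp
    from increments_covariance_aux[OF cd this ab(2) \<eta>' \<eta>, of k] show ?thesis
      by (simp add: mult.commute min.commute max.commute)
  qed
  then show "integrable M (\<lambda>\<omega>. (\<eta> \<omega> * \<eta>' \<omega>) * ((\<xi> k b \<omega> - \<xi> k a \<omega>) * (\<xi> k d \<omega> - \<xi> k c \<omega>)))"
    "(\<integral>\<omega>. (\<eta> \<omega> * \<eta>' \<omega>) * ((\<xi> k b \<omega> - \<xi> k a \<omega>) * (\<xi> k d \<omega> - \<xi> k c \<omega>)) \<partial>M) =
       (\<integral>\<omega>. \<eta> \<omega> * \<eta>' \<omega> \<partial>M) * max 0 (min b d - max a c)" by auto
qed

text \<open>The intervals may overlap and need not be ordered, so that the isometry applies to the
  difference of two elementary processes without passing to a common partition.\<close>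

lemma step_isometry:
  assumes I: "finite I" and ab: "\<And>i. i \<in> I \<Longrightarrow> 0 \<le> a i" "\<And>i. i \<in> I \<Longrightarrow> a i \<le> b i"
    and c: "\<And>i. i \<in> I \<Longrightarrow> c i \<in> borel_measurable (F (a i))"
    and K: "\<And>i \<omega>. i \<in> I \<Longrightarrow> \<omega> \<in> space M \<Longrightarrow> \<bar>c i \<omega>\<bar> \<le> K"
  shows "(\<integral>\<^sup>+ \<omega>. ennreal ((\<Sum>i\<in>I. c i \<omega> * (\<xi> k (b i) \<omega> - \<xi> k (a i) \<omega>))\<^sup>2) \<partial>M) =
    (\<integral>\<^sup>+ \<omega>. (\<integral>\<^sup>+ s. ennreal ((\<Sum>i\<in>I. c i \<omega> * indicator {a i<..b i} s)\<^sup>2) \<partial>lborel) \<partial>M)"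
proof -
  define L where "L i j = max 0 (min (b i) (b j) - max (a i) (a j))" for i j
  have cM[measurable]: "c i \<in> borel_measurable M" if "i \<in> I" for i
    using measurable_F[OF c[OF that] ab(1)[OF that]] .
  have cb: "\<bar>c i \<omega> * c j \<omega>\<bar> \<le> K * K" if "i \<in> I" "j \<in> I" "\<omega> \<in> space M" for i j \<omega>
    using K[OF that(1,3)] K[OF that(2,3)] unfolding abs_mult by (intro mult_mono) auto
  have ci: "integrable M (\<lambda>\<omega>. c i \<omega> * c j \<omega>)" if "i \<in> I" "j \<in> I" for i j
    using that cb by (intro bounded_integrable[where c="K * K"]) auto
  have sqW: "(\<Sum>i\<in>I. c i \<omega> * (\<xi> k (b i) \<omega> - \<xi> k (a i) \<omega>))\<^sup>2 =
    (\<Sum>i\<in>I. \<Sum>j\<in>I. (c i \<omega> * c j \<omega>) * ((\<xi> k (b i) \<omega> - \<xi> k (a i) \<omega>) * (\<xi> k (b j) \<omega> - \<xi> k (a j) \<omega>)))" for \<omega>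
    unfolding power2_eq_square sum_product by (intro sum.cong) (auto simp: mult_ac)
  note cov = increments_covariance[OF ab(1) ab(2) ab(1) ab(2) c K c K]
  have "(\<integral>\<^sup>+ \<omega>. ennreal ((\<Sum>i\<in>I. c i \<omega> * (\<xi> k (b i) \<omega> - \<xi> k (a i) \<omega>))\<^sup>2) \<partial>M) =
    ennreal (\<integral>\<omega>. (\<Sum>i\<in>I. c i \<omega> * (\<xi> k (b i) \<omega> - \<xi> k (a i) \<omega>))\<^sup>2 \<partial>M)"
    unfolding sqW using cov(1)
    by (intro nn_integral_eq_integral Bochner_Integration.integrable_sum) (auto simp flip: sqW)
  also have "(\<integral>\<omega>. (\<Sum>i\<in>I. c i \<omega> * (\<xi> k (b i) \<omega> - \<xi> k (a i) \<omega>))\<^sup>2 \<partial>M) =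
    (\<Sum>i\<in>I. \<Sum>j\<in>I. (\<integral>\<omega>. c i \<omega> * c j \<omega> \<partial>M) * L i j)"
    unfolding sqW L_def using cov by (simp add: Bochner_Integration.integral_sum)
  finally have lhs: "(\<integral>\<^sup>+ \<omega>. ennreal ((\<Sum>i\<in>I. c i \<omega> * (\<xi> k (b i) \<omega> - \<xi> k (a i) \<omega>))\<^sup>2) \<partial>M) =
    ennreal (\<Sum>i\<in>I. \<Sum>j\<in>I. (\<integral>\<omega>. c i \<omega> * c j \<omega> \<partial>M) * L i j)" .
  \<comment> \<open>The product of two interval indicators is the indicator of the intersection, and
    its length \<open>L i j\<close> is also the covariance of the increments: both sides of the
    isometry reduce to the same double sum.\<close>
  have sqs: "(\<Sum>i\<in>I. c i \<omega> * indicator {a i<..b i} s)\<^sup>2 =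
    (\<Sum>i\<in>I. \<Sum>j\<in>I. (c i \<omega> * c j \<omega>) * indicator {max (a i) (a j)<..min (b i) (b j)} s)" for \<omega> s
    unfolding power2_eq_square sum_product by (intro sum.cong) (auto simp: indicator_def)
  have Lint: "integrable lborel (indicator {max (a i) (a j)<..min (b i) (b j)} :: real \<Rightarrow> real)"
     "(\<integral>s. indicator {max (a i) (a j)<..min (b i) (b j)} s \<partial>lborel) = L i j" for i j
    unfolding L_def by (rule integrable_indicator_Ioc, rule integral_indicator_Ioc)
  have inner: "(\<integral>\<^sup>+ s. ennreal ((\<Sum>i\<in>I. c i \<omega> * indicator {a i<..b i} s)\<^sup>2) \<partial>lborel) =
     ennreal (\<Sum>i\<in>I. \<Sum>j\<in>I. (c i \<omega> * c j \<omega>) * L i j)"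
     "0 \<le> (\<Sum>i\<in>I. \<Sum>j\<in>I. (c i \<omega> * c j \<omega>) * L i j)" for \<omega>
  proof -
    have i: "integrable lborel (\<lambda>s. (\<Sum>i\<in>I. c i \<omega> * indicator {a i<..b i} s)\<^sup>2)"
      unfolding sqs using Lint(1) by (intro Bochner_Integration.integrable_sum integrable_mult_right)
    have v: "(\<integral>s. (\<Sum>i\<in>I. c i \<omega> * indicator {a i<..b i} s)\<^sup>2 \<partial>lborel) = (\<Sum>i\<in>I. \<Sum>j\<in>I. (c i \<omega> * c j \<omega>) * L i j)"
      unfolding sqs using Lint by (simp add: Bochner_Integration.integral_sum)
    show "(\<integral>\<^sup>+ s. ennreal ((\<Sum>i\<in>I. c i \<omega> * indicator {a i<..b i} s)\<^sup>2) \<partial>lborel) =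
     ennreal (\<Sum>i\<in>I. \<Sum>j\<in>I. (c i \<omega> * c j \<omega>) * L i j)"
      using i unfolding v[symmetric] by (intro nn_integral_eq_integral) auto
    show "0 \<le> (\<Sum>i\<in>I. \<Sum>j\<in>I. (c i \<omega> * c j \<omega>) * L i j)"
      unfolding v[symmetric] by (rule Bochner_Integration.integral_nonneg) simp
  qed
  have "(\<integral>\<^sup>+ \<omega>. ennreal (\<Sum>i\<in>I. \<Sum>j\<in>I. (c i \<omega> * c j \<omega>) * L i j) \<partial>M) =
     ennreal (\<integral>\<omega>. (\<Sum>i\<in>I. \<Sum>j\<in>I. (c i \<omega> * c j \<omega>) * L i j) \<partial>M)"
    using ci inner(2) by (intro nn_integral_eq_integral Bochner_Integration.integrable_sum integrable_mult_left) auto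
  also have "(\<integral>\<omega>. (\<Sum>i\<in>I. \<Sum>j\<in>I. (c i \<omega> * c j \<omega>) * L i j) \<partial>M) = (\<Sum>i\<in>I. \<Sum>j\<in>I. (\<integral>\<omega>. c i \<omega> * c j \<omega> \<partial>M) * L i j)"
    using ci by (simp add: Bochner_Integration.integral_sum)
  finally show ?thesis unfolding lhs inner(1) by simp
qed

section \<open>Elementary processes and the isometry for their integrals\<close>

lemma elementary_process_mono:
  assumes "elementary_process M F m \<tau> \<eta>" "i \<le> m"
  shows "0 \<le> \<tau> i"
  using assms(2)
proof (induction i)
  case (Suc i)
  then have "\<tau> i \<le> \<tau> (Suc i)" using assms(1) by (auto simp: elementary_process_def)
  then show ?case using Suc by auto
qed (use assms in \<open>auto simp: elementary_process_def\<close>)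

lemma elementary_process_bound:
  assumes "elementary_process M F m \<tau> \<eta>"
  obtains K where "0 \<le> K" "\<And>i \<omega>. i < m \<Longrightarrow> \<omega> \<in> space M \<Longrightarrow> \<bar>\<eta> i \<omega>\<bar> \<le> K"
proof -
  have "bounded (\<Union>i<m. \<eta> i ` space M)"
    using assms by (intro bounded_Union) (auto simp: elementary_process_def)
  then obtain K where K: "\<forall>x\<in>(\<Union>i<m. \<eta> i ` space M). \<bar>x\<bar> \<le> K" by (auto simp: bounded_iff)
  show ?thesis
  proof (rule that[of "\<bar>K\<bar>"])
    fix i \<omega> assume "i < m" "\<omega> \<in> space M"
    then have "\<eta> i \<omega> \<in> (\<Union>i<m. \<eta> i ` space M)" by auto
    with K have "\<bar>\<eta> i \<omega>\<bar> \<le> K" by blast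
    then show "\<bar>\<eta> i \<omega>\<bar> \<le> \<bar>K\<bar>" by linarith
  qed simp
qed

lemma elementary_measurable:
  assumes "elementary_process M F m \<tau> \<eta>" "i < m"
  shows "\<eta> i \<in> borel_measurable M"
  using assms measurable_F[of "\<eta> i" "\<tau> i"] elementary_process_mono[OF assms(1), of i]
  by (auto simp: elementary_process_def)

lemma elementary_integral_measurable:
  assumes "elementary_process M F m \<tau> \<eta>" "0 \<le> t"
  shows "elementary_integral (\<xi> k) m \<tau> \<eta> t \<in> borel_measurable M"
  unfolding elementary_integral_def[abs_def]
  using elementary_measurable[OF assms(1)] elementary_process_mono[OF assms(1)] assms(2)
  by (intro borel_measurable_sum borel_measurable_times measurable_increment) auto

lemma elementary_value_measurable:
  assumes "elementary_process M F m \<tau> \<eta>"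
  shows "cut t (elementary_value m \<tau> \<eta>) \<in> borel_measurable MT"
proof -
  have [measurable]: "\<eta> i \<in> borel_measurable M" if "i < m" for i using elementary_measurable[OF assms that] .
  have "(\<lambda>p. indicator {0..t} (snd p) * (\<Sum>i<m. \<eta> i (fst p) * indicator {\<tau> i<..\<tau> (Suc i)} (snd p))) \<in> borel_measurable MT"
    by measurable
  then show ?thesis unfolding cut_def elementary_value_def by (simp add: case_prod_unfold)
qed

text \<open>The difference of two elementary integrals is one step sum over the disjoint union of
  the index sets, with the coefficients of the second family negated.\<close>

lemma elementary_isometry:
  assumes e: "elementary_process M F m \<tau> \<eta>" and e': "elementary_process M F m' \<tau>' \<eta>'" and t: "0 \<le> t"
  shows "msd M (elementary_integral (\<xi> k) m \<tau> \<eta> t) (elementary_integral (\<xi> k) m' \<tau>' \<eta>' t) =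
    msd MT (cut t (elementary_value m \<tau> \<eta>)) (cut t (elementary_value m' \<tau>' \<eta>'))"
proof -
  obtain K where K: "0 \<le> K" "\<And>i \<omega>. i < m \<Longrightarrow> \<omega> \<in> space M \<Longrightarrow> \<bar>\<eta> i \<omega>\<bar> \<le> K"
    using elementary_process_bound[OF e] by blast
  obtain K' where K': "0 \<le> K'" "\<And>i \<omega>. i < m' \<Longrightarrow> \<omega> \<in> space M \<Longrightarrow> \<bar>\<eta>' i \<omega>\<bar> \<le> K'"
    using elementary_process_bound[OF e'] by blast
  define I where "I = {..<m} <+> {..<m'}"
  \<comment> \<open>Intervals starting after t collapse to the point t, where their coefficient need
    not be measurable yet; setting it to 0 changes neither the integral nor the cut process.\<close>
  define c where "c = case_sum (\<lambda>i \<omega>. if \<tau> i \<le> t then \<eta> i \<omega> else 0) (\<lambda>i \<omega>. if \<tau>' i \<le> t then - \<eta>' i \<omega> else 0)"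
  define a where "a = case_sum (\<lambda>i. min t (\<tau> i)) (\<lambda>i. min t (\<tau>' i))"
  define b where "b = case_sum (\<lambda>i. min t (\<tau> (Suc i))) (\<lambda>i. min t (\<tau>' (Suc i)))"
  have sumI: "sum f I = (\<Sum>i<m. f (Inl i)) + (\<Sum>i<m'. f (Inr i))" for f :: "nat + nat \<Rightarrow> real"
    unfolding I_def by (simp add: sum.Plus)
  have "(\<integral>\<^sup>+ \<omega>. ennreal ((\<Sum>i\<in>I. c i \<omega> * (\<xi> k (b i) \<omega> - \<xi> k (a i) \<omega>))\<^sup>2) \<partial>M) =
    (\<integral>\<^sup>+ \<omega>. (\<integral>\<^sup>+ s. ennreal ((\<Sum>i\<in>I. c i \<omega> * indicator {a i<..b i} s)\<^sup>2) \<partial>lborel) \<partial>M)"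
  proof (rule step_isometry)
    show "finite I" by (simp add: I_def)
    show "0 \<le> a i" "a i \<le> b i" if "i \<in> I" for i
      using that e e' t elementary_process_mono[OF e] elementary_process_mono[OF e']
      by (auto simp: I_def a_def b_def elementary_process_def intro: min.mono)
    show "c i \<in> borel_measurable (F (a i))" if "i \<in> I" for i
    proof (cases i)
      case (Inl x)
      then have x: "x < m" using that by (auto simp: I_def)
      show ?thesis
      proof (cases "\<tau> x \<le> t")
        case True
        then have "c i = \<eta> x" "a i = \<tau> x" using Inl by (auto simp: c_def a_def)
        then show ?thesis using e x by (auto simp: elementary_process_def)
      next
        case False
        then have "c i = (\<lambda>_. 0)" using Inl by (auto simp: c_def)
        then show ?thesis by simp
      qed
    next
      case (Inr x)
      then have x: "x < m'" using that by (auto simp: I_def)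
      show ?thesis
      proof (cases "\<tau>' x \<le> t")
        case True
        then have "c i = (\<lambda>\<omega>. - \<eta>' x \<omega>)" "a i = \<tau>' x" using Inr by (auto simp: c_def a_def)
        then show ?thesis using e' x by (auto simp: elementary_process_def)
      next
        case False
        then have "c i = (\<lambda>_. 0)" using Inr by (auto simp: c_def)
        then show ?thesis by simp
      qed
    qed
    show "\<bar>c i \<omega>\<bar> \<le> max K K'" if "i \<in> I" "\<omega> \<in> space M" for i \<omega>
      using that K K' by (auto simp: I_def c_def le_max_iff_disj)
  qed
  moreover have "(\<Sum>i\<in>I. c i \<omega> * (\<xi> k (b i) \<omega> - \<xi> k (a i) \<omega>)) =
     elementary_integral (\<xi> k) m \<tau> \<eta> t \<omega> - elementary_integral (\<xi> k) m' \<tau>' \<eta>' t \<omega>" for \<omega>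
  proof -
    have 1: "c (Inl i) \<omega> * (\<xi> k (b (Inl i)) \<omega> - \<xi> k (a (Inl i)) \<omega>) =
      \<eta> i \<omega> * (\<xi> k (min t (\<tau> (Suc i))) \<omega> - \<xi> k (min t (\<tau> i)) \<omega>)" if "i < m" for i
    proof -
      have "\<tau> i \<le> \<tau> (Suc i)" using e that by (auto simp: elementary_process_def)
      then show ?thesis by (auto simp: a_def b_def c_def min_def)
    qed
    have 2: "c (Inr i) \<omega> * (\<xi> k (b (Inr i)) \<omega> - \<xi> k (a (Inr i)) \<omega>) =
      - (\<eta>' i \<omega> * (\<xi> k (min t (\<tau>' (Suc i))) \<omega> - \<xi> k (min t (\<tau>' i)) \<omega>))" if "i < m'" for i
    proof -
      have "\<tau>' i \<le> \<tau>' (Suc i)" using e' that by (auto simp: elementary_process_def)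
      then show ?thesis by (auto simp: a_def b_def c_def min_def)
    qed
    show ?thesis
      unfolding sumI elementary_integral_def diff_conv_add_uminus sum_negf[symmetric]
      by (intro arg_cong2[where f="(+)"] sum.cong refl)
        (use 1 2 in \<open>simp_all only: lessThan_iff diff_conv_add_uminus\<close>)
  qed
  moreover have "(\<Sum>i\<in>I. c i \<omega> * indicator {a i<..b i} s) =
     cut t (elementary_value m \<tau> \<eta>) (\<omega>, s) - cut t (elementary_value m' \<tau>' \<eta>') (\<omega>, s)" for \<omega> s
  proof -
    have 1: "c (Inl i) \<omega> * indicator {a (Inl i)<..b (Inl i)} s =
      indicator {0..t} s * (\<eta> i \<omega> * indicator {\<tau> i<..\<tau> (Suc i)} s)" if "i < m" for i
      using elementary_process_mono[OF e, of i] that by (auto simp: indicator_def a_def b_def c_def)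
    have 2: "c (Inr i) \<omega> * indicator {a (Inr i)<..b (Inr i)} s =
      - (indicator {0..t} s * (\<eta>' i \<omega> * indicator {\<tau>' i<..\<tau>' (Suc i)} s))" if "i < m'" for i
      using elementary_process_mono[OF e', of i] that by (auto simp: indicator_def a_def b_def c_def)
    show ?thesis
      unfolding sumI cut_def elementary_value_def diff_conv_add_uminus prod.case sum_distrib_left sum_negf[symmetric]
      by (intro arg_cong2[where f="(+)"] sum.cong refl) (use 1 2 in \<open>simp_all only: lessThan_iff\<close>)
  qed
  moreover have "(\<integral>\<^sup>+ \<omega>. (\<integral>\<^sup>+ s. ennreal ((cut t (elementary_value m \<tau> \<eta>) (\<omega>, s) - cut t (elementary_value m' \<tau>' \<eta>') (\<omega>, s))\<^sup>2) \<partial>lborel) \<partial>M) =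
      msd MT (cut t (elementary_value m \<tau> \<eta>)) (cut t (elementary_value m' \<tau>' \<eta>'))"
    unfolding msd_def using elementary_value_measurable[OF e, of t] elementary_value_measurable[OF e', of t]
    by (subst lborel.nn_integral_fst) auto
  ultimately show ?thesis by (simp add: msd_def)
qed

section \<open>Stability and existence of the Ito integral\<close>

lemma has_ito_integral_iff:
  assumes "cut t H \<in> borel_measurable MT"
  shows "has_ito_integral M F W H t J \<longleftrightarrow> J \<in> borel_measurable M \<and>
     (\<exists>m \<tau> \<eta>. (\<forall>n. elementary_process M F (m n) (\<tau> n) (\<eta> n)) \<and>
        (\<lambda>n. msd MT (cut t (elementary_value (m n) (\<tau> n) (\<eta> n))) (cut t H)) \<longlonglongrightarrow> 0 \<and>
        (\<lambda>n. msd M (elementary_integral W (m n) (\<tau> n) (\<eta> n) t) J) \<longlonglongrightarrow> 0)"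
proof -
  have "((\<forall>n. elementary_process M F (m n) (\<tau> n) (\<eta> n)) \<and>
      (\<lambda>n. \<integral>\<^sup>+ \<omega>. (\<integral>\<^sup>+ s\<in>{0..t}.
            ennreal ((elementary_value (m n) (\<tau> n) (\<eta> n) s \<omega> - H s \<omega>)\<^sup>2) \<partial>lborel) \<partial>M) \<longlonglongrightarrow> 0 \<and> X) \<longleftrightarrow>
    ((\<forall>n. elementary_process M F (m n) (\<tau> n) (\<eta> n)) \<and>
      (\<lambda>n. msd MT (cut t (elementary_value (m n) (\<tau> n) (\<eta> n))) (cut t H)) \<longlonglongrightarrow> 0 \<and> X)" for m \<tau> \<eta> X
  proof (rule conj_cong[OF refl])
    assume "\<forall>n. elementary_process M F (m n) (\<tau> n) (\<eta> n)"
    then show "((\<lambda>n. \<integral>\<^sup>+ \<omega>. (\<integral>\<^sup>+ s\<in>{0..t}.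
            ennreal ((elementary_value (m n) (\<tau> n) (\<eta> n) s \<omega> - H s \<omega>)\<^sup>2) \<partial>lborel) \<partial>M) \<longlonglongrightarrow> 0 \<and> X) \<longleftrightarrow>
      ((\<lambda>n. msd MT (cut t (elementary_value (m n) (\<tau> n) (\<eta> n))) (cut t H)) \<longlonglongrightarrow> 0 \<and> X)"
      by (simp only: pd_eq_msd[OF elementary_value_measurable assms])
  qed
  then show ?thesis by (simp only: has_ito_integral_def msd_def[of M])
qed

text \<open>Each integral only comes with some approximating sequence, so the two sequences are
  linked through the isometry. The constant 16 collects four nested uses of the triangle inequality
  with factor 2. For H = H' this says that the integral does not depend on the sequence, up to null
  sets.\<close>

lemma ito_integral_stable:
  assumes t: "0 \<le> t" and H: "cut t H \<in> borel_measurable MT" "cut t H' \<in> borel_measurable MT"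
    and J: "has_ito_integral M F (\<xi> k) H t J" "has_ito_integral M F (\<xi> k) H' t J'"
  shows "msd M J J' \<le> 16 * msd MT (cut t H) (cut t H')"
proof -
  obtain m \<tau> \<eta> where e: "\<And>n. elementary_process M F (m n) (\<tau> n) (\<eta> n)"
    and l1: "(\<lambda>n. msd MT (cut t (elementary_value (m n) (\<tau> n) (\<eta> n))) (cut t H)) \<longlonglongrightarrow> 0"
    and l2: "(\<lambda>n. msd M (elementary_integral (\<xi> k) (m n) (\<tau> n) (\<eta> n) t) J) \<longlonglongrightarrow> 0"
    and Jm: "J \<in> borel_measurable M"
    using J(1) unfolding has_ito_integral_iff[OF H(1)] by blast
  obtain m' \<tau>' \<eta>' where e': "\<And>n. elementary_process M F (m' n) (\<tau>' n) (\<eta>' n)"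
    and l1': "(\<lambda>n. msd MT (cut t (elementary_value (m' n) (\<tau>' n) (\<eta>' n))) (cut t H')) \<longlonglongrightarrow> 0"
    and l2': "(\<lambda>n. msd M (elementary_integral (\<xi> k) (m' n) (\<tau>' n) (\<eta>' n) t) J') \<longlonglongrightarrow> 0"
    and Jm': "J' \<in> borel_measurable M"
    using J(2) unfolding has_ito_integral_iff[OF H(2)] by blast
  let ?I = "\<lambda>n. elementary_integral (\<xi> k) (m n) (\<tau> n) (\<eta> n) t"
  let ?I' = "\<lambda>n. elementary_integral (\<xi> k) (m' n) (\<tau>' n) (\<eta>' n) t"
  let ?E = "\<lambda>n. cut t (elementary_value (m n) (\<tau> n) (\<eta> n))"
  let ?E' = "\<lambda>n. cut t (elementary_value (m' n) (\<tau>' n) (\<eta>' n))"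
  note Im = elementary_integral_measurable[OF e t] elementary_integral_measurable[OF e' t]
  note Em = elementary_value_measurable[OF e] elementary_value_measurable[OF e']
  let ?d = "msd MT (cut t H) (cut t H')"
  have "msd M J J' \<le> 2 * msd M (?I n) J + 2 * (2 * (2 * msd MT (?E n) (cut t H) + 2 * (2 * ?d + 2 * msd MT (?E' n) (cut t H'))) + 2 * msd M (?I' n) J')" for n
  proof -
    have "msd M (?I n) (?I' n) = msd MT (?E n) (?E' n)" by (rule elementary_isometry[OF e e' t])
    also have "\<dots> \<le> 2 * msd MT (?E n) (cut t H) + 2 * msd MT (cut t H) (?E' n)"
      by (intro msd_triangle Em H)
    also have "msd MT (cut t H) (?E' n) \<le> 2 * ?d + 2 * msd MT (cut t H') (?E' n)"
      by (intro msd_triangle Em H)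
    finally have 1: "msd M (?I n) (?I' n) \<le> 2 * msd MT (?E n) (cut t H) + 2 * (2 * ?d + 2 * msd MT (?E' n) (cut t H'))"
      by (simp add: msd_commute[of _ "cut t H'"] mult_left_mono add_left_mono)
    have "msd M J J' \<le> 2 * msd M J (?I n) + 2 * msd M (?I n) J'"
      by (intro msd_triangle Im Jm Jm')
    also have "msd M (?I n) J' \<le> 2 * msd M (?I n) (?I' n) + 2 * msd M (?I' n) J'"
      by (intro msd_triangle Im Jm Jm')
    finally have "msd M J J' \<le> 2 * msd M (?I n) J + 2 * (2 * msd M (?I n) (?I' n) + 2 * msd M (?I' n) J')"
      by (simp add: msd_commute[of _ J] mult_left_mono add_left_mono)
    also have "\<dots> \<le> 2 * msd M (?I n) J + 2 * (2 * (2 * msd MT (?E n) (cut t H) + 2 * (2 * ?d + 2 * msd MT (?E' n) (cut t H'))) + 2 * msd M (?I' n) J')"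
      by (intro add_left_mono mult_left_mono add_mono 1) auto
    finally show ?thesis .
  qed
  moreover have "(\<lambda>n. 2 * msd M (?I n) J + 2 * (2 * (2 * msd MT (?E n) (cut t H) + 2 * (2 * ?d + 2 * msd MT (?E' n) (cut t H'))) + 2 * msd M (?I' n) J'))
    \<longlonglongrightarrow> 2 * 0 + 2 * (2 * (2 * 0 + 2 * (2 * ?d + 2 * 0)) + 2 * 0)"
    by (intro tendsto_add ennreal_tendsto_cmult tendsto_const l1 l2 l1' l2') auto
  ultimately have "msd M J J' \<le> 2 * 0 + 2 * (2 * (2 * 0 + 2 * (2 * ?d + 2 * 0)) + 2 * 0)"
    by (intro LIMSEQ_le_const[OF _ exI[of _ 0]]) auto
  also have "\<dots> = 16 * ?d" by (simp add: mult.assoc[symmetric])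
  finally show ?thesis .
qed

text \<open>The rate 8^(-n) for the integrands makes successive integrals differ by O(2^(-n)) in
  mean, so they converge almost surely; Fatou's lemma then recovers the mean square rate for the
  limit.\<close>

lemma ito_integral_exists:
  assumes t: "0 \<le> t" and H: "cut t H \<in> borel_measurable MT"
    and e: "\<And>n. elementary_process M F (m n) (\<tau> n) (\<eta> n)"
    and approx: "\<And>n. msd MT (cut t (elementary_value (m n) (\<tau> n) (\<eta> n))) (cut t H) \<le> ennreal ((1/8) ^ n)"
  shows "\<exists>J. has_ito_integral M F (\<xi> k) H t J"
proof -
  let ?I = "\<lambda>n. elementary_integral (\<xi> k) (m n) (\<tau> n) (\<eta> n) t"
  let ?E = "\<lambda>n. cut t (elementary_value (m n) (\<tau> n) (\<eta> n))"
  note Im[measurable] = elementary_integral_measurable[OF e t]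
  note Em = elementary_value_measurable[OF e]
  have cauchy: "msd M (?I n) (?I l) \<le> ennreal (4 * (1/8) ^ n)" if "n \<le> l" for n l
  proof -
    have "msd M (?I n) (?I l) = msd MT (?E n) (?E l)" by (rule elementary_isometry[OF e e t])
    also have "\<dots> \<le> 2 * msd MT (?E n) (cut t H) + 2 * msd MT (cut t H) (?E l)"
      by (intro msd_triangle Em H)
    also have "\<dots> \<le> 2 * ennreal ((1/8) ^ n) + 2 * ennreal ((1/8) ^ l)"
      using approx[of n] approx[of l] by (intro add_mono mult_left_mono) (auto simp: msd_commute[of _ "cut t H"])
    also have "\<dots> \<le> 2 * ennreal ((1/8) ^ n) + 2 * ennreal ((1/8) ^ n)"
      using that by (intro add_left_mono mult_left_mono ennreal_leI power_decreasing) auto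
    also have "\<dots> = ennreal (4 * (1/8) ^ n)"
      by (simp add: ennreal_mult' flip: ennreal_plus distrib_right)
    finally show ?thesis .
  qed
  have L1: "(\<integral>\<^sup>+ \<omega>. ennreal \<bar>?I (Suc n) \<omega> - ?I n \<omega>\<bar> \<partial>M) \<le> ennreal (5 * (1/2) ^ n)" for n
  proof -
    \<comment> \<open>Young's inequality with weight 2^n: a second moment of order 8^(-n)
      contributes order 4^(-n), which the first term 2^(-n) dominates.\<close>
    have "ennreal \<bar>x\<bar> \<le> ennreal ((1/2) ^ n) + ennreal (2 ^ n) * ennreal (x\<^sup>2)" for x :: real
    proof -
      have "y \<le> 1 + y\<^sup>2" if "0 \<le> y" for y :: real
        using sum_squares_bound[of 1 y] that by simp
      then have "2 ^ n * \<bar>x\<bar> \<le> 1 + (2 ^ n * \<bar>x\<bar>)\<^sup>2" by simp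
      also have "\<dots> = 2 ^ n * ((1/2) ^ n + 2 ^ n * x\<^sup>2)"
        by (simp add: distrib_left power2_eq_square mult_ac flip: power_mult_distrib)
      finally have "\<bar>x\<bar> \<le> (1/2) ^ n + 2 ^ n * x\<^sup>2" by simp
      then have "ennreal \<bar>x\<bar> \<le> ennreal ((1/2) ^ n + 2 ^ n * x\<^sup>2)" by (rule ennreal_leI)
      then show ?thesis by (simp add: ennreal_plus ennreal_mult')
    qed
    then have "(\<integral>\<^sup>+ \<omega>. ennreal \<bar>?I (Suc n) \<omega> - ?I n \<omega>\<bar> \<partial>M) \<le>
      (\<integral>\<^sup>+ \<omega>. ennreal ((1/2) ^ n) + ennreal (2 ^ n) * ennreal ((?I (Suc n) \<omega> - ?I n \<omega>)\<^sup>2) \<partial>M)"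
      by (intro nn_integral_mono)
    also have "\<dots> = ennreal ((1/2) ^ n) + ennreal (2 ^ n) * msd M (?I n) (?I (Suc n))"
      unfolding msd_commute[of _ "?I n" "?I (Suc n)"] unfolding msd_def
      by (subst nn_integral_add, simp, simp, subst nn_integral_cmult) (auto simp: emeasure_space_1)
    also have "\<dots> \<le> ennreal ((1/2) ^ n) + ennreal (2 ^ n) * ennreal (4 * (1/8) ^ n)"
      by (intro add_left_mono mult_left_mono cauchy) auto
    also have "\<dots> = ennreal ((1/2) ^ n + 2 ^ n * (4 * (1/8) ^ n))"
      by (simp add: ennreal_plus ennreal_mult')
    also have "\<dots> \<le> ennreal (5 * (1/2) ^ n)"
    proof (rule ennreal_leI)
      have "2 ^ n * (1/8) ^ n = (1/4::real) ^ n" by (simp flip: power_mult_distrib)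
      moreover have "(1/4::real) ^ n \<le> (1/2) ^ n" by (intro power_mono) auto
      ultimately show "(1/2) ^ n + 2 ^ n * (4 * (1/8) ^ n) \<le> 5 * (1/2::real) ^ n" by simp
    qed
    finally show ?thesis .
  qed
  have "(\<integral>\<^sup>+ \<omega>. (\<Sum>n. ennreal \<bar>?I (Suc n) \<omega> - ?I n \<omega>\<bar>) \<partial>M) = (\<Sum>n. \<integral>\<^sup>+ \<omega>. ennreal \<bar>?I (Suc n) \<omega> - ?I n \<omega>\<bar> \<partial>M)"
    by (intro nn_integral_suminf) auto
  also have "\<dots> \<le> (\<Sum>n. ennreal (5 * (1/2) ^ n))"
    by (intro suminf_le L1) auto
  also have "\<dots> = ennreal (\<Sum>n. 5 * (1/2) ^ n)"
    by (intro suminf_ennreal2) (auto intro!: summable_mult summable_geometric)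
  also have "\<dots> < \<infinity>" by simp
  finally have "AE \<omega> in M. (\<Sum>n. ennreal \<bar>?I (Suc n) \<omega> - ?I n \<omega>\<bar>) \<noteq> \<infinity>"
    by (intro nn_integral_PInf_AE) auto
  then have conv: "AE \<omega> in M. (\<lambda>n. ?I n \<omega>) \<longlonglongrightarrow> lim (\<lambda>n. ?I n \<omega>)"
  proof eventually_elim
    case (elim \<omega>)
    then have "summable (\<lambda>n. \<bar>?I (Suc n) \<omega> - ?I n \<omega>\<bar>)"
      by (intro summable_suminf_not_top) auto
    then have "summable (\<lambda>n. ?I (Suc n) \<omega> - ?I n \<omega>)"
      by (rule summable_rabs_cancel)
    then have "(\<lambda>n. \<Sum>i<n. ?I (Suc i) \<omega> - ?I i \<omega>) \<longlonglongrightarrow> (\<Sum>i. ?I (Suc i) \<omega> - ?I i \<omega>)"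
      by (rule summable_LIMSEQ)
    then have "(\<lambda>n. ?I n \<omega> - ?I 0 \<omega>) \<longlonglongrightarrow> (\<Sum>i. ?I (Suc i) \<omega> - ?I i \<omega>)"
      by (simp add: sum_lessThan_telescope[of "\<lambda>i. ?I i \<omega>"])
    from tendsto_add[OF this tendsto_const[of "?I 0 \<omega>"]]
    have "convergent (\<lambda>n. ?I n \<omega>)" by (auto simp: convergent_def)
    then show ?case by (simp add: convergent_LIMSEQ_iff)
  qed
  \<comment> \<open>Where the sequence diverges \<open>lim\<close> has some unspecified value; that
    set is null, and the function is measurable all the same.\<close>
  define J where "J \<omega> = lim (\<lambda>n. ?I n \<omega>)" for \<omega>
  have Jm[measurable]: "J \<in> borel_measurable M" unfolding J_def by measurable
  have JI: "msd M (?I n) J \<le> ennreal (4 * (1/8) ^ n)" for n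
  proof -
    have "msd M (?I n) J = (\<integral>\<^sup>+ \<omega>. liminf (\<lambda>l. ennreal ((?I n \<omega> - ?I l \<omega>)\<^sup>2)) \<partial>M)"
      unfolding msd_def
    proof (rule nn_integral_cong_AE)
      from conv show "AE \<omega> in M. ennreal ((?I n \<omega> - J \<omega>)\<^sup>2) = liminf (\<lambda>l. ennreal ((?I n \<omega> - ?I l \<omega>)\<^sup>2))"
      proof eventually_elim
        case (elim \<omega>)
        then have "(\<lambda>l. ennreal ((?I n \<omega> - ?I l \<omega>)\<^sup>2)) \<longlonglongrightarrow> ennreal ((?I n \<omega> - J \<omega>)\<^sup>2)"
          unfolding J_def by (intro tendsto_ennrealI tendsto_intros)
        from lim_imp_Liminf[OF trivial_limit_sequentially this] show ?case by (rule sym)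
      qed
    qed
    also have "\<dots> \<le> liminf (\<lambda>l. msd M (?I n) (?I l))"
      unfolding msd_def by (rule nn_integral_liminf) measurable
    also have "\<dots> \<le> ennreal (4 * (1/8) ^ n)"
      using cauchy[of n] by (intro Liminf_le eventually_sequentiallyI[of n]) auto
    finally show ?thesis .
  qed
  have lim0: "(\<lambda>n. ennreal (c * (1/8) ^ n)) \<longlonglongrightarrow> 0" for c
  proof -
    have "(\<lambda>n. ennreal (c * (1/8) ^ n)) \<longlonglongrightarrow> ennreal (c * 0)"
      by (intro tendsto_ennrealI tendsto_mult tendsto_const LIMSEQ_power_zero) auto
    then show ?thesis by simp
  qed
  have "(\<lambda>n. msd M (?I n) J) \<longlonglongrightarrow> 0"
    by (rule tendsto_sandwich[OF _ _ tendsto_const lim0[of 4]]) (use JI in auto)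
  moreover have "(\<lambda>n. msd MT (?E n) (cut t H)) \<longlonglongrightarrow> 0"
    by (rule tendsto_sandwich[OF _ _ tendsto_const lim0[of 1]]) (use approx in auto)
  ultimately show ?thesis
    unfolding has_ito_integral_iff[OF H] using e Jm by blast
qed

end

section \<open>Approximation of predictable processes on grids\<close>

text \<open>For s > 0, the k with k h < s \<le> (k + 1) h. Cells are open on the left because
  predictable rectangles are. At s = 0 the difference is -1, which \<open>nat\<close> sends to the
  index of the first cell.\<close>

definition cell :: "real \<Rightarrow> real \<Rightarrow> nat" where
  "cell h s = nat (\<lceil>s / h\<rceil> - 1)"

lemma cell_eq_iff:
  assumes "0 < h" "0 < s"
  shows "cell h s = k \<longleftrightarrow> real k * h < s \<and> s \<le> real (Suc k) * h"
proof -
  have pos: "0 < s / h" using assms by simp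
  then have "0 < \<lceil>s / h\<rceil>" by simp
  then have "cell h s = k \<longleftrightarrow> \<lceil>s / h\<rceil> = int k + 1"
    by (auto simp: cell_def)
  also have "\<dots> \<longleftrightarrow> real k < s / h \<and> s / h \<le> real (Suc k)"
    by (auto simp: ceiling_eq_iff)
  finally show ?thesis using assms by (simp add: field_simps)
qed

lemma cell_bounds: "0 < h \<Longrightarrow> 0 < s \<Longrightarrow> real (cell h s) * h < s"
  "0 < h \<Longrightarrow> 0 < s \<Longrightarrow> s \<le> real (Suc (cell h s)) * h"
  using cell_eq_iff[of h s "cell h s"] by auto

lemma cell_0: "cell h 0 = 0"
  by (simp add: cell_def)

lemma sets_UNION_cells:
  assumes "0 < h" "\<And>k. A k \<in> sets M"
  shows "{p \<in> space M \<times> {0<..t}. fst p \<in> A (cell h (snd p))} \<in> sets (M \<Otimes>\<^sub>M (lborel :: real measure))"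
proof -
  have "{p \<in> space M \<times> {0<..t}. fst p \<in> A (cell h (snd p))} =
     (\<Union>k. A k \<times> ({real k * h<..real (Suc k) * h} \<inter> {0<..t}))" (is "?L = ?R")
  proof (intro set_eqI iffI)
    fix p assume "p \<in> ?L"
    then show "p \<in> ?R" using cell_bounds[OF assms(1), of "snd p"]
      by (auto intro!: exI[of _ "cell h (snd p)"])
  next
    fix p assume "p \<in> ?R"
    then obtain k where "fst p \<in> A k" "real k * h < snd p" "snd p \<le> real (Suc k) * h" "0 < snd p" "snd p \<le> t"
      by auto
    moreover then have "cell h (snd p) = k" using cell_eq_iff[OF assms(1), of "snd p" k] by auto
    ultimately show "p \<in> ?L" using sets.sets_into_space[OF assms(2)] by (cases p) auto
  qed
  also have "\<dots> \<in> sets (M \<Otimes>\<^sub>M (lborel :: real measure))"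
    using assms by (intro sets.countable_UN image_subsetI pair_measureI) auto
  finally show ?thesis .
qed

section \<open>Predictable sets inside the product space\<close>

context brownian_family begin

abbreviation "predictable_gen \<equiv> {A \<times> {0} | A. A \<in> sets (F 0)} \<union>
      {A \<times> {s<..t} | A s t. (0::real) \<le> s \<and> s \<le> t \<and> A \<in> sets (F s)}"

lemma predictable_gen_subset: "predictable_gen \<subseteq> Pow (space M \<times> {0..})"
  using sets.sets_into_space[OF sets_F] by auto

lemma space_predictable: "space (predictable_sigma M F) = space M \<times> {0..}"
  unfolding predictable_sigma_def by (rule space_measure_of) (rule predictable_gen_subset)

lemma sets_predictable: "sets (predictable_sigma M F) = sigma_sets (space M \<times> {0..}) predictable_gen"
  unfolding predictable_sigma_def by (rule sets_measure_of) (rule predictable_gen_subset)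

lemma predictable_sets_MT: "D \<in> sets (predictable_sigma M F) \<Longrightarrow> D \<in> sets MT"
  unfolding sets_predictable
proof (induction rule: sigma_sets.induct)
  case (Basic D)
  then show ?case using sets_F[of 0] sets_F by (auto intro!: pair_measureI)
next
  case (Compl D)
  have "space M \<times> {0::real..} \<in> sets MT" by (intro pair_measureI) auto
  then show ?case using Compl by auto
qed auto

lemma emeasure_window: "0 \<le> t \<Longrightarrow> emeasure MT (space M \<times> {0<..t}) = ennreal t"
  by (subst lborel.emeasure_pair_measure_Times) (auto simp: emeasure_space_1)

end

locale brownian_grid = brownian_family +
  fixes h :: "nat \<Rightarrow> real"
  assumes h_pos: "\<And>n. 0 < h n" and h_lim: "h \<longlonglongrightarrow> 0"
begin

definition mismatch :: "real \<Rightarrow> nat \<Rightarrow> ('a \<times> real) set \<Rightarrow> (nat \<Rightarrow> 'a set) \<Rightarrow> ('a \<times> real) set" where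
  "mismatch t n D A = {p \<in> space M \<times> {0<..t}. (p \<in> D) \<noteq> (fst p \<in> A (cell (h n) (snd p)))}"

text \<open>The set attached to the k-th cell has to be known at the left end of that cell.
  Approximation is demanded for all large n and not merely for some, so that finitely many sets can
  be approximated on one common grid.\<close>

definition grid_approx :: "real \<Rightarrow> ('a \<times> real) set \<Rightarrow> bool" where
  "grid_approx t D \<longleftrightarrow> (\<forall>\<epsilon>>0. \<forall>\<^sub>F n in sequentially. \<exists>A.
     (\<forall>k. A k \<in> sets (F (real k * h n))) \<and> emeasure MT (mismatch t n D A) \<le> ennreal \<epsilon>)"

lemma sets_F_grid: "A \<in> sets (F (real k * h n)) \<Longrightarrow> A \<in> sets M"
  using sets_F[of "real k * h n"] h_pos[of n] by simp

lemma mismatch_sets: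
  assumes "D \<in> sets MT" "\<And>k. A k \<in> sets (F (real k * h n))"
  shows "mismatch t n D A \<in> sets MT"
proof -
  let ?W = "space M \<times> {0<..t}" and ?S = "{p \<in> space M \<times> {0<..t}. fst p \<in> A (cell (h n) (snd p))}"
  have S: "?S \<in> sets MT" using sets_UNION_cells[OF h_pos, of A M t n] sets_F_grid[OF assms(2)] by blast
  have "mismatch t n D A = (?W \<inter> D - ?S) \<union> (?S - D)" by (auto simp: mismatch_def)
  then show ?thesis using S assms(1) by auto
qed

text \<open>The rectangle is replaced by A on the cells whose left end lies in [p, q); from p
  onwards A belongs to the \<sigma>-algebra at that left end. The two sets differ at most on a
  window of length \<open>h n\<close> after p and one after q.\<close>

lemma grid_approx_rectangle:
  assumes p: "0 \<le> p" "p \<le> q" and A: "A \<in> sets (F p)" and t: "0 \<le> t"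
  shows "grid_approx t (A \<times> {p<..q})"
  unfolding grid_approx_def
proof (intro allI impI)
  fix \<epsilon> :: real assume "\<epsilon> > 0"
  then have "\<forall>\<^sub>F n in sequentially. h n < \<epsilon> / 2"
    using h_lim by (intro order_tendstoD(2)) auto
  then show "\<forall>\<^sub>F n in sequentially. \<exists>A'. (\<forall>k. A' k \<in> sets (F (real k * h n))) \<and>
      emeasure MT (mismatch t n (A \<times> {p<..q}) A') \<le> ennreal \<epsilon>"
  proof eventually_elim
    case (elim n)
    define A' where "A' k = (if p \<le> real k * h n \<and> real k * h n < q then A else {})" for k
    have A': "A' k \<in> sets (F (real k * h n))" for k
      using A subalgebra_F_mono[OF p(1), of "real k * h n"] by (auto simp: A'_def subalgebra_def)
    have "mismatch t n (A \<times> {p<..q}) A' \<subseteq> space M \<times> {p<..p + h n} \<union> space M \<times> {q<..q + h n}"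
    proof
      fix x assume x: "x \<in> mismatch t n (A \<times> {p<..q}) A'"
      then have s: "0 < snd x" and \<omega>: "fst x \<in> space M" by (auto simp: mismatch_def)
      note c = cell_bounds[OF h_pos[of n] s]
      have c2: "snd x \<le> real (cell (h n) (snd x)) * h n + h n"
        using c(2) by (simp add: algebra_simps)
      show "x \<in> space M \<times> {p<..p + h n} \<union> space M \<times> {q<..q + h n}"
        using x c(1) c2 \<omega> by (cases x) (auto simp: mismatch_def A'_def split: if_splits)
    qed
    then have "emeasure MT (mismatch t n (A \<times> {p<..q}) A') \<le>
      emeasure MT (space M \<times> {p<..p + h n} \<union> space M \<times> {q<..q + h n})"
      by (intro emeasure_mono) auto
    also have "\<dots> \<le> emeasure MT (space M \<times> {p<..p + h n}) + emeasure MT (space M \<times> {q<..q + h n})"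
      by (intro emeasure_subadditive) auto
    also have "\<dots> = ennreal (h n + h n)"
      using h_pos[of n] by (subst ennreal_plus) (simp_all add: lborel.emeasure_pair_measure_Times emeasure_space_1)
    also have "\<dots> \<le> ennreal \<epsilon>" using elim by (intro ennreal_leI) simp
    finally have "emeasure MT (mismatch t n (A \<times> {p<..q}) A') \<le> ennreal \<epsilon>" .
    then show ?case using A' by blast
  qed
qed

text \<open>Continuity from above on the window (0, t], which has finite measure, makes the part
  outside finitely many members of the union negligible; those finitely many are approximated on a
  common grid.\<close>

lemma grid_approx_UNION:
  assumes a: "\<And>i::nat. grid_approx t (a i)" and aM: "\<And>i. a i \<in> sets MT" and t: "0 \<le> t"
  shows "grid_approx t (\<Union>i. a i)"
  unfolding grid_approx_def
proof (intro allI impI)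
  fix \<epsilon> :: real assume \<epsilon>: "\<epsilon> > 0"
  define E where "E N = space M \<times> {0<..t} \<inter> ((\<Union>i. a i) - (\<Union>i<N. a i))" for N
  have Em: "E N \<in> sets MT" for N unfolding E_def using aM by auto
  have "(\<lambda>N. emeasure MT (E N)) \<longlonglongrightarrow> emeasure MT (\<Inter>N. E N)"
  proof (rule Lim_emeasure_decseq)
    show "range E \<subseteq> sets MT" using Em by auto
    show "decseq E" by (auto simp: decseq_def E_def)
    have "emeasure MT (E i) \<le> emeasure MT (space M \<times> {0<..t})" for i
      by (intro emeasure_mono) (auto simp: E_def)
    then have "emeasure MT (E i) \<le> ennreal t" for i by (simp add: emeasure_window[OF t])
    from neq_top_trans[OF ennreal_neq_top this] show "emeasure MT (E i) \<noteq> \<infinity>" for i by simp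
  qed
  also have "(\<Inter>N. E N) = {}" by (auto simp: E_def)
  finally have "\<forall>\<^sub>F N in sequentially. emeasure MT (E N) < ennreal (\<epsilon> / 2)"
    using \<epsilon> by (intro order_tendstoD(2)) auto
  then obtain N where N: "emeasure MT (E N) < ennreal (\<epsilon> / 2)"
    by (auto simp: eventually_sequentially)
  \<comment> \<open>Half of the error goes to the tail, the other half is shared by N sets;
    \<open>Suc\<close> keeps the denominator positive for N = 0.\<close>
  define \<epsilon>' where "\<epsilon>' = \<epsilon> / (2 * real (Suc N))"
  have \<epsilon>': "\<epsilon>' > 0" using \<epsilon> by (simp add: \<epsilon>'_def)
  have "\<forall>\<^sub>F n in sequentially. \<forall>i\<in>{..<N}. \<exists>A. (\<forall>k. A k \<in> sets (F (real k * h n))) \<and>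
     emeasure MT (mismatch t n (a i) A) \<le> ennreal \<epsilon>'"
    using a \<epsilon>' by (intro eventually_ball_finite) (auto simp: grid_approx_def)
  then show "\<forall>\<^sub>F n in sequentially. \<exists>A. (\<forall>k. A k \<in> sets (F (real k * h n))) \<and>
     emeasure MT (mismatch t n (\<Union>i. a i) A) \<le> ennreal \<epsilon>"
  proof eventually_elim
    case (elim n)
    from bchoice[OF elim] obtain A where "\<forall>i\<in>{..<N}. (\<forall>k. A i k \<in> sets (F (real k * h n))) \<and>
      emeasure MT (mismatch t n (a i) (A i)) \<le> ennreal \<epsilon>'" by blast
    then have A: "\<And>i k. i < N \<Longrightarrow> A i k \<in> sets (F (real k * h n))"
      "\<And>i. i < N \<Longrightarrow> emeasure MT (mismatch t n (a i) (A i)) \<le> ennreal \<epsilon>'"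
      by auto
    define B where "B k = (\<Union>i<N. A i k)" for k
    have B: "B k \<in> sets (F (real k * h n))" for k using A(1) by (auto simp: B_def)
    have mm: "mismatch t n (a i) (A i) \<in> sets MT" if "i < N" for i
      using aM A(1)[OF that] by (rule mismatch_sets)
    have "mismatch t n (\<Union>i. a i) B \<subseteq> E N \<union> (\<Union>i<N. mismatch t n (a i) (A i))"
      by (auto simp: mismatch_def B_def E_def)
    then have "emeasure MT (mismatch t n (\<Union>i. a i) B) \<le> emeasure MT (E N \<union> (\<Union>i<N. mismatch t n (a i) (A i)))"
      using Em mm by (intro emeasure_mono) auto
    also have "\<dots> \<le> emeasure MT (E N) + emeasure MT (\<Union>i<N. mismatch t n (a i) (A i))"
      using Em mm by (intro emeasure_subadditive) auto
    also have "\<dots> \<le> ennreal (\<epsilon> / 2) + (\<Sum>i<N. emeasure MT (mismatch t n (a i) (A i)))"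
      using N mm by (intro add_mono emeasure_subadditive_finite) auto
    also have "\<dots> \<le> ennreal (\<epsilon> / 2) + (\<Sum>i<N. ennreal \<epsilon>')"
      using A(2) by (intro add_left_mono sum_mono) auto
    also have "\<dots> = ennreal (\<epsilon> / 2 + real N * \<epsilon>')"
      using \<epsilon> \<epsilon>' by (simp add: ennreal_plus ennreal_mult' ennreal_of_nat_eq_real_of_nat)
    also have "\<dots> \<le> ennreal \<epsilon>"
      using \<epsilon> by (intro ennreal_leI) (simp add: \<epsilon>'_def field_simps)
    finally show ?case using B by blast
  qed
qed

text \<open>Approximability holds for the generators and passes to complements and countable unions.
  A complement has the same mismatch, with complements on the cells. Generators at time 0 are
  approximated by empty sets, since mismatches are counted on (0, t] only.\<close>

lemma predictable_grid_approx:
  assumes D: "D \<in> sets (predictable_sigma M F)" and t: "0 \<le> t"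
  shows "grid_approx t D"
  using D unfolding sets_predictable
proof (induction rule: sigma_sets.induct)
  case (Basic D)
  then consider A where "D = A \<times> {0}" "A \<in> sets (F 0)"
    | A p q where "D = A \<times> {p<..q}" "0 \<le> p" "p \<le> q" "A \<in> sets (F p)" by auto
  then show ?case
  proof cases
    case 1
    then have "mismatch t n D (\<lambda>_. {}) = {}" for n by (auto simp: mismatch_def)
    then show ?thesis unfolding grid_approx_def
      by (intro allI impI always_eventually exI[of _ "\<lambda>_. {}"]) simp
  qed (use grid_approx_rectangle t in auto)
next
  case Empty
  have "mismatch t n {} (\<lambda>_. {}) = {}" for n by (auto simp: mismatch_def)
  then show ?case unfolding grid_approx_def
    by (intro allI impI always_eventually exI[of _ "\<lambda>_. {}"]) simp
next
  case (Compl D)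
  have "\<exists>A. (\<forall>k. A k \<in> sets (F (real k * h n))) \<and> emeasure MT (mismatch t n (space M \<times> {0..} - D) A) \<le> \<epsilon>"
    if ex: "\<exists>A. (\<forall>k. A k \<in> sets (F (real k * h n))) \<and> emeasure MT (mismatch t n D A) \<le> \<epsilon>" for \<epsilon> n
  proof -
    obtain A where A: "\<And>k. A k \<in> sets (F (real k * h n))" "emeasure MT (mismatch t n D A) \<le> \<epsilon>"
      using ex by auto
    have sp: "space (F (real k * h n)) = space M" for k using h_pos[of n] by (intro space_F) simp
    have "mismatch t n (space M \<times> {0..} - D) (\<lambda>k. space M - A k) = mismatch t n D A"
      by (auto simp: mismatch_def)
    moreover have "space M - A k \<in> sets (F (real k * h n))" for k
      using A(1)[of k] sets.compl_sets[of "A k" "F (real k * h n)"] by (simp add: sp)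
    ultimately show ?thesis using A(2) by (intro exI[of _ "\<lambda>k. space M - A k"]) auto
  qed
  note compl = this
  show ?case unfolding grid_approx_def
  proof (intro allI impI)
    fix \<epsilon> :: real assume "\<epsilon> > 0"
    with Compl.IH have "\<forall>\<^sub>F n in sequentially. \<exists>A. (\<forall>k. A k \<in> sets (F (real k * h n))) \<and>
      emeasure MT (mismatch t n D A) \<le> ennreal \<epsilon>" by (auto simp: grid_approx_def)
    then show "\<forall>\<^sub>F n in sequentially. \<exists>A. (\<forall>k. A k \<in> sets (F (real k * h n))) \<and>
      emeasure MT (mismatch t n (space M \<times> {0..} - D) A) \<le> ennreal \<epsilon>"
      by (rule eventually_mono) (rule compl)
  qed
next
  case (Union a)
  have "a i \<in> sets MT" for i
    using Union.hyps by (intro predictable_sets_MT) (simp add: sets_predictable)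
  then show ?case using Union.IH t by (intro grid_approx_UNION)
qed

text \<open>A countably valued predictable process is approximated through its level sets: the
  levels from some N on are negligible, the others are approximated on one grid, and the
  approximating sets are turned back into an index.\<close>

lemma predictable_index_approx:
  assumes i: "i \<in> measurable (predictable_sigma M F) (count_space UNIV)" and t: "0 \<le> t" and \<epsilon>: "\<epsilon> > 0"
  shows "\<forall>\<^sub>F n in sequentially. \<exists>idx :: nat \<Rightarrow> 'a \<Rightarrow> nat.
     (\<forall>k. idx k \<in> measurable (F (real k * h n)) (count_space UNIV)) \<and>
     {p \<in> space M \<times> {0<..t}. i p \<noteq> idx (cell (h n) (snd p)) (fst p)} \<in> sets MT \<and>
     emeasure MT {p \<in> space M \<times> {0<..t}. i p \<noteq> idx (cell (h n) (snd p)) (fst p)} \<le> ennreal \<epsilon>"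
proof -
  define D where "D l = i -` {l} \<inter> (space M \<times> {0..})" for l :: nat
  have Dp: "D l \<in> sets (predictable_sigma M F)" for l
    using measurable_sets[OF i, of "{l}"] by (simp add: D_def space_predictable)
  have DM: "D l \<in> sets MT" for l using Dp by (rule predictable_sets_MT)
  define E where "E N = space M \<times> {0<..t} - (\<Union>l<N. D l)" for N
  have Em: "E N \<in> sets MT" for N unfolding E_def using DM by auto
  have "(\<lambda>N. emeasure MT (E N)) \<longlonglongrightarrow> emeasure MT (\<Inter>N. E N)"
  proof (rule Lim_emeasure_decseq)
    show "range E \<subseteq> sets MT" using Em by auto
    show "decseq E" by (auto simp: decseq_def E_def)
    have "emeasure MT (E i) \<le> emeasure MT (space M \<times> {0<..t})" for i
      by (intro emeasure_mono) (auto simp: E_def)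
    then have "emeasure MT (E i) \<le> ennreal t" for i by (simp add: emeasure_window[OF t])
    from neq_top_trans[OF ennreal_neq_top this] show "emeasure MT (E i) \<noteq> \<infinity>" for i by simp
  qed
  also have "(\<Inter>N. E N) = {}" by (auto simp: E_def D_def)
  finally have "\<forall>\<^sub>F N in sequentially. emeasure MT (E N) < ennreal (\<epsilon> / 2)"
    using \<epsilon> by (intro order_tendstoD(2)) auto
  then obtain N where N: "emeasure MT (E N) < ennreal (\<epsilon> / 2)"
    by (auto simp: eventually_sequentially)
  define \<epsilon>' where "\<epsilon>' = \<epsilon> / (2 * real (Suc N))"
  have \<epsilon>': "\<epsilon>' > 0" using \<epsilon> by (simp add: \<epsilon>'_def)
  have "\<forall>\<^sub>F n in sequentially. \<forall>l\<in>{..<N}. \<exists>A. (\<forall>k. A k \<in> sets (F (real k * h n))) \<and>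
     emeasure MT (mismatch t n (D l) A) \<le> ennreal \<epsilon>'"
    using predictable_grid_approx[OF Dp t] \<epsilon>' by (intro eventually_ball_finite) (auto simp: grid_approx_def)
  then show ?thesis
  proof eventually_elim
    case (elim n)
    from bchoice[OF elim] obtain A where "\<forall>l\<in>{..<N}. (\<forall>k. A l k \<in> sets (F (real k * h n))) \<and>
      emeasure MT (mismatch t n (D l) (A l)) \<le> ennreal \<epsilon>'" by blast
    then have A: "\<And>l k. l < N \<Longrightarrow> A l k \<in> sets (F (real k * h n))"
      "\<And>l. l < N \<Longrightarrow> emeasure MT (mismatch t n (D l) (A l)) \<le> ennreal \<epsilon>'"
      by auto
    \<comment> \<open>The approximating sets may overlap or leave gaps, so the least matching level
      is taken, with N as default. The result is measurable at the left end of the cell.\<close>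
    define idx where "idx k \<omega> = (LEAST l. (l < N \<and> \<omega> \<in> A l k) \<or> l = N)" for k \<omega>
    have idx: "idx k \<in> measurable (F (real k * h n)) (count_space UNIV)" for k
      unfolding idx_def
    proof (rule measurable_Least)
      fix l
      show "Measurable.pred (F (real k * h n)) (\<lambda>\<omega>. (l < N \<and> \<omega> \<in> A l k) \<or> l = N)"
        using A(1)[of l k] by (cases "l < N") auto
    qed
    have mm: "mismatch t n (D l) (A l) \<in> sets MT" if "l < N" for l
      using DM A(1)[OF that] by (rule mismatch_sets)
    let ?X = "{p \<in> space M \<times> {0<..t}. i p \<noteq> idx (cell (h n) (snd p)) (fst p)}"
    have sub: "?X \<subseteq> E N \<union> (\<Union>l<N. mismatch t n (D l) (A l))"
    proof
      fix p assume p: "p \<in> ?X"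
      show "p \<in> E N \<union> (\<Union>l<N. mismatch t n (D l) (A l))"
      proof (rule ccontr)
        assume no: "p \<notin> E N \<union> (\<Union>l<N. mismatch t n (D l) (A l))"
        let ?k = "cell (h n) (snd p)"
        from no p have "i p < N" by (auto simp: E_def D_def)
        from no p have eq: "fst p \<in> A l ?k \<longleftrightarrow> l = i p" if "l < N" for l
        proof -
          have "p \<notin> mismatch t n (D l) (A l)" using no that by blast
          then show ?thesis using p by (auto simp: mismatch_def D_def)
        qed
        have "idx ?k (fst p) = i p"
          unfolding idx_def using \<open>i p < N\<close> eq by (intro Least_equality) auto
        then show False using p by auto
      qed
    qed
    have Xm: "?X \<in> sets MT"
    proof -
      have "{p \<in> space M \<times> {0<..t}. fst p \<in> {\<omega> \<in> space M. idx (cell (h n) (snd p)) \<omega> = l}} \<in> sets MT" for l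
      proof (rule sets_UNION_cells[OF h_pos, where A="\<lambda>k. {\<omega> \<in> space M. idx k \<omega> = l}"])
        fix k
        have "0 \<le> real k * h n" using h_pos[of n] by simp
        then have "{\<omega> \<in> space M. idx k \<omega> = l} = idx k -` {l} \<inter> space (F (real k * h n))"
          by (auto simp: space_F)
        also have "\<dots> \<in> sets (F (real k * h n))" by (rule measurable_sets[OF idx]) simp
        finally show "{\<omega> \<in> space M. idx k \<omega> = l} \<in> sets M" by (rule sets_F_grid)
      qed
      then have "(\<Union>l. {p \<in> space M \<times> {0<..t}. fst p \<in> {\<omega> \<in> space M. idx (cell (h n) (snd p)) \<omega> = l}} - D l) \<in> sets MT"
        using DM by (intro sets.countable_UN) auto
      also have "(\<Union>l. {p \<in> space M \<times> {0<..t}. fst p \<in> {\<omega> \<in> space M. idx (cell (h n) (snd p)) \<omega> = l}} - D l) = ?X"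
        by (auto simp: D_def)
      finally show ?thesis .
    qed
    have "emeasure MT ?X \<le> emeasure MT (E N \<union> (\<Union>l<N. mismatch t n (D l) (A l)))"
      using Em mm sub by (intro emeasure_mono) auto
    also have "\<dots> \<le> emeasure MT (E N) + emeasure MT (\<Union>l<N. mismatch t n (D l) (A l))"
      using Em mm by (intro emeasure_subadditive) auto
    also have "\<dots> \<le> ennreal (\<epsilon> / 2) + (\<Sum>l<N. emeasure MT (mismatch t n (D l) (A l)))"
      using N mm by (intro add_mono emeasure_subadditive_finite) auto
    also have "\<dots> \<le> ennreal (\<epsilon> / 2) + (\<Sum>l<N. ennreal \<epsilon>')"
      using A(2) by (intro add_left_mono sum_mono) auto
    also have "\<dots> = ennreal (\<epsilon> / 2 + real N * \<epsilon>')"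
      using \<epsilon> \<epsilon>' by (simp add: ennreal_plus ennreal_mult' ennreal_of_nat_eq_real_of_nat)
    also have "\<dots> \<le> ennreal \<epsilon>"
      using \<epsilon> by (intro ennreal_leI) (simp add: \<epsilon>'_def field_simps)
    finally show ?case using idx Xm by blast
  qed
qed

end

section \<open>Orthonormal series and controls\<close>

definition ser :: "(nat \<Rightarrow> 'a::real_normed_vector) \<Rightarrow> (nat \<Rightarrow> real) \<Rightarrow> 'a" where
  "ser e c = (\<Sum>k. c k *\<^sub>R e k)"

lemma borel_measurable_ser:
  fixes e :: "nat \<Rightarrow> 'a::{banach, second_countable_topology}"
  assumes "\<And>k. (\<lambda>\<omega>. c \<omega> k) \<in> borel_measurable N"
  shows "(\<lambda>\<omega>. ser e (c \<omega>)) \<in> borel_measurable N"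
  unfolding ser_def using assms by (intro borel_measurable_suminf borel_measurable_scaleR) auto

lemma norm_add_orthogonal: "x \<bullet> y = 0 \<Longrightarrow> (norm (x + y))\<^sup>2 = (norm x)\<^sup>2 + (norm y)\<^sup>2"
  by (simp add: power2_norm_eq_inner inner_add_left inner_add_right inner_commute)

lemma norm_sum_orthonormal:
  assumes "orthonormal_basis e" "finite A"
  shows "(norm (\<Sum>k\<in>A. c k *\<^sub>R e k))\<^sup>2 = (\<Sum>k\<in>A. (c k)\<^sup>2 * (norm (e k))\<^sup>2)"
  using assms(2)
proof (induction A rule: finite_induct)
  case (insert a A)
  have "e a \<bullet> e k = 0" if "k \<in> A" for k
  proof -
    have "a \<noteq> k" using that insert.hyps by auto
    then show ?thesis using assms(1) by (simp add: orthonormal_basis_def)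
  qed
  then have "(c a *\<^sub>R e a) \<bullet> (\<Sum>k\<in>A. c k *\<^sub>R e k) = 0"
    by (simp add: inner_sum_right)
  then have "(norm (c a *\<^sub>R e a + (\<Sum>k\<in>A. c k *\<^sub>R e k)))\<^sup>2 =
     (norm (c a *\<^sub>R e a))\<^sup>2 + (norm (\<Sum>k\<in>A. c k *\<^sub>R e k))\<^sup>2"
    by (rule norm_add_orthogonal)
  then show ?case using insert by (simp add: power_mult_distrib)
qed simp

lemma norm_basis_le: "orthonormal_basis e \<Longrightarrow> (norm (e k))\<^sup>2 \<le> 1"
  unfolding orthonormal_basis_def by (metis norm_zero one_power2 order_refl zero_le_one zero_power2)

lemma norm_sum_orthonormal_le:
  assumes "orthonormal_basis e" "finite A"
  shows "(norm (\<Sum>k\<in>A. c k *\<^sub>R e k))\<^sup>2 \<le> (\<Sum>k\<in>A. (c k)\<^sup>2)"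
  unfolding norm_sum_orthonormal[OF assms]
  using norm_basis_le[OF assms(1)] by (intro sum_mono mult_left_le) auto

lemma summable_squares: "(\<Sum>k. ennreal ((c k)\<^sup>2)) \<noteq> \<top> \<Longrightarrow> summable (\<lambda>k. (c k)\<^sup>2)"
  by (intro summable_suminf_not_top) auto

lemma suminf_squares: "(\<Sum>k. ennreal ((c k)\<^sup>2)) \<noteq> \<top> \<Longrightarrow> (\<Sum>k. ennreal ((c k)\<^sup>2)) = ennreal (\<Sum>k. (c k)\<^sup>2)"
  using summable_squares[of c] by (intro suminf_ennreal2) auto

lemma ser_summable:
  fixes e :: "nat \<Rightarrow> 'a::{real_inner, banach}"
  assumes e: "orthonormal_basis e" and c: "(\<Sum>k. ennreal ((c k)\<^sup>2)) \<noteq> \<top>"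
  shows "summable (\<lambda>k. c k *\<^sub>R e k)"
  unfolding summable_Cauchy
proof (intro allI impI)
  fix \<epsilon> :: real assume \<epsilon>: "\<epsilon> > 0"
  then have "\<epsilon>\<^sup>2 > 0" by simp
  then obtain N where N: "\<And>m n. m \<ge> N \<Longrightarrow> norm (\<Sum>k\<in>{m..<n}. (c k)\<^sup>2) < \<epsilon>\<^sup>2"
    using summable_squares[OF c] unfolding summable_Cauchy by blast
  show "\<exists>N. \<forall>m\<ge>N. \<forall>n. norm (\<Sum>k\<in>{m..<n}. c k *\<^sub>R e k) < \<epsilon>"
  proof (intro exI[of _ N] allI impI)
    fix m n assume "m \<ge> N"
    have "(norm (\<Sum>k\<in>{m..<n}. c k *\<^sub>R e k))\<^sup>2 \<le> (\<Sum>k\<in>{m..<n}. (c k)\<^sup>2)"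
      by (rule norm_sum_orthonormal_le[OF e]) simp
    also have "\<dots> < \<epsilon>\<^sup>2" using N[OF \<open>m \<ge> N\<close>, of n] by simp
    finally show "norm (\<Sum>k\<in>{m..<n}. c k *\<^sub>R e k) < \<epsilon>"
      by (rule power2_less_imp_less) (use \<epsilon> in simp)
  qed
qed

lemma ser_norm_le:
  fixes e :: "nat \<Rightarrow> 'a::{real_inner, banach}"
  assumes e: "orthonormal_basis e"
  shows "ennreal ((norm (ser e c))\<^sup>2) \<le> (\<Sum>k. ennreal ((c k)\<^sup>2))"
proof (cases "(\<Sum>k. ennreal ((c k)\<^sup>2)) = \<top>")
  case False
  have "(\<lambda>n. (norm (\<Sum>k<n. c k *\<^sub>R e k))\<^sup>2) \<longlonglongrightarrow> (norm (ser e c))\<^sup>2"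
    unfolding ser_def by (intro tendsto_intros summable_LIMSEQ ser_summable e False)
  moreover have "(norm (\<Sum>k<n. c k *\<^sub>R e k))\<^sup>2 \<le> (\<Sum>k. (c k)\<^sup>2)" for n
    by (rule order_trans[OF norm_sum_orthonormal_le[OF e] sum_le_suminf[OF summable_squares[OF False]]]) auto
  ultimately have "(norm (ser e c))\<^sup>2 \<le> (\<Sum>k. (c k)\<^sup>2)"
    by (intro LIMSEQ_le_const2) auto
  then show ?thesis unfolding suminf_squares[OF False] by (rule ennreal_leI)
qed simp

text \<open>Coefficients at padding vectors count in the sum of squares but not in the series;
  equality therefore asks them to vanish.\<close>

lemma ser_norm_eq:
  fixes e :: "nat \<Rightarrow> 'a::{real_inner, banach}"
  assumes e: "orthonormal_basis e" and c: "(\<Sum>k. ennreal ((c k)\<^sup>2)) \<noteq> \<top>" and z: "\<And>k. e k = 0 \<Longrightarrow> c k = 0"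
  shows "(\<Sum>k. ennreal ((c k)\<^sup>2)) = ennreal ((norm (ser e c))\<^sup>2)"
proof -
  have "(c k)\<^sup>2 * (norm (e k))\<^sup>2 = (c k)\<^sup>2" for k
    using e z[of k] unfolding orthonormal_basis_def by (cases "e k = 0") auto
  then have "(norm (\<Sum>k<n. c k *\<^sub>R e k))\<^sup>2 = (\<Sum>k<n. (c k)\<^sup>2)" for n
    unfolding norm_sum_orthonormal[OF e finite_lessThan] by (intro sum.cong refl)
  moreover have "(\<lambda>n. (norm (\<Sum>k<n. c k *\<^sub>R e k))\<^sup>2) \<longlonglongrightarrow> (norm (ser e c))\<^sup>2"
    unfolding ser_def by (intro tendsto_intros summable_LIMSEQ ser_summable e c)
  ultimately have "(\<lambda>n. (\<Sum>k<n. (c k)\<^sup>2)) \<longlonglongrightarrow> (norm (ser e c))\<^sup>2" by simp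
  with summable_LIMSEQ[OF summable_squares[OF c]] have "(\<Sum>k. (c k)\<^sup>2) = (norm (ser e c))\<^sup>2"
    by (rule LIMSEQ_unique)
  then show ?thesis by (simp add: suminf_squares[OF c])
qed

lemma ser_diff:
  fixes e :: "nat \<Rightarrow> 'a::{real_inner, banach}"
  assumes "orthonormal_basis e" "(\<Sum>k. ennreal ((c k)\<^sup>2)) \<noteq> \<top>" "(\<Sum>k. ennreal ((d k)\<^sup>2)) \<noteq> \<top>"
  shows "ser e c - ser e d = ser e (\<lambda>k. c k - d k)"
  unfolding ser_def using suminf_diff[OF ser_summable[OF assms(1,2)] ser_summable[OF assms(1,3)]]
  by (simp add: scaleR_left_diff_distrib)

lemma AE_suminf_finite:
  assumes "\<And>k. J k \<in> borel_measurable N" "(\<Sum>k. \<integral>\<^sup>+ x. ennreal ((J k x)\<^sup>2) \<partial>N) \<noteq> \<top>"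
  shows "AE x in N. (\<Sum>k. ennreal ((J k x)\<^sup>2)) \<noteq> \<top>"
proof -
  have [measurable]: "\<And>k. J k \<in> borel_measurable N" by fact
  have "(\<integral>\<^sup>+ x. (\<Sum>k. ennreal ((J k x)\<^sup>2)) \<partial>N) = (\<Sum>k. \<integral>\<^sup>+ x. ennreal ((J k x)\<^sup>2) \<partial>N)"
    by (rule nn_integral_suminf) measurable
  then have "(\<integral>\<^sup>+ x. (\<Sum>k. ennreal ((J k x)\<^sup>2)) \<partial>N) \<noteq> \<infinity>"
    using assms(2) by (simp only: infinity_ennreal_def not_False_eq_True)
  then have "AE x in N. (\<Sum>k. ennreal ((J k x)\<^sup>2)) \<noteq> \<infinity>"
    by (rule nn_integral_PInf_AE[rotated]) measurable
  then show ?thesis unfolding infinity_ennreal_def .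
qed

text \<open>Finite second moments make both sums of squares finite almost surely, so the difference
  of the series is the series of the differences, and \<open>ser_norm_le\<close> applies
  pointwise.\<close>

lemma ser_msd:
  fixes e :: "nat \<Rightarrow> 'a::{real_inner, banach}"
  assumes e: "orthonormal_basis e" and [measurable]: "\<And>k. J k \<in> borel_measurable N" "\<And>k. J' k \<in> borel_measurable N"
    and fin: "(\<Sum>k. \<integral>\<^sup>+ x. ennreal ((J k x)\<^sup>2) \<partial>N) \<noteq> \<top>" "(\<Sum>k. \<integral>\<^sup>+ x. ennreal ((J' k x)\<^sup>2) \<partial>N) \<noteq> \<top>"
  shows "(\<integral>\<^sup>+ x. ennreal ((norm (ser e (\<lambda>k. J k x) - ser e (\<lambda>k. J' k x)))\<^sup>2) \<partial>N) \<le> (\<Sum>k. msd N (J k) (J' k))"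
proof -
  have "(\<integral>\<^sup>+ x. ennreal ((norm (ser e (\<lambda>k. J k x) - ser e (\<lambda>k. J' k x)))\<^sup>2) \<partial>N) \<le>
    (\<integral>\<^sup>+ x. (\<Sum>k. ennreal ((J k x - J' k x)\<^sup>2)) \<partial>N)"
  proof (rule nn_integral_mono_AE)
    from AE_suminf_finite[OF assms(2) fin(1)] AE_suminf_finite[OF assms(3) fin(2)]
    show "AE x in N. ennreal ((norm (ser e (\<lambda>k. J k x) - ser e (\<lambda>k. J' k x)))\<^sup>2) \<le>
      (\<Sum>k. ennreal ((J k x - J' k x)\<^sup>2))"
    proof eventually_elim
      case (elim x)
      show ?case unfolding ser_diff[OF e elim] by (rule ser_norm_le[OF e])
    qed
  qed
  also have "\<dots> = (\<Sum>k. msd N (J k) (J' k))"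
    unfolding msd_def by (rule nn_integral_suminf) measurable
  finally show ?thesis .
qed

section \<open>Measurability of the components of a control\<close>

lemma abs_component_le_l1_dist:
  assumes "x \<in> l1" "y \<in> l1"
  shows "\<bar>x k - y k\<bar> \<le> l1_dist x y"
proof -
  have "(\<lambda>k. \<bar>x k - y k\<bar>) summable_on UNIV"
  proof (rule summable_on_comparison_test)
    show "(\<lambda>k. \<bar>x k\<bar> + \<bar>y k\<bar>) summable_on UNIV"
      using assms by (auto simp: l1_def intro: summable_on_add)
  qed auto
  from finite_sum_le_infsum[OF this, of "{k}"] show ?thesis by (simp add: l1_dist_def)
qed

lemma openin_l1_component:
  assumes "open S"
  shows "openin (Metric_space.mtopology l1 l1_dist) {x \<in> l1. x k \<in> S}"
proof -
  interpret L: Metric_space l1 l1_dist by (rule Metric_space_l1)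
  show ?thesis
    unfolding L.openin_mtopology
  proof (intro conjI allI impI)
    fix x assume x: "x \<in> {x \<in> l1. x k \<in> S}"
    then obtain r where r: "r > 0" "ball (x k) r \<subseteq> S" using assms by (auto simp: open_contains_ball)
    have "L.mball x r \<subseteq> {x \<in> l1. x k \<in> S}"
    proof
      fix y assume "y \<in> L.mball x r"
      then have y: "y \<in> l1" "l1_dist x y < r" by (auto simp: L.in_mball)
      then have "y k \<in> ball (x k) r"
        using abs_component_le_l1_dist[of x y k] x by (auto simp: dist_real_def)
      then show "y \<in> {x \<in> l1. x k \<in> S}" using r y by auto
    qed
    then show "\<exists>r>0. L.mball x r \<subseteq> {x \<in> l1. x k \<in> S}" using r by blast
  qed auto
qed

context
  fixes \<Lambda> :: "('a::{real_inner, banach, second_countable_topology} \<times> (nat \<Rightarrow> real)) set"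
begin

lemma space_control_borel: "space (control_borel \<Lambda>) = \<Lambda>"
  unfolding control_borel_def by (rule space_measure_of) auto

lemma sets_control_borel: "openin (prod_topology euclidean (Metric_space.mtopology l1 l1_dist)) U \<Longrightarrow> \<Lambda> \<inter> U \<in> sets (control_borel \<Lambda>)"
  unfolding control_borel_def by (subst sets_measure_of) auto

lemma measurable_control_fst:
  assumes "\<Lambda> \<subseteq> UNIV \<times> l1"
  shows "fst \<in> borel_measurable (control_borel \<Lambda>)"
proof (rule borel_measurableI)
  fix S :: "'a set" assume "open S"
  interpret L: Metric_space l1 l1_dist by (rule Metric_space_l1)
  have "openin L.mtopology l1" using openin_topspace[of L.mtopology] by simp
  then have "openin (prod_topology euclidean L.mtopology) (S \<times> l1)"
    using \<open>open S\<close> by (simp add: openin_prod_Times_iff)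
  moreover have "fst -` S \<inter> space (control_borel \<Lambda>) = \<Lambda> \<inter> (S \<times> l1)"
    using assms by (auto simp: space_control_borel)
  ultimately show "fst -` S \<inter> space (control_borel \<Lambda>) \<in> sets (control_borel \<Lambda>)"
    by (simp add: sets_control_borel)
qed

lemma measurable_control_snd:
  assumes "\<Lambda> \<subseteq> UNIV \<times> l1"
  shows "(\<lambda>l. snd l k) \<in> borel_measurable (control_borel \<Lambda>)"
proof (rule borel_measurableI)
  fix S :: "real set" assume "open S"
  then have "openin (prod_topology euclidean (Metric_space.mtopology l1 l1_dist)) ((UNIV :: 'a set) \<times> {x \<in> l1. x k \<in> S})"
    by (simp add: openin_prod_Times_iff openin_l1_component)
  moreover have "(\<lambda>l. snd l k) -` S \<inter> space (control_borel \<Lambda>) = \<Lambda> \<inter> (UNIV \<times> {x \<in> l1. x k \<in> S})"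
    using assms by (auto simp: space_control_borel)
  ultimately show "(\<lambda>l. snd l k) -` S \<inter> space (control_borel \<Lambda>) \<in> sets (control_borel \<Lambda>)"
    by (simp only: sets_control_borel)
qed

end

text \<open>Predictable functions are given for times s \<ge> 0, while the product space carries the
  whole time line; extension by zero mediates between the two.\<close>

lemma (in brownian_family) predictable_borel_MT:
  fixes f :: "'w \<times> real \<Rightarrow> 'c::{real_normed_vector, second_countable_topology}"
  assumes "f \<in> borel_measurable (predictable_sigma M F)"
  shows "(\<lambda>p. indicator (space M \<times> {0..}) p *\<^sub>R f p) \<in> borel_measurable MT"
proof -
  have W: "space M \<times> {0::real..} \<in> sets MT" by (intro pair_measureI) auto
  have sp: "space M \<times> {0::real..} \<subseteq> space MT" by (auto simp: space_pair_measure)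
  have "f \<in> borel_measurable (restrict_space MT (space M \<times> {0..}))"
  proof (rule borel_measurableI)
    fix S :: "'c set" assume "open S"
    then have "f -` S \<inter> (space M \<times> {0..}) \<in> sets (predictable_sigma M F)"
      using measurable_sets[OF assms, of S] by (simp add: space_predictable)
    then have "f -` S \<inter> (space M \<times> {0..}) \<in> sets MT" by (rule predictable_sets_MT)
    then show "f -` S \<inter> space (restrict_space MT (space M \<times> {0..})) \<in> sets (restrict_space MT (space M \<times> {0..}))"
      using W sp by (subst sets_restrict_space_iff) (auto simp: space_restrict_space Int_absorb2)
  qed
  then show ?thesis
    using W sp by (subst (asm) borel_measurable_restrict_space_iff) (auto simp: Int_absorb2)
qed

text \<open>From here on the operators are visible only through bounds on drifts and eigenvalues.
  The one constant C bounds both the norm of a drift and the sum of the eigenvalues.\<close>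

locale control_setup = brownian_grid M F \<xi> h
  for M :: "'w measure" and F \<xi> h +
  fixes e :: "nat \<Rightarrow> 'a::{real_inner, banach, second_countable_topology}"
    and \<Lambda> :: "('a \<times> (nat \<Rightarrow> real)) set" and C :: real
  assumes basis: "orthonormal_basis e" and nonempty: "\<Lambda> \<noteq> {}" and C_nonneg: "0 \<le> C"
    and drift_bound: "\<And>l. l \<in> \<Lambda> \<Longrightarrow> norm (fst l) \<le> C"
    and eigen_nonneg: "\<And>l k. l \<in> \<Lambda> \<Longrightarrow> 0 \<le> snd l k"
    and eigen_padding: "\<And>l k. l \<in> \<Lambda> \<Longrightarrow> e k = 0 \<Longrightarrow> snd l k = 0"
    and eigen_sum: "\<And>l. l \<in> \<Lambda> \<Longrightarrow> (\<Sum>k. ennreal (snd l k)) \<le> ennreal C"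
begin

section \<open>Control values as points of a Hilbert space\<close>

definition rt :: "'a \<times> (nat \<Rightarrow> real) \<Rightarrow> nat \<Rightarrow> real" where
  "rt l k = sqrt (snd l k)"

definition sg :: "'a \<times> (nat \<Rightarrow> real) \<Rightarrow> 'a" where
  "sg l = ser e (rt l)"

definition emb :: "'a \<times> (nat \<Rightarrow> real) \<Rightarrow> 'a \<times> 'a" where
  "emb l = (fst l, sg l)"

text \<open>The cost of exchanging one control value for another. The first summand is the squared
  error of the drift. On \<Lambda> the second one is the sum of the squared differences of the
  \<surd>\<mu>_k, which the isometry turns into the mean square error of the noise.\<close>

definition dd :: "'a \<times> (nat \<Rightarrow> real) \<Rightarrow> 'a \<times> (nat \<Rightarrow> real) \<Rightarrow> real" where
  "dd l l' = (norm (fst l - fst l'))\<^sup>2 + (norm (sg l - sg l'))\<^sup>2"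

lemma dd_eq_dist: "dd l l' = (dist (emb l) (emb l'))\<^sup>2"
  by (simp add: dd_def emb_def dist_norm norm_Pair)

lemma rt_power2: "l \<in> \<Lambda> \<Longrightarrow> (rt l k)\<^sup>2 = snd l k"
  by (simp add: rt_def eigen_nonneg)

lemma rt_sum: "l \<in> \<Lambda> \<Longrightarrow> (\<Sum>k. ennreal ((rt l k)\<^sup>2)) \<le> ennreal C"
  by (simp add: rt_power2 eigen_sum)

lemma rt_sum_finite: "l \<in> \<Lambda> \<Longrightarrow> (\<Sum>k. ennreal ((rt l k)\<^sup>2)) \<noteq> \<top>"
  using rt_sum neq_top_trans[OF ennreal_neq_top] by blast

lemma rt_le: assumes "l \<in> \<Lambda>" shows "(rt l k)\<^sup>2 \<le> C"
proof -
  have "ennreal ((rt l k)\<^sup>2) = (\<Sum>j\<in>{k}. ennreal ((rt l j)\<^sup>2))" by simp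
  also have "\<dots> \<le> (\<Sum>k. ennreal ((rt l k)\<^sup>2))" by (intro sum_le_suminf) auto
  also have "\<dots> \<le> ennreal C" by (rule rt_sum[OF assms])
  finally show ?thesis using C_nonneg by simp
qed

lemma sg_norm: assumes "l \<in> \<Lambda>" shows "(norm (sg l))\<^sup>2 \<le> C"
proof -
  have "ennreal ((norm (sg l))\<^sup>2) \<le> ennreal C"
    unfolding sg_def using ser_norm_le[OF basis] rt_sum[OF assms] by (rule order_trans)
  then show ?thesis using C_nonneg by simp
qed

text \<open>Finiteness comes from (x - y)^2 \<le> 2 x^2 + 2 y^2. The differences of roots are then
  coefficients of an orthonormal series, and \<open>eigen_padding\<close> makes the identity exact
  at padding indices.\<close>

lemma rt_dist:
  assumes "l \<in> \<Lambda>" "l' \<in> \<Lambda>"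
  shows "(\<Sum>k. ennreal ((rt l k - rt l' k)\<^sup>2)) = ennreal ((norm (sg l - sg l'))\<^sup>2)"
proof -
  have "(\<Sum>k. ennreal ((rt l k - rt l' k)\<^sup>2)) \<le> (\<Sum>k. 2 * ennreal ((rt l k)\<^sup>2) + 2 * ennreal ((rt l' k)\<^sup>2))"
  proof (intro suminf_le)
    fix k
    have "ennreal ((rt l k - rt l' k)\<^sup>2) \<le> ennreal (2 * (rt l k)\<^sup>2 + 2 * (rt l' k)\<^sup>2)"
      using square_diff_le[of "rt l k" "rt l' k" 0] by (intro ennreal_leI) simp
    then show "ennreal ((rt l k - rt l' k)\<^sup>2) \<le> 2 * ennreal ((rt l k)\<^sup>2) + 2 * ennreal ((rt l' k)\<^sup>2)"
      by (simp add: ennreal_plus ennreal_mult')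
  qed auto
  also have "\<dots> = 2 * (\<Sum>k. ennreal ((rt l k)\<^sup>2)) + 2 * (\<Sum>k. ennreal ((rt l' k)\<^sup>2))"
    by (simp add: suminf_add[symmetric] ennreal_suminf_cmult)
  finally have le: "(\<Sum>k. ennreal ((rt l k - rt l' k)\<^sup>2)) \<le> 2 * (\<Sum>k. ennreal ((rt l k)\<^sup>2)) + 2 * (\<Sum>k. ennreal ((rt l' k)\<^sup>2))" .
  have "2 * (\<Sum>k. ennreal ((rt l k)\<^sup>2)) + 2 * (\<Sum>k. ennreal ((rt l' k)\<^sup>2)) \<noteq> \<top>"
    using rt_sum_finite[OF assms(1)] rt_sum_finite[OF assms(2)] by (simp add: ennreal_mult_eq_top_iff)
  from neq_top_trans[OF this le] have fin: "(\<Sum>k. ennreal ((rt l k - rt l' k)\<^sup>2)) \<noteq> \<top>" .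
  have "rt l k - rt l' k = 0" if "e k = 0" for k
    using eigen_padding[OF assms(1) that] eigen_padding[OF assms(2) that] by (simp add: rt_def)
  from ser_norm_eq[OF basis fin this] show ?thesis
    unfolding sg_def ser_diff[OF basis rt_sum_finite[OF assms(1)] rt_sum_finite[OF assms(2)]] .
qed

text \<open>From |x - y|^2 \<le> 2 |x|^2 + 2 |y|^2, applied to drifts of norm at most C and to
  vectors \<open>sg l\<close> of squared norm at most C.\<close>

definition dd_max :: real where "dd_max = 4 * C\<^sup>2 + 4 * C"

lemma dd_max_nonneg: "0 \<le> dd_max"
  using C_nonneg by (simp add: dd_max_def)

lemma norm_diff_square_le: "(norm (x - y))\<^sup>2 \<le> 2 * (norm x)\<^sup>2 + 2 * (norm (y :: 'c::real_normed_vector))\<^sup>2"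
proof -
  have "(norm (x - y))\<^sup>2 \<le> (norm x + norm y)\<^sup>2" by (intro power_mono norm_triangle_ineq4) auto
  also have "\<dots> \<le> 2 * (norm x)\<^sup>2 + 2 * (norm y)\<^sup>2"
    using square_diff_le[of "norm x" "- norm y" 0] by simp
  finally show ?thesis .
qed

lemma dd_le: assumes "l \<in> \<Lambda>" "l' \<in> \<Lambda>" shows "dd l l' \<le> dd_max"
proof -
  have "(norm (fst l))\<^sup>2 \<le> C\<^sup>2" "(norm (fst l'))\<^sup>2 \<le> C\<^sup>2"
    using drift_bound[OF assms(1)] drift_bound[OF assms(2)] by (simp_all add: power_mono)
  then show ?thesis
    using norm_diff_square_le[of "fst l" "fst l'"] norm_diff_square_le[of "sg l" "sg l'"] sg_norm[OF assms(1)] sg_norm[OF assms(2)]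
    unfolding dd_def dd_max_def by linarith
qed

lemma Lambda_l1: "\<Lambda> \<subseteq> UNIV \<times> l1"
proof
  fix l assume l: "l \<in> \<Lambda>"
  have "summable (\<lambda>k. snd l k)"
    using eigen_sum[OF l] eigen_nonneg[OF l] by (intro summable_suminf_not_top) (auto simp: top_unique)
  then have "(\<lambda>k. snd l k) summable_on UNIV"
    using eigen_nonneg[OF l] by (subst summable_on_UNIV_nonneg_real_iff) auto
  then have "(\<lambda>k. \<bar>snd l k\<bar>) summable_on UNIV" using eigen_nonneg[OF l] by simp
  then show "l \<in> UNIV \<times> l1" by (cases l) (simp add: l1_def)
qed

lemma dense_sequence: "\<exists>s :: nat \<Rightarrow> _. range s \<subseteq> \<Lambda> \<and> (\<forall>l\<in>\<Lambda>. \<forall>\<epsilon>>0. \<exists>n. dist (emb l) (emb (s n)) < \<epsilon>)"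
proof -
  obtain T where T: "countable T" "T \<subseteq> emb ` \<Lambda>" "emb ` \<Lambda> \<subseteq> closure T"
    using separable[of "emb ` \<Lambda>"] by metis
  have "T \<noteq> {}" using T nonempty by auto
  have "\<forall>n. \<exists>l\<in>\<Lambda>. emb l = from_nat_into T n"
    using from_nat_into[OF \<open>T \<noteq> {}\<close>] T(2) by (metis (mono_tags, lifting) image_iff subsetD)
  then obtain s where s: "\<And>n. s n \<in> \<Lambda>" "\<And>n. emb (s n) = from_nat_into T n" by metis
  have "\<exists>n. dist (emb l) (emb (s n)) < \<epsilon>" if l: "l \<in> \<Lambda>" and \<epsilon>: "\<epsilon> > 0" for l \<epsilon>
  proof -
    have "emb l \<in> closure T" using T(3) l by auto
    then obtain y where y: "y \<in> T" "dist y (emb l) < \<epsilon>" using \<epsilon> by (auto simp: closure_approachable)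
    obtain n where "from_nat_into T n = y" using from_nat_into_surj[OF T(1) y(1)] by auto
    then show ?thesis using y s(2)[of n] by (auto simp: dist_commute intro!: exI[of _ n])
  qed
  then show ?thesis using s(1) by (intro exI[of _ s]) auto
qed

text \<open>An enumeration of control values that is dense with respect to \<open>emb\<close>. All
  approximating controls take their values in it, so choosing a control amounts to choosing a
  natural number.\<close>

definition lam :: "nat \<Rightarrow> 'a \<times> (nat \<Rightarrow> real)" where
  "lam = (SOME s. range s \<subseteq> \<Lambda> \<and> (\<forall>l\<in>\<Lambda>. \<forall>\<epsilon>>0. \<exists>n. dist (emb l) (emb (s n)) < \<epsilon>))"

lemma lam: "lam n \<in> \<Lambda>" "l \<in> \<Lambda> \<Longrightarrow> \<epsilon> > 0 \<Longrightarrow> \<exists>n. dist (emb l) (emb (lam n)) < \<epsilon>"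
  using someI_ex[OF dense_sequence] unfolding lam_def[symmetric] by auto

lemma control_in: "\<alpha> \<in> controls M F \<Lambda> \<Longrightarrow> \<omega> \<in> space M \<Longrightarrow> 0 \<le> s \<Longrightarrow> \<alpha> (\<omega>, s) \<in> \<Lambda>"
  using measurable_space[of \<alpha> "predictable_sigma M F" "control_borel \<Lambda>" "(\<omega>, s)"]
  by (auto simp: controls_def space_predictable space_control_borel)

lemma control_fst: "\<alpha> \<in> controls M F \<Lambda> \<Longrightarrow> (\<lambda>p. fst (\<alpha> p)) \<in> borel_measurable (predictable_sigma M F)"
  unfolding controls_def using measurable_control_fst[OF Lambda_l1] by (rule measurable_compose[rotated])

lemma control_rt: "\<alpha> \<in> controls M F \<Lambda> \<Longrightarrow> (\<lambda>p. rt (\<alpha> p) k) \<in> borel_measurable (predictable_sigma M F)"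
  unfolding controls_def rt_def
  by (drule measurable_compose[OF _ measurable_control_snd[OF Lambda_l1, of k]], erule measurable_compose) measurable

lemma control_sg: "\<alpha> \<in> controls M F \<Lambda> \<Longrightarrow> (\<lambda>p. sg (\<alpha> p)) \<in> borel_measurable (predictable_sigma M F)"
  unfolding sg_def by (intro borel_measurable_ser control_rt)

lemma control_emb: "\<alpha> \<in> controls M F \<Lambda> \<Longrightarrow> (\<lambda>p. emb (\<alpha> p)) \<in> borel_measurable (predictable_sigma M F)"
  unfolding emb_def by (intro borel_measurable_Pair control_fst control_sg)

section \<open>Controls that are constant on the cells of a grid\<close>

definition grid_control :: "nat \<Rightarrow> (nat \<Rightarrow> 'w \<Rightarrow> nat) \<Rightarrow> 'w \<times> real \<Rightarrow> 'a \<times> (nat \<Rightarrow> real)" where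
  "grid_control n idx p = lam (idx (cell (h n) (snd p)) (fst p))"

definition grid_adapted :: "nat \<Rightarrow> (nat \<Rightarrow> 'w \<Rightarrow> nat) \<Rightarrow> bool" where
  "grid_adapted n idx \<longleftrightarrow> (\<forall>k. idx k \<in> measurable (F (real k * h n)) (count_space UNIV))"

lemma grid_time_nonneg: "0 \<le> real k * h n"
  using h_pos[of n] by simp

lemma grid_control_in: "grid_control n idx p \<in> \<Lambda>"
  by (simp add: grid_control_def lam)

text \<open>The level sets of the index are unions of predictable rectangles, because the choice for
  a cell is known at its left end and the cell excludes that end; time 0 is added through the
  generators at 0.\<close>

lemma grid_control_controls:
  assumes idx: "grid_adapted n idx"
  shows "grid_control n idx \<in> controls M F \<Lambda>"
proof -
  have "(\<lambda>p. idx (cell (h n) (snd p)) (fst p)) \<in> measurable (predictable_sigma M F) (count_space UNIV)"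
    unfolding measurable_count_space_eq2_countable
  proof (intro conjI ballI)
    fix l :: nat
    define A where "A k = idx k -` {l} \<inter> space M" for k
    have A: "A k \<in> sets (F (real k * h n))" for k
      using measurable_sets[of "idx k" "F (real k * h n)" "count_space UNIV" "{l}"] idx space_F[OF grid_time_nonneg, of k n]
      by (simp add: A_def grid_adapted_def)
    have "(\<lambda>p. idx (cell (h n) (snd p)) (fst p)) -` {l} \<inter> space (predictable_sigma M F) =
      A 0 \<times> {0} \<union> (\<Union>k. A k \<times> {real k * h n<..real (Suc k) * h n})" (is "?L = ?R")
    proof (intro set_eqI iffI)
      fix p assume p: "p \<in> ?L"
      show "p \<in> ?R"
      proof (cases "snd p = 0")
        case True
        then show ?thesis using p by (cases p) (auto simp: A_def cell_0 space_predictable)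
      next
        case False
        then have "0 < snd p" using p by (auto simp: space_predictable)
        then show ?thesis using p cell_bounds[OF h_pos[of n], of "snd p"]
          by (cases p) (auto simp: A_def space_predictable intro!: exI[of _ "cell (h n) (snd p)"])
      qed
    next
      fix p assume p: "p \<in> ?R"
      then consider "p \<in> A 0 \<times> {0}" | k where "p \<in> A k \<times> {real k * h n<..real (Suc k) * h n}" by blast
      then show "p \<in> ?L"
      proof cases
        case 1
        then show ?thesis by (auto simp: A_def cell_0 space_predictable)
      next
        case 2
        then have "0 < snd p" using grid_time_nonneg[of k n] by auto
        then have "cell (h n) (snd p) = k" using 2 cell_eq_iff[OF h_pos[of n], of "snd p" k] by auto
        then show ?thesis using 2 \<open>0 < snd p\<close> by (cases p) (auto simp: A_def space_predictable)
      qed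
    qed
    also have "\<dots> \<in> sets (predictable_sigma M F)"
    proof (intro sets.Un sets.countable_UN image_subsetI)
      show "A 0 \<times> {0} \<in> sets (predictable_sigma M F)"
        unfolding sets_predictable using A[of 0] by (intro sigma_sets.Basic) auto
      show "A k \<times> {real k * h n<..real (Suc k) * h n} \<in> sets (predictable_sigma M F)" for k
        unfolding sets_predictable using A[of k] h_pos[of n]
        by (intro sigma_sets.Basic UnI2 CollectI exI conjI refl) (auto intro: mult_right_mono)
    qed
    finally show "(\<lambda>p. idx (cell (h n) (snd p)) (fst p)) -` {l} \<inter> space (predictable_sigma M F) \<in> sets (predictable_sigma M F)" .
  qed auto
  moreover have "lam \<in> measurable (count_space UNIV) (control_borel \<Lambda>)"
    using lam(1) by (simp add: measurable_count_space_eq1 space_control_borel)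
  ultimately show ?thesis
    unfolding controls_def grid_control_def[abs_def] by (rule measurable_compose)
qed

text \<open>Values are discretised before time is. The least index of a point of \<open>lam\<close>
  within \<eta> of the control is a predictable process with countably many values, and it is
  replaced by a grid index. Where the two indices agree, \<open>dd\<close> is at most \<eta>^2; on
  the small remainder it is at most \<open>dd_max\<close>.\<close>

lemma control_approx:
  assumes \<alpha>: "\<alpha> \<in> controls M F \<Lambda>" and t: "0 \<le> t" and \<epsilon>: "\<epsilon> > 0"
  shows "\<forall>\<^sub>F n in sequentially. \<exists>idx. grid_adapted n idx \<and>
    (\<integral>\<^sup>+ p\<in>space M \<times> {0<..t}. ennreal (dd (\<alpha> p) (grid_control n idx p)) \<partial>MT) \<le> ennreal \<epsilon>"
proof -
  \<comment> \<open>The two errors \<eta>^2 t and \<open>dd_max\<close> times \<epsilon>' are each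
    to be at most \<epsilon> / 2; the added 1 keeps the denominators positive.\<close>
  define \<eta> where "\<eta> = sqrt (\<epsilon> / (2 * (t + 1)))"
  define \<epsilon>' where "\<epsilon>' = \<epsilon> / (2 * (dd_max + 1))"
  have \<eta>: "\<eta> > 0" "\<eta>\<^sup>2 = \<epsilon> / (2 * (t + 1))" using \<epsilon> t by (auto simp: \<eta>_def)
  have \<epsilon>': "\<epsilon>' > 0" using \<epsilon> dd_max_nonneg by (auto simp: \<epsilon>'_def)
  define i where "i p = (LEAST m. dist (emb (\<alpha> p)) (emb (lam m)) < \<eta>)" for p
  have "i \<in> measurable (predictable_sigma M F) (count_space UNIV)"
    unfolding i_def[abs_def] using control_emb[OF \<alpha>] by (intro measurable_Least) measurable
  then have "\<forall>\<^sub>F n in sequentially. \<exists>idx :: nat \<Rightarrow> 'w \<Rightarrow> nat.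
     (\<forall>k. idx k \<in> measurable (F (real k * h n)) (count_space UNIV)) \<and>
     {p \<in> space M \<times> {0<..t}. i p \<noteq> idx (cell (h n) (snd p)) (fst p)} \<in> sets MT \<and>
     emeasure MT {p \<in> space M \<times> {0<..t}. i p \<noteq> idx (cell (h n) (snd p)) (fst p)} \<le> ennreal \<epsilon>'"
    by (rule predictable_index_approx[OF _ t \<epsilon>'])
  then show ?thesis
  proof eventually_elim
    case (elim n)
    from elim obtain idx :: "nat \<Rightarrow> 'w \<Rightarrow> nat" where idx: "\<And>k. idx k \<in> measurable (F (real k * h n)) (count_space UNIV)"
      and X: "{p \<in> space M \<times> {0<..t}. i p \<noteq> idx (cell (h n) (snd p)) (fst p)} \<in> sets MT"
      and Xe: "emeasure MT {p \<in> space M \<times> {0<..t}. i p \<noteq> idx (cell (h n) (snd p)) (fst p)} \<le> ennreal \<epsilon>'" by auto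
    let ?X = "{p \<in> space M \<times> {0<..t}. i p \<noteq> idx (cell (h n) (snd p)) (fst p)}"
    have "ennreal (dd (\<alpha> p) (grid_control n idx p)) * indicator (space M \<times> {0<..t}) p \<le>
       ennreal (\<eta>\<^sup>2) * indicator (space M \<times> {0<..t}) p + ennreal dd_max * indicator ?X p" for p
    proof (cases "p \<in> space M \<times> {0<..t}")
      case True
      then have \<alpha>p: "\<alpha> p \<in> \<Lambda>" using control_in[OF \<alpha>, of "fst p" "snd p"] by auto
      show ?thesis
      proof (cases "p \<in> ?X")
        case True
        then have "ennreal (dd (\<alpha> p) (grid_control n idx p)) \<le> ennreal dd_max"
          by (intro ennreal_leI dd_le \<alpha>p grid_control_in)
        then show ?thesis using True \<open>p \<in> space M \<times> {0<..t}\<close> by (simp add: add_increasing)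
      next
        case False
        then have "i p = idx (cell (h n) (snd p)) (fst p)" using \<open>p \<in> space M \<times> {0<..t}\<close> by auto
        then have "dist (emb (\<alpha> p)) (emb (grid_control n idx p)) < \<eta>"
          using LeastI_ex[OF lam(2)[OF \<alpha>p \<eta>(1)]] by (simp add: i_def grid_control_def)
        then have "dd (\<alpha> p) (grid_control n idx p) \<le> \<eta>\<^sup>2"
          unfolding dd_eq_dist by (intro power_mono) auto
        then show ?thesis using False \<open>p \<in> space M \<times> {0<..t}\<close> by (simp add: ennreal_leI)
      qed
    qed simp
    then have "(\<integral>\<^sup>+ p\<in>space M \<times> {0<..t}. ennreal (dd (\<alpha> p) (grid_control n idx p)) \<partial>MT) \<le>
      (\<integral>\<^sup>+ p. ennreal (\<eta>\<^sup>2) * indicator (space M \<times> {0<..t}) p + ennreal dd_max * indicator ?X p \<partial>MT)"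
      by (intro nn_integral_mono)
    also have "\<dots> = ennreal (\<eta>\<^sup>2) * emeasure MT (space M \<times> {0<..t}) + ennreal dd_max * emeasure MT ?X"
      using X by (subst nn_integral_add) (auto simp: nn_integral_cmult_indicator)
    also have "\<dots> \<le> ennreal (\<eta>\<^sup>2) * ennreal t + ennreal dd_max * ennreal \<epsilon>'"
      using Xe by (intro add_mono mult_left_mono) (auto simp: emeasure_window[OF t])
    also have "\<dots> = ennreal (\<eta>\<^sup>2 * t + dd_max * \<epsilon>')"
      using t \<epsilon>' dd_max_nonneg by (simp add: ennreal_plus ennreal_mult')
    also have "\<dots> \<le> ennreal \<epsilon>"
    proof (rule ennreal_leI)
      have "\<eta>\<^sup>2 * t \<le> \<epsilon> / 2" unfolding \<eta>(2) using \<epsilon> t by (simp add: field_simps)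
      moreover have "dd_max * \<epsilon>' \<le> \<epsilon> / 2" unfolding \<epsilon>'_def using \<epsilon> dd_max_nonneg by (simp add: field_simps)
      ultimately show "\<eta>\<^sup>2 * t + dd_max * \<epsilon>' \<le> \<epsilon>" by simp
    qed
    finally show ?case using idx by (auto simp: grid_adapted_def)
  qed
qed

end

section \<open>Controlled states and random walks\<close>

lemma norm_add_square_le: "(norm (x + y))\<^sup>2 \<le> 2 * (norm x)\<^sup>2 + 2 * (norm (y :: 'c::real_normed_vector))\<^sup>2"
proof -
  have "(norm (x + y))\<^sup>2 \<le> (norm x + norm y)\<^sup>2" by (intro power_mono norm_triangle_ineq) auto
  also have "\<dots> \<le> 2 * (norm x)\<^sup>2 + 2 * (norm y)\<^sup>2"
    using square_diff_le[of "norm x" "- norm y" 0] by simp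
  finally show ?thesis .
qed

text \<open>Cauchy-Schwarz against the indicator of (0, t]; this is the origin of the factor t in
  the drift estimates.\<close>

lemma norm_integral_square_le:
  fixes f :: "real \<Rightarrow> 'c::{banach, second_countable_topology}"
  assumes f: "integrable lborel f" and 0: "\<And>s. s \<notin> {0<..t} \<Longrightarrow> f s = 0" and t: "0 \<le> t"
  shows "ennreal ((norm (\<integral>s. f s \<partial>lborel))\<^sup>2) \<le> ennreal t * (\<integral>\<^sup>+ s. ennreal ((norm (f s))\<^sup>2) \<partial>lborel)"
proof -
  have [measurable]: "f \<in> borel_measurable lborel" using f by auto
  have "ennreal (norm (\<integral>s. f s \<partial>lborel)) \<le> (\<integral>\<^sup>+ s. ennreal (norm (f s)) \<partial>lborel)"
    by (rule integral_norm_bound_ennreal[OF f])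
  also have "\<dots> = (\<integral>\<^sup>+ s. ennreal (norm (f s)) * indicator {0<..t} s \<partial>lborel)"
    using 0 by (intro nn_integral_cong) (auto simp: indicator_def)
  finally have "(ennreal (norm (\<integral>s. f s \<partial>lborel)))\<^sup>2 \<le> (\<integral>\<^sup>+ s. ennreal (norm (f s)) * indicator {0<..t} s \<partial>lborel)\<^sup>2"
    by (intro power_mono) auto
  also have "\<dots> \<le> (\<integral>\<^sup>+ s. (ennreal (norm (f s)))\<^sup>2 \<partial>lborel) * (\<integral>\<^sup>+ s. (indicator {0<..t} s)\<^sup>2 \<partial>lborel)"
    by (rule Cauchy_Schwarz_nn_integral) auto
  also have "(\<lambda>s. (indicator {0<..t} s :: ennreal)\<^sup>2) = indicator {0<..t}"
    by (auto simp: indicator_def)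
  also have "(\<integral>\<^sup>+ s. indicator {0<..t} s \<partial>lborel) = ennreal t" using t by simp
  finally show ?thesis by (simp add: ennreal_power mult.commute)
qed

context brownian_family begin

text \<open>Stochastic integrals refer to [0, t], cells and windows to (0, t]; the slice at time 0
  is negligible.\<close>

lemma AE_time_pos: "AE p in MT. snd p \<noteq> 0"
proof (rule AE_I')
  have "emeasure MT (space M \<times> {0}) = emeasure M (space M) * emeasure lborel {0::real}"
    by (rule lborel.emeasure_pair_measure_Times) auto
  moreover have "space M \<times> {0::real} \<in> sets MT" by (intro pair_measureI) auto
  ultimately show "space M \<times> {0} \<in> null_sets MT" by (auto simp: null_sets_def)
qed (auto simp: space_pair_measure)

lemma has_ito_integral_elementary:
  assumes e: "elementary_process M F m \<tau> \<eta>" and t: "0 \<le> t"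
  shows "has_ito_integral M F (\<xi> k) (elementary_value m \<tau> \<eta>) t (elementary_integral (\<xi> k) m \<tau> \<eta> t)"
  unfolding has_ito_integral_iff[OF elementary_value_measurable[OF e]]
  using elementary_integral_measurable[OF e t] e
  by (intro conjI exI[of _ "\<lambda>_. m"] exI[of _ "\<lambda>_. \<tau>"] exI[of _ "\<lambda>_. \<eta>"]) (auto simp: msd_def)

lemma has_ito_integral_zero:
  assumes "0 \<le> t"
  shows "has_ito_integral M F (\<xi> k) (\<lambda>_ _. 0) t (\<lambda>_. 0)"
proof -
  have "elementary_process M F 0 (\<lambda>_. 0) (\<lambda>_ _. 0)" by (auto simp: elementary_process_def)
  from has_ito_integral_elementary[OF this assms] show ?thesis
    by (simp add: elementary_value_def[abs_def] elementary_integral_def[abs_def])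
qed

lemma cut_zero: "cut t (\<lambda>_ _. 0) = (\<lambda>_. 0)"
  by (auto simp: cut_def)

text \<open>The stability estimate with the zero integrand as comparison, which is where the
  constant 16 comes from.\<close>

lemma ito_integral_moment2:
  assumes "0 \<le> t" "cut t H \<in> borel_measurable MT" "has_ito_integral M F (\<xi> k) H t J"
  shows "(\<integral>\<^sup>+ \<omega>. ennreal ((J \<omega>)\<^sup>2) \<partial>M) \<le> 16 * (\<integral>\<^sup>+ p. ennreal ((cut t H p)\<^sup>2) \<partial>MT)"
  using ito_integral_stable[OF assms(1,2) _ assms(3) has_ito_integral_zero[OF assms(1)]]
  by (simp add: cut_zero msd_def)

end

context control_setup begin

definition time :: "nat \<Rightarrow> nat \<Rightarrow> real" where
  "time n j = real j * h n"

lemma time_nonneg [simp]: "0 \<le> time n j"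
  unfolding time_def by (rule grid_time_nonneg)

lemma time_mono: "i \<le> j \<Longrightarrow> time n i \<le> time n j"
  unfolding time_def using h_pos[of n] by (intro mult_right_mono) auto

lemma time_Suc: "time n (Suc j) = time n j + h n"
  by (simp add: time_def algebra_simps)

lemma time_less_Suc: "time n j < time n (Suc j)"
  using h_pos[of n] by (simp add: time_Suc)

lemma adapted_index: "grid_adapted n idx \<Longrightarrow> idx j \<in> measurable (F (time n j)) (count_space UNIV)"
  by (simp add: grid_adapted_def time_def)

lemma adapted_compose:
  assumes "grid_adapted n idx" "time n j \<le> u"
  shows "(\<lambda>\<omega>. g (idx j \<omega>)) \<in> borel_measurable (F u)"
proof -
  have "g \<in> borel_measurable (count_space UNIV)" by simp
  then have "(\<lambda>\<omega>. g (idx j \<omega>)) \<in> borel_measurable (F (time n j))"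
    by (rule measurable_compose[OF adapted_index[OF assms(1)]])
  then show ?thesis using assms(2) by (rule measurable_F_mono[OF _ time_nonneg])
qed

abbreviation "grid_coeff idx k \<equiv> \<lambda>j \<omega>. rt (lam (idx j \<omega>)) k"

lemma elementary_grid:
  assumes "grid_adapted n idx"
  shows "elementary_process M F N (time n) (grid_coeff idx k)"
  unfolding elementary_process_def
proof (intro conjI allI impI)
  show "time n i \<le> time n (Suc i)" for i using time_less_Suc[of n i] by simp
  show "grid_coeff idx k i \<in> borel_measurable (F (time n i))" for i
    by (rule adapted_compose[OF assms]) simp
  have "\<bar>rt (lam j) k\<bar> \<le> sqrt C" for j
    using rt_le[OF lam(1)] by (intro real_le_rsqrt) simp
  then show "bounded (grid_coeff idx k i ` space M)" for i
    by (intro boundedI[of _ "sqrt C"]) auto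
qed simp

lemma cell_time:
  assumes "0 < s"
  shows "s \<in> {time n i<..time n (Suc i)} \<longleftrightarrow> i = cell (h n) s"
    "s \<le> time n N \<longleftrightarrow> cell (h n) s < N"
proof -
  show 1: "s \<in> {time n i<..time n (Suc i)} \<longleftrightarrow> i = cell (h n) s"
    using cell_eq_iff[OF h_pos[of n] assms, of i] by (auto simp: time_def)
  have "time n (cell (h n) s) < s" "s \<le> time n (Suc (cell (h n) s))"
    using cell_bounds[OF h_pos[of n] assms] by (auto simp: time_def)
  then show "s \<le> time n N \<longleftrightarrow> cell (h n) s < N"
    using time_mono[of "Suc (cell (h n) s)" N n] time_mono[of N "cell (h n) s" n]
    by (auto simp: not_le[symmetric] Suc_le_eq)
qed

lemma sum_cells:
  fixes g :: "nat \<Rightarrow> 'c::real_vector"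
  assumes "0 < s"
  shows "(\<Sum>i<N. indicator {time n i<..time n (Suc i)} s *\<^sub>R g i) = (if s \<le> time n N then g (cell (h n) s) else 0)"
proof -
  have "(\<Sum>i<N. indicator {time n i<..time n (Suc i)} s *\<^sub>R g i) = (\<Sum>i<N. if i = cell (h n) s then g i else 0)"
    using cell_time(1)[OF assms, of n] by (intro sum.cong) (auto simp: indicator_def)
  then show ?thesis using cell_time(2)[OF assms, of n N] by simp
qed

lemma elementary_grid_value:
  assumes "0 < s"
  shows "elementary_value N (time n) (grid_coeff idx k) s \<omega> =
    (if s \<le> time n N then rt (grid_control n idx (\<omega>, s)) k else 0)"
  using sum_cells[OF assms, where g="\<lambda>i. rt (lam (idx i \<omega>)) k" and n=n and N=N]
  by (simp add: elementary_value_def grid_control_def mult.commute)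

abbreviation "rt_process \<alpha> k \<equiv> (\<lambda>s \<omega>. rt (\<alpha> (\<omega>, s)) k)"

lemma predictable_window_MT:
  fixes f :: "'w \<times> real \<Rightarrow> 'c::{real_normed_vector, second_countable_topology}"
  assumes "f \<in> borel_measurable (predictable_sigma M F)" "A \<subseteq> {0..}" "A \<in> sets borel"
  shows "(\<lambda>p. indicator A (snd p) *\<^sub>R f p) \<in> borel_measurable MT"
proof -
  have "(\<lambda>p. indicator A (snd p) *\<^sub>R (indicator (space M \<times> {0..}) p *\<^sub>R f p)) \<in> borel_measurable MT"
    using predictable_borel_MT[OF assms(1)] assms(3) by measurable
  also have "?this \<longleftrightarrow> ?thesis"
    using assms(2) by (intro measurable_cong) (auto simp: indicator_def space_pair_measure)
  finally show ?thesis .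
qed

lemma cut_rt_measurable:
  assumes "\<alpha> \<in> controls M F \<Lambda>"
  shows "cut t (rt_process \<alpha> k) \<in> borel_measurable MT"
  using predictable_window_MT[OF control_rt[OF assms], of "{0..t}" k]
  by (simp add: cut_def case_prod_beta')

lemma dd_predictable:
  assumes "\<alpha> \<in> controls M F \<Lambda>" "\<beta> \<in> controls M F \<Lambda>"
  shows "(\<lambda>p. dd (\<alpha> p) (\<beta> p)) \<in> borel_measurable (predictable_sigma M F)"
  unfolding dd_def using control_fst[OF assms(1)] control_fst[OF assms(2)] control_sg[OF assms(1)] control_sg[OF assms(2)]
  by measurable

lemma dd_window_measurable:
  assumes "\<alpha> \<in> controls M F \<Lambda>" "\<beta> \<in> controls M F \<Lambda>"
  shows "(\<lambda>p. ennreal (dd (\<alpha> p) (\<beta> p)) * indicator (space M \<times> {0<..t}) p) \<in> borel_measurable MT"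
proof -
  have "(\<lambda>p. ennreal (indicator {0<..t} (snd p) *\<^sub>R dd (\<alpha> p) (\<beta> p))) \<in> borel_measurable MT"
    by (intro measurable_compose[OF _ measurable_ennreal] predictable_window_MT dd_predictable assms) auto
  also have "?this \<longleftrightarrow> ?thesis"
    by (intro measurable_cong) (auto simp: indicator_def space_pair_measure)
  finally show ?thesis .
qed

definition mean_dd :: "real \<Rightarrow> ('w \<times> real \<Rightarrow> 'a \<times> (nat \<Rightarrow> real)) \<Rightarrow> ('w \<times> real \<Rightarrow> 'a \<times> (nat \<Rightarrow> real)) \<Rightarrow> ennreal" where
  "mean_dd t \<alpha> \<beta> = (\<integral>\<^sup>+ p\<in>space M \<times> {0<..t}. ennreal (dd (\<alpha> p) (\<beta> p)) \<partial>MT)"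

lemma emeasure_window': "a \<le> b \<Longrightarrow> emeasure MT (space M \<times> {a<..b}) = ennreal (b - a)"
  by (subst lborel.emeasure_pair_measure_Times) (auto simp: emeasure_space_1)

text \<open>All coordinates are summed before integrating, which keeps the bound free of the
  dimension. Up to the last grid point \<open>rt_dist\<close> turns the sum into at most
  \<open>dd\<close>; on the incomplete step the elementary process is 0 and the squared roots sum to
  at most C.\<close>

lemma grid_msd:
  assumes \<alpha>: "\<alpha> \<in> controls M F \<Lambda>" and idx: "grid_adapted n idx" and N: "time n N \<le> t"
  shows "(\<Sum>k. msd MT (cut t (elementary_value N (time n) (grid_coeff idx k))) (cut t (rt_process \<alpha> k)))
    \<le> mean_dd t \<alpha> (grid_control n idx) + ennreal (C * (t - time n N))"
proof -
  let ?E = "\<lambda>k. cut t (elementary_value N (time n) (grid_coeff idx k))" and ?H = "\<lambda>k. cut t (rt_process \<alpha> k)"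
  let ?\<beta> = "grid_control n idx"
  note \<beta> = grid_control_controls[OF idx]
  have [measurable]: "?E k \<in> borel_measurable MT" "?H k \<in> borel_measurable MT" for k
    using elementary_value_measurable[OF elementary_grid[OF idx]] cut_rt_measurable[OF \<alpha>] by auto
  have "(\<Sum>k. msd MT (?E k) (?H k)) = (\<integral>\<^sup>+ p. (\<Sum>k. ennreal ((?E k p - ?H k p)\<^sup>2)) \<partial>MT)"
    unfolding msd_def by (rule nn_integral_suminf[symmetric]) measurable
  also have "\<dots> \<le> (\<integral>\<^sup>+ p. ennreal (dd (\<alpha> p) (?\<beta> p)) * indicator (space M \<times> {0<..t}) p
      + ennreal C * indicator (space M \<times> {time n N<..t}) p \<partial>MT)"
  proof (rule nn_integral_mono_AE)
    show "AE p in MT. (\<Sum>k. ennreal ((?E k p - ?H k p)\<^sup>2)) \<le>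
      ennreal (dd (\<alpha> p) (?\<beta> p)) * indicator (space M \<times> {0<..t}) p + ennreal C * indicator (space M \<times> {time n N<..t}) p"
      using AE_time_pos AE_space
    proof eventually_elim
      case (elim p)
      obtain \<omega> s where p: "p = (\<omega>, s)" by (cases p)
      with elim have s: "s \<noteq> 0" and \<omega>: "\<omega> \<in> space M" by (auto simp: space_pair_measure)
      consider "s < 0 \<or> t < s" | "0 < s" "s \<le> t" "s \<le> time n N" | "0 < s" "s \<le> t" "time n N < s" using s by linarith
      then show ?case
      proof cases
        case 1
        then have "indicator {0..t} s = (0 :: real)" by auto
        then have "?E k p = 0" "?H k p = 0" for k unfolding p cut_def prod.case by (simp_all only: mult_zero_left)
        then show ?thesis by (simp only: diff_self power_zero_numeral ennreal_0 suminf_zero zero_le)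
      next
        case 2
        have "(\<Sum>k. ennreal ((?E k p - ?H k p)\<^sup>2)) = (\<Sum>k. ennreal ((rt (?\<beta> p) k - rt (\<alpha> p) k)\<^sup>2))"
          using 2 by (simp add: p cut_def elementary_grid_value)
        also have "\<dots> = ennreal ((norm (sg (?\<beta> p) - sg (\<alpha> p)))\<^sup>2)"
          using control_in[OF \<alpha> \<omega>, of s] 2 by (intro rt_dist grid_control_in) (simp add: p)
        also have "\<dots> \<le> ennreal (dd (\<alpha> p) (?\<beta> p))"
          by (intro ennreal_leI) (simp add: dd_def norm_minus_commute)
        finally show ?thesis using 2 \<omega> by (simp add: p)
      next
        case 3
        have "(\<Sum>k. ennreal ((?E k p - ?H k p)\<^sup>2)) = (\<Sum>k. ennreal ((rt (\<alpha> p) k)\<^sup>2))"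
          using 3 by (simp add: p cut_def elementary_grid_value)
        also have "\<dots> \<le> ennreal C"
          using control_in[OF \<alpha> \<omega>, of s] 3 by (intro rt_sum) (simp add: p)
        finally show ?thesis using 3 \<omega> by (simp add: p add_increasing)
      qed
    qed
  qed
  also have "\<dots> = mean_dd t \<alpha> ?\<beta> + ennreal C * emeasure MT (space M \<times> {time n N<..t})"
    unfolding mean_dd_def using dd_window_measurable[OF \<alpha> \<beta>, of t]
    by (subst nn_integral_add) (auto simp: nn_integral_cmult_indicator)
  also have "\<dots> = mean_dd t \<alpha> ?\<beta> + ennreal (C * (t - time n N))"
    using N C_nonneg by (simp add: emeasure_window' ennreal_mult')
  finally show ?thesis .
qed

section \<open>Existence and second moments of the noise\<close>

lemma suminf_component_le: "f k \<le> (\<Sum>k. f k)" for f :: "nat \<Rightarrow> ennreal"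
  using sum_le_suminf[of f "{k}"] by auto

text \<open>A closed form of \<open>num_steps\<close> for t \<ge> 0; see
  \<open>num_steps_eq\<close>.\<close>

definition steps :: "nat \<Rightarrow> real \<Rightarrow> nat" where
  "steps n t = nat \<lfloor>t / h n\<rfloor>"

lemma steps:
  assumes "0 \<le> t"
  shows "time n (steps n t) \<le> t" "t < time n (steps n t) + h n"
proof -
  have 1: "real (steps n t) = of_int \<lfloor>t / h n\<rfloor>"
    using assms h_pos[of n] by (simp add: steps_def)
  have "real (steps n t) \<le> t / h n" "t / h n < real (steps n t) + 1" unfolding 1 by linarith+
  then show "time n (steps n t) \<le> t" "t < time n (steps n t) + h n"
    using h_pos[of n] by (simp_all add: time_def field_simps)
qed

text \<open>Grid controls approximating \<alpha> supply the elementary processes. The mesh may vary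
  with j, so the rate 8^(-j) asked for by \<open>ito_integral_exists\<close> can be imposed; the
  bound of \<open>grid_msd\<close> on the sum dominates each coordinate.\<close>

lemma ito_rt_exists:
  assumes \<alpha>: "\<alpha> \<in> controls M F \<Lambda>" and t: "0 \<le> t"
  shows "\<exists>J. has_ito_integral M F (\<xi> k) (rt_process \<alpha> k) t J"
proof -
  have "\<exists>n idx. grid_adapted n idx \<and>
     mean_dd t \<alpha> (grid_control n idx) + ennreal (C * (t - time n (steps n t))) \<le> ennreal ((1/8) ^ j)" for j
  proof -
    \<comment> \<open>One half of the error is for the distance of the controls, the other for the
      incomplete step, which costs at most C \<open>h n\<close>. Dividing by C + 1 instead of C
      below allows C = 0.\<close>
    let ?\<delta> = "(1/8 :: real) ^ j / 2"
    have "\<forall>\<^sub>F n in sequentially. h n < ?\<delta> / (C + 1)"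
      using h_lim C_nonneg by (intro order_tendstoD(2)) auto
    moreover have "\<forall>\<^sub>F n in sequentially. \<exists>idx. grid_adapted n idx \<and> mean_dd t \<alpha> (grid_control n idx) \<le> ennreal ?\<delta>"
      unfolding mean_dd_def by (rule control_approx[OF \<alpha> t]) simp
    ultimately have "\<forall>\<^sub>F n in sequentially. h n < ?\<delta> / (C + 1) \<and> (\<exists>idx. grid_adapted n idx \<and> mean_dd t \<alpha> (grid_control n idx) \<le> ennreal ?\<delta>)"
      by (rule eventually_conj)
    then obtain n idx where n: "h n < ?\<delta> / (C + 1)" "grid_adapted n idx" "mean_dd t \<alpha> (grid_control n idx) \<le> ennreal ?\<delta>"
      by (auto simp: eventually_sequentially)
    have "C * (t - time n (steps n t)) \<le> C * h n"
      using steps[OF t, of n] C_nonneg by (intro mult_left_mono) auto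
    also have "\<dots> \<le> (C + 1) * h n" using h_pos[of n] by simp
    also have "\<dots> \<le> ?\<delta>"
    proof -
      have "h n * (C + 1) < ?\<delta>" using n(1) C_nonneg by (subst (asm) pos_less_divide_eq) auto
      then show ?thesis by (simp only: mult.commute less_imp_le)
    qed
    finally have "mean_dd t \<alpha> (grid_control n idx) + ennreal (C * (t - time n (steps n t))) \<le> ennreal ?\<delta> + ennreal ?\<delta>"
      using n(3) by (intro add_mono ennreal_leI) auto
    also have "\<dots> = ennreal ((1/8) ^ j)" by (subst ennreal_plus[symmetric]) auto
    finally show ?thesis using n(2) by blast
  qed
  then obtain n idx where *: "\<And>j. grid_adapted (n j) (idx j)"
    "\<And>j. mean_dd t \<alpha> (grid_control (n j) (idx j)) + ennreal (C * (t - time (n j) (steps (n j) t))) \<le> ennreal ((1/8) ^ j)"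
    by metis
  show ?thesis
  proof (rule ito_integral_exists[OF t cut_rt_measurable[OF \<alpha>] elementary_grid[OF *(1)]])
    fix j
    have "msd MT (cut t (elementary_value (steps (n j) t) (time (n j)) (grid_coeff (idx j) k))) (cut t (rt_process \<alpha> k))
      \<le> (\<Sum>k. msd MT (cut t (elementary_value (steps (n j) t) (time (n j)) (grid_coeff (idx j) k))) (cut t (rt_process \<alpha> k)))"
      by (rule suminf_component_le)
    also have "\<dots> \<le> ennreal ((1/8) ^ j)"
      by (rule order_trans[OF grid_msd[OF \<alpha> *(1) steps(1)[OF t]] *(2)])
    finally show "msd MT (cut t (elementary_value (steps (n j) t) (time (n j)) (grid_coeff (idx j) k))) (cut t (rt_process \<alpha> k)) \<le> ennreal ((1/8) ^ j)" .
  qed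
qed

definition noise :: "('w \<times> real \<Rightarrow> 'a \<times> (nat \<Rightarrow> real)) \<Rightarrow> real \<Rightarrow> nat \<Rightarrow> 'w \<Rightarrow> real" where
  "noise \<alpha> t k = ito_integral M F (\<xi> k) (rt_process \<alpha> k) t"

lemma has_ito_noise:
  assumes "\<alpha> \<in> controls M F \<Lambda>" "0 \<le> t"
  shows "has_ito_integral M F (\<xi> k) (rt_process \<alpha> k) t (noise \<alpha> t k)"
  unfolding noise_def ito_integral_def by (rule someI_ex[OF ito_rt_exists[OF assms]])

lemma noise_measurable:
  assumes "\<alpha> \<in> controls M F \<Lambda>" "0 \<le> t"
  shows "noise \<alpha> t k \<in> borel_measurable M"
  using has_ito_noise[OF assms] by (auto simp: has_ito_integral_def)

text \<open>The integral over time and probability of the sum of squares is at most C t, and 16 is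
  the stability constant. The noise of a control and its elementary approximation on a grid are both
  instances.\<close>

lemma moment2_bound:
  assumes t: "0 \<le> t" and m: "\<And>k. cut t (H k) \<in> borel_measurable MT"
    and H: "\<And>\<omega> s. \<omega> \<in> space M \<Longrightarrow> 0 \<le> s \<Longrightarrow> (\<Sum>k. ennreal ((H k s \<omega>)\<^sup>2)) \<le> ennreal C"
    and J: "\<And>k. has_ito_integral M F (\<xi> k) (H k) t (J k)"
  shows "(\<Sum>k. \<integral>\<^sup>+ \<omega>. ennreal ((J k \<omega>)\<^sup>2) \<partial>M) \<le> ennreal (16 * (C * t))"
proof -
  have W: "space M \<times> {0..t} \<in> sets MT" by (intro pair_measureI) auto
  have [measurable]: "\<And>k. cut t (H k) \<in> borel_measurable MT" by fact
  have "(\<Sum>k. \<integral>\<^sup>+ \<omega>. ennreal ((J k \<omega>)\<^sup>2) \<partial>M) \<le> (\<Sum>k. 16 * (\<integral>\<^sup>+ p. ennreal ((cut t (H k) p)\<^sup>2) \<partial>MT))"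
    by (intro suminf_le ito_integral_moment2[OF t m J]) auto
  also have "\<dots> = 16 * (\<integral>\<^sup>+ p. (\<Sum>k. ennreal ((cut t (H k) p)\<^sup>2)) \<partial>MT)"
    by (subst nn_integral_suminf) (auto simp: ennreal_suminf_cmult)
  also have "(\<integral>\<^sup>+ p. (\<Sum>k. ennreal ((cut t (H k) p)\<^sup>2)) \<partial>MT) \<le> (\<integral>\<^sup>+ p. ennreal C * indicator (space M \<times> {0..t}) p \<partial>MT)"
  proof (rule nn_integral_mono)
    fix p assume "p \<in> space MT"
    then obtain \<omega> s where p: "p = (\<omega>, s)" and \<omega>: "\<omega> \<in> space M" by (auto simp: space_pair_measure)
    show "(\<Sum>k. ennreal ((cut t (H k) p)\<^sup>2)) \<le> ennreal C * indicator (space M \<times> {0..t}) p"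
    proof (cases "s \<in> {0..t}")
      case True
      then have c: "cut t (H k) p = H k s \<omega>" for k by (simp add: p cut_def)
      have i: "indicator (space M \<times> {0..t}) p = (1 :: ennreal)" using True \<omega> by (simp add: p)
      have "0 \<le> s" using True by simp
      from H[OF \<omega> this] show ?thesis unfolding c i mult_1_right .
    next
      case False
      then have "cut t (H k) p = 0" for k by (simp add: p cut_def)
      then show ?thesis by simp
    qed
  qed
  also have "\<dots> = ennreal C * ennreal t"
    using W t by (subst nn_integral_cmult_indicator) (auto simp: lborel.emeasure_pair_measure_Times emeasure_space_1)
  finally show ?thesis
    using C_nonneg t by (simp add: ennreal_mult' mult_left_mono)
qed

lemma noise_moment2:
  assumes \<alpha>: "\<alpha> \<in> controls M F \<Lambda>" and t: "0 \<le> t"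
  shows "(\<Sum>k. \<integral>\<^sup>+ \<omega>. ennreal ((noise \<alpha> t k \<omega>)\<^sup>2) \<partial>M) \<le> ennreal (16 * (C * t))"
  by (rule moment2_bound[OF t cut_rt_measurable[OF \<alpha>] _ has_ito_noise[OF \<alpha> t]])
    (rule rt_sum[OF control_in[OF \<alpha>]])

lemma grid_noise_moment2:
  assumes idx: "grid_adapted n idx" and t: "0 \<le> t"
  shows "(\<Sum>k. \<integral>\<^sup>+ \<omega>. ennreal ((elementary_integral (\<xi> k) N (time n) (grid_coeff idx k) t \<omega>)\<^sup>2) \<partial>M) \<le> ennreal (16 * (C * t))"
proof (rule moment2_bound[OF t elementary_value_measurable[OF elementary_grid[OF idx]] _ has_ito_integral_elementary[OF elementary_grid[OF idx] t]])
  fix \<omega> and s :: real assume "\<omega> \<in> space M" "0 \<le> s"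
  show "(\<Sum>k. ennreal ((elementary_value N (time n) (grid_coeff idx k) s \<omega>)\<^sup>2)) \<le> ennreal C"
  proof (cases "0 < s \<and> s \<le> time n N")
    case True
    then show ?thesis using rt_sum[OF grid_control_in[of n idx "(\<omega>, s)"]] by (simp add: elementary_grid_value)
  next
    case False
    have "elementary_value N (time n) (grid_coeff idx k) s \<omega> = 0" for k
    proof (cases "s = 0")
      case True
      have "indicator {time n i<..time n (Suc i)} s = (0 :: real)" for i
      proof -
        have "\<not> time n i < 0" by (simp add: not_less)
        then show ?thesis using True by (auto simp: indicator_def)
      qed
      then show ?thesis by (simp add: elementary_value_def)
    next
      case F: False
      then show ?thesis using False \<open>0 \<le> s\<close> by (simp add: elementary_grid_value)
    qed
    then show ?thesis by simp
  qed
qed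

section \<open>States, walks and their mean square distance\<close>

definition drift :: "('w \<times> real \<Rightarrow> 'a \<times> (nat \<Rightarrow> real)) \<Rightarrow> real \<Rightarrow> 'w \<Rightarrow> 'a" where
  "drift \<alpha> t \<omega> = (LBINT s:{0..t}. fst (\<alpha> (\<omega>, s)))"

definition state :: "('w \<times> real \<Rightarrow> 'a \<times> (nat \<Rightarrow> real)) \<Rightarrow> real \<Rightarrow> 'w \<Rightarrow> 'a" where
  "state \<alpha> t \<omega> = drift \<alpha> t \<omega> + ser e (\<lambda>k. noise \<alpha> t k \<omega>)"

definition increment :: "nat \<Rightarrow> nat \<Rightarrow> 'w \<Rightarrow> nat \<Rightarrow> real" where
  "increment n j \<omega> k = \<xi> k (time n (Suc j)) \<omega> - \<xi> k (time n j) \<omega>"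

text \<open>The displacement during a step of length \<delta> when the control is frozen at l and
  the noise vector is z; \<open>I_op\<close> takes an expectation over such displacements.\<close>

definition jump :: "real \<Rightarrow> 'a \<times> (nat \<Rightarrow> real) \<Rightarrow> (nat \<Rightarrow> real) \<Rightarrow> 'a" where
  "jump \<delta> l z = \<delta> *\<^sub>R fst l + ser e (\<lambda>k. rt l k * z k)"

definition walk :: "nat \<Rightarrow> (nat \<Rightarrow> 'w \<Rightarrow> nat) \<Rightarrow> nat \<Rightarrow> 'w \<Rightarrow> 'a" where
  "walk n idx N \<omega> = (\<Sum>j<N. jump (h n) (lam (idx j \<omega>)) (increment n j \<omega>))"

lemma drift_section:
  assumes \<alpha>: "\<alpha> \<in> controls M F \<Lambda>" and \<omega>: "\<omega> \<in> space M" and A: "A \<subseteq> {0..t}" "A \<in> sets borel"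
  shows "integrable lborel (\<lambda>s. indicator A s *\<^sub>R fst (\<alpha> (\<omega>, s)))"
proof (rule Bochner_Integration.integrable_bound[of _ "\<lambda>s. indicator {0..t} s * C"])
  have "(\<lambda>p. indicator A (snd p) *\<^sub>R fst (\<alpha> p)) \<in> borel_measurable MT"
    using A by (intro predictable_window_MT control_fst \<alpha>) auto
  from measurable_compose[OF measurable_Pair1'[OF \<omega>] this]
  show "(\<lambda>s. indicator A s *\<^sub>R fst (\<alpha> (\<omega>, s))) \<in> borel_measurable lborel" by simp
  show "AE s in lborel. norm (indicator A s *\<^sub>R fst (\<alpha> (\<omega>, s))) \<le> norm (indicator {0..t} s * C)"
  proof (rule AE_I2)
    fix s :: real
    show "norm (indicator A s *\<^sub>R fst (\<alpha> (\<omega>, s))) \<le> norm (indicator {0..t} s * C)"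
      using drift_bound[OF control_in[OF \<alpha> \<omega>, of s]] A(1) C_nonneg
      by (cases "s \<in> A") (auto simp: indicator_def)
  qed
  have "integrable lborel (indicator {0..t} :: real \<Rightarrow> real)"
    by (cases "0 \<le> t") auto
  then show "integrable lborel (\<lambda>s. indicator {0..t} s * C)" by (rule integrable_mult_left)
qed

lemma drift_measurable:
  assumes \<alpha>: "\<alpha> \<in> controls M F \<Lambda>"
  shows "drift \<alpha> t \<in> borel_measurable M"
proof -
  have "(\<lambda>(\<omega>, s). indicator {0..t} s *\<^sub>R fst (\<alpha> (\<omega>, s))) \<in> borel_measurable MT"
    using predictable_window_MT[OF control_fst[OF \<alpha>], of "{0..t}"] by (simp add: case_prod_beta')
  from lborel.borel_measurable_lebesgue_integral[OF this] show ?thesis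
    by (simp add: drift_def[abs_def] set_lebesgue_integral_def)
qed

lemma state_measurable:
  assumes "\<alpha> \<in> controls M F \<Lambda>" "0 \<le> t"
  shows "state \<alpha> t \<in> borel_measurable M"
  unfolding state_def[abs_def]
  by (intro borel_measurable_add drift_measurable borel_measurable_ser noise_measurable assms)

lemma jump_measurable:
  assumes "grid_adapted n idx"
  shows "(\<lambda>\<omega>. jump (h n) (lam (idx j \<omega>)) (increment n j \<omega>)) \<in> borel_measurable (F (time n (Suc j)))"
  unfolding jump_def increment_def
  using time_less_Suc[of n j]
  by (intro borel_measurable_add borel_measurable_scaleR borel_measurable_const borel_measurable_ser
      borel_measurable_times adapted_compose[OF assms] adapted_increment) auto

lemma walk_measurable:
  assumes "grid_adapted n idx"
  shows "walk n idx N \<in> borel_measurable (F (time n N))"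
  unfolding walk_def[abs_def]
  by (intro borel_measurable_sum measurable_F_mono[OF jump_measurable[OF assms]] time_nonneg time_mono) auto

lemma walk_measurable_M: "grid_adapted n idx \<Longrightarrow> walk n idx N \<in> borel_measurable M"
  by (rule measurable_F[OF walk_measurable time_nonneg])

text \<open>The coefficient is known at the left end of the step and the increment is independent of
  it with variance \<open>h n\<close>, so the coordinates sum to at most C \<open>h n\<close>. This
  gives almost sure convergence of the series in each jump.\<close>

lemma increment_coeff_moment2:
  assumes idx: "grid_adapted n idx"
  shows "(\<Sum>k. \<integral>\<^sup>+ \<omega>. ennreal ((rt (lam (idx j \<omega>)) k * increment n j \<omega> k)\<^sup>2) \<partial>M) \<noteq> \<top>"
proof -
  have m: "(\<lambda>\<omega>. (rt (lam (idx j \<omega>)) k)\<^sup>2) \<in> borel_measurable (F (time n j))" for k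
    by (rule adapted_compose[OF idx]) simp
  have mM: "(\<lambda>\<omega>. (rt (lam (idx j \<omega>)) k)\<^sup>2) \<in> borel_measurable M" for k
    by (rule measurable_F[OF m]) simp
  have i: "integrable M (\<lambda>\<omega>. (rt (lam (idx j \<omega>)) k)\<^sup>2)" for k
    by (rule bounded_integrable[OF mM, of _ C]) (use rt_le[OF lam(1)] in simp)
  have eq: "(\<integral>\<^sup>+ \<omega>. ennreal ((rt (lam (idx j \<omega>)) k * increment n j \<omega> k)\<^sup>2) \<partial>M) =
      (\<integral>\<^sup>+ \<omega>. ennreal ((rt (lam (idx j \<omega>)) k)\<^sup>2) \<partial>M) * ennreal (h n)" for k
  proof -
    note * = increment_mult_square_real[OF time_nonneg less_imp_le[OF time_less_Suc] m i, of k]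
    have "(\<integral>\<^sup>+ \<omega>. ennreal ((rt (lam (idx j \<omega>)) k * increment n j \<omega> k)\<^sup>2) \<partial>M) =
      ennreal (\<integral>\<omega>. (rt (lam (idx j \<omega>)) k)\<^sup>2 * (\<xi> k (time n (Suc j)) \<omega> - \<xi> k (time n j) \<omega>)\<^sup>2 \<partial>M)"
      unfolding increment_def power_mult_distrib by (rule nn_integral_eq_integral[OF *(1)]) auto
    also have "\<dots> = ennreal (\<integral>\<omega>. (rt (lam (idx j \<omega>)) k)\<^sup>2 \<partial>M) * ennreal (h n)"
      unfolding *(2) using h_pos[of n] by (simp add: time_Suc ennreal_mult')
    also have "ennreal (\<integral>\<omega>. (rt (lam (idx j \<omega>)) k)\<^sup>2 \<partial>M) = (\<integral>\<^sup>+ \<omega>. ennreal ((rt (lam (idx j \<omega>)) k)\<^sup>2) \<partial>M)"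
      by (rule nn_integral_eq_integral[OF i, symmetric]) auto
    finally show ?thesis .
  qed
  have "(\<Sum>k. \<integral>\<^sup>+ \<omega>. ennreal ((rt (lam (idx j \<omega>)) k * increment n j \<omega> k)\<^sup>2) \<partial>M) =
     (\<Sum>k. \<integral>\<^sup>+ \<omega>. ennreal ((rt (lam (idx j \<omega>)) k)\<^sup>2) \<partial>M) * ennreal (h n)"
    unfolding eq by simp
  also have "(\<Sum>k. \<integral>\<^sup>+ \<omega>. ennreal ((rt (lam (idx j \<omega>)) k)\<^sup>2) \<partial>M) = (\<integral>\<^sup>+ \<omega>. (\<Sum>k. ennreal ((rt (lam (idx j \<omega>)) k)\<^sup>2)) \<partial>M)"
    using mM by (intro nn_integral_suminf[symmetric] measurable_compose[OF _ measurable_ennreal])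
  also have "\<dots> \<le> (\<integral>\<^sup>+ \<omega>. ennreal C \<partial>M)"
    by (intro nn_integral_mono rt_sum lam)
  also have "\<dots> = ennreal C" by (simp add: emeasure_space_1)
  finally have "(\<Sum>k. \<integral>\<^sup>+ \<omega>. ennreal ((rt (lam (idx j \<omega>)) k * increment n j \<omega> k)\<^sup>2) \<partial>M) \<le> ennreal C * ennreal (h n)"
    by (simp add: mult_right_mono)
  moreover have "ennreal C * ennreal (h n) \<noteq> \<top>" by (simp add: ennreal_mult_eq_top_iff)
  ultimately show ?thesis by (metis neq_top_trans)
qed

lemma increment_measurable: "(\<lambda>\<omega>. increment n j \<omega> k) \<in> borel_measurable M"
  unfolding increment_def by (intro measurable_increment) auto

text \<open>Collecting the noise of all steps coordinatewise exchanges a finite sum with the series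
  over k. This uses convergence of each jump series, which is known almost surely.\<close>

lemma walk_AE:
  assumes idx: "grid_adapted n idx" and N: "time n N \<le> t"
  shows "AE \<omega> in M. walk n idx N \<omega> = (\<Sum>j<N. h n *\<^sub>R fst (lam (idx j \<omega>))) +
    ser e (\<lambda>k. elementary_integral (\<xi> k) N (time n) (grid_coeff idx k) t \<omega>)"
proof -
  have "(\<lambda>\<omega>. rt (lam (idx j \<omega>)) k * increment n j \<omega> k) \<in> borel_measurable M" for j k
    by (intro borel_measurable_times increment_measurable measurable_F[OF adapted_compose[OF idx order_refl] time_nonneg])
  from AE_suminf_finite[OF this increment_coeff_moment2[OF idx]]
  have "AE \<omega> in M. \<forall>j. (\<Sum>k. ennreal ((rt (lam (idx j \<omega>)) k * increment n j \<omega> k)\<^sup>2)) \<noteq> \<top>"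
    by (simp add: AE_all_countable)
  then show ?thesis
  proof eventually_elim
    case (elim \<omega>)
    have "elementary_integral (\<xi> k) N (time n) (grid_coeff idx k) t \<omega> = (\<Sum>j<N. rt (lam (idx j \<omega>)) k * increment n j \<omega> k)" for k
      unfolding elementary_integral_def increment_def
    proof (intro sum.cong refl)
      fix j assume "j \<in> {..<N}"
      then have "time n (Suc j) \<le> t" "time n j \<le> t" using N time_mono[of "Suc j" N n] time_mono[of j N n] by auto
      then show "grid_coeff idx k j \<omega> * (\<xi> k (min t (time n (Suc j))) \<omega> - \<xi> k (min t (time n j)) \<omega>) =
        rt (lam (idx j \<omega>)) k * (\<xi> k (time n (Suc j)) \<omega> - \<xi> k (time n j) \<omega>)" by (simp add: min_absorb2)
    qed
    then have "ser e (\<lambda>k. elementary_integral (\<xi> k) N (time n) (grid_coeff idx k) t \<omega>) =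
      (\<Sum>k. \<Sum>j<N. (rt (lam (idx j \<omega>)) k * increment n j \<omega> k) *\<^sub>R e k)"
      unfolding ser_def by (simp add: scaleR_sum_left)
    also have "\<dots> = (\<Sum>j<N. \<Sum>k. (rt (lam (idx j \<omega>)) k * increment n j \<omega> k) *\<^sub>R e k)"
      using elim by (intro suminf_sum ser_summable[OF basis]) auto
    finally show ?case
      unfolding walk_def jump_def sum.distrib ser_def by simp
  qed
qed

text \<open>The drift of the walk is the time integral of the grid control up to the last full step.
  The squared norm of the integrand of the difference is at most \<open>dd\<close> before that time
  and at most C^2 after it.\<close>

lemma drift_diff:
  assumes \<alpha>: "\<alpha> \<in> controls M F \<Lambda>" and idx: "grid_adapted n idx" and N: "time n N \<le> t" and \<omega>: "\<omega> \<in> space M"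
  shows "ennreal ((norm (drift \<alpha> t \<omega> - (\<Sum>j<N. h n *\<^sub>R fst (lam (idx j \<omega>)))))\<^sup>2) \<le>
    ennreal t * (\<integral>\<^sup>+ s. ennreal (dd (\<alpha> (\<omega>, s)) (grid_control n idx (\<omega>, s))) * indicator (space M \<times> {0<..t}) (\<omega>, s)
      + ennreal (C\<^sup>2) * indicator {time n N<..t} s \<partial>lborel)"
proof -
  let ?\<beta> = "grid_control n idx"
  note \<beta> = grid_control_controls[OF idx]
  have t: "0 \<le> t" using N time_nonneg[of n N] by linarith
  define d where "d s = indicator {0<..t} s *\<^sub>R fst (\<alpha> (\<omega>, s)) - indicator {0<..time n N} s *\<^sub>R fst (?\<beta> (\<omega>, s))" for s
  have i1: "integrable lborel (\<lambda>s. indicator {0<..t} s *\<^sub>R fst (\<alpha> (\<omega>, s)))"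
    by (rule drift_section[OF \<alpha> \<omega>, of _ t]) auto
  have i2: "integrable lborel (\<lambda>s. indicator {0<..time n N} s *\<^sub>R fst (?\<beta> (\<omega>, s)))"
    by (rule drift_section[OF \<beta> \<omega>, of _ t]) (use N in auto)
  have di: "integrable lborel d" unfolding d_def using i1 i2 by (rule Bochner_Integration.integrable_diff)
  have e1: "drift \<alpha> t \<omega> = (\<integral>s. indicator {0<..t} s *\<^sub>R fst (\<alpha> (\<omega>, s)) \<partial>lborel)"
    unfolding drift_def set_lebesgue_integral_def
  proof (rule integral_cong_AE)
    show "(\<lambda>s. indicator {0..t} s *\<^sub>R fst (\<alpha> (\<omega>, s))) \<in> borel_measurable lborel"
      using drift_section[OF \<alpha> \<omega>, of "{0..t}" t] by auto
    show "AE s in lborel. indicator {0..t} s *\<^sub>R fst (\<alpha> (\<omega>, s)) = indicator {0<..t} s *\<^sub>R fst (\<alpha> (\<omega>, s))"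
      using AE_lborel_singleton[of 0] by eventually_elim (auto simp: indicator_def)
  qed (use i1 in auto)
  have e2: "(\<integral>s. indicator {0<..time n N} s *\<^sub>R fst (?\<beta> (\<omega>, s)) \<partial>lborel) = (\<Sum>j<N. h n *\<^sub>R fst (lam (idx j \<omega>)))"
  proof -
    have st: "indicator {0<..time n N} s *\<^sub>R fst (?\<beta> (\<omega>, s)) =
      (\<Sum>j<N. indicator {time n j<..time n (Suc j)} s *\<^sub>R fst (lam (idx j \<omega>)))" for s
    proof (cases "0 < s")
      case True
      show ?thesis unfolding sum_cells[OF True] using True by (simp add: grid_control_def)
    next
      case False
      then have "indicator {time n j<..time n (Suc j)} s = (0 :: real)" for j
        using time_nonneg[of n j] by (auto simp: indicator_def simp del: time_nonneg)
      then show ?thesis using False by simp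
    qed
    have iv: "(\<integral>s. indicator {time n j<..time n (Suc j)} s *\<^sub>R v \<partial>lborel) = h n *\<^sub>R v" for j and v :: 'a
      using h_pos[of n] by (subst integral_scaleR_left) (auto simp: time_Suc)
    have "(\<integral>s. (\<Sum>j<N. indicator {time n j<..time n (Suc j)} s *\<^sub>R fst (lam (idx j \<omega>))) \<partial>lborel) =
      (\<Sum>j<N. \<integral>s. indicator {time n j<..time n (Suc j)} s *\<^sub>R fst (lam (idx j \<omega>)) \<partial>lborel)"
      by (intro Bochner_Integration.integral_sum integrable_scaleR_left integrable_indicator_Ioc)
    then show ?thesis unfolding st iv .
  qed
  have eqd: "drift \<alpha> t \<omega> - (\<Sum>j<N. h n *\<^sub>R fst (lam (idx j \<omega>))) = (\<integral>s. d s \<partial>lborel)"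
    unfolding d_def e1 e2[symmetric] using i1 i2 by (rule Bochner_Integration.integral_diff[symmetric])
  have z: "d s = 0" if "s \<notin> {0<..t}" for s
    using that N by (auto simp: d_def indicator_def)
  have "ennreal ((norm (drift \<alpha> t \<omega> - (\<Sum>j<N. h n *\<^sub>R fst (lam (idx j \<omega>)))))\<^sup>2) \<le>
     ennreal t * (\<integral>\<^sup>+ s. ennreal ((norm (d s))\<^sup>2) \<partial>lborel)"
    unfolding eqd by (rule norm_integral_square_le[OF di z t])
  also have "\<dots> \<le> ennreal t * (\<integral>\<^sup>+ s. ennreal (dd (\<alpha> (\<omega>, s)) (?\<beta> (\<omega>, s))) * indicator (space M \<times> {0<..t}) (\<omega>, s)
      + ennreal (C\<^sup>2) * indicator {time n N<..t} s \<partial>lborel)"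
  proof (intro mult_left_mono nn_integral_mono)
    fix s :: real
    consider "s \<notin> {0<..t}" | "0 < s" "s \<le> t" "s \<le> time n N" | "0 < s" "s \<le> t" "time n N < s" by fastforce
    then show "ennreal ((norm (d s))\<^sup>2) \<le> ennreal (dd (\<alpha> (\<omega>, s)) (?\<beta> (\<omega>, s))) * indicator (space M \<times> {0<..t}) (\<omega>, s)
      + ennreal (C\<^sup>2) * indicator {time n N<..t} s"
    proof cases
      case 1
      then have "d s = 0" using N by (auto simp: d_def indicator_def)
      then show ?thesis by simp
    next
      case 2
      then have "ennreal ((norm (d s))\<^sup>2) \<le> ennreal (dd (\<alpha> (\<omega>, s)) (?\<beta> (\<omega>, s)))"
        by (intro ennreal_leI) (simp add: d_def dd_def)
      then show ?thesis using 2 \<omega> by simp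
    next
      case 3
      then have "norm (d s) \<le> C" using drift_bound[OF control_in[OF \<alpha> \<omega>, of s]] by (simp add: d_def)
      then have "ennreal ((norm (d s))\<^sup>2) \<le> ennreal (C\<^sup>2)" by (intro ennreal_leI power_mono) auto
      then show ?thesis using 3 \<omega> by (simp add: add_increasing)
    qed
  qed simp
  finally show ?thesis .
qed

text \<open>The outer factors 2 come from splitting into drift and noise; t is the Cauchy-Schwarz
  factor of the drift and 16 the stability constant of the noise; 1 + C^2 and 1 + C merge the
  distance of the controls with the incomplete step.\<close>

definition K_walk :: "real \<Rightarrow> real" where
  "K_walk t = 2 * (t * (1 + C\<^sup>2)) + 2 * (16 * (1 + C))"

lemma K_walk_pos: assumes "0 \<le> t" shows "0 < K_walk t"
proof -
  have "0 \<le> 2 * (t * (1 + C\<^sup>2))" "0 < 2 * (16 * (1 + C))" using assms C_nonneg by simp_all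
  then show ?thesis unfolding K_walk_def by linarith
qed

text \<open>The control and the grid index are not related to each other here, which lets the
  estimate be used twice: for an arbitrary control against an approximating walk, and for the
  control of a walk against that same walk.\<close>

lemma state_walk_dist:
  assumes \<alpha>: "\<alpha> \<in> controls M F \<Lambda>" and idx: "grid_adapted n idx" and N: "time n N \<le> t"
  shows "(\<integral>\<^sup>+ \<omega>. ennreal ((norm (state \<alpha> t \<omega> - walk n idx N \<omega>))\<^sup>2) \<partial>M) \<le>
    ennreal (K_walk t) * (mean_dd t \<alpha> (grid_control n idx) + ennreal (t - time n N))"
proof -
  let ?\<beta> = "grid_control n idx"
  let ?D = "mean_dd t \<alpha> ?\<beta>" and ?r = "ennreal (t - time n N)"
  let ?b = "\<lambda>\<omega>. \<Sum>j<N. h n *\<^sub>R fst (lam (idx j \<omega>))"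
  let ?I = "\<lambda>k. elementary_integral (\<xi> k) N (time n) (grid_coeff idx k) t"
  note \<beta> = grid_control_controls[OF idx]
  have t: "0 \<le> t" using N time_nonneg[of n N] by linarith
  have [measurable]: "?I k \<in> borel_measurable M" for k
    by (rule elementary_integral_measurable[OF elementary_grid[OF idx] t])
  have [measurable]: "noise \<alpha> t k \<in> borel_measurable M" for k by (rule noise_measurable[OF \<alpha> t])
  have [measurable]: "drift \<alpha> t \<in> borel_measurable M" by (rule drift_measurable[OF \<alpha>])
  have [measurable]: "?b \<in> borel_measurable M"
    by (intro borel_measurable_sum borel_measurable_scaleR borel_measurable_const measurable_F[OF adapted_compose[OF idx order_refl] time_nonneg])
  have [measurable]: "(\<lambda>\<omega>. ser e (\<lambda>k. noise \<alpha> t k \<omega>)) \<in> borel_measurable M" "(\<lambda>\<omega>. ser e (\<lambda>k. ?I k \<omega>)) \<in> borel_measurable M"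
    by (intro borel_measurable_ser, measurable)+
  have 1: "(\<integral>\<^sup>+ \<omega>. ennreal ((norm (drift \<alpha> t \<omega> - ?b \<omega>))\<^sup>2) \<partial>M) \<le> ennreal t * (?D + ennreal (C\<^sup>2) * ?r)"
  proof -
    let ?g = "\<lambda>p. ennreal (dd (\<alpha> p) (?\<beta> p)) * indicator (space M \<times> {0<..t}) p + ennreal (C\<^sup>2) * indicator (space M \<times> {time n N<..t}) p"
    have gm: "?g \<in> borel_measurable MT" using dd_window_measurable[OF \<alpha> \<beta>, of t] by measurable
    have "(\<integral>\<^sup>+ \<omega>. ennreal ((norm (drift \<alpha> t \<omega> - ?b \<omega>))\<^sup>2) \<partial>M) \<le> (\<integral>\<^sup>+ \<omega>. ennreal t * (\<integral>\<^sup>+ s. ?g (\<omega>, s) \<partial>lborel) \<partial>M)"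
    proof (rule nn_integral_mono)
      fix \<omega> assume \<omega>: "\<omega> \<in> space M"
      then have i: "(indicator (space M \<times> {time n N<..t}) (\<omega>, s) :: ennreal) = indicator {time n N<..t} s" for s
        by (auto simp: indicator_def)
      show "ennreal ((norm (drift \<alpha> t \<omega> - ?b \<omega>))\<^sup>2) \<le> ennreal t * (\<integral>\<^sup>+ s. ?g (\<omega>, s) \<partial>lborel)"
        unfolding i by (rule drift_diff[OF \<alpha> idx N \<omega>])
    qed
    also have "\<dots> = ennreal t * (\<integral>\<^sup>+ p. ?g p \<partial>MT)"
      using lborel.nn_integral_fst[OF gm] by (subst nn_integral_cmult[OF lborel.borel_measurable_nn_integral_fst[OF gm]]) simp
    also have "(\<integral>\<^sup>+ p. ?g p \<partial>MT) = ?D + ennreal (C\<^sup>2) * emeasure MT (space M \<times> {time n N<..t})"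
      unfolding mean_dd_def using dd_window_measurable[OF \<alpha> \<beta>, of t]
      by (subst nn_integral_add) (auto simp: nn_integral_cmult_indicator)
    finally show ?thesis using N by (simp add: emeasure_window')
  qed
  have 2: "(\<integral>\<^sup>+ \<omega>. ennreal ((norm (ser e (\<lambda>k. noise \<alpha> t k \<omega>) - ser e (\<lambda>k. ?I k \<omega>)))\<^sup>2) \<partial>M) \<le> 16 * (?D + ennreal C * ?r)"
  proof -
    have "(\<integral>\<^sup>+ \<omega>. ennreal ((norm (ser e (\<lambda>k. noise \<alpha> t k \<omega>) - ser e (\<lambda>k. ?I k \<omega>)))\<^sup>2) \<partial>M) \<le> (\<Sum>k. msd M (noise \<alpha> t k) (?I k))"
    proof (rule ser_msd[OF basis])
      show "(\<Sum>k. \<integral>\<^sup>+ \<omega>. ennreal ((noise \<alpha> t k \<omega>)\<^sup>2) \<partial>M) \<noteq> \<top>"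
        by (rule neq_top_trans[OF ennreal_neq_top noise_moment2[OF \<alpha> t]])
      show "(\<Sum>k. \<integral>\<^sup>+ \<omega>. ennreal ((?I k \<omega>)\<^sup>2) \<partial>M) \<noteq> \<top>"
        by (rule neq_top_trans[OF ennreal_neq_top grid_noise_moment2[OF idx t]])
    qed measurable
    also have "\<dots> \<le> (\<Sum>k. 16 * msd MT (cut t (rt_process \<alpha> k)) (cut t (elementary_value N (time n) (grid_coeff idx k))))"
      by (intro suminf_le ito_integral_stable[OF t cut_rt_measurable[OF \<alpha>] elementary_value_measurable[OF elementary_grid[OF idx]]
          has_ito_noise[OF \<alpha> t] has_ito_integral_elementary[OF elementary_grid[OF idx] t]]) auto
    also have "\<dots> = 16 * (\<Sum>k. msd MT (cut t (elementary_value N (time n) (grid_coeff idx k))) (cut t (rt_process \<alpha> k)))"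
      by (simp add: ennreal_suminf_cmult msd_commute[of MT "cut t (rt_process \<alpha> _)"])
    also have "\<dots> \<le> 16 * (?D + ennreal (C * (t - time n N)))"
      by (intro mult_left_mono grid_msd[OF \<alpha> idx N]) simp
    finally show ?thesis using C_nonneg N by (simp add: ennreal_mult')
  qed
  have "(\<integral>\<^sup>+ \<omega>. ennreal ((norm (state \<alpha> t \<omega> - walk n idx N \<omega>))\<^sup>2) \<partial>M) \<le>
     (\<integral>\<^sup>+ \<omega>. 2 * ennreal ((norm (drift \<alpha> t \<omega> - ?b \<omega>))\<^sup>2) + 2 * ennreal ((norm (ser e (\<lambda>k. noise \<alpha> t k \<omega>) - ser e (\<lambda>k. ?I k \<omega>)))\<^sup>2) \<partial>M)"
  proof (rule nn_integral_mono_AE)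
    show "AE \<omega> in M. ennreal ((norm (state \<alpha> t \<omega> - walk n idx N \<omega>))\<^sup>2) \<le>
      2 * ennreal ((norm (drift \<alpha> t \<omega> - ?b \<omega>))\<^sup>2) + 2 * ennreal ((norm (ser e (\<lambda>k. noise \<alpha> t k \<omega>) - ser e (\<lambda>k. ?I k \<omega>)))\<^sup>2)"
      using walk_AE[OF idx N]
    proof eventually_elim
      case (elim \<omega>)
      have "state \<alpha> t \<omega> - walk n idx N \<omega> = (drift \<alpha> t \<omega> - ?b \<omega>) + (ser e (\<lambda>k. noise \<alpha> t k \<omega>) - ser e (\<lambda>k. ?I k \<omega>))"
        unfolding elim state_def by simp
      then have "(norm (state \<alpha> t \<omega> - walk n idx N \<omega>))\<^sup>2 \<le> 2 * (norm (drift \<alpha> t \<omega> - ?b \<omega>))\<^sup>2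
        + 2 * (norm (ser e (\<lambda>k. noise \<alpha> t k \<omega>) - ser e (\<lambda>k. ?I k \<omega>)))\<^sup>2"
        by (simp only: norm_add_square_le)
      then have "ennreal ((norm (state \<alpha> t \<omega> - walk n idx N \<omega>))\<^sup>2) \<le> ennreal (2 * (norm (drift \<alpha> t \<omega> - ?b \<omega>))\<^sup>2
        + 2 * (norm (ser e (\<lambda>k. noise \<alpha> t k \<omega>) - ser e (\<lambda>k. ?I k \<omega>)))\<^sup>2)"
        by (rule ennreal_leI)
      then show ?case by (simp add: ennreal_plus ennreal_mult')
    qed
  qed
  also have "\<dots> = 2 * (\<integral>\<^sup>+ \<omega>. ennreal ((norm (drift \<alpha> t \<omega> - ?b \<omega>))\<^sup>2) \<partial>M)
     + 2 * (\<integral>\<^sup>+ \<omega>. ennreal ((norm (ser e (\<lambda>k. noise \<alpha> t k \<omega>) - ser e (\<lambda>k. ?I k \<omega>)))\<^sup>2) \<partial>M)"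
    by (subst nn_integral_add) (auto simp: nn_integral_cmult)
  also have "\<dots> \<le> 2 * (ennreal t * (?D + ennreal (C\<^sup>2) * ?r)) + 2 * (16 * (?D + ennreal C * ?r))"
    by (intro add_mono mult_left_mono 1 2) auto
  \<comment> \<open>The inequality D + c r \<le> (1 + c) (D + r) gathers both errors in one sum at
    the price of larger constants.\<close>
  also have "\<dots> \<le> 2 * (ennreal t * (ennreal (1 + C\<^sup>2) * (?D + ?r))) + 2 * (16 * (ennreal (1 + C) * (?D + ?r)))"
  proof -
    have "?D + ennreal c * ?r \<le> ennreal (1 + c) * (?D + ?r)" if "0 \<le> c" for c
    proof -
      have "?D + ennreal c * ?r \<le> (1 + ennreal c) * ?D + (1 + ennreal c) * ?r"
        by (intro add_mono) (simp_all add: distrib_right)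
      then show ?thesis using that by (simp add: distrib_left ennreal_plus)
    qed
    then show ?thesis using C_nonneg by (intro add_mono mult_left_mono) auto
  qed
  also have "\<dots> = ennreal (K_walk t) * (?D + ?r)"
  proof -
    have "ennreal (2 * (t * a) + 2 * (16 * b)) = 2 * (ennreal t * ennreal a) + 2 * (16 * ennreal b)"
      if "0 \<le> a" "0 \<le> b" for a b
      using that t by (simp add: ennreal_plus ennreal_mult')
    from this[of "1 + C\<^sup>2" "1 + C"]
    have "ennreal (K_walk t) = 2 * (ennreal t * ennreal (1 + C\<^sup>2)) + 2 * (16 * ennreal (1 + C))"
      unfolding K_walk_def using C_nonneg by simp
    then show ?thesis by (simp add: distrib_right mult.assoc)
  qed
  finally show ?thesis .
qed

lemma drift_norm:
  assumes \<alpha>: "\<alpha> \<in> controls M F \<Lambda>" and t: "0 \<le> t" and \<omega>: "\<omega> \<in> space M"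
  shows "norm (drift \<alpha> t \<omega>) \<le> C * t"
proof -
  have i: "integrable lborel (\<lambda>s. indicator {0..t} s *\<^sub>R fst (\<alpha> (\<omega>, s)))"
    by (rule drift_section[OF \<alpha> \<omega>, of _ t]) auto
  have "norm (drift \<alpha> t \<omega>) \<le> (\<integral>s. norm (indicator {0..t} s *\<^sub>R fst (\<alpha> (\<omega>, s))) \<partial>lborel)"
    unfolding drift_def set_lebesgue_integral_def by (rule Bochner_Integration.integral_norm_bound)
  also have "\<dots> \<le> (\<integral>s. indicator {0..t} s *\<^sub>R C \<partial>lborel)"
  proof (rule Bochner_Integration.integral_mono[OF integrable_norm[OF i]])
    show "integrable lborel (\<lambda>s. indicator {0..t} s *\<^sub>R C)"
      using t by (intro integrable_scaleR_left integrable_real_indicator) auto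
    show "norm (indicator {0..t} s *\<^sub>R fst (\<alpha> (\<omega>, s))) \<le> indicator {0..t} s *\<^sub>R C" for s
      using drift_bound[OF control_in[OF \<alpha> \<omega>, of s]] by (cases "s \<in> {0..t}") auto
  qed
  also have "\<dots> = C * t" using t by simp
  finally show ?thesis .
qed

definition K_state :: "real \<Rightarrow> real" where
  "K_state t = 2 * (C * t)\<^sup>2 + 2 * (16 * (C * t))"

lemma K_state_nonneg: "0 \<le> t \<Longrightarrow> 0 \<le> K_state t"
  using C_nonneg by (simp add: K_state_def)

text \<open>The drift is bounded by C t pathwise and the noise has second moment at most 16 C t;
  neither bound depends on the control.\<close>

lemma state_moment2:
  assumes \<alpha>: "\<alpha> \<in> controls M F \<Lambda>" and t: "0 \<le> t"
  shows "(\<integral>\<^sup>+ \<omega>. ennreal ((norm (state \<alpha> t \<omega>))\<^sup>2) \<partial>M) \<le> ennreal (K_state t)"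
proof -
  have [measurable]: "noise \<alpha> t k \<in> borel_measurable M" for k by (rule noise_measurable[OF \<alpha> t])
  have "(\<integral>\<^sup>+ \<omega>. ennreal ((norm (state \<alpha> t \<omega>))\<^sup>2) \<partial>M) \<le> (\<integral>\<^sup>+ \<omega>. ennreal (2 * (C * t)\<^sup>2) + 2 * (\<Sum>k. ennreal ((noise \<alpha> t k \<omega>)\<^sup>2)) \<partial>M)"
  proof (rule nn_integral_mono)
    fix \<omega> assume \<omega>: "\<omega> \<in> space M"
    have "(norm (state \<alpha> t \<omega>))\<^sup>2 \<le> 2 * (norm (drift \<alpha> t \<omega>))\<^sup>2 + 2 * (norm (ser e (\<lambda>k. noise \<alpha> t k \<omega>)))\<^sup>2"
      unfolding state_def by (rule norm_add_square_le)
    also have "\<dots> \<le> 2 * (C * t)\<^sup>2 + 2 * (norm (ser e (\<lambda>k. noise \<alpha> t k \<omega>)))\<^sup>2"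
      using drift_norm[OF \<alpha> t \<omega>] by (intro add_mono mult_left_mono power_mono) auto
    finally have "ennreal ((norm (state \<alpha> t \<omega>))\<^sup>2) \<le> ennreal (2 * (C * t)\<^sup>2 + 2 * (norm (ser e (\<lambda>k. noise \<alpha> t k \<omega>)))\<^sup>2)"
      by (rule ennreal_leI)
    also have "\<dots> = ennreal (2 * (C * t)\<^sup>2) + 2 * ennreal ((norm (ser e (\<lambda>k. noise \<alpha> t k \<omega>)))\<^sup>2)"
      by (subst ennreal_plus) (auto simp: ennreal_mult')
    also have "\<dots> \<le> ennreal (2 * (C * t)\<^sup>2) + 2 * (\<Sum>k. ennreal ((noise \<alpha> t k \<omega>)\<^sup>2))"
      by (intro add_left_mono mult_left_mono ser_norm_le[OF basis]) simp
    finally show "ennreal ((norm (state \<alpha> t \<omega>))\<^sup>2) \<le> \<dots>" .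
  qed
  also have "\<dots> = ennreal (2 * (C * t)\<^sup>2) + 2 * (\<Sum>k. \<integral>\<^sup>+ \<omega>. ennreal ((noise \<alpha> t k \<omega>)\<^sup>2) \<partial>M)"
    by (subst nn_integral_add, simp, simp, subst nn_integral_cmult, simp, subst nn_integral_suminf)
      (auto simp: emeasure_space_1)
  also have "\<dots> \<le> ennreal (2 * (C * t)\<^sup>2) + 2 * ennreal (16 * (C * t))"
    by (intro add_left_mono mult_left_mono noise_moment2[OF \<alpha> t]) simp
  also have "\<dots> = ennreal (K_state t)"
    unfolding K_state_def using C_nonneg t by (subst ennreal_plus) (auto simp: ennreal_mult')
  finally show ?thesis .
qed

end

section \<open>Dynamic programming on a grid\<close>

text \<open>The function class of the induction over steps. Balls of an infinite-dimensional space
  are not compact, so uniform continuity on them is stronger than continuity; it provides a modulus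
  that survives the supremum over controls in \<open>I_op\<close>.\<close>

definition ucb :: "('a::real_normed_vector \<Rightarrow> real) \<Rightarrow> bool" where
  "ucb f \<longleftrightarrow> (\<exists>c. \<forall>x. \<bar>f x\<bar> \<le> c) \<and> (\<forall>R. uniformly_continuous_on (cball 0 R) f)"

lemma ucb_continuous: "ucb f \<Longrightarrow> continuous_on UNIV f"
proof -
  assume f: "ucb f"
  have "isCont f x" for x
  proof -
    have "continuous_on (ball 0 (norm x + 1)) f"
      using f by (intro continuous_on_subset[OF uniformly_continuous_imp_continuous[of "cball 0 (norm x + 1)" f]])
        (auto simp: ucb_def)
    then show ?thesis by (simp add: continuous_on_eq_continuous_at)
  qed
  then show ?thesis by (simp add: continuous_at_imp_continuous_on)
qed

lemma ucb_borel: "ucb f \<Longrightarrow> f \<in> borel_measurable borel"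
  by (intro borel_measurable_continuous_onI ucb_continuous)

lemma ucb_bound: assumes "ucb f" obtains c where "0 \<le> c" "\<And>x. \<bar>f x\<bar> \<le> c"
proof -
  obtain c where c: "\<And>x. \<bar>f x\<bar> \<le> c" using assms by (auto simp: ucb_def)
  have "0 \<le> c" using c[of 0] by linarith
  then show ?thesis using c that by blast
qed

lemma ucbI:
  fixes f :: "'a::real_normed_vector \<Rightarrow> real"
  assumes "\<And>x. \<bar>f x\<bar> \<le> c"
    and "\<And>R \<epsilon>. 0 < \<epsilon> \<Longrightarrow> \<exists>\<eta>>0. \<forall>x y. norm x \<le> R \<longrightarrow> norm (y - x) < \<eta> \<longrightarrow> \<bar>f x - f y\<bar> \<le> \<epsilon>"
  shows "ucb f"
  unfolding ucb_def uniformly_continuous_on_def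
proof (intro conjI allI impI)
  show "\<exists>c. \<forall>x. \<bar>f x\<bar> \<le> c" using assms(1) by blast
  fix R \<epsilon> :: real assume "0 < \<epsilon>"
  then obtain \<eta> where \<eta>: "\<eta> > 0" "\<And>x y. norm x \<le> R \<Longrightarrow> norm (y - x) < \<eta> \<Longrightarrow> \<bar>f x - f y\<bar> \<le> \<epsilon> / 2"
    using assms(2)[of "\<epsilon> / 2" R] by auto
  show "\<exists>d>0. \<forall>x\<in>cball 0 R. \<forall>x'\<in>cball 0 R. dist x' x < d \<longrightarrow> dist (f x') (f x) < \<epsilon>"
  proof (intro exI[of _ \<eta>] conjI ballI impI \<eta>(1))
    fix x x' :: 'a assume "x \<in> cball 0 R" "x' \<in> cball 0 R" "dist x' x < \<eta>"
    then have "\<bar>f x - f x'\<bar> \<le> \<epsilon> / 2" by (intro \<eta>(2)) (auto simp: dist_norm)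
    then show "dist (f x') (f x) < \<epsilon>" using \<open>0 < \<epsilon>\<close> by (simp add: dist_real_def abs_minus_commute)
  qed
qed

text \<open>A pathwise Chebyshev estimate: it gives bounds on differences of expectations that depend
  on second moments only, hence uniformly in the control.\<close>

lemma ucb_modulus:
  fixes f :: "'a::real_normed_vector \<Rightarrow> real"
  assumes f: "ucb f" and \<epsilon>: "0 < \<epsilon>"
  shows "\<exists>b\<ge>0. \<forall>x X X'. norm x \<le> R \<longrightarrow>
    \<bar>f (x + X) - f (x + X')\<bar> \<le> \<epsilon> + \<epsilon> * (norm X)\<^sup>2 + b * (norm (X' - X))\<^sup>2"
proof -
  obtain c where c: "0 \<le> c" "\<And>x. \<bar>f x\<bar> \<le> c" using ucb_bound[OF f] by blast
  have c2: "\<bar>f x - f y\<bar> \<le> 2 * c" for x y using c(2)[of x] c(2)[of y] by linarith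
  \<comment> \<open>From radius r on, \<epsilon> |X|^2 is at least 2 c, the largest possible
    difference of two values of f. Below, b is chosen so that b |X' - X|^2 is at least 2 c as soon
    as |X' - X| \<ge> \<eta>.\<close>
  define r where "r = sqrt (2 * c / \<epsilon>)"
  have r: "0 \<le> r" "\<epsilon> * r\<^sup>2 = 2 * c" using c \<epsilon> by (auto simp: r_def)
  have "uniformly_continuous_on (cball 0 (R + r + 1)) f" using f by (simp add: ucb_def)
  then obtain \<eta>0 where \<eta>0: "\<eta>0 > 0" "\<And>x y. x \<in> cball 0 (R + r + 1) \<Longrightarrow> y \<in> cball 0 (R + r + 1) \<Longrightarrow> dist y x < \<eta>0 \<Longrightarrow> dist (f y) (f x) < \<epsilon>"
    using \<epsilon> unfolding uniformly_continuous_on_def by meson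
  \<comment> \<open>The cap at 1 keeps the perturbed point in the ball of radius R + r + 1 on which
    uniform continuity was invoked.\<close>
  define \<eta> where "\<eta> = min \<eta>0 1"
  have \<eta>: "0 < \<eta>" "\<eta> \<le> 1" "\<eta> \<le> \<eta>0" using \<eta>0 by (auto simp: \<eta>_def)
  define b where "b = 2 * c / \<eta>\<^sup>2"
  have b: "0 \<le> b" "b * \<eta>\<^sup>2 = 2 * c" using c \<eta> by (auto simp: b_def)
  show ?thesis
  proof (intro exI[of _ b] conjI allI impI b(1))
    fix x X X' :: 'a assume x: "norm x \<le> R"
    have nn: "0 \<le> \<epsilon> * (norm X)\<^sup>2" "0 \<le> b * (norm (X' - X))\<^sup>2" using \<epsilon> b by auto
    show "\<bar>f (x + X) - f (x + X')\<bar> \<le> \<epsilon> + \<epsilon> * (norm X)\<^sup>2 + b * (norm (X' - X))\<^sup>2"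
    proof (cases "r < norm X")
      case True
      then have "\<epsilon> * r\<^sup>2 \<le> \<epsilon> * (norm X)\<^sup>2" using \<epsilon> r by (intro mult_left_mono power_mono) auto
      then show ?thesis using c2[of "x + X" "x + X'"] r(2) nn \<epsilon> by linarith
    next
      case F: False
      show ?thesis
      proof (cases "norm (X' - X) < \<eta>")
        case True
        have 1: "norm (x + X) \<le> R + r" using norm_triangle_ineq[of x X] x F by linarith
        have "norm (x + X') \<le> norm (x + X) + norm (X' - X)"
          using norm_triangle_ineq[of "x + X" "X' - X"] by (simp add: algebra_simps)
        then have 2: "norm (x + X') \<le> R + r + 1" using 1 True \<eta> by linarith
        have "x + X \<in> cball 0 (R + r + 1)" "x + X' \<in> cball 0 (R + r + 1)" "dist (x + X') (x + X) < \<eta>0"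
          using 1 2 True \<eta> by (simp_all add: mem_cball_0) (simp add: dist_norm)
        then have "dist (f (x + X')) (f (x + X)) < \<epsilon>" by (rule \<eta>0(2))
        then have "\<bar>f (x + X) - f (x + X')\<bar> < \<epsilon>" by (simp add: dist_real_def abs_minus_commute)
        then show ?thesis using nn by linarith
      next
        case False
        then have "b * \<eta>\<^sup>2 \<le> b * (norm (X' - X))\<^sup>2" using b \<eta> by (intro mult_left_mono power_mono) auto
        then show ?thesis using c2[of "x + X" "x + X'"] b(2) nn \<epsilon> by linarith
      qed
    qed
  qed
qed

text \<open>Integrated form of \<open>ucb_modulus\<close>: the second moment bound K is paid for by
  shrinking \<epsilon>, and the resulting b determines \<delta>. No random variable enters this
  choice, so suprema over controls can be taken afterwards.\<close>

lemma (in prob_space) ucb_expectation_modulus: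
  fixes f :: "'b::{real_normed_vector, second_countable_topology} \<Rightarrow> real"
  assumes f: "ucb f" and \<epsilon>: "0 < \<epsilon>" and K: "0 \<le> K"
  shows "\<exists>\<delta>>0. \<forall>x X X'. norm x \<le> R \<longrightarrow> X \<in> borel_measurable M \<longrightarrow> X' \<in> borel_measurable M \<longrightarrow>
    (\<integral>\<^sup>+ \<omega>. ennreal ((norm (X \<omega>))\<^sup>2) \<partial>M) \<le> ennreal K \<longrightarrow>
    (\<integral>\<^sup>+ \<omega>. ennreal ((norm (X' \<omega> - X \<omega>))\<^sup>2) \<partial>M) \<le> ennreal \<delta> \<longrightarrow>
    \<bar>(\<integral>\<omega>. f (x + X \<omega>) \<partial>M) - (\<integral>\<omega>. f (x + X' \<omega>) \<partial>M)\<bar> \<le> \<epsilon>"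
proof -
  define \<epsilon>' where "\<epsilon>' = \<epsilon> / (2 * (1 + K))"
  have "\<epsilon> / (2 * q) * q = \<epsilon> / 2" if "0 < q" for q using that by simp
  from this[of "1 + K"] have "\<epsilon>' * (1 + K) = \<epsilon> / 2" unfolding \<epsilon>'_def using K by linarith
  then have \<epsilon>': "0 < \<epsilon>'" "\<epsilon>' + \<epsilon>' * K = \<epsilon> / 2" using \<epsilon> K by (simp_all add: \<epsilon>'_def distrib_left)
  obtain b where b: "0 \<le> b" "\<And>x X X'. norm x \<le> R \<Longrightarrow>
    \<bar>f (x + X) - f (x + X')\<bar> \<le> \<epsilon>' + \<epsilon>' * (norm X)\<^sup>2 + b * (norm (X' - X))\<^sup>2"
    using ucb_modulus[OF f \<epsilon>'(1), of R] by blast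
  define \<delta> where "\<delta> = \<epsilon> / (2 * (b + 1))"
  have \<delta>: "0 < \<delta>" "b * \<delta> \<le> \<epsilon> / 2" using \<epsilon> b(1) by (auto simp: \<delta>_def field_simps)
  obtain c where c: "0 \<le> c" "\<And>x. \<bar>f x\<bar> \<le> c" using ucb_bound[OF f] by blast
  show ?thesis
  proof (intro exI[of _ \<delta>] conjI allI impI \<delta>(1))
    fix x :: 'b and X X' :: "'a \<Rightarrow> 'b" assume x: "norm x \<le> R" and X: "X \<in> borel_measurable M" and X': "X' \<in> borel_measurable M"
      and m1: "(\<integral>\<^sup>+ \<omega>. ennreal ((norm (X \<omega>))\<^sup>2) \<partial>M) \<le> ennreal K"
      and m2: "(\<integral>\<^sup>+ \<omega>. ennreal ((norm (X' \<omega> - X \<omega>))\<^sup>2) \<partial>M) \<le> ennreal \<delta>"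
    note [measurable] = X X' ucb_borel[OF f]
    have i: "integrable M (\<lambda>\<omega>. f (x + X \<omega>))" "integrable M (\<lambda>\<omega>. f (x + X' \<omega>))"
      using c by (auto intro!: integrable_const_bound[where B=c])
    have "ennreal \<bar>(\<integral>\<omega>. f (x + X \<omega>) \<partial>M) - (\<integral>\<omega>. f (x + X' \<omega>) \<partial>M)\<bar> = ennreal (norm (\<integral>\<omega>. f (x + X \<omega>) - f (x + X' \<omega>) \<partial>M))"
      using i by simp
    also have "\<dots> \<le> (\<integral>\<^sup>+ \<omega>. ennreal (norm (f (x + X \<omega>) - f (x + X' \<omega>))) \<partial>M)"
      using i by (intro integral_norm_bound_ennreal) auto
    also have "\<dots> \<le> (\<integral>\<^sup>+ \<omega>. ennreal \<epsilon>' + ennreal \<epsilon>' * ennreal ((norm (X \<omega>))\<^sup>2) + ennreal b * ennreal ((norm (X' \<omega> - X \<omega>))\<^sup>2) \<partial>M)"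
    proof (rule nn_integral_mono)
      fix \<omega>
      have "ennreal (norm (f (x + X \<omega>) - f (x + X' \<omega>))) \<le> ennreal (\<epsilon>' + \<epsilon>' * (norm (X \<omega>))\<^sup>2 + b * (norm (X' \<omega> - X \<omega>))\<^sup>2)"
        using b(2)[OF x, of "X \<omega>" "X' \<omega>"] by (intro ennreal_leI) simp
      then show "ennreal (norm (f (x + X \<omega>) - f (x + X' \<omega>))) \<le> ennreal \<epsilon>' + ennreal \<epsilon>' * ennreal ((norm (X \<omega>))\<^sup>2) + ennreal b * ennreal ((norm (X' \<omega> - X \<omega>))\<^sup>2)"
        using \<epsilon>'(1) b(1) by (simp add: ennreal_plus ennreal_mult')
    qed
    also have "\<dots> = ennreal \<epsilon>' + ennreal \<epsilon>' * (\<integral>\<^sup>+ \<omega>. ennreal ((norm (X \<omega>))\<^sup>2) \<partial>M) + ennreal b * (\<integral>\<^sup>+ \<omega>. ennreal ((norm (X' \<omega> - X \<omega>))\<^sup>2) \<partial>M)"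
      by (simp add: nn_integral_add nn_integral_cmult emeasure_space_1)
    also have "\<dots> \<le> ennreal \<epsilon>' + ennreal \<epsilon>' * ennreal K + ennreal b * ennreal \<delta>"
      using m1 m2 by (intro add_mono mult_left_mono) auto
    also have "\<dots> = ennreal (\<epsilon>' + \<epsilon>' * K + b * \<delta>)"
      using \<epsilon>'(1) K b(1) \<delta>(1) by (simp add: ennreal_plus ennreal_mult')
    also have "\<dots> \<le> ennreal \<epsilon>" using \<epsilon>'(2) \<delta>(2) by (intro ennreal_leI) linarith
    finally show "\<bar>(\<integral>\<omega>. f (x + X \<omega>) \<partial>M) - (\<integral>\<omega>. f (x + X' \<omega>) \<partial>M)\<bar> \<le> \<epsilon>" using \<epsilon> by simp
  qed
qed

lemma cSUP_diff_le:
  fixes f g :: "'i \<Rightarrow> real"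
  assumes "A \<noteq> {}" "bdd_above (f ` A)" "bdd_above (g ` A)" "\<And>a. a \<in> A \<Longrightarrow> \<bar>f a - g a\<bar> \<le> \<epsilon>"
  shows "\<bar>(SUP a\<in>A. f a) - (SUP a\<in>A. g a)\<bar> \<le> \<epsilon>"
proof -
  have "(SUP a\<in>A. f a) \<le> (SUP a\<in>A. g a) + \<epsilon>"
  proof (rule cSUP_least[OF assms(1)])
    fix a assume "a \<in> A"
    then show "f a \<le> (SUP a\<in>A. g a) + \<epsilon>"
      using cSUP_upper[OF _ assms(3), of a] assms(4)[of a] by linarith
  qed
  moreover have "(SUP a\<in>A. g a) \<le> (SUP a\<in>A. f a) + \<epsilon>"
  proof (rule cSUP_least[OF assms(1)])
    fix a assume "a \<in> A"
    then show "g a \<le> (SUP a\<in>A. f a) + \<epsilon>"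
      using cSUP_upper[OF _ assms(2), of a] assms(4)[of a] by linarith
  qed
  ultimately show ?thesis by linarith
qed

lemma cSUP_abs_le:
  fixes f :: "'i \<Rightarrow> real"
  assumes "A \<noteq> {}" "\<And>a. a \<in> A \<Longrightarrow> \<bar>f a\<bar> \<le> c"
  shows "bdd_above (f ` A)" "\<bar>SUP a\<in>A. f a\<bar> \<le> c"
proof -
  show bdd: "bdd_above (f ` A)"
    using assms(2) by (intro bdd_aboveI2[of _ _ c]) (auto simp: abs_le_iff)
  obtain a where a: "a \<in> A" using assms(1) by auto
  have "(SUP a\<in>A. f a) \<le> c"
    using assms by (intro cSUP_least) (auto simp: abs_le_iff)
  moreover have "- c \<le> (SUP a\<in>A. f a)"
    using cSUP_upper[OF a bdd] assms(2)[OF a] by (auto simp: abs_le_iff)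
  ultimately show "\<bar>SUP a\<in>A. f a\<bar> \<le> c" by simp
qed

lemma (in prob_space) expectation_abs_le:
  assumes "\<And>\<omega>. \<bar>g \<omega>\<bar> \<le> (c :: real)" "0 \<le> c"
  shows "\<bar>\<integral>\<omega>. g \<omega> \<partial>M\<bar> \<le> c"
proof (cases "g \<in> borel_measurable M")
  case True
  then have i: "integrable M g" using assms by (intro integrable_const_bound[where B=c]) auto
  have "norm (\<integral>\<omega>. g \<omega> \<partial>M) \<le> (\<integral>\<omega>. norm (g \<omega>) \<partial>M)" by (rule Bochner_Integration.integral_norm_bound)
  also have "\<dots> \<le> (\<integral>\<omega>. c \<partial>M)" using i assms by (intro Bochner_Integration.integral_mono) auto
  finally show ?thesis by (simp add: prob_space)
next
  \<comment> \<open>A function that is not integrable has integral 0 by convention, so the bound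
    persists.\<close>
  case False
  then have "\<not> integrable M g" by auto
  then show ?thesis using assms(2) by (simp add: not_integrable_integral_eq)
qed

section \<open>The one-step operator and its iterates\<close>

context control_setup begin

lemma borel_jump: "jump \<delta> l \<in> borel_measurable (Pi\<^sub>M UNIV (\<lambda>_. borel))"
  unfolding jump_def[abs_def]
  by (intro borel_measurable_add borel_measurable_const borel_measurable_ser borel_measurable_times
      measurable_component_singleton) auto

lemma borel_jump_gauss: "jump \<delta> l \<in> borel_measurable (gauss \<delta>)"
  using borel_jump measurable_cong_sets[OF sets_gauss refl] by blast

lemma gauss_coeff:
  assumes "0 < \<delta>"
  shows "(\<integral>\<^sup>+ z. ennreal ((a * z k)\<^sup>2) \<partial>gauss \<delta>) = ennreal (a\<^sup>2) * ennreal \<delta>"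
proof -
  have [measurable]: "(\<lambda>z. z k) \<in> borel_measurable (gauss \<delta>)"
    unfolding measurable_cong_sets[OF sets_gauss refl] by (intro measurable_component_singleton) auto
  show ?thesis
    unfolding power_mult_distrib using gauss_moment2[OF assms, of k]
    by (simp add: ennreal_mult' nn_integral_cmult)
qed

lemma gauss_component: "(\<lambda>z. a * z k) \<in> borel_measurable (gauss \<delta>)"
  unfolding measurable_cong_sets[OF sets_gauss refl]
  by (intro borel_measurable_times borel_measurable_const measurable_component_singleton) auto

lemma gauss_coeff_sum:
  assumes "0 < \<delta>" "l \<in> \<Lambda>"
  shows "(\<Sum>k. \<integral>\<^sup>+ z. ennreal ((rt l k * z k)\<^sup>2) \<partial>gauss \<delta>) \<le> ennreal C * ennreal \<delta>"
  unfolding gauss_coeff[OF assms(1)] using rt_sum[OF assms(2)] by (simp add: mult_right_mono)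

lemma jump_moment2:
  assumes \<delta>: "0 < \<delta>" and l: "l \<in> \<Lambda>"
  shows "(\<integral>\<^sup>+ z. ennreal ((norm (jump \<delta> l z))\<^sup>2) \<partial>gauss \<delta>) \<le> ennreal (2 * (\<delta> * C)\<^sup>2 + 2 * (C * \<delta>))"
proof -
  interpret G: prob_space "gauss \<delta>" by (rule prob_space_gauss[OF \<delta>])
  have [measurable]: "(\<lambda>z. rt l k * z k) \<in> borel_measurable (gauss \<delta>)" for k by (rule gauss_component)
  have "(\<integral>\<^sup>+ z. ennreal ((norm (jump \<delta> l z))\<^sup>2) \<partial>gauss \<delta>) \<le>
     (\<integral>\<^sup>+ z. ennreal (2 * (\<delta> * C)\<^sup>2) + 2 * (\<Sum>k. ennreal ((rt l k * z k)\<^sup>2)) \<partial>gauss \<delta>)"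
  proof (rule nn_integral_mono)
    fix z
    have "(norm (jump \<delta> l z))\<^sup>2 \<le> 2 * (norm (\<delta> *\<^sub>R fst l))\<^sup>2 + 2 * (norm (ser e (\<lambda>k. rt l k * z k)))\<^sup>2"
      unfolding jump_def by (rule norm_add_square_le)
    also have "\<dots> \<le> 2 * (\<delta> * C)\<^sup>2 + 2 * (norm (ser e (\<lambda>k. rt l k * z k)))\<^sup>2"
      using drift_bound[OF l] \<delta> by (intro add_mono mult_left_mono power_mono) auto
    finally have "ennreal ((norm (jump \<delta> l z))\<^sup>2) \<le> ennreal (2 * (\<delta> * C)\<^sup>2 + 2 * (norm (ser e (\<lambda>k. rt l k * z k)))\<^sup>2)"
      by (rule ennreal_leI)
    also have "\<dots> = ennreal (2 * (\<delta> * C)\<^sup>2) + 2 * ennreal ((norm (ser e (\<lambda>k. rt l k * z k)))\<^sup>2)"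
      by (subst ennreal_plus) (auto simp: ennreal_mult')
    also have "\<dots> \<le> ennreal (2 * (\<delta> * C)\<^sup>2) + 2 * (\<Sum>k. ennreal ((rt l k * z k)\<^sup>2))"
      by (intro add_left_mono mult_left_mono ser_norm_le[OF basis]) simp
    finally show "ennreal ((norm (jump \<delta> l z))\<^sup>2) \<le> \<dots>" .
  qed
  also have "\<dots> = ennreal (2 * (\<delta> * C)\<^sup>2) + 2 * (\<Sum>k. \<integral>\<^sup>+ z. ennreal ((rt l k * z k)\<^sup>2) \<partial>gauss \<delta>)"
    by (subst nn_integral_add, simp, simp, subst nn_integral_cmult, simp, subst nn_integral_suminf)
      (auto simp: G.emeasure_space_1)
  also have "\<dots> \<le> ennreal (2 * (\<delta> * C)\<^sup>2) + 2 * (ennreal C * ennreal \<delta>)"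
    by (intro add_left_mono mult_left_mono gauss_coeff_sum[OF \<delta> l]) simp
  also have "\<dots> = ennreal (2 * (\<delta> * C)\<^sup>2 + 2 * (C * \<delta>))"
    using C_nonneg \<delta> by (subst ennreal_plus) (auto simp: ennreal_mult')
  finally show ?thesis .
qed

text \<open>The same noise z drives both jumps, so their difference is linear in the differences of
  drifts and roots; the jump is thus continuous in the control with respect to the distance behind
  \<open>dd\<close>.\<close>

lemma jump_diff_moment2:
  assumes \<delta>: "0 < \<delta>" and l: "l \<in> \<Lambda>" "l' \<in> \<Lambda>"
  shows "(\<integral>\<^sup>+ z. ennreal ((norm (jump \<delta> l' z - jump \<delta> l z))\<^sup>2) \<partial>gauss \<delta>) \<le> ennreal ((2 * \<delta>\<^sup>2 + 2 * \<delta>) * dd l' l)"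
proof -
  interpret G: prob_space "gauss \<delta>" by (rule prob_space_gauss[OF \<delta>])
  let ?s = "\<lambda>l z. ser e (\<lambda>k. rt l k * z k)"
  have [measurable]: "(\<lambda>z. rt l k * z k) \<in> borel_measurable (gauss \<delta>)" for k l by (rule gauss_component)
  have [measurable]: "?s l \<in> borel_measurable (gauss \<delta>)" for l by (intro borel_measurable_ser) measurable
  have fin: "(\<Sum>k. \<integral>\<^sup>+ z. ennreal ((rt l k * z k)\<^sup>2) \<partial>gauss \<delta>) \<noteq> \<top>" if "l \<in> \<Lambda>" for l
  proof (rule neq_top_trans[OF _ gauss_coeff_sum[OF \<delta> that]])
    show "ennreal C * ennreal \<delta> \<noteq> \<top>" by (simp add: ennreal_mult_eq_top_iff)
  qed
  have "(\<integral>\<^sup>+ z. ennreal ((norm (?s l' z - ?s l z))\<^sup>2) \<partial>gauss \<delta>) \<le> (\<Sum>k. msd (gauss \<delta>) (\<lambda>z. rt l' k * z k) (\<lambda>z. rt l k * z k))"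
    by (rule ser_msd[OF basis _ _ fin[OF l(2)] fin[OF l(1)]]) measurable
  also have "\<dots> = (\<Sum>k. ennreal ((rt l' k - rt l k)\<^sup>2) * ennreal \<delta>)"
    unfolding msd_def left_diff_distrib[symmetric] gauss_coeff[OF \<delta>] ..
  also have "\<dots> = ennreal ((norm (sg l' - sg l))\<^sup>2) * ennreal \<delta>"
    using rt_dist[OF l(2,1)] by simp
  finally have s: "(\<integral>\<^sup>+ z. ennreal ((norm (?s l' z - ?s l z))\<^sup>2) \<partial>gauss \<delta>) \<le> ennreal ((norm (sg l' - sg l))\<^sup>2 * \<delta>)"
    by (simp add: ennreal_mult')
  let ?b = "(norm (\<delta> *\<^sub>R (fst l' - fst l)))\<^sup>2"
  have "(\<integral>\<^sup>+ z. ennreal ((norm (jump \<delta> l' z - jump \<delta> l z))\<^sup>2) \<partial>gauss \<delta>) \<le>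
    (\<integral>\<^sup>+ z. ennreal (2 * ?b) + 2 * ennreal ((norm (?s l' z - ?s l z))\<^sup>2) \<partial>gauss \<delta>)"
  proof (rule nn_integral_mono)
    fix z
    have "jump \<delta> l' z - jump \<delta> l z = \<delta> *\<^sub>R (fst l' - fst l) + (?s l' z - ?s l z)"
      by (simp add: jump_def algebra_simps)
    then have "(norm (jump \<delta> l' z - jump \<delta> l z))\<^sup>2 \<le> 2 * ?b + 2 * (norm (?s l' z - ?s l z))\<^sup>2"
      by (simp only: norm_add_square_le)
    then have "ennreal ((norm (jump \<delta> l' z - jump \<delta> l z))\<^sup>2) \<le> ennreal (2 * ?b + 2 * (norm (?s l' z - ?s l z))\<^sup>2)"
      by (rule ennreal_leI)
    then show "ennreal ((norm (jump \<delta> l' z - jump \<delta> l z))\<^sup>2) \<le> ennreal (2 * ?b) + 2 * ennreal ((norm (?s l' z - ?s l z))\<^sup>2)"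
      by (subst (asm) ennreal_plus) (auto simp: ennreal_mult')
  qed
  also have "\<dots> = ennreal (2 * ?b) + 2 * (\<integral>\<^sup>+ z. ennreal ((norm (?s l' z - ?s l z))\<^sup>2) \<partial>gauss \<delta>)"
    by (subst nn_integral_add, simp, simp, subst nn_integral_cmult) (auto simp: G.emeasure_space_1)
  also have "\<dots> \<le> ennreal (2 * ?b) + 2 * ennreal ((norm (sg l' - sg l))\<^sup>2 * \<delta>)"
    by (intro add_left_mono mult_left_mono s) simp
  also have "\<dots> = ennreal (2 * ?b + 2 * ((norm (sg l' - sg l))\<^sup>2 * \<delta>))"
    using \<delta> by (subst ennreal_plus) (auto simp: ennreal_mult')
  also have "\<dots> \<le> ennreal ((2 * \<delta>\<^sup>2 + 2 * \<delta>) * dd l' l)"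
  proof (rule ennreal_leI)
    have "0 \<le> 2 * \<delta> * (norm (fst l' - fst l))\<^sup>2" "0 \<le> 2 * \<delta>\<^sup>2 * (norm (sg l' - sg l))\<^sup>2" using \<delta> by auto
    moreover have "?b = \<delta>\<^sup>2 * (norm (fst l' - fst l))\<^sup>2" using \<delta> by (simp add: power_mult_distrib)
    ultimately show "2 * ?b + 2 * ((norm (sg l' - sg l))\<^sup>2 * \<delta>) \<le> (2 * \<delta>\<^sup>2 + 2 * \<delta>) * dd l' l"
      unfolding dd_def by (simp only: distrib_left distrib_right) (simp add: algebra_simps)
  qed
  finally show ?thesis .
qed

definition step_value :: "real \<Rightarrow> ('a \<Rightarrow> real) \<Rightarrow> 'a \<times> (nat \<Rightarrow> real) \<Rightarrow> 'a \<Rightarrow> real" where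
  "step_value \<delta> u l y = (\<integral>z. u (y + jump \<delta> l z) \<partial>gauss \<delta>)"

abbreviation "I_step \<delta> \<equiv> I_op M \<xi> e \<Lambda> \<delta>"

text \<open>Passing from Brownian values to their Gaussian law gives the one-step operator the same
  form as the conditional expectations produced by \<open>freezing\<close>.\<close>

lemma I_step_eq:
  assumes \<delta>: "0 < \<delta>" and u: "u \<in> borel_measurable borel"
  shows "I_step \<delta> u x = (SUP l\<in>\<Lambda>. step_value \<delta> u l x)"
proof -
  have "(LINT \<omega>|M. u (x + \<delta> *\<^sub>R fst l + (\<Sum>k. (sqrt (snd l k) * \<xi> k \<delta> \<omega>) *\<^sub>R e k))) = step_value \<delta> u l x" for l
  proof -
    have "(\<lambda>z. u (x + jump \<delta> l z)) \<in> borel_measurable (Pi\<^sub>M UNIV (\<lambda>_. borel))"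
      using borel_jump[of \<delta> l] u by measurable
    from integral_bm[OF \<delta> this] show ?thesis
      by (simp add: step_value_def jump_def ser_def rt_def add.assoc)
  qed
  then show ?thesis by (simp add: I_op_def case_prod_beta')
qed

lemma step_value_bound:
  assumes "0 < \<delta>" "\<And>x. \<bar>u x\<bar> \<le> c" "0 \<le> c"
  shows "\<bar>step_value \<delta> u l y\<bar> \<le> c"
  unfolding step_value_def using assms by (intro prob_space.expectation_abs_le prob_space_gauss) auto

text \<open>A shift of the starting point is a shift of the displacement: the points x and y are
  compared through the displacements jump and jump + (y - x) from the same point x. Second moments
  of jumps are bounded over \<Lambda>, so one \<eta> serves all controls.\<close>

lemma step_value_equicontinuous:
  assumes \<delta>: "0 < \<delta>" and u: "ucb u" and \<epsilon>: "0 < \<epsilon>"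
  shows "\<exists>\<eta>>0. \<forall>l\<in>\<Lambda>. \<forall>x y. norm x \<le> R \<longrightarrow> norm (y - x) < \<eta> \<longrightarrow> \<bar>step_value \<delta> u l x - step_value \<delta> u l y\<bar> \<le> \<epsilon>"
proof -
  interpret G: prob_space "gauss \<delta>" by (rule prob_space_gauss[OF \<delta>])
  have K: "0 \<le> 2 * (\<delta> * C)\<^sup>2 + 2 * (C * \<delta>)" using \<delta> C_nonneg by simp
  obtain d where d: "d > 0" "\<And>x X X'. norm x \<le> R \<Longrightarrow> X \<in> borel_measurable (gauss \<delta>) \<Longrightarrow> X' \<in> borel_measurable (gauss \<delta>) \<Longrightarrow>
    (\<integral>\<^sup>+ z. ennreal ((norm (X z))\<^sup>2) \<partial>gauss \<delta>) \<le> ennreal (2 * (\<delta> * C)\<^sup>2 + 2 * (C * \<delta>)) \<Longrightarrow>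
    (\<integral>\<^sup>+ z. ennreal ((norm (X' z - X z))\<^sup>2) \<partial>gauss \<delta>) \<le> ennreal d \<Longrightarrow>
    \<bar>(\<integral>z. u (x + X z) \<partial>gauss \<delta>) - (\<integral>z. u (x + X' z) \<partial>gauss \<delta>)\<bar> \<le> \<epsilon>"
    using G.ucb_expectation_modulus[OF u \<epsilon> K, of R] by blast
  show ?thesis
  proof (intro exI[of _ "sqrt d"] conjI ballI allI impI)
    fix l and x y :: 'a assume l: "l \<in> \<Lambda>" and x: "norm x \<le> R" and y: "norm (y - x) < sqrt d"
    have "(norm (y - x))\<^sup>2 \<le> d"
      using y d(1) power_mono[of "norm (y - x)" "sqrt d" 2] by simp
    then have "(\<integral>\<^sup>+ z. ennreal ((norm ((jump \<delta> l z + (y - x)) - jump \<delta> l z))\<^sup>2) \<partial>gauss \<delta>) \<le> ennreal d"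
      by (simp add: G.emeasure_space_1 ennreal_leI)
    moreover have "(\<lambda>z. jump \<delta> l z + (y - x)) \<in> borel_measurable (gauss \<delta>)"
      using borel_jump_gauss[of \<delta> l] by measurable
    ultimately show "\<bar>step_value \<delta> u l x - step_value \<delta> u l y\<bar> \<le> \<epsilon>"
      using d(2)[OF x borel_jump_gauss _ jump_moment2[OF \<delta> l], of "\<lambda>z. jump \<delta> l z + (y - x)"]
      by (simp add: step_value_def algebra_simps)
  qed (use d in auto)
qed

lemma step_value_ucb:
  assumes "0 < \<delta>" "ucb u" "l \<in> \<Lambda>"
  shows "ucb (step_value \<delta> u l)"
proof -
  obtain c where c: "0 \<le> c" "\<And>x. \<bar>u x\<bar> \<le> c" using ucb_bound[OF assms(2)] by blast
  show ?thesis
  proof (rule ucbI[of _ c])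
    show "\<bar>step_value \<delta> u l x\<bar> \<le> c" for x by (rule step_value_bound[OF assms(1) c(2,1)])
    show "\<exists>\<eta>>0. \<forall>x y. norm x \<le> R \<longrightarrow> norm (y - x) < \<eta> \<longrightarrow> \<bar>step_value \<delta> u l x - step_value \<delta> u l y\<bar> \<le> \<epsilon>"
      if "0 < \<epsilon>" for R \<epsilon>
      using step_value_equicontinuous[OF assms(1,2) that, of R] assms(3) by blast
  qed
qed

lemma step_value_le_I:
  assumes "0 < \<delta>" "ucb u" "l \<in> \<Lambda>"
  shows "step_value \<delta> u l y \<le> I_step \<delta> u y"
proof -
  obtain c where c: "0 \<le> c" "\<And>x. \<bar>u x\<bar> \<le> c" using ucb_bound[OF assms(2)] by blast
  show ?thesis
    unfolding I_step_eq[OF assms(1) ucb_borel[OF assms(2)]]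
    using step_value_bound[OF assms(1) c(2,1)]
    by (intro cSUP_upper assms(3) cSUP_abs_le(1)[OF nonempty]) auto
qed

text \<open>A supremum over a bounded family with a common modulus of continuity on balls inherits
  the bound and the modulus.\<close>

lemma I_step_ucb:
  assumes \<delta>: "0 < \<delta>" and u: "ucb u"
  shows "ucb (I_step \<delta> u)"
proof -
  obtain c where c: "0 \<le> c" "\<And>x. \<bar>u x\<bar> \<le> c" using ucb_bound[OF u] by blast
  note b = step_value_bound[OF \<delta> c(2,1)]
  note bdd = cSUP_abs_le[OF nonempty, of "\<lambda>l. step_value \<delta> u l _", OF b]
  note eq = I_step_eq[OF \<delta> ucb_borel[OF u]]
  show ?thesis
  proof (rule ucbI[of _ c])
    show "\<bar>I_step \<delta> u x\<bar> \<le> c" for x unfolding eq by (rule bdd(2))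
    show "\<exists>\<eta>>0. \<forall>x y. norm x \<le> R \<longrightarrow> norm (y - x) < \<eta> \<longrightarrow> \<bar>I_step \<delta> u x - I_step \<delta> u y\<bar> \<le> \<epsilon>"
      if \<epsilon>: "0 < \<epsilon>" for R \<epsilon>
    proof -
      obtain \<eta> where \<eta>: "\<eta> > 0" "\<And>l x y. l \<in> \<Lambda> \<Longrightarrow> norm x \<le> R \<Longrightarrow> norm (y - x) < \<eta> \<Longrightarrow> \<bar>step_value \<delta> u l x - step_value \<delta> u l y\<bar> \<le> \<epsilon>"
        using step_value_equicontinuous[OF \<delta> u \<epsilon>, of R] by blast
      show ?thesis
        unfolding eq by (intro exI[of _ \<eta>] conjI allI impI \<eta>(1) cSUP_diff_le[OF nonempty bdd(1) bdd(1)] \<eta>(2))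
    qed
  qed
qed

lemma I_iterate_ucb: "0 < \<delta> \<Longrightarrow> ucb u \<Longrightarrow> ucb ((I_step \<delta> ^^ N) u)"
  by (induction N) (auto intro: I_step_ucb)

text \<open>A nearly optimal control in \<Lambda> can be moved into the dense sequence, since
  \<open>jump_diff_moment2\<close> makes the jumps close in mean square and hence the expected
  values close. A near-optimal choice then exists among countably many candidates.\<close>

lemma near_optimal_index:
  assumes \<delta>: "0 < \<delta>" and u: "ucb u" and \<epsilon>: "0 < \<epsilon>"
  shows "\<exists>m. I_step \<delta> u y - \<epsilon> < step_value \<delta> u (lam m) y"
proof -
  interpret G: prob_space "gauss \<delta>" by (rule prob_space_gauss[OF \<delta>])
  obtain c where c: "0 \<le> c" "\<And>x. \<bar>u x\<bar> \<le> c" using ucb_bound[OF u] by blast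
  note b = step_value_bound[OF \<delta> c(2,1)]
  have "I_step \<delta> u y - \<epsilon> / 2 < (SUP l\<in>\<Lambda>. step_value \<delta> u l y)"
    unfolding I_step_eq[OF \<delta> ucb_borel[OF u]] using \<epsilon> by simp
  then obtain l where l: "l \<in> \<Lambda>" "I_step \<delta> u y - \<epsilon> / 2 < step_value \<delta> u l y"
    using less_cSUP_iff[OF nonempty cSUP_abs_le(1)[OF nonempty, of "\<lambda>l. step_value \<delta> u l y", OF b]] by blast
  have K: "0 \<le> 2 * (\<delta> * C)\<^sup>2 + 2 * (C * \<delta>)" using \<delta> C_nonneg by simp
  have \<epsilon>2: "0 < \<epsilon> / 4" using \<epsilon> by simp
  obtain d where d: "d > 0" "\<And>x X X'. norm x \<le> norm y \<Longrightarrow> X \<in> borel_measurable (gauss \<delta>) \<Longrightarrow> X' \<in> borel_measurable (gauss \<delta>) \<Longrightarrow>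
    (\<integral>\<^sup>+ z. ennreal ((norm (X z))\<^sup>2) \<partial>gauss \<delta>) \<le> ennreal (2 * (\<delta> * C)\<^sup>2 + 2 * (C * \<delta>)) \<Longrightarrow>
    (\<integral>\<^sup>+ z. ennreal ((norm (X' z - X z))\<^sup>2) \<partial>gauss \<delta>) \<le> ennreal d \<Longrightarrow>
    \<bar>(\<integral>z. u (x + X z) \<partial>gauss \<delta>) - (\<integral>z. u (x + X' z) \<partial>gauss \<delta>)\<bar> \<le> \<epsilon> / 4"
    using G.ucb_expectation_modulus[OF u \<epsilon>2 K, of "norm y"] by blast
  \<comment> \<open>The constant of \<open>jump_diff_moment2\<close>; r is the distance in
    \<open>emb\<close> at which that bound equals d.\<close>
  define k where "k = 2 * \<delta>\<^sup>2 + 2 * \<delta>"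
  have k: "0 < k" using \<delta> by (simp add: k_def add_pos_pos)
  define r where "r = sqrt (d / k)"
  have r: "0 < r" "k * r\<^sup>2 = d" using d k by (auto simp: r_def)
  obtain m where m: "dist (emb l) (emb (lam m)) < r" using lam(2)[OF l(1) r(1)] by blast
  have "dd (lam m) l \<le> r\<^sup>2"
    unfolding dd_eq_dist using m by (intro power_mono) (auto simp: dist_commute)
  then have "k * dd (lam m) l \<le> d" using k r(2) by (metis mult_left_mono less_imp_le)
  then have "(\<integral>\<^sup>+ z. ennreal ((norm (jump \<delta> (lam m) z - jump \<delta> l z))\<^sup>2) \<partial>gauss \<delta>) \<le> ennreal d"
    using jump_diff_moment2[OF \<delta> l(1) lam(1), of m] unfolding k_def[symmetric]
    by (meson ennreal_leI order_trans)
  from d(2)[OF order_refl borel_jump_gauss borel_jump_gauss jump_moment2[OF \<delta> l(1)] this]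
  have "\<bar>step_value \<delta> u l y - step_value \<delta> u (lam m) y\<bar> \<le> \<epsilon> / 4" by (simp add: step_value_def)
  then show ?thesis using l(2) \<epsilon> by (intro exI[of _ m]) linarith
qed

text \<open>The position Y and the index are known at the left end of the step, so
  \<open>freezing\<close> replaces the increments by an independent Gaussian vector while both are
  held fixed.\<close>

lemma one_step:
  assumes u: "ucb u" and idx: "grid_adapted n idx" and Y: "Y \<in> borel_measurable (F (time n j))"
  shows "(\<integral>\<omega>. u (Y \<omega> + jump (h n) (lam (idx j \<omega>)) (increment n j \<omega>)) \<partial>M) =
      (\<integral>\<omega>. step_value (h n) u (lam (idx j \<omega>)) (Y \<omega>) \<partial>M)"
    and "(\<lambda>\<omega>. step_value (h n) u (lam (idx j \<omega>)) (Y \<omega>)) \<in> borel_measurable M"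
proof -
  obtain c where c: "0 \<le> c" "\<And>x. \<bar>u x\<bar> \<le> c" using ucb_bound[OF u] by blast
  let ?PM = "Pi\<^sub>M UNIV (\<lambda>_. borel) :: (nat \<Rightarrow> real) measure"
  define H where "H p = u (Y (fst p) + jump (h n) (lam (idx j (fst p))) (snd p))" for p
  have Hm: "H \<in> borel_measurable (F (time n j) \<Otimes>\<^sub>M ?PM)"
  proof -
    have 1: "(\<lambda>p. g (idx j (fst p))) \<in> borel_measurable (F (time n j) \<Otimes>\<^sub>M ?PM)" for g :: "nat \<Rightarrow> 'z::topological_space"
    proof (rule measurable_compose[OF measurable_fst])
      have "g \<in> borel_measurable (count_space UNIV)" by simp
      then show "(\<lambda>\<omega>. g (idx j \<omega>)) \<in> borel_measurable (F (time n j))"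
        by (rule measurable_compose[OF adapted_index[OF idx]])
    qed
    have 2: "(\<lambda>p. snd p k) \<in> borel_measurable (F (time n j) \<Otimes>\<^sub>M ?PM)" for k
      by (rule measurable_compose[OF measurable_snd]) (intro measurable_component_singleton, simp)
    have 3: "(\<lambda>p. Y (fst p)) \<in> borel_measurable (F (time n j) \<Otimes>\<^sub>M ?PM)"
      by (rule measurable_compose[OF measurable_fst Y])
    have "(\<lambda>p. Y (fst p) + jump (h n) (lam (idx j (fst p))) (snd p)) \<in> borel_measurable (F (time n j) \<Otimes>\<^sub>M ?PM)"
      unfolding jump_def
      by (intro borel_measurable_add 3 borel_measurable_scaleR borel_measurable_const
          borel_measurable_ser borel_measurable_times 1 2)
    then show ?thesis unfolding H_def by (rule measurable_compose[OF _ ucb_borel[OF u]])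
  qed
  have "\<bar>H p\<bar> \<le> c" for p unfolding H_def by (rule c)
  note fr = freezing[OF time_nonneg time_less_Suc Hm this]
  have d: "time n (Suc j) - time n j = h n" by (simp add: time_Suc)
  have eq: "(\<integral>z. H (\<omega>, z) \<partial>gauss (h n)) = step_value (h n) u (lam (idx j \<omega>)) (Y \<omega>)" for \<omega>
    by (simp add: H_def step_value_def)
  show "(\<integral>\<omega>. u (Y \<omega> + jump (h n) (lam (idx j \<omega>)) (increment n j \<omega>)) \<partial>M) =
      (\<integral>\<omega>. step_value (h n) u (lam (idx j \<omega>)) (Y \<omega>) \<partial>M)"
    using fr(1) unfolding d eq by (simp add: H_def increment_def[abs_def])
  show "(\<lambda>\<omega>. step_value (h n) u (lam (idx j \<omega>)) (Y \<omega>)) \<in> borel_measurable M"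
    using measurable_F[OF fr(2) time_nonneg] unfolding d eq .
qed

lemma walk_Suc: "walk n idx (Suc N) \<omega> = walk n idx N \<omega> + jump (h n) (lam (idx N \<omega>)) (increment n N \<omega>)"
  by (simp add: walk_def)

lemma ucb_integrable:
  assumes "ucb u" "X \<in> borel_measurable M"
  shows "integrable M (\<lambda>\<omega>. u (X \<omega>))"
proof -
  obtain c where c: "0 \<le> c" "\<And>x. \<bar>u x\<bar> \<le> c" using ucb_bound[OF assms(1)] by blast
  have "(\<lambda>\<omega>. u (X \<omega>)) \<in> borel_measurable M" by (rule measurable_compose[OF assms(2) ucb_borel[OF assms(1)]])
  then show ?thesis using c by (intro integrable_const_bound[where B=c]) auto
qed

lemma step_value_integrable:
  assumes u: "ucb u" and idx: "grid_adapted n idx" and Y: "Y \<in> borel_measurable (F (time n j))"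
  shows "integrable M (\<lambda>\<omega>. step_value (h n) u (lam (idx j \<omega>)) (Y \<omega>))"
proof -
  obtain c where c: "0 \<le> c" "\<And>x. \<bar>u x\<bar> \<le> c" using ucb_bound[OF u] by blast
  show ?thesis
    using one_step(2)[OF assms] step_value_bound[OF h_pos c(2,1)] by (intro integrable_const_bound[where B=c]) auto
qed

lemma shifted_walk_measurable:
  "grid_adapted n idx \<Longrightarrow> (\<lambda>\<omega>. x + walk n idx N \<omega>) \<in> borel_measurable (F (time n N))"
  by (intro borel_measurable_add borel_measurable_const walk_measurable)

text \<open>The last step of the walk is peeled off: given the past, its expected value is at most
  \<open>I_step (h n) u\<close> at the current position. The induction hypothesis is then used for
  that function, which is why u varies.\<close>

lemma walk_le_iterate:
  assumes idx: "grid_adapted n idx"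
  shows "ucb u \<Longrightarrow> (\<integral>\<omega>. u (x + walk n idx N \<omega>) \<partial>M) \<le> (I_step (h n) ^^ N) u x"
proof (induction N arbitrary: u)
  case 0
  then show ?case by (simp add: walk_def prob_space)
next
  case (Suc N)
  note m = shifted_walk_measurable[OF idx, of x N]
  have "(\<integral>\<omega>. u (x + walk n idx (Suc N) \<omega>) \<partial>M) = (\<integral>\<omega>. step_value (h n) u (lam (idx N \<omega>)) (x + walk n idx N \<omega>) \<partial>M)"
    unfolding walk_Suc add.assoc[symmetric] by (rule one_step(1)[OF Suc.prems idx m])
  also have "\<dots> \<le> (\<integral>\<omega>. I_step (h n) u (x + walk n idx N \<omega>) \<partial>M)"
    by (intro Bochner_Integration.integral_mono step_value_integrable[OF Suc.prems idx m] step_value_le_I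
        ucb_integrable I_step_ucb measurable_F[OF m time_nonneg] h_pos Suc.prems lam)
  also have "\<dots> \<le> (I_step (h n) ^^ N) (I_step (h n) u) x"
    by (intro Suc.IH I_step_ucb h_pos Suc.prems)
  finally show ?case by (simp add: funpow_swap1)
qed

text \<open>The induction hypothesis for the function \<open>I_step (h n) u\<close> supplies the
  first N choices; the last choice is the least near-optimal index at the position reached by then.
  Each step loses at most \<epsilon>.\<close>

lemma iterate_le_walk:
  fixes \<epsilon> :: real
  assumes \<epsilon>: "0 < \<epsilon>"
  shows "ucb u \<Longrightarrow> \<exists>idx. grid_adapted n idx \<and> (I_step (h n) ^^ N) u x \<le> (\<integral>\<omega>. u (x + walk n idx N \<omega>) \<partial>M) + N * \<epsilon>"
proof (induction N arbitrary: u)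
  case 0
  have "grid_adapted n (\<lambda>_ _. 0)" by (simp add: grid_adapted_def)
  then show ?case by (auto simp: walk_def prob_space)
next
  case (Suc N)
  let ?v = "I_step (h n) u"
  have v: "ucb ?v" by (intro I_step_ucb h_pos Suc.prems)
  obtain idx where idx: "grid_adapted n idx"
    "(I_step (h n) ^^ N) ?v x \<le> (\<integral>\<omega>. ?v (x + walk n idx N \<omega>) \<partial>M) + N * \<epsilon>"
    using Suc.IH[OF v] by blast
  let ?Y = "\<lambda>\<omega>. x + walk n idx N \<omega>"
  note m = shifted_walk_measurable[OF idx(1), of x N]
  \<comment> \<open>A least index over countably many measurable conditions on the current position,
    hence measurable with respect to the past of the step.\<close>
  define i where "i \<omega> = (LEAST k. ?v (?Y \<omega>) - \<epsilon> < step_value (h n) u (lam k) (?Y \<omega>))" for \<omega>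
  have i_opt: "?v (?Y \<omega>) - \<epsilon> < step_value (h n) u (lam (i \<omega>)) (?Y \<omega>)" for \<omega>
    unfolding i_def by (rule LeastI_ex[OF near_optimal_index[OF h_pos Suc.prems \<epsilon>]])
  have im: "i \<in> measurable (F (time n N)) (count_space UNIV)"
    unfolding i_def
  proof (rule measurable_Least)
    fix k
    have [measurable]: "(\<lambda>\<omega>. ?v (?Y \<omega>)) \<in> borel_measurable (F (time n N))"
      "(\<lambda>\<omega>. step_value (h n) u (lam k) (?Y \<omega>)) \<in> borel_measurable (F (time n N))"
      by (rule measurable_compose[OF m ucb_borel[OF v]],
          rule measurable_compose[OF m ucb_borel[OF step_value_ucb[OF h_pos Suc.prems lam(1)]]])
    show "Measurable.pred (F (time n N)) (\<lambda>\<omega>. ?v (?Y \<omega>) - \<epsilon> < step_value (h n) u (lam k) (?Y \<omega>))"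
      by measurable
  qed
  \<comment> \<open>The first N steps of the walk read only indices below N, so they are unaffected
    by the change.\<close>
  define idx' where "idx' = idx(N := i)"
  have idx': "grid_adapted n idx'"
    using idx(1) im by (auto simp: grid_adapted_def idx'_def time_def)
  have walk': "walk n idx' N \<omega> = walk n idx N \<omega>" for \<omega>
    unfolding walk_def idx'_def by (intro sum.cong) auto
  have "(\<integral>\<omega>. ?v (?Y \<omega>) \<partial>M) - \<epsilon> = (\<integral>\<omega>. ?v (?Y \<omega>) - \<epsilon> \<partial>M)"
    using ucb_integrable[OF v measurable_F[OF m time_nonneg]] by (simp add: prob_space)
  also have "\<dots> \<le> (\<integral>\<omega>. step_value (h n) u (lam (idx' N \<omega>)) (?Y \<omega>) \<partial>M)"
  proof (rule Bochner_Integration.integral_mono)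
    show "integrable M (\<lambda>\<omega>. ?v (?Y \<omega>) - \<epsilon>)"
      using ucb_integrable[OF v measurable_F[OF m time_nonneg]] by simp
    show "integrable M (\<lambda>\<omega>. step_value (h n) u (lam (idx' N \<omega>)) (?Y \<omega>))"
      by (rule step_value_integrable[OF Suc.prems idx' m])
    show "?v (?Y \<omega>) - \<epsilon> \<le> step_value (h n) u (lam (idx' N \<omega>)) (?Y \<omega>)" for \<omega>
      using i_opt[of \<omega>] by (simp add: idx'_def)
  qed
  also have "\<dots> = (\<integral>\<omega>. u (x + walk n idx' (Suc N) \<omega>) \<partial>M)"
    unfolding walk_Suc walk' add.assoc[symmetric] by (rule one_step(1)[OF Suc.prems idx' m, symmetric])
  finally have "(I_step (h n) ^^ Suc N) u x \<le> (\<integral>\<omega>. u (x + walk n idx' (Suc N) \<omega>) \<partial>M) + Suc N * \<epsilon>"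
    using idx(2) by (simp add: funpow_swap1 algebra_simps)
  then show ?case using idx' by blast
qed

end

section \<open>Convergence\<close>

text \<open>Uniqueness of the positive square root, tested on eigenvectors. If S is a root and A e =
  a e with a > 0, then v = S e - a e satisfies S v = - a v, and positivity of S forces v = 0.
  Density of the span extends the identity to the whole space.\<close>

lemma op_abs_positive:
  fixes A :: "'a::real_inner \<Rightarrow>\<^sub>L 'a"
  assumes sa: "selfadjoint_op A" and pos: "positive_op A" and basis: "orthonormal_basis e"
    and eig: "\<And>k. blinfun_apply A (e k) = a k *\<^sub>R e k"
  shows "op_abs A = A"
proof -
  have adj: "adjoint (blinfun_apply A) = blinfun_apply A"
    using sa by (intro adjoint_unique) (auto simp: selfadjoint_op_def)
  show ?thesis
    unfolding op_abs_def adj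
  proof (rule the_equality)
    show "selfadjoint_op A \<and> positive_op A \<and> (\<forall>x. blinfun_apply A (blinfun_apply A x) = blinfun_apply A (blinfun_apply A x))"
      using sa pos by simp
    fix S assume S: "selfadjoint_op S \<and> positive_op S \<and> (\<forall>x. blinfun_apply S (blinfun_apply S x) = blinfun_apply A (blinfun_apply A x))"
    have eq: "blinfun_apply S (e k) = blinfun_apply A (e k)" for k
    proof (cases "e k = 0")
      case False
      have ek: "e k \<bullet> e k = 1"
        using basis False by (auto simp: orthonormal_basis_def simp flip: power2_norm_eq_inner)
      have ak: "0 \<le> a k" using pos eig[of k] ek unfolding positive_op_def by (metis inner_scaleR_left mult.right_neutral)
      have SS: "blinfun_apply S (blinfun_apply S (e k)) = (a k * a k) *\<^sub>R e k"
        using S by (simp add: eig blinfun.scaleR_right)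
      have Sad: "blinfun_apply S x \<bullet> y = x \<bullet> blinfun_apply S y" for x y using S by (simp add: selfadjoint_op_def)
      have Spos: "0 \<le> blinfun_apply S x \<bullet> x" for x using S by (simp add: positive_op_def)
      show ?thesis
      proof (cases "a k = 0")
        case True
        \<comment> \<open>For the eigenvalue 0 the vector v gives no information; here
          selfadjointness yields |S e|^2 = e \<bullet> S (S e) = 0.\<close>
        have "blinfun_apply S (e k) \<bullet> blinfun_apply S (e k) = 0"
          unfolding Sad SS using True by simp
        then show ?thesis using True by (simp add: eig)
      next
        case False
        define v where "v = blinfun_apply S (e k) - a k *\<^sub>R e k"
        have "blinfun_apply S v = - a k *\<^sub>R v"
          by (simp add: v_def blinfun.diff_right blinfun.scaleR_right SS algebra_simps)
        then have "0 \<le> - a k * (v \<bullet> v)" using Spos[of v] by simp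
        moreover have "0 < a k" using ak False by simp
        ultimately have "v \<bullet> v \<le> 0" by (simp add: mult_le_0_iff)
        then have "v \<bullet> v = 0" using inner_ge_zero[of v] by (rule antisym)
        then have "v = 0" by (simp only: inner_eq_zero_iff)
        then show ?thesis by (simp add: v_def eig)
      qed
    qed (simp add: blinfun.zero_right)
    show "S = A"
    proof (rule blinfun_eqI)
      fix x
      let ?E = "{x. blinfun_apply S x = blinfun_apply A x}"
      have "closed ?E" by (intro closed_Collect_eq continuous_intros)
      moreover have "subspace ?E"
        by (auto simp: subspace_def blinfun.zero_right blinfun.add_right blinfun.scaleR_right)
      then have "span (range e) \<subseteq> ?E" using eq by (intro span_minimal) auto
      ultimately have "closure (span (range e)) \<subseteq> ?E" by (intro closure_minimal)
      then show "blinfun_apply S x = blinfun_apply A x" using basis by (auto simp: orthonormal_basis_def)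
    qed
  qed
qed

text \<open>The trace norm is a supremum over bases; its member at the joint eigenbasis, where
  \<open>op_abs A\<close> is A itself, is the sum of the eigenvalues.\<close>

lemma eigenvalues_trace_norm:
  fixes A :: "'a::real_inner \<Rightarrow>\<^sub>L 'a"
  assumes sa: "selfadjoint_op A" and pos: "positive_op A" and eig: "joint_eigenbasis Q e \<mu>" and A: "A \<in> Q"
  shows "0 \<le> \<mu> A k" and "(\<Sum>k. ennreal (\<mu> A k)) \<le> trace_norm A"
proof -
  have basis: "orthonormal_basis e" and Ae: "blinfun_apply A (e k) = \<mu> A k *\<^sub>R e k" "e k = 0 \<Longrightarrow> \<mu> A k = 0" for k
    using eig A by (auto simp: joint_eigenbasis_def)
  have *: "blinfun_apply A (e k) \<bullet> e k = \<mu> A k" for k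
  proof (cases "e k = 0")
    case False
    then have "e k \<bullet> e k = 1"
      using basis by (auto simp: orthonormal_basis_def simp flip: power2_norm_eq_inner)
    then show ?thesis by (simp add: Ae)
  qed (simp add: Ae)
  show "0 \<le> \<mu> A k" using pos *[of k] unfolding positive_op_def by metis
  have "(\<Sum>k. ennreal (blinfun_apply (op_abs A) (e k) \<bullet> e k)) \<le> trace_norm A"
    unfolding trace_norm_def using basis by (intro SUP_upper) simp
  then show "(\<Sum>k. ennreal (\<mu> A k)) \<le> trace_norm A"
    unfolding op_abs_positive[OF sa pos basis Ae(1)] * .
qed

lemma compact_operator_bound:
  assumes "compact_operator K"
  obtains c where "0 < c" "\<And>x. norm (K x) \<le> c * norm x"
proof -
  have lin: "linear K" and "compact (closure (K ` cball 0 1))"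
    using assms by (auto simp: compact_operator_def)
  then have "bounded (K ` cball 0 1)" using compact_imp_bounded bounded_subset closure_subset by metis
  then obtain c where c: "0 < c" "\<And>x. x \<in> cball 0 1 \<Longrightarrow> norm (K x) \<le> c" by (auto simp: bounded_pos)
  have "norm (K x) \<le> c * norm x" for x
  proof (cases "x = 0")
    case False
    have "norm (K (inverse (norm x) *\<^sub>R x)) \<le> c" using False by (intro c(2)) simp
    then have "inverse (norm x) * norm (K x) \<le> c" by (simp add: linear_scale[OF lin])
    then show ?thesis using False by (simp add: field_simps)
  qed (simp add: linear_0[OF lin])
  then show ?thesis using c(1) that by blast
qed

text \<open>K maps a ball into a relatively compact set, on whose closure g is uniformly continuous;
  K is Lipschitz, so the modulus pulls back to the ball.\<close>

lemma ucb_compact_factor: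
  assumes K: "compact_operator (K :: 'a::real_normed_vector \<Rightarrow> 'b::real_normed_vector)" and g: "g \<in> bcontfun" and f: "\<And>x. f x = g (K x)"
  shows "ucb f"
proof -
  have cont: "continuous_on UNIV g" and "bounded (range g)" using g by (auto simp: bcontfun_def)
  then obtain c where c: "\<And>x. \<bar>g x\<bar> \<le> c" by (auto simp: bounded_iff)
  obtain k where k: "0 < k" "\<And>x. norm (K x) \<le> k * norm x" using compact_operator_bound[OF K] by blast
  have lin: "linear K" using K by (simp add: compact_operator_def)
  show ?thesis
  proof (rule ucbI[of _ c])
    show "\<bar>f x\<bar> \<le> c" for x using c f by simp
    fix R \<epsilon> :: real assume \<epsilon>: "0 < \<epsilon>"
    \<comment> \<open>The radius R + 1 leaves room for y, which is taken within distance 1 of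
      x.\<close>
    let ?S = "closure (K ` cball 0 (R + 1))"
    have "compact ?S" using K by (auto simp: compact_operator_def)
    then have "uniformly_continuous_on ?S g"
      by (intro compact_uniformly_continuous continuous_on_subset[OF cont]) auto
    then obtain d where d: "d > 0" "\<And>x y. x \<in> ?S \<Longrightarrow> y \<in> ?S \<Longrightarrow> dist y x < d \<Longrightarrow> dist (g y) (g x) < \<epsilon>"
      using \<epsilon> unfolding uniformly_continuous_on_def by meson
    show "\<exists>\<eta>>0. \<forall>x y. norm x \<le> R \<longrightarrow> norm (y - x) < \<eta> \<longrightarrow> \<bar>f x - f y\<bar> \<le> \<epsilon>"
    proof (intro exI[of _ "min 1 (d / k)"] conjI allI impI)
      fix x y :: 'a assume x: "norm x \<le> R" and xy: "norm (y - x) < min 1 (d / k)"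
      have "norm y \<le> norm x + norm (y - x)" using norm_triangle_ineq[of x "y - x"] by simp
      then have xy': "x \<in> cball 0 (R + 1)" "y \<in> cball 0 (R + 1)" using x xy by (auto simp: mem_cball_0)
      have S: "K x \<in> ?S" "K y \<in> ?S"
        using xy' closure_subset[of "K ` cball 0 (R + 1)"] by (meson imageI subsetD)+
      have "dist (K y) (K x) = norm (K (y - x))" by (simp add: dist_norm linear_diff[OF lin])
      also have "\<dots> \<le> k * norm (y - x)" by (rule k)
      also have "\<dots> < d" using xy k(1) by (simp add: field_simps)
      finally have "dist (g (K y)) (g (K x)) < \<epsilon>" using d(2)[OF S] by simp
      then show "\<bar>f x - f y\<bar> \<le> \<epsilon>" by (simp add: f dist_real_def abs_minus_commute)
    qed (use d k in auto)
  qed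
qed

lemma ucb_bcontfun: "ucb f \<Longrightarrow> f \<in> bcontfun"
  using ucb_continuous[of f] by (auto simp: bcontfun_def ucb_def bounded_iff)

section \<open>Convergence of the iterates to the value function\<close>

context control_setup begin

abbreviation "T_step \<equiv> T_op M F \<xi> e \<Lambda>"

lemma T_step_eq: "T_step t u x = (SUP \<alpha>\<in>controls M F \<Lambda>. \<integral>\<omega>. u (x + state \<alpha> t \<omega>) \<partial>M)"
  unfolding T_op_def state_def drift_def noise_def ser_def rt_def by (simp add: add.assoc)

lemma controls_nonempty: "controls M F \<Lambda> \<noteq> {}"
proof -
  have "grid_adapted 0 (\<lambda>_ _. 0)" by (simp add: grid_adapted_def)
  from grid_control_controls[OF this] show ?thesis by blast
qed

lemma num_steps_eq:
  assumes t: "0 \<le> t"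
  shows "num_steps (h n) t = steps n t"
proof -
  have "{k. real k * h n \<le> t} = {..steps n t}"
  proof (intro set_eqI iffI)
    fix k assume "k \<in> {k. real k * h n \<le> t}"
    then have "real k * h n < real (Suc (steps n t)) * h n"
      using steps(2)[OF t, of n] by (simp add: time_def algebra_simps)
    then have "real k < real (Suc (steps n t))" using h_pos[of n] by (simp only: mult_less_cancel_right_pos)
    then show "k \<in> {..steps n t}" by simp
  next
    fix k assume "k \<in> {..steps n t}"
    then have "time n k \<le> t" using time_mono[of k "steps n t" n] steps(1)[OF t, of n] by simp
    then show "k \<in> {k. real k * h n \<le> t}" by (simp add: time_def)
  qed
  moreover have "Max {..steps n t} = steps n t" by (intro Max_eqI) auto
  ultimately show ?thesis by (simp add: num_steps_def)
qed

abbreviation "scheme t u n \<equiv> (I_step (h n) ^^ num_steps (h n) t) u"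

lemma dd_refl: "dd l l = 0"
  by (simp add: dd_def)

lemma mean_dd_refl: "mean_dd t \<alpha> \<alpha> = 0"
  by (simp add: mean_dd_def dd_refl)

text \<open>A common second moment bound for states and walks at time t: a walk is a state plus an
  error of mean square at most \<open>K_walk t * t\<close>.\<close>

definition K_all :: "real \<Rightarrow> real" where
  "K_all t = 2 * K_state t + 2 * (K_walk t * t)"

lemma K_all_nonneg: "0 \<le> t \<Longrightarrow> 0 \<le> K_all t"
  using K_state_nonneg[of t] K_walk_pos[of t] by (simp add: K_all_def)

lemma K_state_le_all: "0 \<le> t \<Longrightarrow> K_state t \<le> K_all t"
  using K_state_nonneg[of t] K_walk_pos[of t] mult_nonneg_nonneg[of "K_walk t" t] unfolding K_all_def by linarith

text \<open>The control is the one generated by the walk, so the distance of the controls is 0 and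
  the last incomplete step alone separates walk and state.\<close>

lemma walk_state_dist:
  assumes idx: "grid_adapted n idx" and t: "0 \<le> t"
  shows "(\<integral>\<^sup>+ \<omega>. ennreal ((norm (walk n idx (steps n t) \<omega> - state (grid_control n idx) t \<omega>))\<^sup>2) \<partial>M) \<le>
    ennreal (K_walk t * (t - time n (steps n t)))"
  using state_walk_dist[OF grid_control_controls[OF idx] idx steps(1)[OF t]] K_walk_pos[OF t]
  by (simp add: mean_dd_refl norm_minus_commute ennreal_mult')

lemma walk_moment2:
  assumes idx: "grid_adapted n idx" and t: "0 \<le> t"
  shows "(\<integral>\<^sup>+ \<omega>. ennreal ((norm (walk n idx (steps n t) \<omega>))\<^sup>2) \<partial>M) \<le> ennreal (K_all t)"
proof -
  let ?\<alpha> = "grid_control n idx" and ?N = "steps n t"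
  note \<alpha> = grid_control_controls[OF idx]
  have [measurable]: "state ?\<alpha> t \<in> borel_measurable M" "walk n idx ?N \<in> borel_measurable M"
    by (rule state_measurable[OF \<alpha> t], rule walk_measurable_M[OF idx])
  have "(\<integral>\<^sup>+ \<omega>. ennreal ((norm (walk n idx ?N \<omega>))\<^sup>2) \<partial>M) \<le>
    (\<integral>\<^sup>+ \<omega>. 2 * ennreal ((norm (state ?\<alpha> t \<omega>))\<^sup>2) + 2 * ennreal ((norm (walk n idx ?N \<omega> - state ?\<alpha> t \<omega>))\<^sup>2) \<partial>M)"
  proof (rule nn_integral_mono)
    fix \<omega>
    have "(norm (walk n idx ?N \<omega>))\<^sup>2 \<le> 2 * (norm (state ?\<alpha> t \<omega>))\<^sup>2 + 2 * (norm (walk n idx ?N \<omega> - state ?\<alpha> t \<omega>))\<^sup>2"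
      using norm_add_square_le[of "state ?\<alpha> t \<omega>" "walk n idx ?N \<omega> - state ?\<alpha> t \<omega>"] by simp
    then have "ennreal ((norm (walk n idx ?N \<omega>))\<^sup>2) \<le> ennreal (2 * (norm (state ?\<alpha> t \<omega>))\<^sup>2 + 2 * (norm (walk n idx ?N \<omega> - state ?\<alpha> t \<omega>))\<^sup>2)"
      by (rule ennreal_leI)
    then show "ennreal ((norm (walk n idx ?N \<omega>))\<^sup>2) \<le> 2 * ennreal ((norm (state ?\<alpha> t \<omega>))\<^sup>2) + 2 * ennreal ((norm (walk n idx ?N \<omega> - state ?\<alpha> t \<omega>))\<^sup>2)"
      by (subst (asm) ennreal_plus) (auto simp: ennreal_mult')
  qed
  also have "\<dots> = 2 * (\<integral>\<^sup>+ \<omega>. ennreal ((norm (state ?\<alpha> t \<omega>))\<^sup>2) \<partial>M) + 2 * (\<integral>\<^sup>+ \<omega>. ennreal ((norm (walk n idx ?N \<omega> - state ?\<alpha> t \<omega>))\<^sup>2) \<partial>M)"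
    by (subst nn_integral_add) (auto simp: nn_integral_cmult)
  also have "\<dots> \<le> 2 * ennreal (K_state t) + 2 * ennreal (K_walk t * (t - time n ?N))"
    by (intro add_mono mult_left_mono state_moment2[OF \<alpha> t] walk_state_dist[OF idx t]) auto
  also have "\<dots> = ennreal (2 * K_state t + 2 * (K_walk t * (t - time n ?N)))"
    using K_state_nonneg[OF t] K_walk_pos[OF t] steps(1)[OF t, of n] by (subst ennreal_plus) (auto simp: ennreal_mult')
  also have "\<dots> \<le> ennreal (K_all t)"
    unfolding K_all_def using K_walk_pos[OF t] time_nonneg[of n ?N]
    by (intro ennreal_leI add_left_mono mult_left_mono) auto
  finally show ?thesis .
qed

text \<open>The class over which the moduli of expectations are uniform; it contains the states at
  time t and, for every mesh, the walks.\<close>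

definition admissible :: "real \<Rightarrow> ('w \<Rightarrow> 'a) \<Rightarrow> bool" where
  "admissible t X \<longleftrightarrow> X \<in> borel_measurable M \<and> (\<integral>\<^sup>+ \<omega>. ennreal ((norm (X \<omega>))\<^sup>2) \<partial>M) \<le> ennreal (K_all t)"

lemma admissible_state: "\<alpha> \<in> controls M F \<Lambda> \<Longrightarrow> 0 \<le> t \<Longrightarrow> admissible t (state \<alpha> t)"
  unfolding admissible_def
  using state_measurable state_moment2 K_state_le_all by (meson ennreal_leI order_trans)

lemma admissible_walk: "grid_adapted n idx \<Longrightarrow> 0 \<le> t \<Longrightarrow> admissible t (walk n idx (steps n t))"
  unfolding admissible_def using walk_measurable_M walk_moment2 by blast

lemma expectation_modulus:
  assumes u: "ucb u" and \<epsilon>: "0 < \<epsilon>" and t: "0 \<le> t"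
  obtains \<delta> where "0 < \<delta>" "\<And>x X X'. norm x \<le> R \<Longrightarrow> admissible t X \<Longrightarrow> X' \<in> borel_measurable M \<Longrightarrow>
    (\<integral>\<^sup>+ \<omega>. ennreal ((norm (X' \<omega> - X \<omega>))\<^sup>2) \<partial>M) \<le> ennreal \<delta> \<Longrightarrow>
    \<bar>(\<integral>\<omega>. u (x + X \<omega>) \<partial>M) - (\<integral>\<omega>. u (x + X' \<omega>) \<partial>M)\<bar> \<le> \<epsilon>"
  using ucb_expectation_modulus[OF u \<epsilon> K_all_nonneg[OF t], of R] unfolding admissible_def by blast

text \<open>The shift argument of \<open>step_value_equicontinuous\<close>, now for all admissible
  displacements at once.\<close>

lemma expectation_equicontinuous:
  assumes u: "ucb u" and \<epsilon>: "0 < \<epsilon>" and t: "0 \<le> t"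
  obtains \<eta> where "0 < \<eta>" "\<And>x y X. norm x \<le> R \<Longrightarrow> norm (y - x) < \<eta> \<Longrightarrow> admissible t X \<Longrightarrow>
    \<bar>(\<integral>\<omega>. u (x + X \<omega>) \<partial>M) - (\<integral>\<omega>. u (y + X \<omega>) \<partial>M)\<bar> \<le> \<epsilon>"
proof -
  obtain \<delta> where \<delta>: "0 < \<delta>" "\<And>x X X'. norm x \<le> R \<Longrightarrow> admissible t X \<Longrightarrow> X' \<in> borel_measurable M \<Longrightarrow>
    (\<integral>\<^sup>+ \<omega>. ennreal ((norm (X' \<omega> - X \<omega>))\<^sup>2) \<partial>M) \<le> ennreal \<delta> \<Longrightarrow>
    \<bar>(\<integral>\<omega>. u (x + X \<omega>) \<partial>M) - (\<integral>\<omega>. u (x + X' \<omega>) \<partial>M)\<bar> \<le> \<epsilon>"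
    using expectation_modulus[OF u \<epsilon> t] by blast
  show ?thesis
  proof (rule that[of "sqrt \<delta>"])
    fix x y :: 'a and X assume x: "norm x \<le> R" and y: "norm (y - x) < sqrt \<delta>" and X: "admissible t X"
    have "(norm (y - x))\<^sup>2 \<le> \<delta>"
      using y \<delta>(1) power_mono[of "norm (y - x)" "sqrt \<delta>" 2] by simp
    then have 1: "(\<integral>\<^sup>+ \<omega>. ennreal ((norm ((X \<omega> + (y - x)) - X \<omega>))\<^sup>2) \<partial>M) \<le> ennreal \<delta>"
      by (simp add: emeasure_space_1 ennreal_leI)
    have [measurable]: "X \<in> borel_measurable M" using X by (simp add: admissible_def)
    have 2: "(\<lambda>\<omega>. X \<omega> + (y - x)) \<in> borel_measurable M" by measurable
    have eq: "x + (X \<omega> + (y - x)) = y + X \<omega>" for \<omega> by simp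
    from \<delta>(2)[OF x X 2 1] show "\<bar>(\<integral>\<omega>. u (x + X \<omega>) \<partial>M) - (\<integral>\<omega>. u (y + X \<omega>) \<partial>M)\<bar> \<le> \<epsilon>"
      unfolding eq .
  qed (use \<delta> in simp)
qed

lemma expectation_bdd:
  assumes "\<And>x. \<bar>u x\<bar> \<le> c" "0 \<le> c"
  shows "bdd_above ((\<lambda>\<alpha>. \<integral>\<omega>. u (x + state \<alpha> t \<omega>) \<partial>M) ` controls M F \<Lambda>)" "\<bar>T_step t u x\<bar> \<le> c"
  unfolding T_step_eq using cSUP_abs_le[OF controls_nonempty, of "\<lambda>\<alpha>. \<integral>\<omega>. u (x + state \<alpha> t \<omega>) \<partial>M" c]
    expectation_abs_le[of "\<lambda>\<omega>. u (x + state _ t \<omega>)" c] assms by auto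

lemma T_step_ucb:
  assumes u: "ucb u" and t: "0 \<le> t"
  shows "ucb (T_step t u)"
proof -
  obtain c where c: "0 \<le> c" "\<And>x. \<bar>u x\<bar> \<le> c" using ucb_bound[OF u] by blast
  show ?thesis
  proof (rule ucbI[of _ c])
    show "\<bar>T_step t u x\<bar> \<le> c" for x by (rule expectation_bdd(2)[where u=u, OF c(2,1)])
    show "\<exists>\<eta>>0. \<forall>x y. norm x \<le> R \<longrightarrow> norm (y - x) < \<eta> \<longrightarrow> \<bar>T_step t u x - T_step t u y\<bar> \<le> \<epsilon>"
      if \<epsilon>: "0 < \<epsilon>" for R \<epsilon>
    proof -
      obtain \<eta> where \<eta>: "0 < \<eta>" "\<And>x y X. norm x \<le> R \<Longrightarrow> norm (y - x) < \<eta> \<Longrightarrow> admissible t X \<Longrightarrow>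
        \<bar>(\<integral>\<omega>. u (x + X \<omega>) \<partial>M) - (\<integral>\<omega>. u (y + X \<omega>) \<partial>M)\<bar> \<le> \<epsilon>"
        using expectation_equicontinuous[OF u \<epsilon> t] by blast
      show ?thesis
        unfolding T_step_eq
        by (intro exI[of _ \<eta>] conjI allI impI \<eta>(1) cSUP_diff_le[OF controls_nonempty] expectation_bdd(1)[where u=u, OF c(2,1)]
            \<eta>(2) admissible_state t)
    qed
  qed
qed

text \<open>The loss per step is \<epsilon> / (N + 1), so N steps lose at most \<epsilon>; the added
  1 covers N = 0.\<close>

lemma scheme_near_walk:
  assumes u: "ucb u" and \<epsilon>: "0 < \<epsilon>" and t: "0 \<le> t"
  shows "\<exists>idx. grid_adapted n idx \<and> scheme t u n x \<le> (\<integral>\<omega>. u (x + walk n idx (steps n t) \<omega>) \<partial>M) + \<epsilon>"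
proof -
  let ?N = "steps n t"
  have "0 < \<epsilon> / (real ?N + 1)" using \<epsilon> by simp
  from iterate_le_walk[OF this u, of n ?N x] obtain idx where idx: "grid_adapted n idx"
    "(I_step (h n) ^^ ?N) u x \<le> (\<integral>\<omega>. u (x + walk n idx ?N \<omega>) \<partial>M) + real ?N * (\<epsilon> / (real ?N + 1))" by blast
  have "real ?N * (\<epsilon> / (real ?N + 1)) \<le> \<epsilon>" using \<epsilon> by (simp add: field_simps)
  then show ?thesis using idx by (intro exI[of _ idx]) (auto simp: num_steps_eq[OF t])
qed

lemma walk_le_scheme:
  assumes "ucb u" "0 \<le> t" "grid_adapted n idx"
  shows "(\<integral>\<omega>. u (x + walk n idx (steps n t) \<omega>) \<partial>M) \<le> scheme t u n x"
  unfolding num_steps_eq[OF assms(2)] by (rule walk_le_iterate[OF assms(3,1)])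

text \<open>One \<eta> serves all n because walks of every mesh are admissible with the same bound.
  The walk that is nearly optimal at x is used as a competitor at y.\<close>

lemma scheme_equicontinuous:
  assumes u: "ucb u" and \<epsilon>: "0 < \<epsilon>" and t: "0 \<le> t"
  obtains \<eta> where "0 < \<eta>" "\<And>x y n. norm x \<le> R \<Longrightarrow> norm (y - x) < \<eta> \<Longrightarrow> scheme t u n x \<le> scheme t u n y + \<epsilon>"
proof -
  have \<epsilon>2: "0 < \<epsilon> / 2" using \<epsilon> by simp
  obtain \<eta> where \<eta>: "0 < \<eta>" "\<And>x y X. norm x \<le> R \<Longrightarrow> norm (y - x) < \<eta> \<Longrightarrow> admissible t X \<Longrightarrow>
        \<bar>(\<integral>\<omega>. u (x + X \<omega>) \<partial>M) - (\<integral>\<omega>. u (y + X \<omega>) \<partial>M)\<bar> \<le> \<epsilon> / 2"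
    using expectation_equicontinuous[OF u \<epsilon>2 t] by blast
  show ?thesis
  proof (rule that[OF \<eta>(1)])
    fix x y :: 'a and n assume xy: "norm x \<le> R" "norm (y - x) < \<eta>"
    obtain idx where idx: "grid_adapted n idx" "scheme t u n x \<le> (\<integral>\<omega>. u (x + walk n idx (steps n t) \<omega>) \<partial>M) + \<epsilon> / 2"
      using scheme_near_walk[OF u \<epsilon>2 t] by blast
    show "scheme t u n x \<le> scheme t u n y + \<epsilon>"
      using \<eta>(2)[OF xy admissible_walk[OF idx(1) t]] idx(2) walk_le_scheme[OF u t idx(1), of y] by linarith
  qed
qed

text \<open>The condition restricts the incomplete step rather than the mesh. It holds for all small
  meshes, and at a grid time it holds for the given n whatever its mesh, as the supremum formula
  requires.\<close>

lemma scheme_le_T: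
  assumes u: "ucb u" and \<epsilon>: "0 < \<epsilon>" and t: "0 \<le> t"
  obtains \<delta> where "0 < \<delta>" "\<And>n x. norm x \<le> R \<Longrightarrow> t - time n (steps n t) \<le> \<delta> \<Longrightarrow> scheme t u n x \<le> T_step t u x + \<epsilon>"
proof -
  obtain c where c: "0 \<le> c" "\<And>x. \<bar>u x\<bar> \<le> c" using ucb_bound[OF u] by blast
  have \<epsilon>2: "0 < \<epsilon> / 2" using \<epsilon> by simp
  obtain \<delta> where \<delta>: "0 < \<delta>" "\<And>x X X'. norm x \<le> R \<Longrightarrow> admissible t X \<Longrightarrow> X' \<in> borel_measurable M \<Longrightarrow>
    (\<integral>\<^sup>+ \<omega>. ennreal ((norm (X' \<omega> - X \<omega>))\<^sup>2) \<partial>M) \<le> ennreal \<delta> \<Longrightarrow>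
    \<bar>(\<integral>\<omega>. u (x + X \<omega>) \<partial>M) - (\<integral>\<omega>. u (x + X' \<omega>) \<partial>M)\<bar> \<le> \<epsilon> / 2"
    using expectation_modulus[OF u \<epsilon>2 t] by blast
  show ?thesis
  proof (rule that[of "\<delta> / K_walk t"])
    fix n and x :: 'a assume x: "norm x \<le> R" and n: "t - time n (steps n t) \<le> \<delta> / K_walk t"
    obtain idx where idx: "grid_adapted n idx" "scheme t u n x \<le> (\<integral>\<omega>. u (x + walk n idx (steps n t) \<omega>) \<partial>M) + \<epsilon> / 2"
      using scheme_near_walk[OF u \<epsilon>2 t] by blast
    let ?\<alpha> = "grid_control n idx"
    note \<alpha> = grid_control_controls[OF idx(1)]
    have "K_walk t * (t - time n (steps n t)) \<le> \<delta>"
      using n K_walk_pos[OF t] by (simp add: pos_le_divide_eq mult.commute)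
    then have "(\<integral>\<^sup>+ \<omega>. ennreal ((norm (walk n idx (steps n t) \<omega> - state ?\<alpha> t \<omega>))\<^sup>2) \<partial>M) \<le> ennreal \<delta>"
      by (intro order_trans[OF walk_state_dist[OF idx(1) t]] ennreal_leI)
    from \<delta>(2)[OF x admissible_state[OF \<alpha> t] walk_measurable_M[OF idx(1)] this]
    have "(\<integral>\<omega>. u (x + walk n idx (steps n t) \<omega>) \<partial>M) \<le> (\<integral>\<omega>. u (x + state ?\<alpha> t \<omega>) \<partial>M) + \<epsilon> / 2" by linarith
    also have "(\<integral>\<omega>. u (x + state ?\<alpha> t \<omega>) \<partial>M) \<le> T_step t u x"
      unfolding T_step_eq by (rule cSUP_upper[OF \<alpha> expectation_bdd(1)[where u=u, OF c(2,1)]])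
    finally show "scheme t u n x \<le> T_step t u x + \<epsilon>" using idx(2) by linarith
  qed (use \<delta> K_walk_pos[OF t] in simp)
qed

text \<open>A near-optimal control depends on x, and so does the mesh from which on it is well
  approximated; the estimate is therefore pointwise in x.\<close>

lemma T_le_scheme:
  assumes u: "ucb u" and \<epsilon>: "0 < \<epsilon>" and t: "0 \<le> t"
  shows "\<forall>\<^sub>F n in sequentially. T_step t u x \<le> scheme t u n x + \<epsilon>"
proof -
  obtain c where c: "0 \<le> c" "\<And>x. \<bar>u x\<bar> \<le> c" using ucb_bound[OF u] by blast
  have \<epsilon>2: "0 < \<epsilon> / 2" using \<epsilon> by simp
  have "T_step t u x - \<epsilon> / 2 < (SUP \<alpha>\<in>controls M F \<Lambda>. \<integral>\<omega>. u (x + state \<alpha> t \<omega>) \<partial>M)"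
    using \<epsilon> unfolding T_step_eq by simp
  moreover have "bdd_above ((\<lambda>\<alpha>. \<integral>\<omega>. u (x + state \<alpha> t \<omega>) \<partial>M) ` controls M F \<Lambda>)"
    by (rule expectation_bdd(1)[where u=u, OF c(2,1)])
  ultimately obtain \<alpha> where \<alpha>: "\<alpha> \<in> controls M F \<Lambda>" "T_step t u x - \<epsilon> / 2 < (\<integral>\<omega>. u (x + state \<alpha> t \<omega>) \<partial>M)"
    using less_cSUP_iff[OF controls_nonempty] by blast
  obtain \<delta> where \<delta>: "0 < \<delta>" "\<And>y X X'. norm y \<le> norm x \<Longrightarrow> admissible t X \<Longrightarrow> X' \<in> borel_measurable M \<Longrightarrow>
    (\<integral>\<^sup>+ \<omega>. ennreal ((norm (X' \<omega> - X \<omega>))\<^sup>2) \<partial>M) \<le> ennreal \<delta> \<Longrightarrow>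
    \<bar>(\<integral>\<omega>. u (y + X \<omega>) \<partial>M) - (\<integral>\<omega>. u (y + X' \<omega>) \<partial>M)\<bar> \<le> \<epsilon> / 2"
    using expectation_modulus[OF u \<epsilon>2 t] by blast
  \<comment> \<open>The bound of \<open>state_walk_dist\<close> is shared equally by the distance of
    the controls and the incomplete step.\<close>
  define r where "r = \<delta> / (2 * K_walk t)"
  have r: "0 < r" "K_walk t * (r + r) = \<delta>" using \<delta> K_walk_pos[OF t] by (auto simp: r_def field_simps)
  have "\<forall>\<^sub>F n in sequentially. h n < r" using h_lim r by (intro order_tendstoD(2)) auto
  moreover have "\<forall>\<^sub>F n in sequentially. \<exists>idx. grid_adapted n idx \<and> mean_dd t \<alpha> (grid_control n idx) \<le> ennreal r"
    unfolding mean_dd_def by (rule control_approx[OF \<alpha>(1) t r(1)])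
  ultimately show ?thesis
  proof eventually_elim
    case (elim n)
    then obtain idx where idx: "grid_adapted n idx" "mean_dd t \<alpha> (grid_control n idx) \<le> ennreal r" by blast
    let ?W = "walk n idx (steps n t)"
    have "(\<integral>\<^sup>+ \<omega>. ennreal ((norm (?W \<omega> - state \<alpha> t \<omega>))\<^sup>2) \<partial>M) = (\<integral>\<^sup>+ \<omega>. ennreal ((norm (state \<alpha> t \<omega> - ?W \<omega>))\<^sup>2) \<partial>M)"
      by (simp add: norm_minus_commute)
    also have "\<dots> \<le> ennreal (K_walk t) * (mean_dd t \<alpha> (grid_control n idx) + ennreal (t - time n (steps n t)))"
      by (rule state_walk_dist[OF \<alpha>(1) idx(1) steps(1)[OF t]])
    also have "\<dots> \<le> ennreal (K_walk t) * (ennreal r + ennreal r)"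
      using idx(2) steps(2)[OF t, of n] elim by (intro mult_left_mono add_mono ennreal_leI) auto
    also have "ennreal r + ennreal r = ennreal (r + r)"
      using r(1) by (intro ennreal_plus[symmetric]) auto
    also have "ennreal (K_walk t) * ennreal (r + r) = ennreal (K_walk t * (r + r))"
      using K_walk_pos[OF t] by (intro ennreal_mult'[symmetric]) simp
    finally have "(\<integral>\<^sup>+ \<omega>. ennreal ((norm (?W \<omega> - state \<alpha> t \<omega>))\<^sup>2) \<partial>M) \<le> ennreal \<delta>" unfolding r(2) .
    from \<delta>(2)[OF order_refl admissible_state[OF \<alpha>(1) t] walk_measurable_M[OF idx(1)] this]
    show ?case using \<alpha>(2) walk_le_scheme[OF u t idx(1), of x] by linarith
  qed
qed

lemma eventually_scheme_le_T:
  assumes u: "ucb u" and \<epsilon>: "0 < \<epsilon>" and t: "0 \<le> t"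
  shows "\<forall>\<^sub>F n in sequentially. \<forall>x. norm x \<le> R \<longrightarrow> scheme t u n x \<le> T_step t u x + \<epsilon>"
proof -
  obtain \<delta> where \<delta>: "0 < \<delta>" "\<And>n x. norm x \<le> R \<Longrightarrow> t - time n (steps n t) \<le> \<delta> \<Longrightarrow> scheme t u n x \<le> T_step t u x + \<epsilon>"
    using scheme_le_T[OF u \<epsilon> t] by blast
  have "\<forall>\<^sub>F n in sequentially. h n < \<delta>" using h_lim \<delta> by (intro order_tendstoD(2)) auto
  then show ?thesis
  proof eventually_elim
    case (elim n)
    then have "t - time n (steps n t) \<le> \<delta>" using steps(2)[OF t, of n] by linarith
    then show ?case using \<delta>(2) by blast
  qed
qed

text \<open>The upper bound is uniform on balls already. The lower bound holds for large n at the
  points of a finite \<eta>-net of S and spreads to S by equicontinuity of the iterates and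
  continuity of the limit; three errors \<epsilon> / 4 add up.\<close>

lemma scheme_uniform_limit:
  assumes u: "ucb u" and t: "0 \<le> t" and S: "compact S"
  shows "uniform_limit S (scheme t u) (T_step t u) sequentially"
proof (rule uniform_limitI)
  fix \<epsilon> :: real assume "0 < \<epsilon>"
  then have \<epsilon>: "0 < \<epsilon> / 4" by simp
  obtain R where R: "\<And>x. x \<in> S \<Longrightarrow> norm x \<le> R" using compact_imp_bounded[OF S] by (auto simp: bounded_iff)
  obtain \<eta>1 where \<eta>1: "0 < \<eta>1" "\<And>x y n. norm x \<le> R \<Longrightarrow> norm (y - x) < \<eta>1 \<Longrightarrow> scheme t u n x \<le> scheme t u n y + \<epsilon> / 4"
    using scheme_equicontinuous[OF u \<epsilon> t] by blast
  have "uniformly_continuous_on (cball 0 R) (T_step t u)" using T_step_ucb[OF u t] by (simp add: ucb_def)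
  then obtain \<eta>2 where \<eta>2: "0 < \<eta>2" "\<And>x y. x \<in> cball 0 R \<Longrightarrow> y \<in> cball 0 R \<Longrightarrow> dist y x < \<eta>2 \<Longrightarrow> dist (T_step t u y) (T_step t u x) < \<epsilon> / 4"
    using \<epsilon> unfolding uniformly_continuous_on_def by meson
  define \<eta> where "\<eta> = min \<eta>1 \<eta>2"
  have "0 < \<eta>" using \<eta>1 \<eta>2 by (simp add: \<eta>_def)
  then obtain D where D: "finite D" "D \<subseteq> S" "S \<subseteq> (\<Union>c\<in>D. ball c \<eta>)"
    using compactE_image[OF S, of S "\<lambda>c. ball c \<eta>"] by (metis (no_types, lifting) UN_iff centre_in_ball open_ball subsetI)
  have "\<forall>\<^sub>F n in sequentially. \<forall>c\<in>D. T_step t u c \<le> scheme t u n c + \<epsilon> / 4"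
    using T_le_scheme[OF u \<epsilon> t] by (intro eventually_ball_finite D(1) ballI)
  with eventually_scheme_le_T[OF u \<epsilon> t, of R]
  show "\<forall>\<^sub>F n in sequentially. \<forall>x\<in>S. dist (scheme t u n x) (T_step t u x) < \<epsilon>"
  proof eventually_elim
    case (elim n)
    show ?case
    proof
      fix x assume x: "x \<in> S"
      then obtain c where c: "c \<in> D" "dist c x < \<eta>" using D(3) by auto
      have cS: "c \<in> S" using c(1) D(2) by auto
      have "dist (T_step t u c) (T_step t u x) < \<epsilon> / 4"
        using R[OF x] R[OF cS] c(2) by (intro \<eta>2(2)) (simp_all add: \<eta>_def mem_cball_0)
      then have "T_step t u x \<le> T_step t u c + \<epsilon> / 4" unfolding dist_real_def by linarith
      also have "T_step t u c \<le> scheme t u n c + \<epsilon> / 4" using elim(2) c(1) by blast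
      also have "scheme t u n c \<le> scheme t u n x + \<epsilon> / 4"
        using \<eta>1(2)[OF R[OF cS], of x n] c(2) by (simp add: \<eta>_def dist_norm norm_minus_commute)
      finally have "T_step t u x \<le> scheme t u n x + 3 * (\<epsilon> / 4)" by simp
      moreover have "scheme t u n x \<le> T_step t u x + \<epsilon> / 4" using elim(1) R[OF x] by blast
      ultimately show "dist (scheme t u n x) (T_step t u x) < \<epsilon>"
        using \<open>0 < \<epsilon>\<close> by (simp add: dist_real_def abs_less_iff)
    qed
  qed
qed

lemma scheme_bound:
  assumes "\<And>x. \<bar>u x\<bar> \<le> c" "ucb u"
  shows "\<bar>(I_step (h n) ^^ N) u x\<bar> \<le> c"
  using assms
proof (induction N arbitrary: u)
  case (Suc N)
  have "0 \<le> c" using Suc.prems(1)[of 0] by linarith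
  have "\<bar>I_step (h n) u x\<bar> \<le> c" for x
    unfolding I_step_eq[OF h_pos ucb_borel[OF Suc.prems(2)]]
    by (rule cSUP_abs_le(2)[OF nonempty step_value_bound[OF h_pos Suc.prems(1) \<open>0 \<le> c\<close>]])
  then show ?case using Suc.IH[of "I_step (h n) u"] I_step_ucb[OF h_pos Suc.prems(2)] by (simp add: funpow_swap1)
qed simp

text \<open>At a grid time the incomplete step has length 0, so \<open>scheme_le_T\<close> applies
  for every \<epsilon>.\<close>

lemma scheme_le_T_grid:
  assumes u: "ucb u" and t: "0 \<le> t" and n: "t \<in> grid (h n)"
  shows "scheme t u n x \<le> T_step t u x"
proof (rule field_le_epsilon)
  fix \<epsilon> :: real assume \<epsilon>: "0 < \<epsilon>"
  obtain k where "t = time n k" using n by (auto simp: grid_def time_def)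
  then have "time n k < time n (Suc (steps n t))" "t = time n k" using steps(2)[OF t, of n] by (simp_all add: time_Suc)
  then have "k \<le> steps n t" using time_mono[of "Suc (steps n t)" k n] by (meson not_less_eq_eq not_less)
  then have "t \<le> time n (steps n t)" using time_mono[of k "steps n t" n] \<open>t = time n k\<close> by simp
  moreover obtain \<delta> where \<delta>: "0 < \<delta>" "\<And>n y. norm y \<le> norm x \<Longrightarrow> t - time n (steps n t) \<le> \<delta> \<Longrightarrow> scheme t u n y \<le> T_step t u y + \<epsilon>"
    using scheme_le_T[OF u \<epsilon> t] by blast
  ultimately show "scheme t u n x \<le> T_step t u x + \<epsilon>" by (intro \<delta>(2)) auto
qed

lemma scheme_mixed_limit:
  assumes u: "ucb u" and t: "0 \<le> t"
  shows "mixed_limit (scheme t u) (T_step t u)"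
proof -
  obtain c where c: "\<And>x. \<bar>u x\<bar> \<le> c" using ucb_bound[OF u] by blast
  show ?thesis
    unfolding mixed_limit_def
    using scheme_bound[OF c u] scheme_uniform_limit[OF u t]
    by (intro conjI allI impI exI[of _ c] ucb_bcontfun I_iterate_ucb[OF h_pos u] T_step_ucb[OF u t]) auto
qed

text \<open>Nestedness keeps t on all finer grids, so among the indices whose iterates come within
  \<epsilon> of the limit there are some over which the supremum is taken; the opposite inequality
  is \<open>scheme_le_T_grid\<close>.\<close>

lemma T_step_SUP:
  assumes u: "ucb u" and t: "0 \<le> t" and grid: "\<And>n. grid (h n) \<subseteq> grid (h (Suc n))" and tg: "t \<in> (\<Union>n. grid (h n))"
  shows "T_step t u x = (SUP n\<in>{n. t \<in> grid (h n)}. scheme t u n x)"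
proof (rule antisym)
  let ?G = "{n. t \<in> grid (h n)}"
  obtain m where m: "t \<in> grid (h m)" using tg by auto
  have ev: "t \<in> grid (h n)" if "m \<le> n" for n
    using lift_Suc_mono_le[of "\<lambda>n. grid (h n)" m n, OF grid that] m by auto
  have bdd: "bdd_above ((\<lambda>n. scheme t u n x) ` ?G)"
    using scheme_le_T_grid[OF u t] by (intro bdd_aboveI2[of _ _ "T_step t u x"]) auto
  show "(SUP n\<in>?G. scheme t u n x) \<le> T_step t u x"
    using m scheme_le_T_grid[OF u t] by (intro cSUP_least) auto
  show "T_step t u x \<le> (SUP n\<in>?G. scheme t u n x)"
  proof (rule field_le_epsilon)
    fix \<epsilon> :: real assume \<epsilon>: "0 < \<epsilon>"
    have "\<forall>\<^sub>F n in sequentially. T_step t u x \<le> scheme t u n x + \<epsilon> \<and> m \<le> n"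
      by (intro eventually_conj T_le_scheme[OF u \<epsilon> t] eventually_ge_at_top)
    then obtain n where n: "T_step t u x \<le> scheme t u n x + \<epsilon>" "m \<le> n" by (auto simp: eventually_sequentially)
    have "scheme t u n x \<le> (SUP n\<in>?G. scheme t u n x)"
      using ev[OF n(2)] by (intro cSUP_upper bdd) auto
    then show "T_step t u x \<le> (SUP n\<in>?G. scheme t u n x) + \<epsilon>" using n(1) by linarith
  qed
qed

end

theorem theorem6p6:
  fixes B :: "'a::{real_inner, banach, second_countable_topology} set"
    and Q :: "('a \<Rightarrow>\<^sub>L 'a) set"
    and e :: "nat \<Rightarrow> 'a"
    and \<mu> :: "('a \<Rightarrow>\<^sub>L 'a) \<Rightarrow> nat \<Rightarrow> real"
    and M :: "'w measure"
    and F :: "real \<Rightarrow> 'w measure"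
    and \<xi> :: "nat \<Rightarrow> real \<Rightarrow> 'w \<Rightarrow> real"
    and \<Lambda> :: "('a \<times> (nat \<Rightarrow> real)) set"
    and h :: "nat \<Rightarrow> real"
    and t :: real
    and f :: "'a \<Rightarrow> real"
  assumes nonempty: "B \<noteq> {}" "Q \<noteq> {}"
    and trace_class: "Q \<subseteq> trace_class"
    and selfadjoint: "\<And>A. A \<in> Q \<Longrightarrow> selfadjoint_op A"
    and positive: "\<And>A. A \<in> Q \<Longrightarrow> positive_op A"
    and commute: "\<And>A1 A2. A1 \<in> Q \<Longrightarrow> A2 \<in> Q \<Longrightarrow> A1 o\<^sub>L A2 = A2 o\<^sub>L A1"
    and bounded: "bounded_in_trace_class (B \<times> Q)"
    and eigenbasis: "joint_eigenbasis Q e \<mu>"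
    and space: "usual_filtered_prob_space M F"
    and brownian: "indep_brownian_motions M F \<xi>"
    and Lambda: "\<Lambda> = control_set B Q \<mu>"
    and h_pos: "\<And>n. 0 < h n"
    and h_lim: "h \<longlonglongrightarrow> 0"
    and nested: "\<And>n. grid (h n) \<subseteq> grid (h (Suc n))"
    and t: "0 \<le> t"
    and f: "f \<in> bcontfun"
    and factor: "\<exists>K g. compact_operator (K :: 'a \<Rightarrow> 'a) \<and> g \<in> bcontfun \<and> (\<forall>x. f x = g (K x))"
  shows "mixed_limit (\<lambda>n. (I_op M \<xi> e \<Lambda> (h n) ^^ num_steps (h n) t) f) (T_op M F \<xi> e \<Lambda> t f) \<and>
    (t \<in> (\<Union>n. grid (h n)) \<longrightarrow>
      (\<forall>x. T_op M F \<xi> e \<Lambda> t f x =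
        (SUP n\<in>{n. t \<in> grid (h n)}. (I_op M \<xi> e \<Lambda> (h n) ^^ num_steps (h n) t) f x)))"
proof -
  obtain C :: real where C: "\<And>b A. b \<in> B \<Longrightarrow> A \<in> Q \<Longrightarrow> norm b \<le> C \<and> trace_norm A \<le> ennreal C"
    using bounded by (auto simp: bounded_in_trace_class_def)
  obtain b0 A0 where b0: "b0 \<in> B" and A0: "A0 \<in> Q" using nonempty by auto
  note eig = eigenvalues_trace_norm[OF selfadjoint positive eigenbasis]
  \<comment> \<open>The boundedness constant becomes C: it bounds the drifts directly and the sums
    of eigenvalues through the trace norm. Nonempty factors give C \<ge> 0 and a nonempty
    \<Lambda>.\<close>
  interpret control_setup M F \<xi> h e \<Lambda> C
  proof (intro control_setup.intro brownian_grid.intro brownian_family.intro)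
    show "prob_space M" using space by (simp add: usual_filtered_prob_space_def)
    show "brownian_family_axioms M F \<xi>" using space brownian by (rule brownian_family_axioms.intro)
    show "brownian_grid_axioms h" using h_pos h_lim by (rule brownian_grid_axioms.intro)
    show "control_setup_axioms e \<Lambda> C"
    proof
      show "orthonormal_basis e" using eigenbasis by (simp add: joint_eigenbasis_def)
      show "\<Lambda> \<noteq> {}" using nonempty by (simp add: Lambda control_set_def)
      show "0 \<le> C" using C[OF b0 A0] norm_ge_zero[of b0] by linarith
      fix l assume "l \<in> \<Lambda>"
      then obtain b A where l: "b \<in> B" "A \<in> Q" "l = (b, \<mu> A)" by (auto simp: Lambda control_set_def)
      show "norm (fst l) \<le> C" using C[OF l(1,2)] l(3) by simp
      show "0 \<le> snd l k" for k using eig(1)[OF l(2) l(2) l(2)] l(3) by simp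
      show "snd l k = 0" if "e k = 0" for k
        using eigenbasis l that by (simp add: joint_eigenbasis_def)
      show "(\<Sum>k. ennreal (snd l k)) \<le> ennreal C"
        using order_trans[OF eig(2)[OF l(2) l(2) l(2)]] C[OF l(1,2)] l(3) by simp
    qed
  qed
  obtain K g where "compact_operator (K :: 'a \<Rightarrow> 'a)" "g \<in> bcontfun" "\<And>x. f x = g (K x)" using factor by blast
  then have u: "ucb f" by (rule ucb_compact_factor)
  show ?thesis
    using scheme_mixed_limit[OF u t] T_step_SUP[OF u t nested] by blast
qed

end
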